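(* Let $s>0$ and suppose $P_{1/2}(s):=(P_\ell(s))\sim\mathrm{PD}\big(\tfrac12\,\big|\,\tfrac12s^{-2}\big)$. Then, for $\tfrac12<\alpha<1$, $$P_\alpha(s)=\mathrm{FRAG}_{\alpha,-\frac12}(P_{1/2}(s))\sim\mathrm{PD}_{\alpha|\frac12}\big(\alpha\,\big|\,\tfrac12s^{-2}\big),$$ with corresponding EPPF, for positive integers $n_1,\dots,n_k$ with sum $n$, expressed as a mixture of Hermite functions: $$\left[\sum_{j=1}^k\mathbb{P}^{(k)}_{\frac{1}{2\alpha},0}(j)\,2^{n-1}s^{j-1}\tilde H_{j+1-2n}(s)\,\frac{\Gamma(n)}{\Gamma(j)}\right]p_\alpha(n_1,\ldots,n_k).$$
   Context: $\mathcal P_\infty=\{(s_1,s_2,\ldots): s_1\ge s_2\ge\cdots\ge 0,\ \sum_k s_k=1\}$. For $\gamma\in(0,1)$ let $J_1>J_2>\cdots$ be the ranked points of a Poisson process on $(0,\infty)$ with intensity $\frac{\gamma}{\Gamma(1-\gamma)}x^{-\gamma-1}dx$ and $T_\gamma=\sum_i J_i$, a positive $\gamma$-stable variable with $\mathbb{E}[e^{-\lambda T_\gamma}]=e^{-\lambda^\gamma}$ and density $f_\gamma$. $\mathrm{PD}(\gamma,0)$ is the law of $(J_i/T_\gamma)_i$, and $\mathrm{PD}(\gamma|t)$ its regular conditional law given $T_\gamma=t$ (weakly continuous version in $t$). For $0\le\gamma<1$, $\theta>-\gamma$, $\mathrm{PD}(\gamma,\theta)$ is the law of the decreasing rearrangement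 of $(R_k\prod_{j<k}(1-R_j))_{k\ge1}$ with $R_k\sim\mathrm{Beta}(1-\gamma,\theta+k\gamma)$ independent. $\mathrm{FRAG}_{\alpha,-\beta}((P_i))$ is the decreasing rearrangement of all masses $P_i\hat Q^{(i)}_\ell$, $i,\ell\ge1$, where $\hat Q^{(i)}=(\hat Q^{(i)}_\ell)_\ell$ are iid $\mathrm{PD}(\alpha,-\beta)$, independent of $(P_i)$. For $0<\beta<\alpha<1$, $\mathrm{PD}_{\alpha|\beta}(\alpha|y):=\int_0^\infty\mathrm{PD}(\alpha|s)\,\omega^{(y)}_{\frac{\beta}{\alpha},\beta}(s)f_\alpha(s)\,ds$, with $\omega^{(y)}_{\frac{\beta}{\alpha},\beta}(s)=\dfrac{\alpha y^{\alpha-1}f_{\beta/\alpha}((y/s)^\alpha)}{s^\alpha f_\beta(y)}$. A random $P\in\mathcal P_\infty$ generates an exchangeable partition of $[n]=\{1,\dots,n\}$ by sampling, given $P$, iid indices $I_1,\dots,I_n$ with $\mathbb{P}(I_m=i|P)=P_i$, and putting $m,m'$ in the same block iff $I_m=I_{m'}$; its EPPF $p(n_1,\dots,n_k)$ is the probability that it equals a given partition $\{A_1,\dots,A_k\}$ of $[n]$ with $|A_i|=n_i$. For $\mathrm{PD}(\alpha,0)$ it is $p_\alpha(n_1,\dots,n_k)=\frac{\alpha^{k-1}\Gamma(k)}{\Gamma(n)}\prod_{j=1}^k(1-\alpha)_{n_j-1}$, $(x)_m=\Gamma(x+m)/\Gamma(x)$. $\mathbb{P}^{(k)}_{\gamma,0}(j)$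 is the probability that a $\mathrm{PD}(\gamma,0)$ partition of $[k]$ has $j$ blocks. $\tilde H_{-2q}(s)=2^{-q}U\big(q,\tfrac12,\tfrac{s^2}{2}\big)$, $q\ge0$, is a Hermite function of index $-2q$, with $U(a,b,c)$ the confluent hypergeometric function of the second kind; for $q>0$ it equals $\sum_{\ell\ge0}\frac{(-s)^\ell}{\ell!}\frac{\Gamma(q+\ell/2)}{2\Gamma(2q)}2^{q+\ell/2}$. *)

theory Defs
  imports "HOL-Probability.Probability"
begin

text \<open>
  Ranked mass sequences are functions \<open>nat \<Rightarrow> real\<close>, indexed from 0.  Laws of such sequences are
  measures on \<open>borel :: (nat \<Rightarrow> real) measure\<close>, the Borel sets of the product topology, which induces
  on \<open>P_infty\<close> the same topology as the \<open>\<ell>\<^sup>1\<close> metric.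
\<close>

definition P_infty :: "(nat \<Rightarrow> real) set" where
  "P_infty = {p. decseq p \<and> (\<forall>i. 0 \<le> p i) \<and> p sums 1}"

definition has_law ::
    "'a measure \<Rightarrow> ('a \<Rightarrow> 'b::topological_space) \<Rightarrow> 'b measure \<Rightarrow> bool" where
  "has_law M X L \<longleftrightarrow> X \<in> borel_measurable M \<and> distr M borel X = L"

text \<open>
  Decreasing rearrangement, with multiplicities, of a summable nonnegative family: the \<open>k\<close>-th entry
  is the smallest level \<open>t \<ge> 0\<close> exceeded by at most \<open>k\<close> members.  If only finitely many members are
  positive, the sequence is continued by zeros.
\<close>

definition ranked :: "('i \<Rightarrow> real) \<Rightarrow> nat \<Rightarrow> real" where
  "ranked x k = Inf {t. 0 \<le> t \<and> finite {i. t < x i} \<and> card {i. t < x i} \<le> k}"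


subsection \<open>Stable subordinator jumps\<close>

definition stable_intensity :: "real \<Rightarrow> real measure" where
  "stable_intensity \<gamma> = density lborel
     (\<lambda>x. ennreal (indicator {0<..} x * (\<gamma> / Gamma (1 - \<gamma>) * x powr (- \<gamma> - 1))))"

text \<open>
  The Poisson probabilities are written out because \<open>poisson_pmf\<close> excludes rate 0.
\<close>

definition poisson_points :: "'a measure \<Rightarrow> real measure \<Rightarrow> (nat \<Rightarrow> 'a \<Rightarrow> real) \<Rightarrow> bool" where
  "poisson_points M \<mu> J \<longleftrightarrow>
     prob_space M \<and> (\<forall>i. J i \<in> borel_measurable M) \<and>
     (\<forall>A\<in>sets borel. emeasure \<mu> A < \<infinity> \<longrightarrow>
        (AE \<omega> in M. finite {i. J i \<omega> \<in> A}) \<and>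
        (\<forall>k. measure M {\<omega> \<in> space M. finite {i. J i \<omega> \<in> A} \<and> card {i. J i \<omega> \<in> A} = k}
               = exp (- measure \<mu> A) * measure \<mu> A ^ k / fact k)) \<and>
     (\<forall>(m::nat) A. (\<forall>l<m. A l \<in> sets borel \<and> emeasure \<mu> (A l) < \<infinity>) \<and> disjoint_family_on A {..<m} \<longrightarrow>
        prob_space.indep_vars M (\<lambda>_. count_space UNIV) (\<lambda>l \<omega>. card {i. J i \<omega> \<in> A l}) {..<m})"

definition ranked_stable_jumps :: "'a measure \<Rightarrow> real \<Rightarrow> (nat \<Rightarrow> 'a \<Rightarrow> real) \<Rightarrow> bool" where
  "ranked_stable_jumps M \<gamma> J \<longleftrightarrow>
     poisson_points M (stable_intensity \<gamma>) J \<and>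
     (AE \<omega> in M. \<forall>i. 0 < J (Suc i) \<omega> \<and> J (Suc i) \<omega> < J i \<omega>)"

definition total_jump :: "(nat \<Rightarrow> 'a \<Rightarrow> real) \<Rightarrow> 'a \<Rightarrow> real" where
  "total_jump J \<omega> = (\<Sum>i. J i \<omega>)"

definition normalized_jumps :: "(nat \<Rightarrow> 'a \<Rightarrow> real) \<Rightarrow> 'a \<Rightarrow> nat \<Rightarrow> real" where
  "normalized_jumps J \<omega> = (\<lambda>i. J i \<omega> / total_jump J \<omega>)"

text \<open>
  The continuous version of the density is meant, since it is evaluated at individual points.
\<close>

definition continuous_density :: "'a measure \<Rightarrow> ('a \<Rightarrow> real) \<Rightarrow> (real \<Rightarrow> real) \<Rightarrow> bool" where
  "continuous_density M T f \<longleftrightarrow>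
     distributed M lborel T (\<lambda>x. ennreal (f x)) \<and> (\<forall>x. 0 \<le> f x) \<and> continuous_on {0<..} f"

text \<open>
  \<open>\<kappa>\<close> is a weakly continuous regular version, indexed by \<open>t > 0\<close>, of the conditional law on
  \<open>P_infty\<close> of \<open>X\<close> given \<open>T = t\<close>.
\<close>

definition continuous_cond_law ::
    "'a measure \<Rightarrow> ('a \<Rightarrow> nat \<Rightarrow> real) \<Rightarrow> ('a \<Rightarrow> real) \<Rightarrow> (real \<Rightarrow> (nat \<Rightarrow> real) measure) \<Rightarrow> bool" where
  "continuous_cond_law M X T \<kappa> \<longleftrightarrow>
     \<kappa> \<in> restrict_space borel {0<..} \<rightarrow>\<^sub>M prob_algebra borel \<and>
     (\<forall>t>0. AE p in \<kappa> t. p \<in> P_infty) \<and>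
     (\<forall>A\<in>sets borel. \<forall>B\<in>sets borel. B \<subseteq> {0<..} \<longrightarrow>
        emeasure M {\<omega> \<in> space M. X \<omega> \<in> A \<and> T \<omega> \<in> B}
          = (\<integral>\<^sup>+ t. indicator B t * emeasure (\<kappa> t) A \<partial>distr M borel T)) \<and>
     (\<forall>g :: (nat \<Rightarrow> real) \<Rightarrow> real. continuous_on UNIV g \<and> bounded (range g) \<longrightarrow>
        continuous_on {0<..} (\<lambda>t. \<integral>p. g p \<partial>\<kappa> t))"


subsection \<open>Two-parameter Poisson--Dirichlet laws and fragmentation\<close>

definition beta_law :: "real \<Rightarrow> real \<Rightarrow> real measure" where
  "beta_law a b = density lborel
     (\<lambda>x. ennreal (indicator {0<..<1} x * (x powr (a - 1) * (1 - x) powr (b - 1) / Beta a b)))"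

text \<open>Stick-breaking; \<open>R k\<close> is the fraction with the one-based index \<open>k + 1\<close>.\<close>

definition PD :: "real \<Rightarrow> real \<Rightarrow> (nat \<Rightarrow> real) measure" where
  "PD \<gamma> \<theta> = distr (PiM UNIV (\<lambda>k. beta_law (1 - \<gamma>) (\<theta> + real (Suc k) * \<gamma>))) borel
     (\<lambda>R. ranked (\<lambda>k. R k * (\<Prod>j<k. 1 - R j)))"

text \<open>
  \<open>X\<close> is obtained from \<open>P\<close> by the operator FRAG with parameters \<open>\<alpha>\<close> and \<open>\<theta>\<close>.  Joint independence
  of the family made of \<open>P\<close> (index \<open>None\<close>) and all \<open>Q i\<close> (index \<open>Some i\<close>) says that the
  \<open>Q i\<close> are independent of each other and of \<open>P\<close>.
\<close>

definition is_FRAG ::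
    "'a measure \<Rightarrow> real \<Rightarrow> real \<Rightarrow> ('a \<Rightarrow> nat \<Rightarrow> real) \<Rightarrow> ('a \<Rightarrow> nat \<Rightarrow> real) \<Rightarrow> bool" where
  "is_FRAG M \<alpha> \<theta> P X \<longleftrightarrow>
     (\<exists>Q :: nat \<Rightarrow> 'a \<Rightarrow> nat \<Rightarrow> real.
        prob_space.indep_vars M (\<lambda>_. borel) (case_option P Q) UNIV \<and>
        (\<forall>i. has_law M (Q i) (PD \<alpha> \<theta>)) \<and>
        (\<forall>\<omega>\<in>space M. X \<omega> = ranked (\<lambda>(i, l). P \<omega> i * Q i \<omega> l)))"

text \<open>
  In the next two definitions \<open>f \<gamma>\<close> stands for the stable density with index \<open>\<gamma>\<close>, and
  \<open>\<kappa> \<gamma> t\<close> for the law \<open>PD(\<gamma>|t)\<close>.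
\<close>

definition omega_weight :: "(real \<Rightarrow> real \<Rightarrow> real) \<Rightarrow> real \<Rightarrow> real \<Rightarrow> real \<Rightarrow> real \<Rightarrow> real" where
  "omega_weight f \<alpha> \<beta> y s =
     \<alpha> * y powr (\<alpha> - 1) * f (\<beta> / \<alpha>) ((y / s) powr \<alpha>) / (s powr \<alpha> * f \<beta> y)"

definition PD_mixed ::
    "(real \<Rightarrow> real \<Rightarrow> real) \<Rightarrow> (real \<Rightarrow> real \<Rightarrow> (nat \<Rightarrow> real) measure) \<Rightarrow>
     real \<Rightarrow> real \<Rightarrow> real \<Rightarrow> (nat \<Rightarrow> real) measure" where
  "PD_mixed f \<kappa> \<alpha> \<beta> y =
     bind (density (restrict_space lborel {0<..}) (\<lambda>s. ennreal (omega_weight f \<alpha> \<beta> y s * f \<alpha> s))) (\<kappa> \<alpha>)"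


subsection \<open>Exchangeable partitions\<close>

definition index_partition :: "nat \<Rightarrow> (nat \<Rightarrow> nat) \<Rightarrow> nat set set" where
  "index_partition n I = (\<lambda>m. {m' \<in> {1..n}. I m' = I m}) ` {1..n}"

text \<open>
  \<open>partition_prob L n S\<close> is the probability that the partition of \<open>{1..n}\<close> generated by a random
  mass sequence with law \<open>L\<close> belongs to \<open>S\<close>: given the masses \<open>p\<close>, the indices \<open>I 1, \<dots>, I n\<close> are
  independent with point probabilities \<open>p\<close>.
\<close>

definition partition_prob :: "(nat \<Rightarrow> real) measure \<Rightarrow> nat \<Rightarrow> nat set set set \<Rightarrow> real" where
  "partition_prob L n S = enn2real (\<integral>\<^sup>+ p.
     (let \<nu> = PiM {1..n} (\<lambda>_. point_measure UNIV (\<lambda>i. ennreal (p i)))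
      in emeasure \<nu> {I \<in> space \<nu>. index_partition n I \<in> S}) \<partial>L)"

definition has_EPPF :: "(nat \<Rightarrow> real) measure \<Rightarrow> (nat list \<Rightarrow> real) \<Rightarrow> bool" where
  "has_EPPF L p \<longleftrightarrow>
     (\<forall>n\<ge>1. \<forall>As. distinct As \<and> partition_on {1..n} (set As) \<longrightarrow>
        partition_prob L n {set As} = p (map card As))"

definition block_count_prob :: "real \<Rightarrow> nat \<Rightarrow> nat \<Rightarrow> real" where
  "block_count_prob \<gamma> k j = partition_prob (PD \<gamma> 0) k {\<pi>. card \<pi> = j}"

definition eppf_PD0 :: "real \<Rightarrow> nat list \<Rightarrow> real" where
  "eppf_PD0 \<alpha> ns =
     \<alpha> ^ (length ns - 1) * Gamma (real (length ns)) / Gamma (real (sum_list ns)) *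
     (\<Prod>m\<leftarrow>ns. pochhammer (1 - \<alpha>) (m - 1))"


subsection \<open>Hermite functions\<close>

definition kummer_M :: "real \<Rightarrow> real \<Rightarrow> real \<Rightarrow> real" where
  "kummer_M a b z = (\<Sum>l. pochhammer a l / (pochhammer b l * fact l) * z ^ l)"

text \<open>
  The confluent hypergeometric function of the second kind for non-integer \<open>b\<close> and \<open>z > 0\<close>.  Using
  the entire function \<open>rGamma = 1/Gamma\<close> makes the formula valid at \<open>a = 0\<close>, where the value is 1.
\<close>

definition tricomi_U :: "real \<Rightarrow> real \<Rightarrow> real \<Rightarrow> real" where
  "tricomi_U a b z =
     Gamma (1 - b) * rGamma (a - b + 1) * kummer_M a b z +
     Gamma (b - 1) * rGamma a * z powr (1 - b) * kummer_M (a - b + 1) (2 - b) z"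

text \<open>The argument \<open>\<nu>\<close> is the index; the formula \<open>2\<^sup>-\<^sup>q U(q, 1/2, s\<^sup>2/2)\<close> is used at \<open>\<nu> = -2q \<le> 0\<close>.\<close>

definition hermite_fn :: "real \<Rightarrow> real \<Rightarrow> real" where
  "hermite_fn \<nu> s = 2 powr (\<nu> / 2) * tricomi_U (- \<nu> / 2) (1 / 2) (s\<^sup>2 / 2)"

end

theory Submission
  imports Defs
begin

text \<open>
  The law of a random \<open>p \<in> P_infty\<close> is determined by the expectations of the sums
  \<open>edsum A n p\<close> of \<open>\<Prod>a\<in>A. p (I a) ^ n a\<close> over injective \<open>I\<close>, and these are the values of the EPPF.
  Stick-breaking computes them for PD.  For the conditional laws, the Laplace functional of the
  Poisson points gives the Laplace transform in \<open>t\<close> of \<open>t ^ n * f t\<close> times the expectation given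
  \<open>T = t\<close>.  Fragmentation expresses the sums of \<open>X\<close> through those of \<open>P\<close>, one term for each partition of \<open>A\<close>,
  and the Laplace transform in \<open>y\<close> of the result agrees with that of the mixture; since both
  sides are continuous in \<open>y\<close>, they agree at every \<open>y\<close>.  For \<open>\<beta> = 1 / 2\<close> the transforms are
  those of explicit Gaussian integrals, which are Hermite functions of \<open>(2 * y) powr (- 1 / 2)\<close>.
\<close>

subsection \<open>Sums over distinct indices\<close>

text \<open>The fragmentation and the mixture agree because
  \<open>l powr \<beta> = (l powr \<alpha>) powr (\<beta> / \<alpha>)\<close>: a \<beta>-stable
  variable is a product \<open>S * U powr (1 / \<alpha>)\<close>, where S and U are independent and
  stable with indices \<alpha> and \<open>\<beta> / \<alpha>\<close>. After a Laplace transform the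
  two sides match block by block (\<open>block_identity\<close>). The obstacle is the passage to one
  value of y. A Laplace transform fixes a function only almost everywhere, and the hypotheses give
  densities that are continuous on the open half-line but come without any bound. Continuity of the
  mixture therefore needs a domination that has to be proved first: the size-biasing identity shows
  that \<open>t * f t\<close> is bounded on every half-line starting at a positive point. Moreover,
  weak continuity is assumed only for bounded continuous functions of the whole sequence. Power sums
  are not such functions; on \<open>P_infty\<close> they are uniform limits of such
  functions.\<close>

abbreviation nn_integral_pos :: "(real \<Rightarrow> ennreal) \<Rightarrow> ennreal" (binder "\<integral>\<^sub>+ " 10) where
  "nn_integral_pos F \<equiv> \<integral>\<^sup>+ x. indicator {0<..} x * F x \<partial>lborel"

text \<open>The sum over injective maps is an integral over a countable space with values in
  \<open>ennreal\<close>, so that it can be exchanged with expectations without summability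
  conditions. Extensional maps ensure that each assignment of indices is counted once.\<close>

definition dsum :: "'a set \<Rightarrow> ('a \<Rightarrow> nat \<Rightarrow> ennreal) \<Rightarrow> ennreal" where
  "dsum A w = (\<integral>\<^sup>+ I. (if inj_on I A then \<Prod>a\<in>A. w a (I a) else 0) \<partial>count_space (A \<rightarrow>\<^sub>E UNIV))"

lemma nn_integral_count_space_PiE_insert:
  fixes F :: "('a \<Rightarrow> nat) \<Rightarrow> ennreal"
  assumes "a \<notin> A"
  shows "(\<integral>\<^sup>+ I. F I \<partial>count_space (insert a A \<rightarrow>\<^sub>E UNIV)) =
    (\<Sum>i. \<integral>\<^sup>+ I. F (I(a := i)) \<partial>count_space (A \<rightarrow>\<^sub>E UNIV))"
proof -
  let ?F = "A \<rightarrow>\<^sub>E UNIV"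
  have bij: "bij_betw (\<lambda>(i, I). I(a := i)) (UNIV \<times> ?F) (insert a A \<rightarrow>\<^sub>E (UNIV :: nat set))"
    unfolding bij_betw_def using inj_combinator[OF assms, of "\<lambda>_. UNIV :: nat set"]
    by (simp add: PiE_insert_eq)
  have "(\<integral>\<^sup>+ I. F I \<partial>count_space (insert a A \<rightarrow>\<^sub>E UNIV)) =
     (\<integral>\<^sup>+ z. F ((\<lambda>(i, I). I(a := i)) z) \<partial>count_space (UNIV \<times> ?F))"
    by (rule nn_integral_bij_count_space[OF bij, symmetric])
  also have "\<dots> = (\<integral>\<^sup>+ z. F ((snd z)(a := fst z)) * indicator ?F (snd z) \<partial>count_space UNIV)"
    by (subst nn_integral_count_space_indicator)
       (auto intro!: nn_integral_cong split: split_indicator)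
  also have "\<dots> = (\<integral>\<^sup>+ i. \<integral>\<^sup>+ I. F (I(a := i)) * indicator ?F I \<partial>count_space UNIV \<partial>count_space UNIV)"
    by (subst nn_integral_fst_count_space[symmetric]) simp
  also have "\<dots> = (\<integral>\<^sup>+ i. \<integral>\<^sup>+ I. F (I(a := i)) \<partial>count_space ?F \<partial>count_space UNIV)"
    by (rule nn_integral_cong, subst (2) nn_integral_count_space_indicator) auto
  finally show ?thesis by (simp add: nn_integral_count_space_nat)
qed

lemma dsum_empty [simp]: "dsum {} w = 1"
  by (simp add: dsum_def nn_integral_count_space_finite)

lemma dsum_cong:
  assumes "A = B" "\<And>a i. a \<in> B \<Longrightarrow> w a i = w' a i"
  shows "dsum A w = dsum B w'"
  unfolding dsum_def using assms by (auto intro!: nn_integral_cong prod.cong)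

text \<open>Once \<open>a\<close> has taken the index \<open>i\<close>, injectivity is imposed on
  the other slots by setting their weights at \<open>i\<close> to zero. The index set itself never
  has to shrink.\<close>

lemma dsum_insert:
  assumes "finite A" "a \<notin> A"
  shows "dsum (insert a A) w = (\<Sum>i. w a i * dsum A (\<lambda>b j. if j = i then 0 else w b j))"
  unfolding dsum_def
proof (subst nn_integral_count_space_PiE_insert[OF assms(2)], rule suminf_cong)
  fix i
  show "(\<integral>\<^sup>+ I. (if inj_on (I(a := i)) (insert a A) then \<Prod>b\<in>insert a A. w b ((I(a := i)) b) else 0)
           \<partial>count_space (A \<rightarrow>\<^sub>E UNIV))
      = w a i * (\<integral>\<^sup>+ I. (if inj_on I A then \<Prod>b\<in>A. if I b = i then 0 else w b (I b) else 0)
           \<partial>count_space (A \<rightarrow>\<^sub>E UNIV))"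
    (is "?L = _ * nn_integral _ ?G")
  proof -
    have "(if inj_on (I(a := i)) (insert a A) then \<Prod>b\<in>insert a A. w b ((I(a := i)) b) else 0) = w a i * ?G I"
      for I
    proof -
      have "inj_on (I(a := i)) (insert a A) \<longleftrightarrow> inj_on I A \<and> i \<notin> I ` A"
      proof -
        have [simp]: "inj_on (I(a := i)) A = inj_on I A"
          using assms by (intro inj_on_cong) auto
        have [simp]: "(I(a := i)) ` (A - {a}) = I ` A"
          using assms by (auto simp: image_iff)
        show ?thesis by (simp add: inj_on_insert del: fun_upd_apply) simp
      qed
      moreover have "(\<Prod>b\<in>insert a A. w b ((I(a := i)) b)) = w a i * (\<Prod>b\<in>A. w b (I b))"
        using assms by (simp, intro arg_cong[where f="\<lambda>x. _ * x"] prod.cong) auto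
      moreover have "(\<Prod>b\<in>A. if I b = i then 0 else w b (I b)) = (if i \<in> I ` A then 0 else \<Prod>b\<in>A. w b (I b))"
        using assms by (auto intro!: prod.cong prod_zero)
      ultimately show ?thesis by simp
    qed
    then show ?thesis by (simp add: nn_integral_cmult)
  qed
qed

lemma dsum_singleton [simp]: "dsum {a} w = (\<Sum>i. w a i)"
  by (subst dsum_insert) auto

text \<open>An index drawn freely for \<open>a\<close> is either new or equal to the index of
  exactly one slot \<open>b\<close> in A; in the latter case its weight is multiplied into slot
  \<open>b\<close>. This recursion drives all inductions on distinct sums below.\<close>

lemma dsum_product:
  assumes "finite A" "a \<notin> A"
  shows "(\<Sum>i. w a i) * dsum A w
       = dsum (insert a A) w + (\<Sum>b\<in>A. dsum A (w(b := \<lambda>i. w b i * w a i)))"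
proof -
  let ?C = "count_space (A \<rightarrow>\<^sub>E (UNIV :: nat set))"
  let ?F = "\<lambda>i::nat. \<integral>\<^sup>+ I. w a i * (if inj_on I A then \<Prod>b\<in>A. if I b = i then 0 else w b (I b) else 0) \<partial>?C"
  let ?p = "\<lambda>I. if inj_on I A then \<Prod>b\<in>A. w b (I b) else 0"
  have 1: "dsum (insert a A) w = (\<integral>\<^sup>+ I. (\<Sum>i. if i \<in> I ` A then 0 else w a i) * ?p I \<partial>?C)"
  proof -
    have "dsum (insert a A) w = (\<Sum>i. \<integral>\<^sup>+ I. (if i \<in> I ` A then 0 else w a i) * ?p I \<partial>?C)"
      unfolding dsum_insert[OF assms]
    proof (rule suminf_cong, goal_cases)
      case (1 i)
      have "w a i * dsum A (\<lambda>b j. if j = i then 0 else w b j)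
        = (?F i)"
        by (simp add: dsum_def nn_integral_cmult)
      moreover have "(\<Prod>b\<in>A. if I b = i then 0 else w b (I b)) = (if i \<in> I ` A then 0 else \<Prod>b\<in>A. w b (I b))" for I
        using assms by (auto intro!: prod.cong prod_zero)
      moreover from calculation(2) have "(?F i)
          = (\<integral>\<^sup>+ I. (if i \<in> I ` A then 0 else w a i) * ?p I \<partial>?C)"
        by (intro nn_integral_cong) simp
      ultimately show ?case
        by simp
    qed
    also have "\<dots> = (\<integral>\<^sup>+ I. (\<Sum>i. (if i \<in> I ` A then 0 else w a i) * ?p I) \<partial>?C)"
      by (rule nn_integral_suminf[symmetric]) simp
    finally show ?thesis by simp
  qed
  have 2: "dsum A (w(b := \<lambda>i. w b i * w a i)) = (\<integral>\<^sup>+ I. w a (I b) * ?p I \<partial>?C)" if "b \<in> A" for b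
  proof -
    have "(\<Prod>c\<in>A. (w(b := \<lambda>i. w b i * w a i)) c (I c)) = w a (I b) * (\<Prod>c\<in>A. w c (I c))" for I
      using that assms by (simp add: prod.remove[of A b] mult_ac)
    then show ?thesis unfolding dsum_def by (intro nn_integral_cong) auto
  qed
  have 3: "(\<Sum>i. w a i) * ?p I = (\<Sum>i. if i \<in> I ` A then 0 else w a i) * ?p I + (\<Sum>b\<in>A. w a (I b) * ?p I)" for I
  proof (cases "inj_on I A")
    case True
    have "(\<Sum>i. w a i) = (\<Sum>i. (if i \<in> I ` A then 0 else w a i) + (if i \<in> I ` A then w a i else 0))"
      by (intro suminf_cong) auto
    also have "\<dots> = (\<Sum>i. if i \<in> I ` A then 0 else w a i) + (\<Sum>i. if i \<in> I ` A then w a i else 0)"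
      by (rule suminf_add[symmetric]) auto
    also have "(\<Sum>i. if i \<in> I ` A then w a i else 0) = (\<Sum>i\<in>I ` A. w a i)"
      using assms by (subst suminf_finite[of "I ` A"]) auto
    also have "\<dots> = (\<Sum>b\<in>A. w a (I b))" using True by (simp add: sum.reindex)
    finally show ?thesis by (simp add: distrib_right sum_distrib_right)
  qed auto
  have "(\<Sum>i. w a i) * dsum A w = (\<integral>\<^sup>+ I. (\<Sum>i. w a i) * ?p I \<partial>?C)"
    unfolding dsum_def by (simp add: nn_integral_cmult)
  also have "\<dots> = dsum (insert a A) w + (\<Sum>b\<in>A. dsum A (w(b := \<lambda>i. w b i * w a i)))"
    unfolding 3 by (simp add: nn_integral_add nn_integral_sum 1 2)
  finally show ?thesis .
qed

lemma dsum_cmult: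
  assumes "finite A"
  shows "dsum A (\<lambda>a i. c a * w a i) = (\<Prod>a\<in>A. c a) * dsum A w"
  unfolding dsum_def by (subst nn_integral_cmult[symmetric]) (auto intro!: nn_integral_cong simp: prod.distrib)

lemma dsum_reindex:
  assumes h: "bij_betw h A B"
  shows "dsum A (\<lambda>a. w (h a)) = dsum B w"
proof -
  let ?g = "\<lambda>I. restrict (\<lambda>a. I (h a)) A"
  have [simp]: "h a \<in> B" if "a \<in> A" for a using h that by (auto simp: bij_betw_def)
  have bij: "bij_betw ?g (B \<rightarrow>\<^sub>E UNIV) (A \<rightarrow>\<^sub>E (UNIV::nat set))"
    by (rule bij_betwI[where g = "\<lambda>I. restrict (\<lambda>b. I (the_inv_into A h b)) B"])
       (use h in \<open>auto simp: fun_eq_iff restrict_def PiE_def extensional_def bij_betw_def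
          the_inv_into_f_f f_the_inv_into_f intro: the_inv_into_into\<close>)
  have inj: "inj_on (?g I) A = inj_on I B" for I
  proof -
    have "inj_on (?g I) A = inj_on (I \<circ> h) A" by (intro inj_on_cong) auto
    also have "\<dots> = inj_on I B"
      using h by (metis bij_betw_def comp_inj_on_iff)
    finally show ?thesis .
  qed
  have pr: "(\<Prod>a\<in>A. w (h a) (?g I a)) = (\<Prod>b\<in>B. w b (I b))" for I
    using prod.reindex_bij_betw[OF h, of "\<lambda>b. w b (I b)"] by simp
  show ?thesis
    unfolding dsum_def by (subst nn_integral_bij_count_space[OF bij, symmetric]) (simp only: inj pr)
qed

lemma dsum_le_prod:
  assumes "finite A"
  shows "dsum A w \<le> (\<Prod>a\<in>A. \<Sum>i. w a i)"
  using assms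
proof induction
  case (insert a A)
  have "dsum (insert a A) w \<le> (\<Sum>i. w a i) * dsum A w"
    by (simp add: dsum_product[OF insert.hyps])
  also have "\<dots> \<le> (\<Sum>i. w a i) * (\<Prod>a\<in>A. \<Sum>i. w a i)"
    by (intro mult_left_mono insert) simp
  finally show ?case using insert by simp
qed simp

lemma dsum_measurable:
  assumes "finite A" "\<And>a i. a \<in> A \<Longrightarrow> (\<lambda>x. w x a i) \<in> borel_measurable M"
  shows "(\<lambda>x. dsum A (w x)) \<in> borel_measurable M"
  using assms
proof (induction arbitrary: w)
  case (insert a A)
  have [measurable]: "(\<lambda>x. w x a i) \<in> borel_measurable M" for i using insert by auto
  have [measurable]: "(\<lambda>x. dsum A (\<lambda>b j. if j = i then 0 else w x b j)) \<in> borel_measurable M" for i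
    by (rule insert.IH) (use insert.prems in auto)
  show ?case by (simp add: dsum_insert[OF insert.hyps])
qed simp

lemma dsum_add_slot:
  assumes "finite A" "a \<in> A"
  shows "dsum A (w(a := \<lambda>i. f i + g i)) = dsum A (w(a := f)) + dsum A (w(a := g))"
proof -
  have *: "(\<Prod>b\<in>A. (w(a := h)) b (I b)) = h (I a) * (\<Prod>b\<in>A - {a}. w b (I b))" for I h
    using assms by (simp add: prod.remove[of A a])
  show ?thesis
    unfolding dsum_def * by (subst nn_integral_add[symmetric]) (auto intro!: nn_integral_cong simp: distrib_right)
qed

lemma dsum_zero_slot:
  assumes "finite A" "a \<in> A" "\<And>i. w a i = 0"
  shows "dsum A w = 0"
proof -
  have "(\<Prod>b\<in>A. w b (I b)) = 0" for I
    using assms by (auto intro!: prod_zero)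
  then have "dsum A w = (\<integral>\<^sup>+ I. 0 \<partial>count_space (A \<rightarrow>\<^sub>E (UNIV :: nat set)))"
    unfolding dsum_def by (intro nn_integral_cong) (simp only: if_cancel)
  then show ?thesis by simp
qed

lemma dsum_sum_slot:
  assumes "finite A" "a \<in> A" "finite S"
  shows "dsum A (w(a := \<lambda>i. \<Sum>s\<in>S. f s i)) = (\<Sum>s\<in>S. dsum A (w(a := f s)))"
  using assms(3)
proof induction
  case (insert s S)
  show ?case
    unfolding sum.insert[OF insert.hyps] by (subst dsum_add_slot[OF assms(1,2)]) (simp only: insert.IH)
qed (simp add: dsum_zero_slot[OF assms(1,2)])

text \<open>By injectivity at most one slot takes the index 0. In stick-breaking this index belongs
  to the first stick.\<close>

lemma dsum_split_first:
  assumes "finite A"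
  shows "dsum A w = dsum A (\<lambda>a i. w a (Suc i)) + (\<Sum>a\<in>A. w a 0 * dsum (A - {a}) (\<lambda>b i. w b (Suc i)))"
  using assms
proof (induction arbitrary: w)
  case (insert a A)
  let ?s = "\<lambda>b i. w b (Suc i)"
  let ?z = "\<lambda>i b j. if j = i then 0 else w b j"
  let ?sz = "\<lambda>i b j. if j = i then 0 else ?s b j"
  have "dsum (insert a A) w = w a 0 * dsum A (?z 0) + (\<Sum>i. w a (Suc i) * dsum A (?z (Suc i)))"
    by (simp add: dsum_insert[OF insert.hyps] suminf_split_head add.commute
        suminf_offset[of "\<lambda>i. w a i * dsum A (?z i)" 1])
  also have "dsum A (?z 0) = dsum A ?s"
    by (subst insert.IH) simp
  also have "(\<Sum>i. w a (Suc i) * dsum A (?z (Suc i)))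
     = (\<Sum>i. ?s a i * dsum A (?sz i) + (\<Sum>b\<in>A. w b 0 * (?s a i * dsum (A - {b}) (?sz i))))"
    by (intro suminf_cong, subst insert.IH) (simp add: distrib_left sum_distrib_left mult_ac)
  also have "\<dots> = dsum (insert a A) ?s + (\<Sum>b\<in>A. w b 0 * (\<Sum>i. ?s a i * dsum (A - {b}) (?sz i)))"
    using insert.hyps
    by (subst suminf_add[symmetric]) (simp_all add: dsum_insert suminf_sum)
  also have "(\<Sum>b\<in>A. w b 0 * (\<Sum>i. ?s a i * dsum (A - {b}) (?sz i)))
      = (\<Sum>b\<in>A. w b 0 * dsum (insert a A - {b}) ?s)"
  proof (rule sum.cong[OF refl], goal_cases)
    case b: (1 b)
    then have "insert a A - {b} = insert a (A - {b})" using insert.hyps by auto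
    with b show ?case
      using insert.hyps by (simp add: dsum_insert)
  qed
  finally show ?case using insert.hyps by (simp add: ac_simps)
qed simp


section \<open>Recursion over set partitions\<close>

text \<open>Deleting \<open>a\<close> from its block is inverse to both constructions: a block
  \<open>{a}\<close> disappears, and a larger block shrinks to the block \<open>B\<close> that
  \<open>a\<close> had joined.\<close>

lemma sum_partition_on_insert:
  fixes f :: "'a set set \<Rightarrow> 'b::comm_monoid_add"
  assumes "finite A" "a \<notin> A"
  shows "(\<Sum>\<sigma> | partition_on (insert a A) \<sigma>. f \<sigma>)
       = (\<Sum>\<sigma> | partition_on A \<sigma>. f (insert {a} \<sigma>) + (\<Sum>B\<in>\<sigma>. f (insert (insert a B) (\<sigma> - {B}))))"
proof -
  let ?P = "{\<sigma>. partition_on A \<sigma>}"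
  let ?Q = "{\<sigma>. partition_on (insert a A) \<sigma>}"
  let ?S = "SIGMA \<sigma>:?P. \<sigma>"
  let ?g = "\<lambda>\<sigma>. insert {a} \<sigma>"
  let ?h = "\<lambda>(\<sigma>, B). insert (insert a B) (\<sigma> - {B})"
  have fin: "finite ?P" "finite ?Q" using assms by (auto intro: finitely_many_partition_on)
  have fs: "finite \<sigma>" if "partition_on A \<sigma>" for \<sigma> using assms that by (auto intro: finite_elements)
  have noa: "a \<notin> B" if "partition_on A \<sigma>" "B \<in> \<sigma>" for \<sigma> B
    using that assms partition_onD1 by blast
  have part: "partition_on (insert a A) (?g \<sigma>)" if "partition_on A \<sigma>" for \<sigma>
    using that assms by (subst partition_on_insert) (auto simp: disjnt_def dest: partition_onD1)
  have part': "partition_on (insert a A) (insert (insert a B) (\<sigma> - {B}))" if \<sigma>: "partition_on A \<sigma>" "B \<in> \<sigma>" for \<sigma> B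
  proof -
    have d: "\<Union>(\<sigma> - {B}) = A - B" "B \<subseteq> A"
      using partition_onD1[OF \<sigma>(1)] partition_onD2[OF \<sigma>(1)] \<sigma>(2) by (auto simp: disjoint_def)
    have "partition_on (A - B) (\<sigma> - {B})"
      using \<sigma> d partition_on_insert[of B "\<sigma> - {B}" A] by (auto simp: disjnt_def insert_absorb)
    moreover have "insert a A - insert a B = A - B" using assms by auto
    ultimately show ?thesis
      using d assms by (subst partition_on_insert) (auto simp: disjnt_def)
  qed
  have Q: "?Q = ?g ` ?P \<union> ?h ` ?S"
  proof (intro equalityI subsetI)
    fix \<tau> assume "\<tau> \<in> ?Q"
    then have \<tau>: "partition_on (insert a A) \<tau>" by simp
    then obtain C where C: "C \<in> \<tau>" "a \<in> C" using partition_onD1 by (metis Union_iff insertI1)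
    have d: "\<Union>(\<tau> - {C}) = insert a A - C" "C \<subseteq> insert a A"
      using partition_onD1[OF \<tau>] partition_onD2[OF \<tau>] C by (auto simp: disjoint_def)
    have rest: "partition_on (insert a A - C) (\<tau> - {C})"
      using \<tau> d C partition_on_insert[of C "\<tau> - {C}" "insert a A"] by (auto simp: disjnt_def insert_absorb)
    show "\<tau> \<in> ?g ` ?P \<union> ?h ` ?S"
    proof (cases "C = {a}")
      case True
      with rest assms C have "partition_on A (\<tau> - {C})" "\<tau> = ?g (\<tau> - {C})" by auto
      then show ?thesis by blast
    next
      case False
      let ?B = "C - {a}"
      have B: "?B \<noteq> {}" "?B \<subseteq> A" using False C d by auto
      \<comment> \<open>Blocks are disjoint and \<open>?B\<close> is a nonempty part of
        \<open>C\<close>, so it cannot be a further block. Hence removing it again after the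
        insertion gives back the original partition.\<close>
      have notin: "?B \<notin> \<tau> - {C}" using d B by (metis DiffD1 Diff_disjoint Int_absorb2 Sup_upper Int_Diff equals0I subset_Diff_insert Diff_iff subsetD insert_Diff_single)
      have "insert a A - C = A - ?B" using C assms by auto
      then have "partition_on A (insert ?B (\<tau> - {C}))"
        using rest B d by (subst partition_on_insert) (auto simp: disjnt_def)
      moreover have "\<tau> = ?h (insert ?B (\<tau> - {C}), ?B)" using C notin by (auto simp: insert_absorb)
      ultimately show ?thesis by blast
    qed
  qed (auto simp: part part')
  have disj: "?g ` ?P \<inter> ?h ` ?S = {}"
  proof -
    have False if "partition_on A \<sigma>" "partition_on A \<sigma>'" "B \<in> \<sigma>'" "?g \<sigma> = insert (insert a B) (\<sigma>' - {B})" for \<sigma> \<sigma>' B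
    proof -
      have "{a} \<in> insert (insert a B) (\<sigma>' - {B})" using that(4) by (metis insertI1)
      then have "{a} = insert a B \<or> {a} \<in> \<sigma>'" by auto
      then show False
        using noa[OF that(2,3)] noa[OF that(2), of "{a}"] partition_onD3[OF that(2)] that(3)
        by (auto dest: subset_singletonD)
    qed
    then show ?thesis by fastforce
  qed
  have injg: "inj_on ?g ?P"
    by (rule inj_onI) (metis insert_ident mem_Collect_eq noa insertI1)
  have injh: "inj_on ?h ?S"
  proof (rule inj_onI, clarify)
    fix \<sigma> B \<sigma>' B'
    assume *: "partition_on A \<sigma>" "B \<in> \<sigma>" "partition_on A \<sigma>'" "B' \<in> \<sigma>'"
      and eq: "insert (insert a B) (\<sigma> - {B}) = insert (insert a B') (\<sigma>' - {B'})"
    have n: "insert a B \<notin> \<sigma>'" "insert a B' \<notin> \<sigma>" using noa * by (meson insertI1)+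
    have "insert a B = insert a B'" using eq n by blast
    then have B: "B = B'" using noa[OF *(1,2)] noa[OF *(3,4)] by (metis insert_ident)
    have "\<sigma> - {B} = \<sigma>' - {B}" using eq n B noa[OF *(1)] noa[OF *(3)] by (metis Diff_iff insert_ident insertI1)
    with B * show "\<sigma> = \<sigma>' \<and> B = B'" by blast
  qed
  have "(\<Sum>\<sigma>\<in>?Q. f \<sigma>) = (\<Sum>\<sigma>\<in>?g ` ?P. f \<sigma>) + (\<Sum>\<sigma>\<in>?h ` ?S. f \<sigma>)"
    using fin Q disj by (metis (no_types, lifting) finite_Un sum.union_disjoint)
  also have "\<dots> = (\<Sum>\<sigma>\<in>?P. f (?g \<sigma>)) + (\<Sum>z\<in>?S. f (?h z))"
    by (simp add: sum.reindex[OF injg] sum.reindex[OF injh] o_def)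
  also have "(\<Sum>z\<in>?S. f (?h z)) = (\<Sum>\<sigma>\<in>?P. \<Sum>B\<in>\<sigma>. f (?h (\<sigma>, B)))"
    using fin fs by (subst sum.Sigma) (auto intro!: sum.cong)
  finally show ?thesis by (simp add: sum.distrib)
qed

text \<open>Renaming the slot \<open>B\<close> to \<open>insert a B\<close> turns a modified weight
  on the old partition into the unmodified weight on the partition in which \<open>a\<close> has
  joined \<open>B\<close>.\<close>

lemma dsum_merge:
  assumes "partition_on A \<sigma>" "B \<in> \<sigma>" "a \<notin> A"
  shows "dsum \<sigma> (v(B := v (insert a B))) = dsum (insert (insert a B) (\<sigma> - {B})) v"
proof -
  let ?h = "\<lambda>C. if C = B then insert a B else C"
  have noa: "a \<notin> C" if "C \<in> \<sigma>" for C using assms that partition_onD1 by blast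
  have "bij_betw ?h \<sigma> (insert (insert a B) (\<sigma> - {B}))"
    unfolding bij_betw_def inj_on_def using assms noa by auto
  from dsum_reindex[OF this, of v] have "dsum (insert (insert a B) (\<sigma> - {B})) v = dsum \<sigma> (\<lambda>C. v (?h C))" ..
  also have "\<dots> = dsum \<sigma> (v(B := v (insert a B)))" by (intro dsum_cong) auto
  finally show ?thesis ..
qed

text \<open>Expand the product and group the index maps by their level sets. The induction works
  because \<open>dsum_product\<close> and \<open>sum_partition_on_insert\<close> distinguish the
  same cases.\<close>

lemma prod_suminf_eq_sum_dsum:
  assumes "finite A"
  shows "(\<Prod>a\<in>A. \<Sum>i. w a i) = (\<Sum>\<sigma> | partition_on A \<sigma>. dsum \<sigma> (\<lambda>B i. \<Prod>b\<in>B. w b i))"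
  using assms
proof induction
  case empty
  then show ?case by (simp add: partition_on_empty)
next
  case (insert a A)
  let ?v = "\<lambda>B i. \<Prod>b\<in>B. w b i"
  have "(\<Prod>a\<in>insert a A. \<Sum>i. w a i) = (\<Sum>\<sigma> | partition_on A \<sigma>. (\<Sum>i. ?v {a} i) * dsum \<sigma> ?v)"
    using insert by (simp add: sum_distrib_left)
  also have "\<dots> = (\<Sum>\<sigma> | partition_on A \<sigma>. dsum (insert {a} \<sigma>) ?v
       + (\<Sum>B\<in>\<sigma>. dsum (insert (insert a B) (\<sigma> - {B})) ?v))"
  proof (intro sum.cong refl, clarify)
    fix \<sigma> assume \<sigma>: "partition_on A \<sigma>"
    have noa: "a \<notin> C" "finite C" if "C \<in> \<sigma>" for C
      using \<sigma> that insert.hyps partition_onD1[OF \<sigma>] by (auto intro: finite_subset)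
    have "dsum \<sigma> (?v(B := \<lambda>i. ?v B i * ?v {a} i)) = dsum (insert (insert a B) (\<sigma> - {B})) ?v" if "B \<in> \<sigma>" for B
      using dsum_merge[OF \<sigma> that insert.hyps(2), of ?v] noa[OF that] by (simp add: mult.commute)
    then show "(\<Sum>i. ?v {a} i) * dsum \<sigma> ?v = dsum (insert {a} \<sigma>) ?v
       + (\<Sum>B\<in>\<sigma>. dsum (insert (insert a B) (\<sigma> - {B})) ?v)"
      using noa finite_elements[OF insert.hyps(1) \<sigma>] by (subst dsum_product) auto
  qed
  finally show ?case using insert.hyps by (simp add: sum_partition_on_insert)
qed

section \<open>Distinct sums and power sums of one sequence\<close>

text \<open>Up to a factor for repeated exponents this is a monomial symmetric function of
  \<open>x\<close>; \<open>psum\<close> is the power sum. Truncation by \<open>ennreal\<close> is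
  harmless, as the sequences of interest are nonnegative.\<close>

definition edsum :: "'a set \<Rightarrow> ('a \<Rightarrow> nat) \<Rightarrow> (nat \<Rightarrow> real) \<Rightarrow> ennreal" where
  "edsum A n x = dsum A (\<lambda>a i. ennreal (x i) ^ n a)"

definition psum :: "nat \<Rightarrow> (nat \<Rightarrow> real) \<Rightarrow> ennreal" where
  "psum m x = (\<Sum>i. ennreal (x i) ^ m)"

lemma edsum_empty [simp]: "edsum {} n x = 1"
  by (simp add: edsum_def)

lemma edsum_singleton [simp]: "edsum {a} n x = psum (n a) x"
  by (simp add: edsum_def psum_def)

lemma edsum_cong: "A = B \<Longrightarrow> (\<And>a. a \<in> B \<Longrightarrow> n a = n' a) \<Longrightarrow> edsum A n x = edsum B n' x"
  unfolding edsum_def by (intro dsum_cong) auto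

lemma edsum_product:
  assumes "finite A" "a \<notin> A"
  shows "psum (n a) x * edsum A n x
       = edsum (insert a A) n x + (\<Sum>b\<in>A. edsum A (n(b := n b + n a)) x)"
proof -
  have "dsum A ((\<lambda>a i. ennreal (x i) ^ n a)(b := \<lambda>i. ennreal (x i) ^ n b * ennreal (x i) ^ n a))
     = edsum A (n(b := n b + n a)) x" for b
    unfolding edsum_def by (intro dsum_cong) (auto simp: power_add)
  with dsum_product[OF assms, of "\<lambda>a i. ennreal (x i) ^ n a"] show ?thesis
    by (simp add: edsum_def psum_def)
qed

lemma edsum_le_prod: "finite A \<Longrightarrow> edsum A n x \<le> (\<Prod>a\<in>A. psum (n a) x)"
  unfolding edsum_def psum_def by (rule dsum_le_prod)

lemma edsum_finite:
  assumes "finite A" "\<And>a. a \<in> A \<Longrightarrow> psum (n a) x < \<top>"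
  shows "edsum A n x < \<top>"
proof -
  have "(\<Prod>a\<in>A. psum (n a) x) < \<top>"
    using assms by (induction A rule: finite_induct) (auto simp: ennreal_mult_less_top)
  with edsum_le_prod[OF assms(1)] show ?thesis by (rule le_less_trans)
qed

lemma edsum_measurable [measurable]:
  assumes "finite A" and [measurable]: "x \<in> borel_measurable M"
  shows "(\<lambda>\<omega>. edsum A n (x \<omega>)) \<in> borel_measurable M"
proof -
  have [measurable]: "(\<lambda>\<omega>. x \<omega> i) \<in> borel_measurable M" for i
    by (rule measurable_product_then_coordinatewise[OF assms(2)])
  show ?thesis unfolding edsum_def by (intro dsum_measurable assms) measurable
qed

lemma psum_measurable [measurable]:
  assumes [measurable]: "x \<in> borel_measurable M"
  shows "(\<lambda>\<omega>. psum m (x \<omega>)) \<in> borel_measurable M"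
proof -
  have [measurable]: "(\<lambda>\<omega>. x \<omega> i) \<in> borel_measurable M" for i
    by (rule measurable_product_then_coordinatewise[OF assms])
  show ?thesis unfolding psum_def by measurable
qed

lemma edsum_scale:
  assumes "finite A" "0 \<le> c"
  shows "edsum A n (\<lambda>i. c * x i) = ennreal c ^ (\<Sum>a\<in>A. n a) * edsum A n x"
  using assms by (simp add: edsum_def ennreal_mult' power_mult_distrib dsum_cmult power_sum)

text \<open>
  The distinct sums of a family depend only on its power sums, so a family may be replaced by any
  rearrangement.
\<close>

lemma edsum_eq_if_psum_eq:
  assumes "finite A" "\<And>a. a \<in> A \<Longrightarrow> 0 < n a"
    and "\<And>m. 0 < m \<Longrightarrow> psum m x = psum m y" "\<And>m. 0 < m \<Longrightarrow> psum m y < \<top>"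
  shows "edsum A n x = edsum A n y"
  using assms(1,2)
proof (induction arbitrary: n)
  case (insert a A)
  have eq: "edsum A (n(b := n b + n a)) x = edsum A (n(b := n b + n a)) y" if "b \<in> A" for b
    using insert.prems that by (intro insert.IH) auto
  have fin: "edsum A (n(b := n b + n a)) y < \<top>" if "b \<in> A" for b
    using insert.prems insert.hyps that by (intro edsum_finite assms(4)) auto
  have "edsum (insert a A) n x + (\<Sum>b\<in>A. edsum A (n(b := n b + n a)) y) = psum (n a) x * edsum A n x"
    unfolding edsum_product[OF insert.hyps] by (simp add: eq cong: sum.cong)
  also have "\<dots> = psum (n a) y * edsum A n y"
    using insert.IH[of n] insert.prems assms(3)[of "n a"] by simp
  also have "\<dots> = edsum (insert a A) n y + (\<Sum>b\<in>A. edsum A (n(b := n b + n a)) y)"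
    by (rule edsum_product[OF insert.hyps])
  finally have "edsum (insert a A) n x + (\<Sum>b\<in>A. edsum A (n(b := n b + n a)) y)
      = edsum (insert a A) n y + (\<Sum>b\<in>A. edsum A (n(b := n b + n a)) y)" .
  \<comment> \<open>Cancellation in \<open>ennreal\<close> requires a finite summand; this is where
    the finiteness of the power sums enters.\<close>
  moreover have "(\<Sum>b\<in>A. edsum A (n(b := n b + n a)) y) \<noteq> \<top>"
    using fin insert.hyps by (simp add: less_top)
  ultimately show ?case by auto
qed simp

text \<open>
  Grouping the indices \<open>(i, l)\<close> of the fragments \<open>P i * Q i l\<close> by their first component.
\<close>

lemma edsum_fragments:
  fixes P :: "nat \<Rightarrow> real" and Q :: "nat \<Rightarrow> nat \<Rightarrow> real"
  assumes "finite A" "\<And>a. a \<in> A \<Longrightarrow> 0 < n a"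
    and y: "\<And>m. 0 < m \<Longrightarrow> psum m y = (\<Sum>i. ennreal (P i) ^ m * psum m (Q i))"
    and fin: "\<And>m. 0 < m \<Longrightarrow> psum m y < \<top>"
  shows "edsum A n y = (\<Sum>\<sigma> | partition_on A \<sigma>.
      dsum \<sigma> (\<lambda>B i. ennreal (P i) ^ (\<Sum>b\<in>B. n b) * edsum B n (Q i)))"
  using assms(1,2)
proof (induction arbitrary: n)
  case empty
  then show ?case by (simp add: partition_on_empty)
next
  case (insert a A)
  define v where "v = (\<lambda>(n :: 'a \<Rightarrow> nat) B i. ennreal (P i) ^ (\<Sum>b\<in>B. n b) * edsum B n (Q i))"
  define m where "m = (\<lambda>b. n(b := n b + n a))"
  define S where "S = (\<Sum>b\<in>A. edsum A (m b) y)"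
  have S: "S = (\<Sum>b\<in>A. \<Sum>\<sigma> | partition_on A \<sigma>. dsum \<sigma> (v (m b)))"
    unfolding S_def v_def m_def using insert.prems by (intro sum.cong insert.IH) auto
  have Sfin: "S \<noteq> \<top>"
    using insert.hyps insert.prems unfolding S_def m_def
    by (simp add: less_top, intro ballI edsum_finite fin) auto
  have IH: "edsum A n y = (\<Sum>\<sigma> | partition_on A \<sigma>. dsum \<sigma> (v n))"
    unfolding v_def using insert.prems by (intro insert.IH) auto
  have "psum (n a) y = (\<Sum>i. v n {a} i)"
    using insert.prems by (simp add: y v_def)
  then have "psum (n a) y * edsum A n y = (\<Sum>\<sigma> | partition_on A \<sigma>. (\<Sum>i. v n {a} i) * dsum \<sigma> (v n))"
    by (simp add: IH sum_distrib_left)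
  also have "\<dots> = (\<Sum>\<sigma> | partition_on A \<sigma>. (dsum (insert {a} \<sigma>) (v n)
       + (\<Sum>B\<in>\<sigma>. dsum (insert (insert a B) (\<sigma> - {B})) (v n))) + (\<Sum>b\<in>A. dsum \<sigma> (v (m b))))"
  proof (intro sum.cong refl, clarify)
    fix \<sigma> assume \<sigma>: "partition_on A \<sigma>"
    have noa: "a \<notin> C" "finite C" if "C \<in> \<sigma>" for C
      using \<sigma> that insert.hyps partition_onD1[OF \<sigma>] by (auto intro: finite_subset)
    have fs: "finite \<sigma>" using finite_elements[OF insert.hyps(1) \<sigma>] .
    have "dsum \<sigma> ((v n)(B := \<lambda>i. v n B i * v n {a} i))
       = dsum (insert (insert a B) (\<sigma> - {B})) (v n) + (\<Sum>b\<in>B. dsum \<sigma> (v (m b)))" if B: "B \<in> \<sigma>" for B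
    proof -
      \<comment> \<open>Inside piece \<open>i\<close> the new slot \<open>a\<close> either has a
        fragment of its own or shares that of some \<open>b\<close> in \<open>B\<close>. This is
        \<open>edsum_product\<close> for \<open>Q i\<close>, multiplied by the power of
        \<open>P i\<close> that both cases have in common.\<close>
      have "v n B i * v n {a} i = v n (insert a B) i + (\<Sum>b\<in>B. v (m b) B i)" for i
      proof -
        have "(\<Sum>c\<in>B. m b c) = (\<Sum>c\<in>B. n c) + n a" if "b \<in> B" for b
          using noa[OF B] that by (simp add: m_def sum.remove[of B b])
        moreover have "v n B i * v n {a} i
            = ennreal (P i) ^ ((\<Sum>b\<in>B. n b) + n a) * (psum (n a) (Q i) * edsum B n (Q i))"
          by (simp add: v_def power_add mult_ac)
        ultimately show ?thesis
          using noa[OF B] unfolding edsum_product[OF noa(2,1)[OF B]]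
          by (simp add: v_def distrib_left sum_distrib_left add.commute[of "n a"]) (simp add: m_def)
      qed
      then have "dsum \<sigma> ((v n)(B := \<lambda>i. v n B i * v n {a} i))
          = dsum \<sigma> ((v n)(B := \<lambda>i. v n (insert a B) i + (\<Sum>b\<in>B. v (m b) B i)))" by simp
      also have "\<dots> = dsum \<sigma> ((v n)(B := v n (insert a B))) + (\<Sum>b\<in>B. dsum \<sigma> ((v n)(B := v (m b) B)))"
        using dsum_add_slot[OF fs B] dsum_sum_slot[OF fs B noa(2)[OF B]] by simp
      also have "dsum \<sigma> ((v n)(B := v n (insert a B))) = dsum (insert (insert a B) (\<sigma> - {B})) (v n)"
        by (rule dsum_merge[OF \<sigma> B insert.hyps(2)])
      \<comment> \<open>The blocks are disjoint, so raising the exponent of an element of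
        \<open>B\<close> changes only the weight of \<open>B\<close>. The family updated at
        \<open>B\<close> is therefore the full family for the exponents \<open>m b\<close>.\<close>
      also have "(\<Sum>b\<in>B. dsum \<sigma> ((v n)(B := v (m b) B))) = (\<Sum>b\<in>B. dsum \<sigma> (v (m b)))"
      proof (intro sum.cong refl dsum_cong)
        fix b C i assume b: "b \<in> B" "C \<in> \<sigma>"
        have "b \<notin> C" if "C \<noteq> B" using that b B partition_onD2[OF \<sigma>] by (auto simp: disjoint_def)
        then show "((v n)(B := v (m b) B)) C i = v (m b) C i"
        proof (cases "C = B")
          case False
          then have "m b c = n c" if "c \<in> C" for c using \<open>C \<noteq> B \<Longrightarrow> b \<notin> C\<close> that by (auto simp: m_def)
          then have "(\<Sum>c\<in>C. m b c) = (\<Sum>c\<in>C. n c)" "edsum C (m b) (Q i) = edsum C n (Q i)"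
            by (auto intro!: sum.cong edsum_cong)
          with False show ?thesis by (simp add: v_def)
        qed simp
      qed
      finally show ?thesis .
    qed
    moreover have "{a} \<notin> \<sigma>" using noa by blast
    moreover have "(\<Sum>B\<in>\<sigma>. \<Sum>b\<in>B. dsum \<sigma> (v (m b))) = (\<Sum>b\<in>A. dsum \<sigma> (v (m b)))"
      using partition_onD1[OF \<sigma>] partition_onD2[OF \<sigma>] noa(2)
      by (simp add: sum.Union_disjoint disjoint_def)
    ultimately show "(\<Sum>i. v n {a} i) * dsum \<sigma> (v n) = dsum (insert {a} \<sigma>) (v n)
       + (\<Sum>B\<in>\<sigma>. dsum (insert (insert a B) (\<sigma> - {B})) (v n)) + (\<Sum>b\<in>A. dsum \<sigma> (v (m b)))"
      using fs by (subst dsum_product) (simp_all add: sum.distrib add.assoc)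
  qed
  also have "\<dots> = (\<Sum>\<sigma> | partition_on (insert a A) \<sigma>. dsum \<sigma> (v n)) + S"
    using insert.hyps unfolding S by (simp add: sum.distrib sum_partition_on_insert sum.swap[of _ A])
  finally have "edsum (insert a A) n y + S = (\<Sum>\<sigma> | partition_on (insert a A) \<sigma>. dsum \<sigma> (v n)) + S"
    using edsum_product[OF insert.hyps, of n y] by (simp add: S_def m_def)
  with Sfin show ?case by (auto simp: v_def)
qed


subsection \<open>Decreasing rearrangement\<close>

text \<open>Only finitely many members exceed \<open>t\<close>, so their minimum
  \<open>\<mu>\<close> lies strictly above \<open>t\<close>, and every level below
  \<open>\<mu>\<close> is exceeded by all of them. Describing \<open>ranked\<close> by these counts
  avoids a sorting permutation.\<close>

lemma less_ranked_iff:
  fixes x :: "'i \<Rightarrow> real"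
  assumes fin: "\<And>t. 0 < t \<Longrightarrow> finite {i. t < x i}" and t: "0 < t"
  shows "t < ranked x k \<longleftrightarrow> k < card {i. t < x i}"
proof -
  let ?S = "{t. 0 \<le> t \<and> finite {i. t < x i} \<and> card {i. t < x i} \<le> k}"
  have bdd: "bdd_below ?S" by (auto intro: bdd_belowI[of _ 0])
  show ?thesis
  proof
    assume "k < card {i. t < x i}"
    define \<mu> where "\<mu> = Min (x ` {i. t < x i})"
    have ne: "{i. t < x i} \<noteq> {}" using \<open>k < _\<close> by (metis card.empty not_less_zero)
    have "t < \<mu>" unfolding \<mu>_def using fin[OF t] ne by (subst Min_gr_iff) auto
    have "\<mu> \<le> s" if "s \<in> ?S" for s
    proof (rule ccontr)
      assume "\<not> \<mu> \<le> s"
      then have "{i. t < x i} \<subseteq> {i. s < x i}"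
      proof (intro subsetI CollectI)
        fix i assume "i \<in> {i. t < x i}"
        then have "\<mu> \<le> x i" unfolding \<mu>_def using fin[OF t] by (intro Min_le) auto
        with \<open>\<not> \<mu> \<le> s\<close> show "s < x i" by simp
      qed
      then have "card {i. t < x i} \<le> k" using that by (auto dest: card_mono[rotated])
      with \<open>k < _\<close> show False by simp
    qed
    moreover have "?S \<noteq> {}"
    proof -
      define T where "T = Max (insert 1 (x ` {i. 1 < x i}))"
      have "1 \<le> T" unfolding T_def using fin[of 1] by auto
      have "\<not> T < x i" for i
      proof
        assume "T < x i"
        with \<open>1 \<le> T\<close> have "x i \<le> T" unfolding T_def using fin[of 1] by (intro Max_ge) auto
        with \<open>T < x i\<close> show False by simp
      qed
      then have "T \<in> ?S" using \<open>1 \<le> T\<close> by simp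
      then show ?thesis by blast
    qed
    ultimately have "\<mu> \<le> ranked x k" unfolding ranked_def by (intro cInf_greatest) auto
    with \<open>t < \<mu>\<close> show "t < ranked x k" by simp
  next
    assume *: "t < ranked x k"
    show "k < card {i. t < x i}"
    proof (rule ccontr)
      assume "\<not> k < card {i. t < x i}"
      then have "t \<in> ?S" using t fin by auto
      then have "ranked x k \<le> t" unfolding ranked_def using bdd by (intro cInf_lower) auto
      with * show False by simp
    qed
  qed
qed

lemma ranked_nonneg:
  fixes x :: "'i \<Rightarrow> real"
  assumes fin: "\<And>t. 0 < t \<Longrightarrow> finite {i. t < x i}"
  shows "0 \<le> ranked x k"
proof (rule ccontr)
  let ?S = "{t. 0 \<le> t \<and> finite {i. t < x i} \<and> card {i. t < x i} \<le> k}"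
  assume neg: "\<not> 0 \<le> ranked x k"
  have "?S \<noteq> {}"
  proof -
    define T where "T = Max (insert 1 (x ` {i. 1 < x i}))"
    have "1 \<le> T" unfolding T_def using fin[of 1] by auto
    have "\<not> T < x i" for i
    proof
      assume "T < x i"
      with \<open>1 \<le> T\<close> have "x i \<le> T" unfolding T_def using fin[of 1] by (intro Max_ge) auto
      with \<open>T < x i\<close> show False by simp
    qed
    then have "T \<in> ?S" using \<open>1 \<le> T\<close> by simp
    then show ?thesis by blast
  qed
  then have "0 \<le> ranked x k" unfolding ranked_def by (intro cInf_greatest) auto
  with neg show False by simp
qed

lemma decseq_ranked:
  fixes x :: "'i \<Rightarrow> real"
  assumes fin: "\<And>t. 0 < t \<Longrightarrow> finite {i. t < x i}"
  shows "decseq (ranked x)"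
proof (rule decseq_SucI)
  fix k :: nat
  show "ranked x (Suc k) \<le> ranked x k"
  proof (rule ccontr)
    assume "\<not> ?thesis"
    then obtain t where t: "ranked x k < t" "t < ranked x (Suc k)" using dense[of "ranked x k" "ranked x (Suc k)"] by auto
    moreover have "0 \<le> ranked x k" by (rule ranked_nonneg[OF fin])
    ultimately have "0 < t" by linarith
    then show False
      using t less_ranked_iff[of x t k] less_ranked_iff[of x t "Suc k"] fin by auto
  qed
qed

lemma ennreal_power_eq_nn_integral:
  assumes "0 < m" "0 \<le> x"
  shows "ennreal x ^ m = (\<integral>\<^sup>+ t. ennreal (real m * t ^ (m - 1)) * indicator {t. 0 < t \<and> t < x} t \<partial>lborel)"
proof -
  have "(\<integral>\<^sup>+ t. ennreal (real m * t ^ (m - 1)) * indicator {t. 0 < t \<and> t < x} t \<partial>lborel)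
     = (\<integral>\<^sup>+ t. ennreal (real m * t ^ (m - 1)) * indicator {0..x} t \<partial>lborel)"
  proof (rule nn_integral_cong_AE)
    have "AE t in lborel. t \<noteq> 0 \<and> t \<noteq> x"
      using AE_lborel_singleton[of 0] AE_lborel_singleton[of x] by eventually_elim auto
    then show "AE t in lborel. ennreal (real m * t ^ (m - 1)) * indicator {t. 0 < t \<and> t < x} t
        = ennreal (real m * t ^ (m - 1)) * indicator {0..x} t"
      by eventually_elim (auto split: split_indicator)
  qed
  also have "\<dots> = ennreal (x ^ m - 0 ^ m)"
    using assms by (intro nn_integral_FTC_Icc) (auto intro!: derivative_eq_intros)
  finally show ?thesis using assms by (simp add: ennreal_power)
qed

lemma finite_superlevel_if_summable:
  fixes x :: "'i \<Rightarrow> real"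
  assumes "(\<integral>\<^sup>+ i. ennreal (x i) \<partial>count_space UNIV) < \<top>" "0 < t"
  shows "finite {i. t < x i}"
proof -
  have "emeasure (count_space UNIV) {i. t < x i} \<le> emeasure (count_space UNIV) {i\<in>UNIV. 1 \<le> ennreal (1 / t) * ennreal (x i)}"
    using assms(2) by (intro emeasure_mono) (auto simp: ennreal_mult'[symmetric] divide_simps)
  also have "\<dots> \<le> ennreal (1 / t) * (\<integral>\<^sup>+ i. ennreal (x i) * indicator UNIV i \<partial>count_space UNIV)"
    by (rule nn_integral_Markov_inequality) auto
  also have "\<dots> < \<top>" using assms by (simp add: ennreal_mult_less_top)
  finally show ?thesis by (simp add: emeasure_count_space split: if_splits)
qed

text \<open>The layer-cake formula: a power sum depends on the family only through the number of
  members above each positive level.\<close>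

lemma nn_integral_count_space_power_eq:
  fixes y :: "'i::countable \<Rightarrow> real"
  assumes "\<And>i. 0 \<le> y i" "0 < m"
  shows "(\<integral>\<^sup>+ i. ennreal (y i) ^ m \<partial>count_space UNIV)
     = (\<integral>\<^sup>+ t. ennreal (real m * t ^ (m - 1)) * indicator {0<..} t * emeasure (count_space UNIV) {i. t < y i} \<partial>lborel)"
proof -
    have "(\<integral>\<^sup>+ i. ennreal (y i) ^ m \<partial>count_space UNIV)
      = (\<integral>\<^sup>+ i. \<integral>\<^sup>+ t. ennreal (real m * t ^ (m - 1)) * indicator {t. 0 < t \<and> t < y i} t \<partial>lborel \<partial>count_space UNIV)"
      using assms by (simp add: ennreal_power_eq_nn_integral)
    also have "\<dots> = (\<integral>\<^sup>+ t. \<integral>\<^sup>+ i. ennreal (real m * t ^ (m - 1)) * indicator {t. 0 < t \<and> t < y i} t \<partial>count_space UNIV \<partial>lborel)"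
      by (rule nn_integral_count_space_nn_integral[symmetric]) auto
    also have "\<dots> = (\<integral>\<^sup>+ t. \<integral>\<^sup>+ i. ennreal (real m * t ^ (m - 1)) * indicator {0<..} t * indicator {i. t < y i} i \<partial>count_space UNIV \<partial>lborel)"
      by (intro nn_integral_cong) (auto split: split_indicator)
    finally show ?thesis by (simp add: nn_integral_cmult)
qed

text \<open>The layer-cake formula applies to both families, and ranking preserves the number of
  members above every positive level.\<close>

lemma psum_ranked:
  fixes x :: "'i::countable \<Rightarrow> real"
  assumes nonneg: "\<And>i. 0 \<le> x i" and sm: "(\<integral>\<^sup>+ i. ennreal (x i) \<partial>count_space UNIV) < \<top>" and "0 < m"
  shows "psum m (ranked x) = (\<integral>\<^sup>+ i. ennreal (x i) ^ m \<partial>count_space UNIV)"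
proof -
  note fin = finite_superlevel_if_summable[OF sm]
  have "emeasure (count_space UNIV) {i. t < ranked x i} = emeasure (count_space UNIV) {i. t < x i}" if "0 < t" for t
  proof -
    have "{i. t < ranked x i} = {..<card {i. t < x i}}"
      using less_ranked_iff[OF fin that] by auto
    then show ?thesis using fin[OF that] by simp
  qed
  note count = this
  have "psum m (ranked x) = (\<integral>\<^sup>+ i. ennreal (ranked x i) ^ m \<partial>count_space UNIV)"
    by (simp add: psum_def nn_integral_count_space_nat)
  also have "\<dots> = (\<integral>\<^sup>+ t. ennreal (real m * t ^ (m - 1)) * indicator {0<..} t
      * emeasure (count_space UNIV) {i. t < ranked x i} \<partial>lborel)"
    by (intro nn_integral_count_space_power_eq ranked_nonneg fin \<open>0 < m\<close>)
  also have "\<dots> = (\<integral>\<^sup>+ t. ennreal (real m * t ^ (m - 1)) * indicator {0<..} t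
      * emeasure (count_space UNIV) {i. t < x i} \<partial>lborel)"
    by (intro nn_integral_cong) (auto simp: count split: split_indicator)
  also have "\<dots> = (\<integral>\<^sup>+ i. ennreal (x i) ^ m \<partial>count_space UNIV)"
    by (intro nn_integral_count_space_power_eq[symmetric] nonneg \<open>0 < m\<close>)
  finally show ?thesis .
qed

lemma P_inftyI:
  assumes "decseq p" "\<And>i. 0 \<le> p i" "psum 1 p = 1"
  shows "p \<in> P_infty"
proof -
  have 1: "(\<Sum>i. ennreal (p i)) = 1" using assms(3) by (simp add: psum_def)
  then have "summable p" using assms(2) by (intro summable_suminf_not_top) auto
  moreover have "ennreal (suminf p) = 1"
    using suminf_ennreal2[OF assms(2) \<open>summable p\<close>] 1 by simp
  then have "suminf p = 1" by (simp add: ennreal_eq_1)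
  ultimately show ?thesis using assms by (auto simp: P_infty_def sums_iff)
qed

lemma P_infty_D:
  assumes "p \<in> P_infty"
  shows "decseq p" "0 \<le> p i" "p i \<le> 1" "psum 1 p = 1" "0 < m \<Longrightarrow> psum m p \<le> 1"
proof -
  have p: "decseq p" "\<And>i. 0 \<le> p i" "p sums 1" using assms by (auto simp: P_infty_def)
  then show "decseq p" "0 \<le> p i" by auto
  show 1: "psum 1 p = 1"
    using suminf_ennreal2[OF p(2)] p(3) by (simp add: psum_def sums_iff)
  have le1: "p i \<le> 1" for i
    using p sum_le_suminf[of p "{i}"] by (auto simp: sums_iff)
  then show "p i \<le> 1" .
  show "psum m p \<le> 1" if "0 < m"
  proof -
    have "psum m p \<le> psum 1 p"
      unfolding psum_def
    proof (intro suminf_le)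
      fix i
      have "p i ^ m \<le> p i ^ 1" using that p le1 by (intro power_decreasing) auto
      then show "ennreal (p i) ^ m \<le> ennreal (p i) ^ 1" using p by (simp add: ennreal_power)
    qed auto
    with 1 show ?thesis by simp
  qed
qed

lemma ranked_in_P_infty:
  fixes x :: "'i::countable \<Rightarrow> real"
  assumes "\<And>i. 0 \<le> x i" and "(\<integral>\<^sup>+ i. ennreal (x i) \<partial>count_space UNIV) = 1"
  shows "ranked x \<in> P_infty"
proof -
  have sm: "(\<integral>\<^sup>+ i. ennreal (x i) \<partial>count_space UNIV) < \<top>" using assms by simp
  note fin = finite_superlevel_if_summable[OF sm]
  show ?thesis
    using psum_ranked[OF assms(1) sm, of 1] assms(2)
    by (intro P_inftyI decseq_ranked[OF fin] ranked_nonneg[OF fin]) auto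
qed

text \<open>The infimum runs over an uncountable set of levels. That set is closed under larger
  levels and, if nonempty, contains its infimum, so a bound on \<open>ranked\<close> becomes the
  defining condition at a single level.\<close>

lemma ranked_measurable:
  fixes x :: "'a \<Rightarrow> 'i::countable \<Rightarrow> real"
  assumes [measurable]: "\<And>i. (\<lambda>\<omega>. x \<omega> i) \<in> borel_measurable M"
  shows "(\<lambda>\<omega>. ranked (x \<omega>)) \<in> borel_measurable M"
proof (rule measurable_coordinatewise_then_product)
  fix k
  let ?N = "\<lambda>y t. finite {i::'i. t < y i} \<and> card {i. t < y i} \<le> k"
  \<comment> \<open>At most \<open>k\<close> members exceed \<open>t\<close> iff no set of
    \<open>k + 1\<close> indices lies wholly above \<open>t\<close>. There are only countably many
    such index sets.\<close>
  have few: "?N y t \<longleftrightarrow> (\<forall>F\<in>{F :: 'i set. finite F \<and> card F = Suc k}. \<exists>i\<in>F. y i \<le> t)" for y :: "'i \<Rightarrow> real" and t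
  proof (intro iffI ballI)
    fix F :: "'i set" assume "?N y t" "F \<in> {F :: 'i set. finite F \<and> card F = Suc k}"
    then show "\<exists>i\<in>F. y i \<le> t"
      by (metis (mono_tags, lifting) card_mono mem_Collect_eq not_less not_less_eq_eq order_trans subsetI)
  next
    assume R: "\<forall>F\<in>{F :: 'i set. finite F \<and> card F = Suc k}. \<exists>i\<in>F. y i \<le> t"
    show "?N y t"
    proof (rule ccontr)
      assume "\<not> ?N y t"
      then have "\<exists>F\<subseteq>{i. t < y i}. finite F \<and> card F = Suc k"
        by (metis infinite_arbitrarily_large not_less_eq_eq obtain_subset_with_card_n)
      with R show False by fastforce
    qed
  qed
  have few_mono: "?N y t'" if "?N y t" "t \<le> t'" for y :: "'i \<Rightarrow> real" and t t'
  proof -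
    have sub: "{i. t' < y i} \<subseteq> {i. t < y i}" using that(2) by auto
    then have "card {i. t' < y i} \<le> card {i. t < y i}" using that(1) by (intro card_mono) auto
    with sub that(1) show ?thesis using finite_subset[OF sub] by simp
  qed
  \<comment> \<open>If no level qualifies, \<open>ranked\<close> is the constant
    \<open>Inf {}\<close>. Since the condition is monotone in the level, this case is detected by
    the natural numbers alone.\<close>
  have ranked_le: "ranked y k \<le> a \<longleftrightarrow> (if \<forall>n::nat. \<not> ?N y (real n) then Inf {} \<le> a else 0 \<le> a \<and> ?N y a)" for y a
  proof (cases "\<forall>n::nat. \<not> ?N y (real n)")
    case True
    have "\<not> (0 \<le> t \<and> ?N y t)" for t
      using True few_mono[of t y "real (nat \<lceil>t\<rceil>)"] by (meson of_nat_ceiling)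
    then show ?thesis using True unfolding ranked_def by (simp cong: conj_cong)
  next
    case False
    let ?S = "{t. 0 \<le> t \<and> ?N y t}"
    have ne: "?S \<noteq> {}" using False by (auto intro: of_nat_0_le_iff)
    have bdd: "bdd_below ?S" by (auto intro: bdd_belowI[of _ 0])
    \<comment> \<open>If \<open>k + 1\<close> members exceeded the infimum, their minimum would lie
      strictly above it, hence above some admissible level, which they would then all
      exceed.\<close>
    have "?N y (Inf ?S)"
    proof (rule few[THEN iffD2], intro ballI, rule ccontr)
      fix F :: "'i set" assume F: "F \<in> {F. finite F \<and> card F = Suc k}" and "\<not> (\<exists>i\<in>F. y i \<le> Inf ?S)"
      then have F': "\<And>i. i \<in> F \<Longrightarrow> Inf ?S < y i" "finite F" "F \<noteq> {}" by (auto simp: not_le)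
      then have "Inf ?S < Min (y ` F)" by (subst Min_gr_iff) auto
      then obtain t where "t \<in> ?S" "t < Min (y ` F)" using cInf_lessD[OF ne] by blast
      then have "?N y t" "\<And>i. i \<in> F \<Longrightarrow> t < y i" using F' by auto
      then show False using F few[of t y] by (meson not_le)
    qed
    moreover have "0 \<le> Inf ?S" using ne by (intro cInf_greatest) auto
    ultimately have "Inf ?S \<le> a \<longleftrightarrow> 0 \<le> a \<and> ?N y a"
    proof (intro iffI)
      assume "?N y (Inf ?S)" "0 \<le> Inf ?S" "Inf ?S \<le> a"
      then show "0 \<le> a \<and> ?N y a" using few_mono[of "Inf ?S" y a] order_trans by blast
    next
      assume "0 \<le> a \<and> ?N y a"
      then show "Inf ?S \<le> a" by (intro cInf_lower bdd) simp
    qed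
    then show ?thesis using False unfolding ranked_def by auto
  qed
  have [measurable]: "Measurable.pred M (\<lambda>\<omega>. ?N (x \<omega>) t)" for t
  proof -
    have "countable {F :: 'i set. finite F \<and> card F = Suc k}"
      by (rule countable_subset[OF _ countable_Collect_finite]) auto
    moreover have "Measurable.pred M (\<lambda>\<omega>. \<exists>i\<in>F. x \<omega> i \<le> t)" if "finite F" for F
      using that by measurable
    ultimately show ?thesis unfolding few by (intro measurable_pred_countable(1)) auto
  qed
  show "(\<lambda>\<omega>. ranked (x \<omega>) k) \<in> borel_measurable M"
    unfolding borel_measurable_iff_le ranked_le by (intro allI) measurable
qed

subsection \<open>Determination by moments\<close>

text \<open>The Hausdorff moment problem: polynomials approximate continuous functions uniformly on
  the unit interval, and continuous ramps approximate the indicators of rays.\<close>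

lemma measure_eqI_power_moments:
  fixes M N :: "real measure"
  assumes "finite_measure M" "finite_measure N" and sets: "sets M = sets borel" "sets N = sets borel"
    and AE: "AE t in M. 0 \<le> t \<and> t \<le> 1" "AE t in N. 0 \<le> t \<and> t \<le> 1"
    and mom: "\<And>k. (\<integral>\<^sup>+ t. ennreal t ^ k \<partial>M) = (\<integral>\<^sup>+ t. ennreal t ^ k \<partial>N)"
  shows "M = N"
proof -
  let ?G = "\<lambda>h. \<integral>t. h t \<partial>N"
  let ?F = "\<lambda>h. \<integral>t. h t \<partial>M"
  interpret M: finite_measure M by fact
  interpret N: finite_measure N by fact
  note sets[measurable_cong]
  have [simp]: "space M = UNIV" "space N = UNIV" using sets[THEN sets_eq_imp_space_eq] by auto
  have int: "integrable L h" if "finite_measure L" "sets L = sets borel" "AE t in L. 0 \<le> t \<and> t \<le> 1"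
      "continuous_on UNIV h" for L and h :: "real \<Rightarrow> real"
  proof -
    interpret finite_measure L by fact
    have "compact (h ` {0..1})"
      using that(4) by (intro compact_continuous_image continuous_on_subset[OF that(4)]) auto
    then obtain B where B: "\<And>t. t \<in> {0..1} \<Longrightarrow> norm (h t) \<le> B"
      using compact_imp_bounded[of "h ` {0..1}"] unfolding bounded_iff by (meson image_eqI)
    have "h \<in> borel_measurable L"
      unfolding measurable_cong_sets[OF that(2) refl] by (rule borel_measurable_continuous_onI[OF that(4)])
    moreover have "AE t in L. norm (h t) \<le> B" using that(3) by eventually_elim (use B in auto)
    ultimately show ?thesis by (intro integrable_const_bound)
  qed
  have intM: "integrable M h" and intN: "integrable N h" if "continuous_on UNIV h" for h :: "real \<Rightarrow> real"
    using that assms int by blast+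
  have pow: "(\<integral>t. t ^ k \<partial>M) = (\<integral>t. t ^ k \<partial>N)" for k
  proof -
    have "(\<integral>t. t ^ k \<partial>L) = enn2real (\<integral>\<^sup>+ t. ennreal t ^ k \<partial>L)"
      if [measurable_cong]: "sets L = sets borel" and ae: "AE t in L. 0 \<le> t \<and> t \<le> 1" for L :: "real measure"
    proof -
      have "(\<integral>t. t ^ k \<partial>L) = enn2real (\<integral>\<^sup>+ t. ennreal (t ^ k) \<partial>L)"
        using ae by (intro integral_eq_nn_integral) auto
      also have "(\<integral>\<^sup>+ t. ennreal (t ^ k) \<partial>L) = (\<integral>\<^sup>+ t. ennreal t ^ k \<partial>L)"
        using ae by (intro nn_integral_cong_AE) (auto simp: ennreal_power elim!: eventually_mono)
      finally show ?thesis .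
    qed
    then show ?thesis using mom sets AE by metis
  qed
  have cont: "(?F h) = (?G h)" if h: "continuous_on UNIV h" for h :: "real \<Rightarrow> real"
  proof -
    define K where "K = measure M UNIV + measure N UNIV"
    have small: "\<bar>(?F h) - (?G h)\<bar> \<le> e * K" if "0 < e" for e
    proof -
      obtain q where q: "real_polynomial_function q" "\<And>t. t \<in> {0..1} \<Longrightarrow> \<bar>h t - q t\<bar> < e"
        using Stone_Weierstrass_real_polynomial_function[of "{0..1}" h e] \<open>0 < e\<close> continuous_on_subset[OF h] by auto
      then obtain a n where qa: "q = (\<lambda>t. \<Sum>i\<le>n. a i * t ^ i)" unfolding real_polynomial_function_iff_sum by auto
      have cq: "continuous_on UNIV q" unfolding qa by (intro continuous_intros)
      have ci: "continuous_on UNIV (\<lambda>t::real. a i * t ^ i)" for i by (intro continuous_intros)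
      have eq: "(\<integral>t. q t \<partial>M) = (\<integral>t. q t \<partial>N)"
        unfolding qa using intM[OF ci] intN[OF ci] by (simp add: pow)
      have bd: "\<bar>(\<integral>t. h t \<partial>L) - (\<integral>t. q t \<partial>L)\<bar> \<le> e * measure L UNIV"
        if L: "finite_measure L" "sets L = sets borel" and ae: "AE t in L. 0 \<le> t \<and> t \<le> 1" for L
      proof -
        interpret finite_measure L by fact
        have [simp]: "space L = UNIV" using L(2)[THEN sets_eq_imp_space_eq] by auto
        have i: "integrable L h" "integrable L q" using int[OF L ae] h cq by auto
        have "\<bar>(\<integral>t. h t \<partial>L) - (\<integral>t. q t \<partial>L)\<bar> = \<bar>\<integral>t. h t - q t \<partial>L\<bar>" using i by simp
        also have "\<dots> \<le> (\<integral>t. \<bar>h t - q t\<bar> \<partial>L)" by (rule integral_abs_bound)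
        also have "\<dots> \<le> (\<integral>t. e \<partial>L)"
        proof (rule integral_mono_AE)
          show "AE t in L. \<bar>h t - q t\<bar> \<le> e"
            using ae by eventually_elim (use q(2) in \<open>auto intro: less_imp_le\<close>)
        qed (use i in auto)
        finally show ?thesis by (simp add: mult.commute)
      qed
      have "\<bar>(?F h) - (?G h)\<bar> \<le>
          \<bar>(?F h) - (\<integral>t. q t \<partial>M)\<bar> + \<bar>(?G h) - (\<integral>t. q t \<partial>N)\<bar>"
        unfolding eq by linarith
      also have "\<dots> \<le> e * measure M UNIV + e * measure N UNIV"
        using assms by (intro add_mono bd) auto
      finally show ?thesis by (simp add: K_def distrib_left)
    qed
    have K: "0 \<le> K" by (simp add: K_def)
    have "\<bar>(?F h) - (?G h)\<bar> \<le> 0 + e" if "0 < e" for e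
    proof -
      \<comment> \<open>Dividing by \<open>K + 1\<close> instead of \<open>K\<close> covers the case
        that both measures vanish.\<close>
      have "\<bar>(?F h) - (?G h)\<bar> \<le> e / (K + 1) * K"
        using that K by (intro small) auto
      also have "\<dots> \<le> e" using that K by (simp add: field_simps)
      finally show ?thesis by simp
    qed
    then have "\<bar>(?F h) - (?G h)\<bar> \<le> 0" by (rule field_le_epsilon)
    then show ?thesis by simp
  qed
  \<comment> \<open>The ramps are 0 up to \<open>a\<close> and reach 1 at distance
    \<open>1 / m\<close> beyond it; dominated convergence is available since the measure is
    finite.\<close>
  have ray: "(\<lambda>m. \<integral>t. min 1 (max 0 (real m * (t - a))) \<partial>L) \<longlonglongrightarrow> measure L {a<..}"
    if L: "finite_measure L" "sets L = sets borel" for L a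
  proof -
    interpret finite_measure L by fact
    note L(2)[measurable_cong]
    have "(\<lambda>m. \<integral>t. min 1 (max 0 (real m * (t - a))) \<partial>L) \<longlonglongrightarrow> (\<integral>t. indicator {a<..} t \<partial>L)"
    proof (rule integral_dominated_convergence[where w = "\<lambda>_. 1"])
      show "AE t in L. (\<lambda>m. min 1 (max 0 (real m * (t - a)))) \<longlonglongrightarrow> indicator {a<..} t"
      proof (rule AE_I2, goal_cases)
        case (1 t)
        show ?case
        proof (cases "a < t")
          case True
          obtain k where k: "1 / (t - a) \<le> real k" using real_arch_simple by blast
          have "eventually (\<lambda>m. min 1 (max 0 (real m * (t - a))) = 1) sequentially"
            using eventually_ge_at_top[of k]
          proof eventually_elim
            case (elim m)
            then have "1 / (t - a) \<le> real m" using k by linarith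
            then have "1 \<le> real m * (t - a)" using True by (simp add: field_simps)
            then show ?case by simp
          qed
          with True show ?thesis by (simp add: tendsto_eventually)
        next
          case False
          then have "max 0 (real m * (t - a)) = 0" for m by (intro max_absorb1 mult_nonneg_nonpos) auto
          with False show ?thesis by simp
        qed
      qed
    qed (auto simp: L)
    then show ?thesis using L(2)[THEN sets_eq_imp_space_eq] by simp
  qed
  show ?thesis
  proof (rule measure_eqI_lessThan)
    fix a
    have "continuous_on UNIV (\<lambda>t. min 1 (max 0 (real m * (t - a))))" for m
      by (intro continuous_intros)
    then have "measure M {a<..} = measure N {a<..}"
      using ray[of M a] ray[of N a] assms by (simp add: cont) (rule LIMSEQ_unique)
    then show "emeasure M {a<..} = emeasure N {a<..}"
      by (simp add: M.emeasure_eq_measure N.emeasure_eq_measure)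
    show "emeasure M {a<..} < \<infinity>" by (simp add: less_top[symmetric])
  qed (use sets in auto)
qed

lemma prod_list_le_one_ennreal: "(\<And>c. c \<in> set cs \<Longrightarrow> c \<le> (1::ennreal)) \<Longrightarrow> prod_list cs \<le> 1"
proof (induction cs)
  case (Cons c cs)
  then show ?case using mult_mono[of c 1 "prod_list cs" 1] by simp
qed simp

text \<open>Coordinates are treated one at a time. With all other factors absorbed into a weight,
  the image of the weighted measure under coordinate \<open>i\<close> lives on the unit interval,
  where equality of all moments permits replacing a power of \<open>x i\<close> by the indicator of
  a Borel set.\<close>

lemma measure_eqI_joint_moments:
  fixes M N :: "(nat \<Rightarrow> real) measure"
  assumes fin: "finite_measure M" "finite_measure N" and sets: "sets M = sets borel" "sets N = sets borel"
    and AE: "AE x in M. \<forall>i. 0 \<le> x i \<and> x i \<le> 1" "AE x in N. \<forall>i. 0 \<le> x i \<and> x i \<le> 1"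
    and mom: "\<And>ks. (\<integral>\<^sup>+ x. (\<Prod>i\<leftarrow>ks. ennreal (x i)) \<partial>M) = (\<integral>\<^sup>+ x. (\<Prod>i\<leftarrow>ks. ennreal (x i)) \<partial>N)"
  shows "M = N"
proof -
  have meas: "(\<lambda>x. x i) \<in> borel_measurable L" if "sets L = sets borel" for L :: "(nat \<Rightarrow> real) measure" and i
    using that measurable_product_coordinates by (simp cong: measurable_cong_sets)
  have measw: "(\<lambda>x. (\<Prod>j\<leftarrow>ks. ennreal (x j)) * (\<Prod>(j, A)\<leftarrow>fs. indicator A (x j))) \<in> borel_measurable L"
    if "\<And>j A. (j, A) \<in> set fs \<Longrightarrow> A \<in> sets borel" "sets L = sets borel"
    for L :: "(nat \<Rightarrow> real) measure" and ks and fs :: "(nat \<times> real set) list"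
  proof -
    note [measurable] = meas[OF that(2)]
    have "(\<lambda>x. (\<Prod>(j, A)\<leftarrow>fs. indicator A (x j)) :: ennreal) \<in> borel_measurable L"
      using that(1)
    proof (induction fs)
      case (Cons f fs)
      obtain j A where f: "f = (j, A)" by force
      then have [measurable]: "A \<in> sets borel" using Cons.prems[of j A] by simp
      have [measurable]: "(\<lambda>x. (\<Prod>(j, A)\<leftarrow>fs. indicator A (x j)) :: ennreal) \<in> borel_measurable L"
        using Cons by (metis list.set_intros(2))
      show ?case unfolding f by simp
    qed simp
    moreover have "(\<lambda>x. (\<Prod>j\<leftarrow>ks. ennreal (x j))) \<in> borel_measurable L"
      by (induction ks) auto
    ultimately show ?thesis by simp
  qed
  have key: "(\<integral>\<^sup>+ x. (\<Prod>j\<leftarrow>ks. ennreal (x j)) * (\<Prod>(j, A)\<leftarrow>fs. indicator A (x j)) \<partial>M)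
           = (\<integral>\<^sup>+ x. (\<Prod>j\<leftarrow>ks. ennreal (x j)) * (\<Prod>(j, A)\<leftarrow>fs. indicator A (x j)) \<partial>N)"
    if "\<And>j A. (j, A) \<in> set fs \<Longrightarrow> A \<in> sets borel" for ks and fs :: "(nat \<times> real set) list"
    using that
  proof (induction fs arbitrary: ks)
    case Nil
    then show ?case using mom[of ks] by simp
  next
    case (Cons f fs)
    obtain i A where f: "f = (i, A)" by force
    then have A: "A \<in> sets borel" using Cons.prems[of i A] by simp
    have fs: "\<And>j A. (j, A) \<in> set fs \<Longrightarrow> A \<in> sets borel" using Cons.prems by auto
    let ?w = "\<lambda>x. (\<Prod>j\<leftarrow>ks. ennreal (x j)) * (\<Prod>(j, A)\<leftarrow>fs. indicator A (x j))"
    define D where "D = (\<lambda>L. distr (density L ?w) borel (\<lambda>x. x i))"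
    have DL: "finite_measure (D L)" "AE t in D L. 0 \<le> t \<and> t \<le> 1"
        "(\<integral>\<^sup>+ t. g t \<partial>D L) = (\<integral>\<^sup>+ x. ?w x * g (x i) \<partial>L)"
      if L: "finite_measure L" "sets L = sets borel" "AE x in L. \<forall>i. 0 \<le> x i \<and> x i \<le> 1"
        and g: "g \<in> borel_measurable borel" for L g
    proof -
      interpret finite_measure L by fact
      note [measurable] = measw[OF fs L(2)] meas[OF L(2)] g
      have eq: "(\<integral>\<^sup>+ t. g' t \<partial>D L) = (\<integral>\<^sup>+ x. ?w x * g' (x i) \<partial>L)" if [measurable]: "g' \<in> borel_measurable borel" for g'
        by (simp add: D_def nn_integral_distr nn_integral_density)
      from g show "(\<integral>\<^sup>+ t. g t \<partial>D L) = (\<integral>\<^sup>+ x. ?w x * g (x i) \<partial>L)" by (rule eq)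
      have "(\<integral>\<^sup>+ t. 1 \<partial>D L) = (\<integral>\<^sup>+ x. ?w x \<partial>L)" by (subst eq) auto
      also have "\<dots> \<le> (\<integral>\<^sup>+ x. 1 \<partial>L)"
      proof (rule nn_integral_mono_AE)
        show "AE x in L. ?w x \<le> 1"
          using L(3)
        proof eventually_elim
          case (elim x)
          have "(\<Prod>j\<leftarrow>ks. ennreal (x j)) \<le> 1"
            using elim by (intro prod_list_le_one_ennreal) auto
          moreover have "(\<Prod>(j, A)\<leftarrow>fs. indicator A (x j)) \<le> (1::ennreal)"
            by (intro prod_list_le_one_ennreal) (auto split: split_indicator)
          ultimately show ?case using mult_mono[of "\<Prod>j\<leftarrow>ks. ennreal (x j)" 1 "\<Prod>(j, A)\<leftarrow>fs. indicator A (x j)" 1] by simp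
        qed
      qed
      also have "\<dots> < \<infinity>" by (simp add: less_top[symmetric])
      finally show "finite_measure (D L)" by (intro finite_measureI) simp
      show "AE t in D L. 0 \<le> t \<and> t \<le> 1"
        using L(3) unfolding D_def by (subst AE_distr_iff) (auto simp: AE_density elim!: eventually_mono)
    qed
    have "D M = D N"
    proof (rule measure_eqI_power_moments)
      fix k
      \<comment> \<open>The k-th moment of the image measure appends \<open>k\<close> copies of
        \<open>i\<close> to the monomial, which is why the induction is over arbitrary
        \<open>ks\<close>.\<close>
      have *: "?w x * ennreal (x i) ^ k = (\<Prod>j\<leftarrow>ks @ replicate k i. ennreal (x j)) * (\<Prod>(j, A)\<leftarrow>fs. indicator A (x j))" for x
        by (simp add: mult_ac prod_list_replicate)
      show "(\<integral>\<^sup>+ t. ennreal t ^ k \<partial>D M) = (\<integral>\<^sup>+ t. ennreal t ^ k \<partial>D N)"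
        using DL(3)[OF fin(1) sets(1) AE(1), of "\<lambda>t. ennreal t ^ k"]
          DL(3)[OF fin(2) sets(2) AE(2), of "\<lambda>t. ennreal t ^ k"]
          Cons.IH[where ks = "ks @ replicate k i", OF fs] unfolding * by simp
    qed (use DL(1,2)[OF fin(1) sets(1) AE(1), of "\<lambda>_. 0"] DL(1,2)[OF fin(2) sets(2) AE(2), of "\<lambda>_. 0"] in \<open>auto simp: D_def\<close>)
    then have "(\<integral>\<^sup>+ t. indicator A t \<partial>D M) = (\<integral>\<^sup>+ t. indicator A t \<partial>D N)" by simp
    then show ?case
      using DL(3)[OF fin(1) sets(1) AE(1), of "indicator A"] DL(3)[OF fin(2) sets(2) AE(2), of "indicator A"] A
      by (simp add: f mult_ac)
  qed
  show ?thesis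
  proof (rule measure_eqI_PiM_infinite[where I = UNIV and M = "\<lambda>_. borel"])
    fix A and J :: "nat set" assume J: "finite J" "\<And>i. i \<in> J \<Longrightarrow> A i \<in> sets (borel :: real measure)"
    obtain js where js: "set js = J" "distinct js" using J(1) finite_distinct_list by blast
    let ?fs = "map (\<lambda>j. (j, A j)) js"
    have ind: "(\<Prod>(j, A)\<leftarrow>?fs. indicator A (x j)) = (indicator (prod_emb UNIV (\<lambda>_. borel) J (Pi\<^sub>E J A)) x :: ennreal)" for x
    proof -
      have "(\<Prod>(j, A)\<leftarrow>?fs. indicator A (x j)) = (\<Prod>j\<in>J. indicator (A j) (x j) :: ennreal)"
        using js by (simp add: o_def prod.distinct_set_conv_list[symmetric])
      also have "\<dots> = indicator (prod_emb UNIV (\<lambda>_. borel) J (Pi\<^sub>E J A)) x"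
        using J(1) by (auto simp: indicator_def prod_emb_def PiE_iff of_bool_def)
      finally show ?thesis .
    qed
    have m: "prod_emb UNIV (\<lambda>_. borel) J (Pi\<^sub>E J A) \<in> sets (PiM UNIV (\<lambda>_::nat. borel :: real measure))"
      using J by (intro sets_PiM_I) auto
    have "(\<integral>\<^sup>+ x. indicator (prod_emb UNIV (\<lambda>_. borel) J (Pi\<^sub>E J A)) x \<partial>M)
        = (\<integral>\<^sup>+ x. indicator (prod_emb UNIV (\<lambda>_. borel) J (Pi\<^sub>E J A)) x \<partial>N)"
      using key[of ?fs "[]"] J(2) js(1) unfolding ind by auto
    then show "emeasure M (prod_emb UNIV (\<lambda>_. borel) J (Pi\<^sub>E J A)) = emeasure N (prod_emb UNIV (\<lambda>_. borel) J (Pi\<^sub>E J A))"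
      using m sets by (simp add: sets_PiM_equal_borel)
  qed (use fin sets in \<open>auto simp: sets_PiM_equal_borel\<close>)
qed

section \<open>Uniqueness of Laplace transforms\<close>

abbreviation (input) laplace :: "(real \<Rightarrow> ennreal) \<Rightarrow> real \<Rightarrow> ennreal" where
  "laplace g l \<equiv> \<integral>\<^sup>+ t. indicator {0<..} t * g t * ennreal (exp (- l * t)) \<partial>lborel"

text \<open>The map \<open>exp (- t)\<close> carries the half-line to the unit interval and the
  transform at \<open>k + 1\<close> to the k-th moment of a measure there. The extra 1 provides the
  weight \<open>exp (- t)\<close>, which makes that measure finite.\<close>

lemma AE_eqI_Laplace:
  fixes g h :: "real \<Rightarrow> ennreal"
  assumes [measurable]: "g \<in> borel_measurable borel" "h \<in> borel_measurable borel"
    and eq: "\<And>l. 0 < l \<Longrightarrow> laplace g l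
                       = laplace h l"
    and fin: "\<And>l. 0 < l \<Longrightarrow> laplace g l < \<top>"
  shows "AE t in lborel. 0 < t \<longrightarrow> g t = h t"
proof -
  let ?d = "\<lambda>g t. indicator {0<..} t * g t * ennreal (exp (- t))"
  let ?D = "\<lambda>g. distr (density lborel (?d g)) borel (\<lambda>t. exp (- t))"
  have mom: "(\<integral>\<^sup>+ t. ennreal t ^ k \<partial>?D g) = laplace g (real k + 1)"
    if [measurable]: "g \<in> borel_measurable borel" for g k
  proof -
    have e: "ennreal (exp (- (real k + 1) * t)) = ennreal (exp (- t)) * ennreal (exp (- t)) ^ k" for t
      by (simp add: ennreal_power ennreal_mult'[symmetric] exp_of_nat_mult[symmetric] exp_add[symmetric] algebra_simps)
    show ?thesis unfolding e by (simp add: nn_integral_distr nn_integral_density mult_ac)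
  qed
  have fm: "finite_measure (?D g)"
    if [measurable]: "g \<in> borel_measurable borel"
      and "laplace g 1 < \<top>" for g
    using mom[of g 0] that by (intro finite_measureI) simp
  have ae: "AE t in ?D g. 0 \<le> t \<and> t \<le> 1" if [measurable]: "g \<in> borel_measurable borel" for g
    by (subst AE_distr_iff) (auto simp: AE_density intro!: AE_I2 split: split_indicator)
  have "?D g = ?D h"
    using eq[of "real k + 1" for k] fin[of 1] eq[of 1]
    by (intro measure_eqI_power_moments fm ae) (auto simp: mom)
  then have "distr (?D g) borel (\<lambda>t. - ln t) = distr (?D h) borel (\<lambda>t. - ln t)" by simp
  then have D: "density lborel (?d g) = density lborel (?d h)"
    by (simp add: distr_distr o_def distr_id2)
  have "AE t in lborel. ?d g t = ?d h t"
    using D by (subst (asm) sigma_finite_measure.density_unique_iff[OF sigma_finite_lborel]) auto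
  then show ?thesis
  proof eventually_elim
    case (elim t)
    show ?case
    proof
      assume "0 < t"
      with elim have "ennreal (exp (- t)) * g t = ennreal (exp (- t)) * h t" by (simp add: mult.commute)
      then show "g t = h t" unfolding ennreal_mult_cancel_left by simp
    qed
  qed
qed

section \<open>Power sums determine the law of a ranked sequence\<close>

text \<open>Each factor \<open>psum m\<close> is absorbed into the distinct sum by
  \<open>edsum_product\<close>, at the price of a sum over further distinct sums, until no power sum
  is left.\<close>

lemma nn_integral_psum_edsum_eqI:
  fixes M N :: "(nat \<Rightarrow> real) measure"
  assumes sets: "sets M = sets borel" "sets N = sets borel"
    and eq: "\<And>A n. finite A \<Longrightarrow> (\<And>a. a \<in> A \<Longrightarrow> 0 < n a)
        \<Longrightarrow> (\<integral>\<^sup>+ x. edsum (A :: nat set) n x \<partial>M) = (\<integral>\<^sup>+ x. edsum A n x \<partial>N)"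
    and "finite A" "\<And>a. a \<in> A \<Longrightarrow> 0 < n a" "\<And>m. m \<in> set ms \<Longrightarrow> 0 < m"
  shows "(\<integral>\<^sup>+ x. (\<Prod>m\<leftarrow>ms. psum m x) * edsum (A :: nat set) n x \<partial>M)
       = (\<integral>\<^sup>+ x. (\<Prod>m\<leftarrow>ms. psum m x) * edsum A n x \<partial>N)"
  using assms(4-6)
proof (induction ms arbitrary: A n)
  case Nil
  then show ?case by (simp add: eq)
next
  case (Cons m ms)
  \<comment> \<open>Slots are natural numbers so that a fresh label always exists for the power sum
    being absorbed.\<close>
  obtain a where a: "a \<notin> A" using Cons.prems ex_new_if_finite by blast
  define n' where "n' = n(a := m)"
  define f where "f = (\<lambda>x. \<Prod>m\<leftarrow>ms. psum m x)"
  have id: "(\<lambda>x. x) \<in> borel_measurable L" if "sets L = sets borel" for L :: "(nat \<Rightarrow> real) measure"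
    unfolding measurable_cong_sets[OF that refl] by simp
  have fm: "f \<in> borel_measurable L" if "sets L = sets borel" for L
    unfolding f_def by (induction ms) (use psum_measurable[OF id[OF that]] in auto)
  have em: "(\<lambda>x. edsum B k x) \<in> borel_measurable L" if "sets L = sets borel" "finite B" for L B and k :: "nat \<Rightarrow> nat"
    by (rule edsum_measurable[OF that(2) id[OF that(1)]])
  have split: "(\<integral>\<^sup>+ x. (\<Prod>m\<leftarrow>m # ms. psum m x) * edsum A n x \<partial>L)
     = (\<integral>\<^sup>+ x. f x * edsum (insert a A) n' x \<partial>L)
       + (\<Sum>b\<in>A. \<integral>\<^sup>+ x. f x * edsum A (n'(b := n' b + n' a)) x \<partial>L)" if "sets L = sets borel" for L
  proof -
    have "psum m x * edsum A n x = edsum (insert a A) n' x + (\<Sum>b\<in>A. edsum A (n'(b := n' b + n' a)) x)" for x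
    proof -
      have "edsum A n' x = edsum A n x" by (rule edsum_cong) (use a in \<open>auto simp: n'_def\<close>)
      then show ?thesis using edsum_product[OF Cons.prems(1) a, of n' x] by (simp add: n'_def)
    qed
    note pe = this
    have "(\<Prod>m\<leftarrow>m # ms. psum m x) * edsum A n x = f x * (psum m x * edsum A n x)" for x
      by (simp add: f_def mult_ac)
    then have "(\<Prod>m\<leftarrow>m # ms. psum m x) * edsum A n x
        = f x * edsum (insert a A) n' x + (\<Sum>b\<in>A. f x * edsum A (n'(b := n' b + n' a)) x)" for x
      by (simp add: pe distrib_left sum_distrib_left)
    then show ?thesis
      using fm[OF that] em[OF that] Cons.prems(1) by (simp add: nn_integral_add nn_integral_sum)
  qed
  show ?case
    unfolding split[OF sets(1)] split[OF sets(2)] f_def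
    using Cons.prems by (intro arg_cong2[where f = "(+)"] sum.cong refl Cons.IH) (auto simp: n'_def)
qed

text \<open>The tail from index \<open>j\<close> on is at least its first term and, by monotonicity,
  at most \<open>x j ^ m\<close> times the remaining mass, which is at most 1. Both bounds have the
  same root asymptotics.\<close>

lemma psum_tail_bounds:
  assumes x: "x \<in> P_infty"
  shows "x j ^ Suc m \<le> enn2real (psum (Suc m) x) - (\<Sum>i<j. x i ^ Suc m)"
    and "enn2real (psum (Suc m) x) - (\<Sum>i<j. x i ^ Suc m) \<le> x j ^ m"
proof -
  note D = P_infty_D[OF x]
  have sm: "summable x" using x by (auto simp: P_infty_def sums_iff)
  have le: "x i ^ Suc m \<le> x i" for i m
    using D(2,3) power_decreasing[of 1 "Suc m" "x i"] by auto
  have sm': "summable (\<lambda>i. x i ^ Suc m)" for m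
    by (rule summable_comparison_test'[OF sm, of 0]) (use D(2) le in auto)
  have ps: "enn2real (psum (Suc m) x) = (\<Sum>i. x i ^ Suc m)" for m
  proof -
    have "psum (Suc m) x = (\<Sum>i. ennreal (x i ^ Suc m))"
      using D(2) by (simp add: psum_def ennreal_power del: power_Suc)
    also have "\<dots> = ennreal (\<Sum>i. x i ^ Suc m)"
      using D(2) sm' by (intro suminf_ennreal2) auto
    finally show ?thesis using D(2) sm' by (simp add: suminf_nonneg del: power_Suc)
  qed
  define t where "t = (\<lambda>m. \<Sum>i. x (i + j) ^ Suc m)"
  have t: "enn2real (psum (Suc m) x) - (\<Sum>i<j. x i ^ Suc m) = t m" for m
    unfolding ps t_def using suminf_split_initial_segment[OF sm', of m j] by simp
  have smj: "summable (\<lambda>i. x (i + j) ^ Suc m)" for m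
    using sm' summable_iff_shift[of "\<lambda>i. x i ^ Suc m" j] by blast
  have lower: "x j ^ Suc m \<le> t m" for m
    unfolding t_def using sum_le_suminf[OF smj, of "{0}"] D(2) by auto
  have upper: "t m \<le> x j ^ m" for m
  proof -
    have smx: "summable (\<lambda>i. x (i + j))" using sm summable_iff_shift[of x j] by blast
    have le1: "(\<Sum>i. x (i + j)) \<le> 1"
    proof -
      have "suminf x = 1" using x by (auto simp: P_infty_def sums_iff)
      then have "(\<Sum>i. x (i + j)) = 1 - (\<Sum>i<j. x i)" using suminf_split_initial_segment[OF sm, of j] by simp
      then show ?thesis using D(2) by (simp add: sum_nonneg)
    qed
    have "t m \<le> (\<Sum>i. x j ^ m * x (i + j))"
      unfolding t_def
    proof (rule suminf_le)
      fix i
      have "x (i + j) \<le> x j" using D(1) by (simp add: decseq_def)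
      then have "x (i + j) ^ m \<le> x j ^ m" using D(2) by (intro power_mono)
      then show "x (i + j) ^ Suc m \<le> x j ^ m * x (i + j)"
        using D(2) by (simp add: mult.commute[of "x (i + j)"] mult_right_mono)
    qed (use smj summable_mult[OF smx] in auto)
    also have "\<dots> = x j ^ m * (\<Sum>i. x (i + j))" by (rule suminf_mult[OF smx])
    also have "\<dots> \<le> x j ^ m" using le1 D(2) by (intro mult_left_le) auto
    finally show ?thesis .
  qed
  show "x j ^ Suc m \<le> enn2real (psum (Suc m) x) - (\<Sum>i<j. x i ^ Suc m)"
    "enn2real (psum (Suc m) x) - (\<Sum>i<j. x i ^ Suc m) \<le> x j ^ m"
    unfolding t by (rule lower, rule upper)
qed

lemma psum_tail_tendsto:
  assumes x: "x \<in> P_infty"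
  shows "(\<lambda>m. (enn2real (psum (Suc m) x) - (\<Sum>i<j. x i ^ Suc m)) powr (1 / real (Suc m))) \<longlonglongrightarrow> x j"
proof -
  note D = P_infty_D[OF x]
  define t where "t = (\<lambda>m. enn2real (psum (Suc m) x) - (\<Sum>i<j. x i ^ Suc m))"
  have lower: "x j ^ Suc m \<le> t m" and upper: "t m \<le> x j ^ m" for m
    unfolding t_def by (rule psum_tail_bounds[OF x])+
  have t: "enn2real (psum (Suc m) x) - (\<Sum>i<j. x i ^ Suc m) = t m" for m by (simp only: t_def)
  show ?thesis
    unfolding t
  proof (cases "x j = 0")
    case True
    \<comment> \<open>For \<open>m = 0\<close> the upper bound is \<open>0 ^ 0 = 1\<close>, hence
      the shift by one.\<close>
    have "t (Suc m) = 0" for m using upper[of "Suc m"] lower[of "Suc m"] True by simp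
    then have "(\<lambda>m. t (Suc m) powr (1 / real (Suc (Suc m)))) \<longlonglongrightarrow> x j" using True by simp
    then show "(\<lambda>m. t m powr (1 / real (Suc m))) \<longlonglongrightarrow> x j"
      using LIMSEQ_imp_Suc[of "\<lambda>m. t m powr (1 / real (Suc m))"] by simp
  next
    case False
    then have pos: "0 < x j" using D(2)[of j] by simp
    have 1: "x j \<le> t m powr (1 / real (Suc m))" for m
    proof -
      have "x j = (x j ^ Suc m) powr (1 / real (Suc m))"
        using pos by (simp add: powr_realpow[symmetric] powr_powr del: power_Suc of_nat_Suc)
      also have "\<dots> \<le> t m powr (1 / real (Suc m))"
        using lower[of m] pos by (intro powr_mono2) auto
      finally show ?thesis .
    qed
    have 2: "t m powr (1 / real (Suc m)) \<le> x j powr (real m / real (Suc m))" for m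
    proof -
      have "0 \<le> t m" using lower[of m] pos by (meson order_trans zero_le_power less_imp_le)
      then have "t m powr (1 / real (Suc m)) \<le> (x j ^ m) powr (1 / real (Suc m))"
        using upper[of m] by (intro powr_mono2) auto
      also have "\<dots> = x j powr (real m / real (Suc m))"
        using pos by (simp add: powr_realpow[symmetric] powr_powr del: of_nat_Suc)
      finally show ?thesis .
    qed
    have "(\<lambda>m. x j powr (real m / real (Suc m))) \<longlonglongrightarrow> x j powr 1"
      using pos by (intro tendsto_powr tendsto_const LIMSEQ_n_over_Suc_n) auto
    then have 3: "(\<lambda>m. x j powr (real m / real (Suc m))) \<longlonglongrightarrow> x j" using pos by simp
    show "(\<lambda>m. t m powr (1 / real (Suc m))) \<longlonglongrightarrow> x j"
      by (rule tendsto_sandwich[OF _ _ tendsto_const 3]) (use 1 2 in auto)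
  qed
qed

text \<open>The largest entry is the limit of roots of power sums; subtracting the powers of the
  entries already found exposes the next one. Since \<open>lim\<close> is total, measurability
  requires no convergence outside \<open>P_infty\<close>.\<close>

lemma exists_measurable_coordinate_from_psums:
  "\<exists>G \<in> borel_measurable borel. \<forall>x\<in>P_infty. G (\<lambda>m. enn2real (psum (Suc m) x)) = (x j :: real)"
proof (induction j rule: less_induct)
  case (less j)
  then have "\<forall>i\<in>{..<j}. \<exists>G. G \<in> borel_measurable borel \<and> (\<forall>x\<in>P_infty. G (\<lambda>m. enn2real (psum (Suc m) x)) = (x i :: real))"
    by auto
  from bchoice[OF this] obtain F where
    F: "\<And>i. i < j \<Longrightarrow> F i \<in> borel_measurable borel"
      "\<And>i x. i < j \<Longrightarrow> x \<in> P_infty \<Longrightarrow> F i (\<lambda>m. enn2real (psum (Suc m) x)) = x i" by auto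
  let ?G = "\<lambda>y. lim (\<lambda>m. (y m - (\<Sum>i<j. F i y ^ Suc m)) powr (1 / real (Suc m)))"
  show ?case
  proof (intro bexI[of _ ?G] ballI)
    have [measurable]: "(\<lambda>y :: nat \<Rightarrow> real. y m) \<in> borel_measurable borel" for m by (rule measurable_product_coordinates)
    have [measurable]: "(\<lambda>y. \<Sum>i<j. F i y ^ Suc m) \<in> borel_measurable borel" for m
      using F(1) by (intro borel_measurable_sum borel_measurable_power) auto
    show "?G \<in> borel_measurable borel" by measurable
    fix x assume x: "x \<in> P_infty"
    show "?G (\<lambda>m. enn2real (psum (Suc m) x)) = x j"
      using psum_tail_tendsto[OF x, of j] by (simp add: F(2)[OF _ x] limI)
  qed
qed

text \<open>The vector of power sums of orders at least 1 takes values in the unit cube, so its law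
  is determined by joint moments, which reduce to distinct sums. A measurable left inverse on
  \<open>P_infty\<close> then transports equality back to the sequences.\<close>

lemma measure_eqI_edsum:
  fixes M N :: "(nat \<Rightarrow> real) measure"
  assumes sets: "sets M = sets borel" "sets N = sets borel"
    and fin: "finite_measure M" "finite_measure N"
    and P: "AE x in M. x \<in> P_infty" "AE x in N. x \<in> P_infty"
    and eq: "\<And>A n. finite A \<Longrightarrow> (\<And>a. a \<in> A \<Longrightarrow> 0 < n a)
        \<Longrightarrow> (\<integral>\<^sup>+ x. edsum (A :: nat set) n x \<partial>M) = (\<integral>\<^sup>+ x. edsum A n x \<partial>N)"
  shows "M = N"
proof -
  let ?F = "\<lambda>ks L. \<integral>\<^sup>+ x. (\<Prod>m\<leftarrow>map Suc ks. psum m x) * edsum ({} :: nat set) (\<lambda>_. 1) x \<partial>L"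
  let ?\<Psi> = "\<lambda>x m. enn2real (psum (Suc m) x)"
  have "\<forall>j. \<exists>G. G \<in> borel_measurable borel \<and> (\<forall>x\<in>P_infty. G (?\<Psi> x) = (x j :: real))"
    using exists_measurable_coordinate_from_psums by blast
  from choice[OF this] obtain G where
    G: "\<And>j. G j \<in> borel_measurable borel" "\<And>j x. x \<in> P_infty \<Longrightarrow> G j (?\<Psi> x) = x j" by blast
  let ?\<Phi> = "\<lambda>y j. G j y"
  have \<Phi>: "?\<Phi> \<in> borel_measurable borel"
    by (rule measurable_coordinatewise_then_product) (rule G(1))
  have id: "(\<lambda>x. x) \<in> borel_measurable L" if "sets L = sets borel" for L :: "(nat \<Rightarrow> real) measure"
    unfolding measurable_cong_sets[OF that refl] by simp
  have \<Psi>: "?\<Psi> \<in> borel_measurable L" if "sets L = sets borel" for L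
    by (rule measurable_coordinatewise_then_product)
       (use psum_measurable[OF id[OF that]] in \<open>auto intro: measurable_compose[OF _ borel_measurable_enn2real]\<close>)
  have psle: "psum (Suc m) x \<le> 1" if "x \<in> P_infty" for x m using P_infty_D(5)[OF that] by simp
  have psr: "ennreal (?\<Psi> x m) = psum (Suc m) x" if "x \<in> P_infty" for x m
    using psle[OF that, of m] by (intro ennreal_enn2real) (auto simp: top_unique less_top[symmetric])
  have rec: "L = distr (distr L borel ?\<Psi>) borel ?\<Phi>" if "sets L = sets borel" "AE x in L. x \<in> P_infty" for L
  proof -
    have "distr (distr L borel ?\<Psi>) borel ?\<Phi> = distr L borel (?\<Phi> \<circ> ?\<Psi>)"
      by (rule distr_distr[OF \<Phi> \<Psi>[OF that(1)]])
    also have "\<dots> = distr L borel (\<lambda>x. x)"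
    proof (rule distr_cong_AE)
      show "AE x in L. (?\<Phi> \<circ> ?\<Psi>) x = x"
        using that(2) by eventually_elim (auto simp: G(2))
      show "?\<Phi> \<circ> ?\<Psi> \<in> borel_measurable L" using measurable_comp[OF \<Psi>[OF that(1)] \<Phi>] by simp
    qed (use id[OF that(1)] in auto)
    also have "\<dots> = L" using that(1) by (simp add: distr_id2)
    finally show ?thesis ..
  qed
  have "distr M borel ?\<Psi> = distr N borel ?\<Psi>"
  proof (rule measure_eqI_joint_moments)
    fix ks :: "nat list"
    have "(\<integral>\<^sup>+ y. (\<Prod>i\<leftarrow>ks. ennreal (y i)) \<partial>distr L borel ?\<Psi>) = (?F ks L)"
      if "sets L = sets borel" "AE x in L. x \<in> P_infty" for L
    proof -
      have m: "(\<lambda>y. \<Prod>i\<leftarrow>ks. ennreal (y i)) \<in> borel_measurable borel"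
      proof (induction ks)
        case (Cons k ks)
        note Cons[measurable]
        have [measurable]: "(\<lambda>y :: nat \<Rightarrow> real. y k) \<in> borel_measurable borel" by (rule measurable_product_coordinates)
        show ?case by simp
      qed simp
      have "(\<integral>\<^sup>+ y. (\<Prod>i\<leftarrow>ks. ennreal (y i)) \<partial>distr L borel ?\<Psi>) = (\<integral>\<^sup>+ x. (\<Prod>i\<leftarrow>ks. ennreal (?\<Psi> x i)) \<partial>L)"
        using m by (intro nn_integral_distr[OF \<Psi>[OF that(1)]]) simp
      also have "\<dots> = (?F ks L)"
        using that(2) by (intro nn_integral_cong_AE, eventually_elim) (simp add: psr o_def)
      finally show ?thesis .
    qed
    note * = this
    show "(\<integral>\<^sup>+ y. (\<Prod>i\<leftarrow>ks. ennreal (y i)) \<partial>distr M borel ?\<Psi>) = (\<integral>\<^sup>+ y. (\<Prod>i\<leftarrow>ks. ennreal (y i)) \<partial>distr N borel ?\<Psi>)"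
      unfolding *[OF sets(1) P(1)] *[OF sets(2) P(2)]
      by (rule nn_integral_psum_edsum_eqI[OF sets eq]) auto
  next
    have *: "AE y in distr L borel ?\<Psi>. \<forall>i. 0 \<le> y i \<and> y i \<le> 1" if "sets L = sets borel" "AE x in L. x \<in> P_infty" for L
    proof -
      have [measurable]: "(\<lambda>y :: nat \<Rightarrow> real. y i) \<in> borel_measurable borel" for i by (rule measurable_product_coordinates)
      have "AE x in L. \<forall>i. 0 \<le> ?\<Psi> x i \<and> ?\<Psi> x i \<le> 1"
        using that(2)
      proof eventually_elim
        case (elim x)
        then have "ennreal (?\<Psi> x i) \<le> ennreal 1" for i using psr[OF elim, of i] psle[OF elim, of i] by simp
        then show ?case by (simp del: ennreal_1)
      qed
      then show ?thesis by (subst AE_distr_iff[OF \<Psi>[OF that(1)]]) auto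
    qed
    show "AE y in distr M borel ?\<Psi>. \<forall>i. 0 \<le> y i \<and> y i \<le> 1" "AE y in distr N borel ?\<Psi>. \<forall>i. 0 \<le> y i \<and> y i \<le> 1"
      using * sets P by auto
    show "finite_measure (distr M borel ?\<Psi>)" "finite_measure (distr N borel ?\<Psi>)"
      using fin \<Psi> sets by (auto intro: finite_measure.finite_measure_distr)
  qed auto
  then show ?thesis using rec[OF sets(1) P(1)] rec[OF sets(2) P(2)] by simp
qed

subsection \<open>Stick-breaking\<close>

lemma measurable_case_nat_PiM:
  "(\<lambda>(s, \<omega>). case_nat s \<omega>) \<in> M 0 \<Otimes>\<^sub>M PiM UNIV (\<lambda>i. M (Suc i)) \<rightarrow>\<^sub>M PiM UNIV M"
proof -
  have "(\<lambda>z i. case_nat (fst z) (snd z) i) \<in> M 0 \<Otimes>\<^sub>M PiM UNIV (\<lambda>i. M (Suc i)) \<rightarrow>\<^sub>M PiM UNIV M"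
  proof (rule measurable_PiM_single')
    show "(\<lambda>z. case_nat (fst z) (snd z) i) \<in> M 0 \<Otimes>\<^sub>M PiM UNIV (\<lambda>i. M (Suc i)) \<rightarrow>\<^sub>M M i" for i
      by (cases i) simp_all
  qed (auto simp: space_pair_measure space_PiM PiE_iff split: nat.split)
  then show ?thesis by (simp add: split_beta')
qed

text \<open>The factors are not identical, so removing the first coordinate shifts the family. For
  stick-breaking the shifted family is the one with parameter \<theta> + \<alpha>.\<close>

lemma PiM_case_nat:
  fixes M :: "nat \<Rightarrow> 'a measure"
  assumes "\<And>i. prob_space (M i)"
  shows "distr (M 0 \<Otimes>\<^sub>M PiM UNIV (\<lambda>i. M (Suc i))) (PiM UNIV M) (\<lambda>(s, \<omega>). case_nat s \<omega>) = PiM UNIV M"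
    (is "?D = _")
proof -
  interpret prob_space "M i" for i by (rule assms)
  interpret product_prob_space M UNIV by unfold_locales
  interpret S: product_prob_space "\<lambda>i. M (Suc i)" UNIV by unfold_locales
  let ?S = "PiM UNIV (\<lambda>i. M (Suc i))"
  let ?f = "\<lambda>(s, \<omega>). case_nat s \<omega>"
  have f: "?f \<in> M 0 \<Otimes>\<^sub>M ?S \<rightarrow>\<^sub>M PiM UNIV M"
    by (rule measurable_case_nat_PiM)
  show ?thesis
  proof (rule PiM_eq)
    fix J E assume J: "finite J" "J \<subseteq> UNIV" "\<And>j. j \<in> J \<Longrightarrow> E j \<in> sets (M j)"
    let ?X = "prod_emb UNIV M J (\<Pi>\<^sub>E j\<in>J. E j)"
    have "\<And>j x. j \<in> J \<Longrightarrow> x \<in> E j \<Longrightarrow> x \<in> space (M j)"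
      using J(3)[THEN sets.sets_into_space] by (auto simp: space_PiM Pi_iff subset_eq)
    with J have "?f -` ?X \<inter> space (M 0 \<Otimes>\<^sub>M ?S) = (if 0 \<in> J then E 0 else space (M 0)) \<times>
      (prod_emb UNIV (\<lambda>i. M (Suc i)) (Suc -` J) (\<Pi>\<^sub>E j\<in>Suc -` J. E (Suc j)))" (is "_ = ?E \<times> ?F")
      by (auto simp: space_pair_measure space_PiM PiE_iff prod_emb_def all_conj_distrib
        split: nat.split nat.split_asm)
    moreover have "?X \<in> sets (PiM UNIV M)" using J by (intro sets_PiM_I) auto
    ultimately have "emeasure ?D ?X = emeasure (M 0 \<Otimes>\<^sub>M ?S) (?E \<times> ?F)"
      using f by (subst emeasure_distr) auto
    also have "\<dots> = emeasure (M 0) ?E * emeasure ?S ?F"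
      using J by (intro S.P.emeasure_pair_measure_Times) (auto intro!: sets_PiM_I finite_vimageI)
    also have "emeasure ?S ?F = (\<Prod>j\<in>Suc -` J. emeasure (M (Suc j)) (E (Suc j)))"
      using J by (intro S.emeasure_PiM_emb) (simp_all add: finite_vimageI)
    also have "\<dots> = (\<Prod>j\<in>J - {0}. emeasure (M j) (E j))"
      by (rule prod.reindex_bij_witness[of _ "\<lambda>j. j - 1" Suc]) auto
    also have "emeasure (M 0) ?E * (\<Prod>j\<in>J - {0}. emeasure (M j) (E j)) = (\<Prod>j\<in>J. emeasure (M j) (E j))"
      using J by (auto simp: prob_space.emeasure_space_1[OF assms] prod.remove)
    finally show "emeasure ?D ?X = (\<Prod>j\<in>J. emeasure (M j) (E j))" .
  qed simp
qed

lemma sets_beta_law [simp, measurable_cong]: "sets (beta_law a b) = sets borel"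
  by (simp add: beta_law_def)

lemma Beta_pos: "0 < a \<Longrightarrow> 0 < b \<Longrightarrow> 0 < Beta a (b :: real)"
  by (simp add: Beta_def)

lemma nn_integral_beta_law:
  assumes ab: "0 < a" "0 < b"
  shows "(\<integral>\<^sup>+ x. ennreal x ^ m * ennreal (1 - x) ^ l \<partial>beta_law a b)
      = ennreal (pochhammer a m * pochhammer b l / pochhammer (a + b) (m + l))"
proof -
  have "(\<integral>\<^sup>+ x. ennreal x ^ m * ennreal (1 - x) ^ l \<partial>beta_law a b)
     = (\<integral>\<^sup>+ x. ennreal (indicator {0<..<1} x * (x powr (a - 1) * (1 - x) powr (b - 1) / Beta a b)) *
         (ennreal x ^ m * ennreal (1 - x) ^ l) \<partial>lborel)"
    unfolding beta_law_def by (subst nn_integral_density) auto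
  also have "\<dots> = (\<integral>\<^sup>+ x. ennreal (1 / Beta a b) * ennreal (indicator {0..1} x *
      (x powr (a + real m - 1) * (1 - x) powr (b + real l - 1))) \<partial>lborel)"
  proof (rule nn_integral_cong_AE)
    have "AE x in lborel. x \<noteq> 0 \<and> x \<noteq> (1::real)"
      using AE_lborel_singleton[of 0] AE_lborel_singleton[of "1::real"] by eventually_elim auto
    then show "AE x in lborel. ennreal (indicator {0<..<1} x * (x powr (a - 1) * (1 - x) powr (b - 1) / Beta a b)) *
         (ennreal x ^ m * ennreal (1 - x) ^ l)
      = ennreal (1 / Beta a b) * ennreal (indicator {0..1} x * (x powr (a + real m - 1) * (1 - x) powr (b + real l - 1)))"
    proof eventually_elim
      case (elim x)
      show ?case
      proof (cases "0 < x \<and> x < 1")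
        case True
        then have "x powr (a + real m - 1) = x powr (a - 1) * x ^ m"
          "(1 - x) powr (b + real l - 1) = (1 - x) powr (b - 1) * (1 - x) ^ l"
          by (simp_all add: powr_realpow[symmetric] powr_add[symmetric] algebra_simps)
        with True Beta_pos[OF ab] show ?thesis
          by (simp add: ennreal_power ennreal_mult'[symmetric] mult_ac)
      qed (use elim in \<open>auto simp: indicator_def\<close>)
    qed
  qed
  also have "\<dots> = ennreal (1 / Beta a b) * ennreal (Beta (a + real m) (b + real l))"
    using nn_integral_has_integral_lebesgue[OF _ has_integral_Beta_real[of "a + real m" "b + real l"]] ab
    by (subst nn_integral_cmult) auto
  also have "\<dots> = ennreal (Beta (a + real m) (b + real l) / Beta a b)"
    using Beta_pos[OF ab] Beta_pos[of "a + real m" "b + real l"] ab by (simp add: ennreal_mult'[symmetric])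
  also have "Beta (a + real m) (b + real l) / Beta a b = pochhammer a m * pochhammer b l / pochhammer (a + b) (m + l)"
  proof -
    have "a \<notin> \<int>\<^sub>\<le>\<^sub>0" "b \<notin> \<int>\<^sub>\<le>\<^sub>0" "a + b \<notin> \<int>\<^sub>\<le>\<^sub>0" using ab by (auto elim!: nonpos_Ints_cases)
    moreover have "Gamma a \<noteq> 0" "Gamma b \<noteq> 0" "Gamma (a + b) \<noteq> 0" "Gamma (a + real m) \<noteq> 0"
        "Gamma (b + real l) \<noteq> 0" "Gamma (a + b + real (m + l)) \<noteq> 0"
      using ab by (auto intro!: less_imp_neq[symmetric] Gamma_real_pos)
    moreover have "a + real m + (b + real l) = a + b + real (m + l)" by simp
    ultimately show ?thesis
      unfolding pochhammer_Gamma[OF \<open>a \<notin> _\<close>] pochhammer_Gamma[OF \<open>b \<notin> _\<close>] pochhammer_Gamma[OF \<open>a + b \<notin> _\<close>] Beta_def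
      by (simp add: divide_simps add_ac)
  qed
  finally show ?thesis .
qed

lemma prob_space_beta_law:
  assumes "0 < a" "0 < b"
  shows "prob_space (beta_law a b)"
  using nn_integral_beta_law[OF assms, of 0 0] by (intro prob_spaceI) simp

lemma AE_beta_law: "AE x in beta_law a b. 0 < x \<and> x < 1"
  unfolding beta_law_def by (subst AE_density) (auto intro!: AE_I2 split: split_indicator)

lemma prod_le_one_ennreal: "(\<And>a. a \<in> A \<Longrightarrow> f a \<le> (1::ennreal)) \<Longrightarrow> prod f A \<le> 1"
proof (induction A rule: infinite_finite_induct)
  case (insert a A)
  then show ?case using mult_mono[of "f a" 1 "prod f A" 1] by simp
qed simp_all

definition stick :: "(nat \<Rightarrow> real) \<Rightarrow> nat \<Rightarrow> real" where
  "stick R k = R k * (\<Prod>j<k. 1 - R j)"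

lemma stick_case_nat: "stick (case_nat r R) = case_nat r (\<lambda>k. (1 - r) * stick R k)"
proof
  fix k show "stick (case_nat r R) k = case_nat r (\<lambda>k. (1 - r) * stick R k) k"
    by (cases k) (simp_all add: stick_def prod.lessThan_Suc_shift del: prod.lessThan_Suc)
qed

lemma stick_nonneg: "(\<And>j. 0 \<le> R j \<and> R j \<le> 1) \<Longrightarrow> 0 \<le> stick R k"
  by (simp add: stick_def prod_nonneg)

lemma psum_stick_le_1:
  assumes "\<And>j. 0 \<le> R j \<and> R j \<le> 1" "0 < m"
  shows "psum m (stick R) \<le> 1"
proof -
  have part: "(\<Sum>k<K. stick R k) = 1 - (\<Prod>j<K. 1 - R j)" for K
    by (induction K) (auto simp: stick_def algebra_simps)
  have le1: "(\<Sum>k<K. stick R k) \<le> 1" for K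
    unfolding part using assms by (simp add: prod_nonneg)
  have "stick R k ^ m \<le> stick R k" for k
  proof -
    have "stick R k \<le> (\<Sum>k<Suc k. stick R k)"
      using stick_nonneg[OF assms(1)] by (intro member_le_sum) auto
    then have "stick R k \<le> 1" using le1[of "Suc k"] by linarith
    then show ?thesis using power_decreasing[of 1 m "stick R k"] stick_nonneg[OF assms(1)] assms(2) by simp
  qed
  then have le: "ennreal (stick R k) ^ m \<le> ennreal (stick R k)" for k
    using stick_nonneg[OF assms(1)] by (simp add: ennreal_power)
  have "psum m (stick R) \<le> (\<Sum>k. ennreal (stick R k))"
    unfolding psum_def by (intro suminf_le le) auto
  also have "\<dots> \<le> 1"
  proof (rule suminf_le_const[OF summableI])
    fix K
    have "(\<Sum>k<K. ennreal (stick R k)) = ennreal (\<Sum>k<K. stick R k)"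
      using stick_nonneg[OF assms(1)] by simp
    also have "\<dots> \<le> 1" using le1 by simp
    finally show "(\<Sum>k<K. ennreal (stick R k)) \<le> 1" .
  qed
  finally show ?thesis .
qed

lemma edsum_stick_case_nat:
  assumes "finite A" "0 \<le> r" "r \<le> 1"
  shows "edsum A n (stick (case_nat r R)) = ennreal (1 - r) ^ (\<Sum>a\<in>A. n a) * edsum A n (stick R)
     + (\<Sum>a\<in>A. ennreal r ^ n a * ennreal (1 - r) ^ (\<Sum>b\<in>A - {a}. n b) * edsum (A - {a}) n (stick R))"
proof -
  have "edsum B n (\<lambda>k. (1 - r) * stick R k) = ennreal (1 - r) ^ (\<Sum>a\<in>B. n a) * edsum B n (stick R)" if "B \<subseteq> A" for B
    using that assms finite_subset by (intro edsum_scale) auto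
  from this[unfolded edsum_def] show ?thesis
    unfolding edsum_def stick_case_nat
    by (subst dsum_split_first[OF assms(1)]) (auto simp: mult.assoc intro!: sum.cong)
qed

lemma P_infty_measurable: "Measurable.pred borel (\<lambda>p :: nat \<Rightarrow> real. p \<in> P_infty)"
proof -
  have c: "(\<lambda>p :: nat \<Rightarrow> real. p j) \<in> borel_measurable borel" for j by (rule measurable_product_coordinates)
  have "(\<lambda>p. psum (Suc 0) p) \<in> borel_measurable borel" by (rule psum_measurable) simp
  from measurable_sets[OF this, of "{1}"]
  have 1: "Measurable.pred borel (\<lambda>p. psum (Suc 0) p = 1)" by (simp add: pred_def vimage_def)
  have 2: "Measurable.pred borel (\<lambda>p :: nat \<Rightarrow> real. p (Suc i) \<le> p i)" for i
    unfolding pred_def by (rule borel_measurable_le[OF c c])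
  have 3: "Measurable.pred borel (\<lambda>p :: nat \<Rightarrow> real. 0 \<le> p i)" for i
    unfolding pred_def by (rule borel_measurable_le[OF _ c]) simp
  have "p \<in> P_infty \<longleftrightarrow> (\<forall>i. p (Suc i) \<le> p i) \<and> (\<forall>i. 0 \<le> p i) \<and> psum (Suc 0) p = 1" for p
    using P_inftyI[of p] P_infty_D(1,2,4)[of p] by (auto simp: decseq_Suc_iff)
  then show ?thesis
    by (simp only:) (intro pred_intros_logic pred_intros_countable 1 2 3)
qed

text \<open>This is the law of the independent fractions; \<open>stick\<close> maps it to the GEM
  law of the sticks in their order of breaking.\<close>

definition gem :: "real \<Rightarrow> real \<Rightarrow> (nat \<Rightarrow> real) measure" where
  "gem \<alpha> \<theta> = PiM UNIV (\<lambda>k. beta_law (1 - \<alpha>) (\<theta> + real (Suc k) * \<alpha>))"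

text \<open>The two-parameter sampling formula of Pitman, with the slots of \<open>A\<close> as
  blocks. By truncated subtraction it has the value 1 for the empty sample.\<close>

definition py_eppf :: "real \<Rightarrow> real \<Rightarrow> 'a set \<Rightarrow> ('a \<Rightarrow> nat) \<Rightarrow> real" where
  "py_eppf \<alpha> \<theta> A n = (\<Prod>i = 1..<card A. \<theta> + real i * \<alpha>) / pochhammer (\<theta> + 1) ((\<Sum>a\<in>A. n a) - 1)
      * (\<Prod>a\<in>A. pochhammer (1 - \<alpha>) (n a - 1))"

locale gem_parameters =
  fixes \<alpha> \<theta> :: real
  assumes \<alpha>: "0 < \<alpha>" "\<alpha> < 1" and \<theta>: "- \<alpha> < \<theta>"
begin

lemma stick_parameters_pos: "0 < 1 - \<alpha>" "0 < \<theta> + real (Suc k) * \<alpha>"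
proof -
  have "\<alpha> \<le> real (Suc k) * \<alpha>" using \<alpha> by simp
  then show "0 < \<theta> + real (Suc k) * \<alpha>" using \<theta> by linarith
qed (use \<alpha> in simp)

lemma prob_space_stick: "prob_space (beta_law (1 - \<alpha>) (\<theta> + real (Suc k) * \<alpha>))"
  by (rule prob_space_beta_law[OF stick_parameters_pos])

lemma prob_space_gem: "prob_space (gem \<alpha> \<theta>)"
  unfolding gem_def by (rule prob_space_PiM[OF prob_space_stick])

lemma sets_gem: "sets (gem \<alpha> \<theta>) = sets borel"
  unfolding gem_def sets_PiM_equal_borel[symmetric] by (intro sets_PiM_cong) auto

lemma measurable_gem_cong: "borel_measurable (gem \<alpha> \<theta>) = borel_measurable (borel :: (nat \<Rightarrow> real) measure)"
  by (rule measurable_cong_sets[OF sets_gem refl])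

lemma AE_gem: "AE R in gem \<alpha> \<theta>. \<forall>j. 0 \<le> R j \<and> R j \<le> 1"
proof -
  interpret prob_space "beta_law (1 - \<alpha>) (\<theta> + real (Suc k) * \<alpha>)" for k by (rule prob_space_stick)
  interpret product_prob_space "\<lambda>k. beta_law (1 - \<alpha>) (\<theta> + real (Suc k) * \<alpha>)" UNIV by unfold_locales
  have "AE x in beta_law (1 - \<alpha>) (\<theta> + real (Suc j) * \<alpha>). 0 \<le> x \<and> x \<le> 1" for j
    using AE_beta_law by eventually_elim auto
  then have "AE R in gem \<alpha> \<theta>. 0 \<le> R j \<and> R j \<le> 1" for j
    unfolding gem_def by (intro AE_component) auto
  then show ?thesis by (simp add: AE_all_countable)
qed

lemma stick_measurable: "stick \<in> borel_measurable borel"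
proof (rule measurable_coordinatewise_then_product)
  have [measurable]: "(\<lambda>R :: nat \<Rightarrow> real. R j) \<in> borel_measurable borel" for j by (rule measurable_product_coordinates)
  show "(\<lambda>R. stick R k) \<in> borel_measurable borel" for k unfolding stick_def by measurable
qed

text \<open>Condition on the first fraction \<open>r\<close>: either no slot uses the first stick or
  exactly one does, and the other sticks are a copy scaled by \<open>1 - r\<close> with parameter
  \<theta> + \<alpha>. The integrals over \<open>r\<close> are mixed moments of a beta law.\<close>

lemma nn_integral_gem_step:
  assumes A: "finite A"
  shows "(\<integral>\<^sup>+ R. edsum A n (stick R) \<partial>gem \<alpha> \<theta>)
    = ennreal (pochhammer (\<theta> + \<alpha>) (\<Sum>a\<in>A. n a) / pochhammer (\<theta> + 1) (\<Sum>a\<in>A. n a))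
        * (\<integral>\<^sup>+ R. edsum A n (stick R) \<partial>gem \<alpha> (\<theta> + \<alpha>))
    + (\<Sum>a\<in>A. ennreal (pochhammer (1 - \<alpha>) (n a) * pochhammer (\<theta> + \<alpha>) (\<Sum>b\<in>A - {a}. n b) / pochhammer (\<theta> + 1) (\<Sum>a\<in>A. n a))
        * (\<integral>\<^sup>+ R. edsum (A - {a}) n (stick R) \<partial>gem \<alpha> (\<theta> + \<alpha>)))"
proof -
  let ?G = "\<lambda>a. \<integral>\<^sup>+ R. edsum (A - {a}) n (stick R) \<partial>gem \<alpha> (\<theta> + \<alpha>)"
  let ?F = "\<integral>\<^sup>+ R. edsum A n (stick R) \<partial>gem \<alpha> (\<theta> + \<alpha>)"
  let ?B = "\<lambda>k. beta_law (1 - \<alpha>) (\<theta> + real (Suc k) * \<alpha>)"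
  let ?H = "?B 0 \<Otimes>\<^sub>M gem \<alpha> (\<theta> + \<alpha>)"
  interpret G': gem_parameters \<alpha> "\<theta> + \<alpha>" using \<alpha> \<theta> by unfold_locales auto
  interpret S: prob_space "gem \<alpha> (\<theta> + \<alpha>)" by (rule G'.prob_space_gem)
  have shift: "PiM UNIV (\<lambda>k. ?B (Suc k)) = gem \<alpha> (\<theta> + \<alpha>)"
    unfolding gem_def by (simp add: algebra_simps)
  have em: "(\<lambda>R. edsum C n (stick R)) \<in> borel_measurable borel" if "C \<subseteq> A" for C
    using that A finite_subset stick_measurable by (intro edsum_measurable) auto
  have em': "(\<lambda>R. edsum C n (stick R)) \<in> borel_measurable (gem \<alpha> (\<theta> + \<alpha>))" if "C \<subseteq> A" for C
    unfolding G'.measurable_gem_cong by (rule em[OF that])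
  note [measurable] = em'[OF order_refl] em'[OF Diff_subset]
  have eq: "distr ?H (gem \<alpha> \<theta>) (\<lambda>(s, \<omega>). case_nat s \<omega>) = gem \<alpha> \<theta>"
    using PiM_case_nat[of ?B, OF prob_space_stick] unfolding shift by (simp add: gem_def)
  have cn: "(\<lambda>(s, \<omega>). case_nat s \<omega>) \<in> ?B 0 \<Otimes>\<^sub>M gem \<alpha> (\<theta> + \<alpha>) \<rightarrow>\<^sub>M gem \<alpha> \<theta>"
    using measurable_case_nat_PiM[of ?B] unfolding shift by (simp add: gem_def)
  have "(\<integral>\<^sup>+ R. edsum A n (stick R) \<partial>gem \<alpha> \<theta>)
      = (\<integral>\<^sup>+ z. edsum A n (stick (case_nat (fst z) (snd z))) \<partial>?H)"
    by (subst eq[symmetric], subst nn_integral_distr[OF cn])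
       (auto simp: split_beta' measurable_gem_cong em)
  also have "\<dots> = (\<integral>\<^sup>+ r. \<integral>\<^sup>+ R. edsum A n (stick (case_nat r R)) \<partial>gem \<alpha> (\<theta> + \<alpha>) \<partial>?B 0)"
  proof (subst S.nn_integral_fst[symmetric])
    have "(\<lambda>R. edsum A n (stick R)) \<in> borel_measurable (gem \<alpha> \<theta>)" by (simp add: measurable_gem_cong em)
    from measurable_compose[OF cn this]
    show "(\<lambda>z. edsum A n (stick (case_nat (fst z) (snd z)))) \<in> borel_measurable ?H"
      by (simp add: split_beta')
  qed simp
  also have "\<dots> = (\<integral>\<^sup>+ r. ennreal (1 - r) ^ (\<Sum>a\<in>A. n a) * ?F
     + (\<Sum>a\<in>A. ennreal r ^ n a * ennreal (1 - r) ^ (\<Sum>b\<in>A - {a}. n b)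
         * (?G a)) \<partial>?B 0)"
  proof (rule nn_integral_cong_AE)
    show "AE r in ?B 0. (\<integral>\<^sup>+ R. edsum A n (stick (case_nat r R)) \<partial>gem \<alpha> (\<theta> + \<alpha>))
      = ennreal (1 - r) ^ (\<Sum>a\<in>A. n a) * ?F
     + (\<Sum>a\<in>A. ennreal r ^ n a * ennreal (1 - r) ^ (\<Sum>b\<in>A - {a}. n b)
         * (?G a))"
      using AE_beta_law
    proof eventually_elim
      case (elim r)
      then show ?case
        by (subst edsum_stick_case_nat[OF A])
           (auto simp: nn_integral_add nn_integral_sum nn_integral_cmult)
    qed
  qed
  also have "\<dots> = (\<integral>\<^sup>+ r. ennreal r ^ 0 * ennreal (1 - r) ^ (\<Sum>a\<in>A. n a) \<partial>?B 0) * ?F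
     + (\<Sum>a\<in>A. (\<integral>\<^sup>+ r. ennreal r ^ n a * ennreal (1 - r) ^ (\<Sum>b\<in>A - {a}. n b) \<partial>?B 0)
         * (?G a))"
    by (subst nn_integral_add) (auto simp: nn_integral_sum nn_integral_multc)
  also have "\<dots> = ennreal (pochhammer (\<theta> + \<alpha>) (\<Sum>a\<in>A. n a) / pochhammer (\<theta> + 1) (\<Sum>a\<in>A. n a))
        * ?F
    + (\<Sum>a\<in>A. ennreal (pochhammer (1 - \<alpha>) (n a) * pochhammer (\<theta> + \<alpha>) (\<Sum>b\<in>A - {a}. n b) / pochhammer (\<theta> + 1) (\<Sum>a\<in>A. n a))
        * (?G a))"
    using A \<alpha> \<theta> by (subst nn_integral_beta_law; simp)+
      (auto intro!: sum.cong arg_cong2[where f = "(+)"] simp: sum.remove add_ac)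
  finally show ?thesis .
qed

lemma nn_integral_gem_le_1:
  assumes "finite A" "\<And>a. a \<in> A \<Longrightarrow> 0 < n a"
  shows "(\<integral>\<^sup>+ R. edsum A n (stick R) \<partial>gem \<alpha> \<theta>) \<le> 1"
proof -
  interpret prob_space "gem \<alpha> \<theta>" by (rule prob_space_gem)
  have "(\<integral>\<^sup>+ R. edsum A n (stick R) \<partial>gem \<alpha> \<theta>) \<le> (\<integral>\<^sup>+ R. 1 \<partial>gem \<alpha> \<theta>)"
  proof (rule nn_integral_mono_AE)
    show "AE R in gem \<alpha> \<theta>. edsum A n (stick R) \<le> 1"
      using AE_gem
    proof eventually_elim
      case (elim R)
      have "edsum A n (stick R) \<le> (\<Prod>a\<in>A. psum (n a) (stick R))" by (rule edsum_le_prod[OF assms(1)])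
      also have "\<dots> \<le> 1"
        using assms(2) elim by (intro prod_le_one_ennreal psum_stick_le_1) auto
      finally show ?case .
    qed
  qed
  also have "\<dots> = 1" by (simp add: emeasure_space_1)
  finally show ?thesis .
qed

lemma pochhammer_pos': "0 < pochhammer (\<theta> + 1) k" "0 < pochhammer (\<theta> + \<alpha>) k" "0 < pochhammer (1 - \<alpha>) k"
  using \<alpha> \<theta> by (auto intro!: pochhammer_pos)

lemma py_eppf_nonneg: "0 \<le> py_eppf \<alpha> \<theta> A n"
proof -
  have "0 \<le> \<theta> + real i * \<alpha>" if "1 \<le> i" for i
    using stick_parameters_pos(2)[of "i - 1"] that by simp
  then show ?thesis
    unfolding py_eppf_def using pochhammer_pos'
    by (intro mult_nonneg_nonneg divide_nonneg_nonneg prod_nonneg) (auto intro: less_imp_le)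
qed

text \<open>After the common factor \<open>C * W / pochhammer (\<theta> + 1) N\<close> is taken out,
  the term without a slot on the first stick contributes \<theta> + k \<alpha>, and the term for
  slot \<open>a\<close> contributes n a - \<alpha>. They add up to \<theta> + N, the last factor of
  the Pochhammer symbol.\<close>

lemma py_eppf_step:
  assumes A: "finite A" "A \<noteq> {}" and n: "\<And>a. a \<in> A \<Longrightarrow> 0 < n a"
  shows "py_eppf \<alpha> \<theta> A n
    = pochhammer (\<theta> + \<alpha>) (\<Sum>a\<in>A. n a) / pochhammer (\<theta> + 1) (\<Sum>a\<in>A. n a) * py_eppf \<alpha> (\<theta> + \<alpha>) A n
    + (\<Sum>a\<in>A. pochhammer (1 - \<alpha>) (n a) * pochhammer (\<theta> + \<alpha>) (\<Sum>b\<in>A - {a}. n b) / pochhammer (\<theta> + 1) (\<Sum>a\<in>A. n a)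
        * py_eppf \<alpha> (\<theta> + \<alpha>) (A - {a}) n)"
proof -
  define N where "N = (\<Sum>a\<in>A. n a)"
  define k where "k = card A"
  let ?H = "\<theta> + real k * \<alpha>"
  let ?F = "\<Prod>i = 1..<k - 1. \<theta> + \<alpha> + real i * \<alpha>"
  define W where "W = (\<Prod>a\<in>A. pochhammer (1 - \<alpha>) (n a - 1))"
  define C where "C = (\<Prod>i = 1..<k. \<theta> + real i * \<alpha>)"
  let ?G = "\<Sum>a\<in>A. C * W / pochhammer (\<theta> + 1) N * (real (n a) - \<alpha>)"
  have k: "1 \<le> k" using A by (simp add: k_def Suc_leI card_gt_0_iff)
  have N: "1 \<le> N" using A n unfolding N_def
    by (metis One_nat_def Suc_leI all_not_in_conv gr0I sum_eq_0_iff less_irrefl)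
  have pos: "0 < pochhammer (\<theta> + 1) j" "0 < pochhammer (\<theta> + \<alpha> + 1) j" for j
    using \<alpha> \<theta> by (auto intro!: pochhammer_pos)
  have split: "pochhammer (\<theta> + \<alpha>) j = (\<theta> + \<alpha>) * pochhammer (\<theta> + \<alpha> + 1) (j - 1)" if "1 \<le> j" for j
    using that by (cases j) (auto simp: pochhammer_rec)
  have prodshift: "(\<theta> + \<alpha>) * (\<Prod>i = 1..<j. \<theta> + \<alpha> + real i * \<alpha>) = (\<Prod>i = 1..<Suc j. \<theta> + real i * \<alpha>)" if "1 \<le> j" for j
    using that by (induction j rule: dec_induct) (simp_all add: algebra_simps)
  have first: "pochhammer (\<theta> + \<alpha>) N / pochhammer (\<theta> + 1) N * py_eppf \<alpha> (\<theta> + \<alpha>) A n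
      = C * W / pochhammer (\<theta> + 1) N * ?H"
  proof -
    have "(\<theta> + \<alpha>) * (\<Prod>i = 1..<k. \<theta> + \<alpha> + real i * \<alpha>) = C * ?H"
      using prodshift[OF k] k by (simp add: C_def)
    moreover have "pochhammer (\<theta> + \<alpha>) N / pochhammer (\<theta> + 1) N * py_eppf \<alpha> (\<theta> + \<alpha>) A n
       = ((\<theta> + \<alpha>) * (\<Prod>i = 1..<k. \<theta> + \<alpha> + real i * \<alpha>)) * W / pochhammer (\<theta> + 1) N"
      using pos(2)[of "N - 1"] by (simp add: py_eppf_def split[OF N] N_def[symmetric] k_def[symmetric] W_def)
    ultimately show ?thesis by (simp add: mult_ac)
  qed
  have second: "pochhammer (1 - \<alpha>) (n a) * pochhammer (\<theta> + \<alpha>) (\<Sum>b\<in>A - {a}. n b) / pochhammer (\<theta> + 1) N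
        * py_eppf \<alpha> (\<theta> + \<alpha>) (A - {a}) n = C * W / pochhammer (\<theta> + 1) N * (real (n a) - \<alpha>)" if a: "a \<in> A" for a
  proof -
    define L where "L = (\<Sum>b\<in>A - {a}. n b)"
    \<comment> \<open>If \<open>a\<close> is the only slot, \<open>L = 0\<close> and
      \<open>L - 1\<close> is truncated to 0. Otherwise the factor \<theta> + \<alpha> left over
      from the Pochhammer symbols completes the shifted product to \<open>C\<close>.\<close>
    have X: "pochhammer (\<theta> + \<alpha>) L * ?F / pochhammer (\<theta> + \<alpha> + 1) (L - 1) = C"
    proof (cases "k = 1")
      case True
      then have "A - {a} = {}" using a A by (simp add: k_def card_1_singleton_iff) auto
      then have "L = 0" by (simp only: L_def sum.empty)
      then show ?thesis using True by (simp add: C_def)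
    next
      case False
      then have k2: "1 \<le> k - 1" using k by simp
      then have "A - {a} \<noteq> {}" using a A by (metis card.empty card_Diff_singleton k_def not_one_le_zero)
      then have "1 \<le> L" using A n unfolding L_def
        by (metis DiffD1 One_nat_def Suc_leI all_not_in_conv finite_Diff gr0I less_irrefl sum_eq_0_iff)
      then have "pochhammer (\<theta> + \<alpha>) L * ?F / pochhammer (\<theta> + \<alpha> + 1) (L - 1)
         = (\<theta> + \<alpha>) * ?F"
        using pos(2)[of "L - 1"] by (simp add: split)
      also have "\<dots> = C" using prodshift[OF k2] k2 by (simp add: C_def)
      finally show ?thesis .
    qed
    have w: "pochhammer (1 - \<alpha>) (n a) = pochhammer (1 - \<alpha>) (n a - 1) * (real (n a) - \<alpha>)"
      using n[OF a] by (cases "n a") (auto simp: pochhammer_Suc algebra_simps)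
    have "card (A - {a}) = k - 1" using a A by (simp add: k_def)
    then have "pochhammer (1 - \<alpha>) (n a) * pochhammer (\<theta> + \<alpha>) L / pochhammer (\<theta> + 1) N * py_eppf \<alpha> (\<theta> + \<alpha>) (A - {a}) n
      = (pochhammer (\<theta> + \<alpha>) L * ?F / pochhammer (\<theta> + \<alpha> + 1) (L - 1))
         * (pochhammer (1 - \<alpha>) (n a - 1) * (\<Prod>b\<in>A - {a}. pochhammer (1 - \<alpha>) (n b - 1)))
         * (real (n a) - \<alpha>) / pochhammer (\<theta> + 1) N"
      by (simp add: py_eppf_def L_def w mult_ac)
    also have "pochhammer (1 - \<alpha>) (n a - 1) * (\<Prod>b\<in>A - {a}. pochhammer (1 - \<alpha>) (n b - 1)) = W"
      using a A by (simp add: W_def prod.remove)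
    finally show ?thesis unfolding X by (simp add: L_def)
  qed
  have "(\<Sum>a\<in>A. real (n a) - \<alpha>) = real N - real k * \<alpha>"
    by (simp add: sum_subtractf N_def k_def)
  then have "C * W / pochhammer (\<theta> + 1) N * ?H
      + ?G
     = C * W / pochhammer (\<theta> + 1) N * (\<theta> + real N)"
    unfolding sum_distrib_left[symmetric] by (simp add: add_divide_distrib[symmetric] distrib_left[symmetric])
  also have "\<dots> = C * W / pochhammer (\<theta> + 1) (N - 1)"
  proof -
    have "pochhammer (\<theta> + 1) N = pochhammer (\<theta> + 1) (N - 1) * (\<theta> + real N)"
      using N by (cases N) (auto simp: pochhammer_Suc algebra_simps)
    moreover have "\<theta> + real N \<noteq> 0" using N \<alpha> \<theta> by auto
    ultimately show ?thesis by simp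
  qed
  also have "\<dots> = py_eppf \<alpha> \<theta> A n"
    by (simp add: py_eppf_def C_def W_def N_def k_def)
  finally have "py_eppf \<alpha> \<theta> A n = C * W / pochhammer (\<theta> + 1) N * ?H
      + ?G" ..
  also have "?G
      = (\<Sum>a\<in>A. pochhammer (1 - \<alpha>) (n a) * pochhammer (\<theta> + \<alpha>) (\<Sum>b\<in>A - {a}. n b) / pochhammer (\<theta> + 1) N
        * py_eppf \<alpha> (\<theta> + \<alpha>) (A - {a}) n)"
    by (intro sum.cong refl second[symmetric])
  finally show ?thesis unfolding first[symmetric] by (simp only: N_def)
qed

text \<open>The bound is uniform in \<theta>, which is needed when \<theta> is shifted by multiples
  of \<alpha> without limit.\<close>

lemma py_eppf_bound:
  assumes "0 \<le> \<theta>" "finite A" "\<And>a. a \<in> A \<Longrightarrow> 0 < n a"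
  shows "py_eppf \<alpha> \<theta> A n \<le> (\<Prod>a\<in>A. pochhammer (1 - \<alpha>) (n a - 1))"
proof -
  let ?F = "\<Prod>i = 1..<card A. \<theta> + real i * \<alpha>"
  define N where "N = (\<Sum>a\<in>A. n a)"
  have "card A \<le> N"
    using sum_mono[of A "\<lambda>_. 1" n] assms(3) by (simp add: N_def Suc_leI)
  have "?F \<le> (\<Prod>i = 1..<card A. \<theta> + real i)"
    using assms(1) \<alpha> by (intro prod_mono) auto
  also have "\<dots> \<le> (\<Prod>i = 1..<N. \<theta> + real i)"
    using assms(1) \<open>card A \<le> N\<close> by (intro prod_mono2) auto
  also have "\<dots> = pochhammer (\<theta> + 1) (N - 1)"
  proof -
    have "(\<Prod>i = 1..<N. \<theta> + real i) = (\<Prod>i = 0..<N - 1. \<theta> + 1 + real i)"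
      by (rule prod.reindex_bij_witness[of _ "\<lambda>i. i + 1" "\<lambda>i. i - 1"]) auto
    then show ?thesis by (simp add: pochhammer_prod)
  qed
  finally have "?F / pochhammer (\<theta> + 1) (N - 1) \<le> 1"
    using pochhammer_pos'(1)[of "N - 1"] by simp
  moreover have "0 \<le> (\<Prod>a\<in>A. pochhammer (1 - \<alpha>) (n a - 1))"
    using pochhammer_pos' by (intro prod_nonneg) (auto intro: less_imp_le)
  moreover have "0 \<le> ?F / pochhammer (\<theta> + 1) (N - 1)"
    using assms(1) \<alpha> pochhammer_pos'(1)[of "N - 1"] by (intro divide_nonneg_pos prod_nonneg) auto
  ultimately show ?thesis
    unfolding py_eppf_def N_def[symmetric] by (intro mult_left_le_one_le)
qed

end

text \<open>The subtracted terms dominate a multiple of \<open>1 / (m + 1)\<close>, so the product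
  is at most the exponential of a negative multiple of the harmonic sum.\<close>

lemma prod_one_minus_harmonic_tendsto_0:
  fixes a b \<delta> :: real
  assumes "0 < a" "0 < b" "0 < \<delta>" "\<And>m. \<delta> / (b + real m * a) \<le> 1"
  shows "(\<lambda>M. \<Prod>m<M. 1 - \<delta> / (b + real m * a)) \<longlonglongrightarrow> 0"
proof -
  define K where "K = max a b"
  have K: "0 < K" "a \<le> K" "b \<le> K" using assms by (auto simp: K_def)
  define d where "d = \<delta> / K"
  have d: "0 < d" using K assms by (simp add: d_def)
  have le: "(\<Prod>m<M. 1 - \<delta> / (b + real m * a)) \<le> exp (- d * ln (real M + 1))" for M
  proof -
    have "(\<Prod>m<M. 1 - \<delta> / (b + real m * a)) \<le> (\<Prod>m<M. exp (- d / real (Suc m)))"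
    proof (intro prod_mono conjI)
      fix m
      have "b + real m * a \<le> K * real (Suc m)"
        using K mult_left_mono[of a K "real m"] by (simp add: algebra_simps)
      then have "\<delta> / (K * real (Suc m)) \<le> \<delta> / (b + real m * a)"
        using assms K by (intro divide_left_mono mult_pos_pos add_pos_nonneg) auto
      then have "1 - \<delta> / (b + real m * a) \<le> 1 + (- d / real (Suc m))"
        by (simp add: d_def)
      also have "\<dots> \<le> exp (- d / real (Suc m))" by (rule exp_ge_add_one_self)
      finally show "1 - \<delta> / (b + real m * a) \<le> exp (- d / real (Suc m))" .
    qed (use assms(4) in simp)
    also have "\<dots> = exp (- d * harm M)"
    proof -
      have "(\<Sum>m<M. - d / real (Suc m)) = - d * harm M"
        by (induction M) (simp add: harm_def, simp add: harm_Suc field_simps)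
      then show ?thesis by (simp add: exp_sum[symmetric])
    qed
    also have "\<dots> \<le> exp (- d * ln (real M + 1))"
      using ln_le_harm[of M] d by simp
    finally show ?thesis .
  qed
  have lim: "(\<lambda>M. exp (- d * ln (real M + 1))) \<longlonglongrightarrow> 0"
    using d by real_asymp
  show ?thesis
    by (rule tendsto_sandwich[OF _ _ tendsto_const lim])
       (use le assms(4) in \<open>auto intro!: prod_nonneg always_eventually\<close>)
qed

text \<open>The recursion contains the same \<open>A\<close> at the parameter \<theta> + \<alpha>,
  so induction on \<open>A\<close> alone does not close it. The difference \<open>e\<close> between
  the expectation and the sampling formula satisfies
  \<open>e \<theta> = c \<theta> * e (\<theta> + \<alpha>)\<close>. Iterating gives a bounded
  quantity times a product that tends to 0.\<close>

lemma nn_integral_edsum_gem: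
  assumes "gem_parameters \<alpha> \<theta>" "finite A" "\<And>a. a \<in> A \<Longrightarrow> 0 < n a"
  shows "(\<integral>\<^sup>+ R. edsum A n (stick R) \<partial>gem \<alpha> \<theta>) = ennreal (py_eppf \<alpha> \<theta> A n)"
  using assms(2,3,1)
proof (induction A arbitrary: \<theta> rule: finite_psubset_induct)
  let ?F = "\<lambda>A (t::real). \<integral>\<^sup>+ R. edsum A n (stick R) \<partial>gem \<alpha> t"
  case (psubset A)
  show ?case
  proof (cases "A = {}")
    case True
    interpret gem_parameters \<alpha> \<theta> by fact
    interpret prob_space "gem \<alpha> \<theta>" by (rule prob_space_gem)
    show ?thesis using True by (simp add: py_eppf_def emeasure_space_1)
  next
    case ne: False
    interpret gem_parameters \<alpha> \<theta> by fact
    define N where "N = (\<Sum>a\<in>A. n a)"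
    have N: "1 \<le> N" using psubset ne unfolding N_def
      by (metis One_nat_def Suc_leI all_not_in_conv gr0I sum_eq_0_iff less_irrefl)
    define S where "S = (\<lambda>\<theta>. enn2real (\<integral>\<^sup>+ R. edsum A n (stick R) \<partial>gem \<alpha> \<theta>))"
    define e where "e = (\<lambda>\<theta>. S \<theta> - py_eppf \<alpha> \<theta> A n)"
    define c where "c = (\<lambda>\<theta>. pochhammer (\<theta> + \<alpha>) N / pochhammer (\<theta> + 1) N)"
    have par: "gem_parameters \<alpha> (\<theta> + real m * \<alpha>)" for m
      using \<alpha> \<theta> by unfold_locales (auto intro: add_strict_increasing2 less_le_trans)
    have Sle: "0 \<le> S t" "S t \<le> 1" "(?F A t) = ennreal (S t)" if "gem_parameters \<alpha> t" for t
    proof -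
      have le: "(?F A t) \<le> 1"
        using gem_parameters.nn_integral_gem_le_1[OF that psubset.hyps psubset.prems(1)] by simp
      then show 3: "(?F A t) = ennreal (S t)"
        unfolding S_def by (intro ennreal_enn2real[symmetric]) (auto simp: less_top[symmetric] top_unique)
      show "0 \<le> S t" by (simp add: S_def)
      show "S t \<le> 1" using le unfolding 3 by simp
    qed
    have step: "e t = c t * e (t + \<alpha>)" if t: "gem_parameters \<alpha> t" for t
    proof -
      interpret T: gem_parameters \<alpha> t by fact
      have t': "gem_parameters \<alpha> (t + \<alpha>)" using T.\<alpha> T.\<theta> by unfold_locales auto
      let ?b = "\<lambda>a. pochhammer (1 - \<alpha>) (n a) * pochhammer (t + \<alpha>) (\<Sum>b\<in>A - {a}. n b) / pochhammer (t + 1) N"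
      have nn: "0 \<le> c t" "\<And>a. 0 \<le> ?b a" "\<And>a. 0 \<le> ?b a * py_eppf \<alpha> (t + \<alpha>) (A - {a}) n"
        using T.pochhammer_pos'[THEN less_imp_le] gem_parameters.py_eppf_nonneg[OF t', of _ n]
        by (auto simp: c_def)
      have IH: "(\<integral>\<^sup>+ R. edsum (A - {a}) n (stick R) \<partial>gem \<alpha> (t + \<alpha>)) = ennreal (py_eppf \<alpha> (t + \<alpha>) (A - {a}) n)"
        if "a \<in> A" for a
        using that psubset.prems(1) by (intro psubset.IH t') auto
      have "ennreal (S t) = ennreal (c t) * ennreal (S (t + \<alpha>))
         + (\<Sum>a\<in>A. ennreal (?b a) * ennreal (py_eppf \<alpha> (t + \<alpha>) (A - {a}) n))"
        unfolding Sle(3)[OF t, symmetric] T.nn_integral_gem_step[OF psubset.hyps, of n] Sle(3)[OF t', symmetric]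
        using IH by (simp add: N_def c_def)
      also have "\<dots> = ennreal (c t * S (t + \<alpha>) + (\<Sum>a\<in>A. ?b a * py_eppf \<alpha> (t + \<alpha>) (A - {a}) n))"
        using nn Sle(1)[OF t'] by (simp add: ennreal_mult'[symmetric] sum_nonneg)
      finally have "S t = c t * S (t + \<alpha>) + (\<Sum>a\<in>A. ?b a * py_eppf \<alpha> (t + \<alpha>) (A - {a}) n)"
        using nn Sle(1)[OF t'] Sle(1)[OF t] by (subst (asm) ennreal_inj) (auto intro!: add_nonneg_nonneg sum_nonneg)
      then show ?thesis
        using T.py_eppf_step[OF psubset.hyps ne psubset.prems(1)]
        by (simp add: e_def c_def N_def right_diff_distrib)
    qed
    have iter: "e \<theta> = (\<Prod>m<M. c (\<theta> + real m * \<alpha>)) * e (\<theta> + real M * \<alpha>)" for M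
      by (induction M) (use step[OF par] in \<open>auto simp: algebra_simps\<close>)
    \<comment> \<open>Of the N quotients in \<open>c t\<close> only the first is kept; the others
      are at most 1.\<close>
    have cle: "0 \<le> c t \<and> c t \<le> 1 - (1 - \<alpha>) / (t + 1)" if "gem_parameters \<alpha> t" for t
    proof -
      interpret T: gem_parameters \<alpha> t by fact
      have "c t = (t + \<alpha>) * pochhammer (t + \<alpha> + 1) (N - 1) / ((t + 1) * pochhammer (t + 1 + 1) (N - 1))"
        unfolding c_def using N by (cases N) (auto simp: pochhammer_rec)
      moreover have "pochhammer (t + \<alpha> + 1) (N - 1) \<le> pochhammer (t + 1 + 1) (N - 1)"
        unfolding pochhammer_prod using T.\<alpha> T.\<theta> by (intro prod_mono) auto
      moreover have "0 < pochhammer (t + \<alpha> + 1) (N - 1)" using T.\<alpha> T.\<theta> by (intro pochhammer_pos) auto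
      ultimately have "c t = (t + \<alpha>) / (t + 1) * (pochhammer (t + \<alpha> + 1) (N - 1) / pochhammer (t + 1 + 1) (N - 1))"
        and "pochhammer (t + \<alpha> + 1) (N - 1) / pochhammer (t + 1 + 1) (N - 1) \<le> 1" by simp_all
      then have "c t \<le> (t + \<alpha>) / (t + 1) * 1"
        using T.\<alpha> T.\<theta> by (simp only:) (intro mult_left_mono, auto)
      also have "\<dots> = 1 - (1 - \<alpha>) / (t + 1)" using T.\<alpha> T.\<theta> by (simp add: field_simps)
      finally show ?thesis using T.pochhammer_pos' by (auto simp: c_def intro!: divide_nonneg_nonneg less_imp_le)
    qed
    define W where "W = (\<Prod>a\<in>A. pochhammer (1 - \<alpha>) (n a - 1))"
    \<comment> \<open>One shift already makes the parameter nonnegative, because - \<alpha> <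
      \<theta>; from then on the expectation is at most 1 and the formula at most
      \<open>W\<close>.\<close>
    have bound: "\<bar>e \<theta>\<bar> \<le> (\<Prod>m<M. 1 - (1 - \<alpha>) / (\<theta> + 1 + real m * \<alpha>)) * (1 + W)" if "1 \<le> M" for M
    proof -
      have "\<alpha> \<le> real M * \<alpha>" using that \<alpha> by simp
      then have ge0: "0 \<le> \<theta> + real M * \<alpha>" using \<theta> by linarith
      interpret T: gem_parameters \<alpha> "\<theta> + real M * \<alpha>" by (rule par)
      have "py_eppf \<alpha> (\<theta> + real M * \<alpha>) A n \<le> W"
        unfolding W_def using psubset.prems(1) by (intro T.py_eppf_bound ge0 psubset.hyps)
      then have "\<bar>e (\<theta> + real M * \<alpha>)\<bar> \<le> 1 + W"
        using Sle(1,2)[OF par[of M]] T.py_eppf_nonneg[of A n] by (simp add: e_def)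
      moreover have "\<bar>\<Prod>m<M. c (\<theta> + real m * \<alpha>)\<bar> \<le> (\<Prod>m<M. 1 - (1 - \<alpha>) / (\<theta> + 1 + real m * \<alpha>))"
        unfolding abs_prod using cle[OF par] by (intro prod_mono) (auto simp: algebra_simps)
      ultimately show ?thesis
        unfolding iter[of M] abs_mult by (intro mult_mono) (auto intro: order_trans[OF abs_ge_zero])
    qed
    have "(\<lambda>M. (\<Prod>m<M. 1 - (1 - \<alpha>) / (\<theta> + 1 + real m * \<alpha>)) * (1 + W)) \<longlonglongrightarrow> 0 * (1 + W)"
    proof (intro tendsto_mult tendsto_const prod_one_minus_harmonic_tendsto_0)
      fix m
      have "0 \<le> real m * \<alpha>" using \<alpha> by simp
      then show "(1 - \<alpha>) / (\<theta> + 1 + real m * \<alpha>) \<le> 1" using \<alpha> \<theta> by (subst divide_le_eq_1_pos) linarith+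
    qed (use \<alpha> \<theta> in auto)
    then have "\<bar>e \<theta>\<bar> \<le> 0"
      by (intro LIMSEQ_le_const[of _ 0]) (use bound in auto)
    then show ?thesis using Sle(3)[OF psubset.prems(2)] by (simp add: e_def)
  qed
qed

lemma PD_eq_distr_gem: "PD \<alpha> \<theta> = distr (gem \<alpha> \<theta>) borel (\<lambda>R. ranked (stick R))"
  by (simp add: PD_def gem_def stick_def[abs_def])

context gem_parameters
begin

lemma ranked_stick_measurable: "(\<lambda>R. ranked (stick R)) \<in> borel_measurable (gem \<alpha> \<theta>)"
  unfolding measurable_gem_cong
  by (intro ranked_measurable measurable_product_then_coordinatewise[OF stick_measurable])

text \<open>The total is at most 1 and has expectation 1, the value of the sampling formula for a
  sample of one point.\<close>

lemma AE_psum_stick: "AE R in gem \<alpha> \<theta>. psum 1 (stick R) = 1"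
proof -
  interpret prob_space "gem \<alpha> \<theta>" by (rule prob_space_gem)
  have ps: "edsum {()} (\<lambda>_. 1) (stick R) = psum 1 (stick R)" for R by simp
  have le: "AE R in gem \<alpha> \<theta>. psum 1 (stick R) \<le> 1"
    using AE_gem by eventually_elim (auto intro: psum_stick_le_1)
  have m: "(\<lambda>R. psum 1 (stick R)) \<in> borel_measurable (gem \<alpha> \<theta>)"
    unfolding measurable_gem_cong by (rule psum_measurable[OF stick_measurable])
  have int: "(\<integral>\<^sup>+ R. psum 1 (stick R) \<partial>gem \<alpha> \<theta>) = 1"
    using nn_integral_edsum_gem[OF gem_parameters_axioms, of "{()}" "\<lambda>_. 1"] unfolding ps
    by (simp add: py_eppf_def)
  have "(\<integral>\<^sup>+ R. 1 - psum 1 (stick R) \<partial>gem \<alpha> \<theta>) = (\<integral>\<^sup>+ R. 1 \<partial>gem \<alpha> \<theta>) - (\<integral>\<^sup>+ R. psum 1 (stick R) \<partial>gem \<alpha> \<theta>)"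
    using m le int by (intro nn_integral_diff) auto
  also have "\<dots> = 0" unfolding int by (simp add: emeasure_space_1)
  finally have "AE R in gem \<alpha> \<theta>. 1 - psum 1 (stick R) = 0"
    using m by (subst (asm) nn_integral_0_iff_AE) auto
  with le show ?thesis
    by eventually_elim (auto simp: diff_eq_0_iff_ennreal intro: antisym)
qed

lemma AE_psum_ranked_stick:
  "AE R in gem \<alpha> \<theta>. ranked (stick R) \<in> P_infty \<and> (\<forall>m>0. psum m (ranked (stick R)) = psum m (stick R))"
  using AE_psum_stick AE_gem
proof eventually_elim
  case (elim R)
  have nn: "0 \<le> stick R i" for i using elim by (intro stick_nonneg) auto
  have 1: "(\<integral>\<^sup>+ i. ennreal (stick R i) \<partial>count_space UNIV) = 1"
    using elim by (simp add: nn_integral_count_space_nat psum_def)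
  then have sm: "(\<integral>\<^sup>+ i. ennreal (stick R i) \<partial>count_space UNIV) < \<top>" by simp
  have "psum m (ranked (stick R)) = psum m (stick R)" if "0 < m" for m
    unfolding psum_ranked[where x = "stick R", OF nn sm that] psum_def[of m "stick R"] nn_integral_count_space_nat ..
  with ranked_in_P_infty[OF nn 1] show ?case by blast
qed

lemma sets_PD: "sets (PD \<alpha> \<theta>) = sets borel"
  by (simp add: PD_eq_distr_gem)

lemma AE_PD: "AE p in PD \<alpha> \<theta>. p \<in> P_infty"
  unfolding PD_eq_distr_gem using AE_psum_ranked_stick P_infty_measurable
  by (subst AE_distr_iff[OF ranked_stick_measurable]) (auto simp: pred_def elim!: eventually_mono)

lemma nn_integral_edsum_PD:
  assumes "finite A" "\<And>a. a \<in> A \<Longrightarrow> 0 < n a"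
  shows "(\<integral>\<^sup>+ p. edsum A n p \<partial>PD \<alpha> \<theta>) = ennreal (py_eppf \<alpha> \<theta> A n)"
proof -
  have "(\<integral>\<^sup>+ p. edsum A n p \<partial>PD \<alpha> \<theta>) = (\<integral>\<^sup>+ R. edsum A n (ranked (stick R)) \<partial>gem \<alpha> \<theta>)"
    unfolding PD_eq_distr_gem
    by (rule nn_integral_distr[OF ranked_stick_measurable]) (use assms in simp)
  also have "\<dots> = (\<integral>\<^sup>+ R. edsum A n (stick R) \<partial>gem \<alpha> \<theta>)"
  proof (rule nn_integral_cong_AE)
    show "AE R in gem \<alpha> \<theta>. edsum A n (ranked (stick R)) = edsum A n (stick R)"
      using AE_psum_ranked_stick AE_gem
    proof eventually_elim
      case (elim R)
      show ?case
      proof (rule edsum_eq_if_psum_eq[OF assms])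
        show "psum m (stick R) < \<top>" if "0 < m" for m
          using psum_stick_le_1[of R m] elim that by (auto simp: le_less_trans)
      qed (use elim in auto)
    qed
  qed
  finally show ?thesis using nn_integral_edsum_gem[OF gem_parameters_axioms assms] by simp
qed

end

subsection \<open>Factorial moments of Poisson points\<close>

text \<open>The function exp(-x) on the extended half-line. The value 0 at infinity is its
  continuous extension, which allows sums over jumps before they are known to converge.\<close>

definition eexp :: "ennreal \<Rightarrow> ennreal" where
  "eexp x = (if x = \<top> then 0 else ennreal (exp (- enn2real x)))"

lemma eexp_ennreal [simp]: "0 \<le> r \<Longrightarrow> eexp (ennreal r) = ennreal (exp (- r))"
  by (simp add: eexp_def)

lemma eexp_top [simp]: "eexp \<top> = 0"
  by (simp add: eexp_def)

lemma eexp_0 [simp]: "eexp 0 = 1"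
  by (simp add: eexp_def)

lemma eexp_le_1: "eexp x \<le> 1"
  by (simp add: eexp_def)

lemma eexp_less_top [simp]: "eexp x < \<top>"
  using eexp_le_1[of x] by (auto simp: le_less_trans)

lemma eexp_add: "eexp (x + y) = eexp x * eexp y"
  by (cases x; cases y) (auto simp: ennreal_plus[symmetric] ennreal_mult'[symmetric] exp_add[symmetric] simp del: ennreal_plus)

lemma eexp_sum: "finite A \<Longrightarrow> eexp (sum f A) = (\<Prod>a\<in>A. eexp (f a))"
  by (induction A rule: finite_induct) (auto simp: eexp_add)

lemma eexp_measurable [measurable]: "eexp \<in> borel_measurable borel"
  unfolding eexp_def by measurable

lemma tendsto_eexp:
  assumes "x \<longlonglongrightarrow> l"
  shows "(\<lambda>n. eexp (x n)) \<longlonglongrightarrow> eexp l"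
proof (cases "l = \<top>")
  case False
  then have "eventually (\<lambda>n. x n < \<top>) sequentially"
    using assms by (simp add: order_tendstoD less_top)
  then have "eventually (\<lambda>n. ennreal (exp (- enn2real (x n))) = eexp (x n)) sequentially"
    by eventually_elim (auto simp: eexp_def)
  moreover have "(\<lambda>n. ennreal (exp (- enn2real (x n)))) \<longlonglongrightarrow> ennreal (exp (- enn2real l))"
    using assms False by (intro tendsto_intros tendsto_enn2real) (auto simp: less_top)
  ultimately show ?thesis using False by (auto simp: eexp_def intro: Lim_transform_eventually)
next
  case True
  show ?thesis
  proof (rule order_tendstoI)
    fix a assume "eexp l < a"
    then have a: "0 < a" using True by simp
    obtain e where e: "0 < e" "ennreal e \<le> a"
    proof (cases a)
      case (real r) then show ?thesis using that[of r] a by (auto simp: ennreal_less_zero_iff)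
    next
      case top then show ?thesis using that[of 1] by simp
    qed
    define K where "K = max 1 (- ln (e / 2))"
    have "eventually (\<lambda>n. ennreal K < x n) sequentially"
      using assms True by (intro order_tendstoD(1)[of x l]) auto
    then show "eventually (\<lambda>n. eexp (x n) < a) sequentially"
    proof eventually_elim
      case (elim n)
      show ?case
      proof (cases "x n")
        case (real r)
        moreover have "0 \<le> K" by (simp add: K_def)
        ultimately have "K < r" using elim by (simp add: ennreal_less_iff)
        then have "exp (- r) < exp (ln (e / 2))" unfolding K_def by (subst exp_less_cancel_iff) auto
        also have "\<dots> < e" using e by simp
        finally have "ennreal (exp (- r)) < ennreal e" using e by (simp add: ennreal_less_iff)
        then show ?thesis using real e by (auto intro: less_le_trans)
      qed (use a in simp)
    qed
  qed (use True in simp)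
qed

locale poisson_jumps = prob_space M for M :: "'a measure" +
  fixes \<mu> :: "real measure" and J :: "nat \<Rightarrow> 'a \<Rightarrow> real"
  assumes points: "poisson_points M \<mu> J"
    and sets_\<mu> [measurable_cong]: "sets \<mu> = sets borel"
    and \<mu>_pos: "AE x in \<mu>. 0 < x"
    and J_pos: "AE \<omega> in M. \<forall>i. 0 < J i \<omega>"
    and \<mu>_fin: "\<And>e. 0 < e \<Longrightarrow> emeasure \<mu> {e<..} < \<top>"
begin

lemma J_measurable [measurable]: "J i \<in> borel_measurable M"
  using points by (simp add: poisson_points_def)

lemma nn_integral_eexp_count:
  assumes A: "A \<in> sets borel" "emeasure \<mu> A < \<top>" and c: "0 \<le> c"
    and m[measurable]: "(\<lambda>\<omega>. card {i. J i \<omega> \<in> A}) \<in> M \<rightarrow>\<^sub>M count_space UNIV"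
  shows "(\<integral>\<^sup>+ \<omega>. ennreal (exp (- c * real (card {i. J i \<omega> \<in> A}))) \<partial>M)
       = ennreal (exp (- (1 - exp (- c)) * measure \<mu> A))"
proof -
  let ?N = "\<lambda>\<omega>. card {i. J i \<omega> \<in> A}"
  let ?m = "measure \<mu> A"
  have fin: "AE \<omega> in M. finite {i. J i \<omega> \<in> A}" and
    pr: "\<And>k. measure M {\<omega> \<in> space M. finite {i. J i \<omega> \<in> A} \<and> ?N \<omega> = k} = exp (- ?m) * ?m ^ k / fact k"
    using points A unfolding poisson_points_def by auto
  have pr': "emeasure M {\<omega> \<in> space M. ?N \<omega> = k} = ennreal (exp (- ?m) * ?m ^ k / fact k)" for k
  \<comment> \<open>An infinite set has \<open>card\<close> 0. So only for \<open>k = 0\<close> can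
    the event differ from the one with the finiteness condition, and then by a null set.\<close>
  proof (cases "k = 0")
    case False
    have "?N \<omega> = k \<Longrightarrow> finite {i. J i \<omega> \<in> A}" for \<omega> using False by (meson card.infinite)
    then have "{\<omega> \<in> space M. ?N \<omega> = k} = {\<omega> \<in> space M. finite {i. J i \<omega> \<in> A} \<and> ?N \<omega> = k}" by auto
    then show ?thesis using pr[of k] by (simp add: emeasure_eq_measure)
  next
    case True
    have ne: "measure M {\<omega> \<in> space M. finite {i. J i \<omega> \<in> A} \<and> ?N \<omega> = k} \<noteq> 0" using pr[of k] True by simp
    \<comment> \<open>A non-measurable set has \<open>measure\<close> 0, whereas the Poisson
      probability of no points is positive.\<close>
    have "{\<omega> \<in> space M. finite {i. J i \<omega> \<in> A} \<and> ?N \<omega> = k} \<in> events"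
      using ne measure_notin_sets by blast
    then have "emeasure M {\<omega> \<in> space M. ?N \<omega> = k} = emeasure M {\<omega> \<in> space M. finite {i. J i \<omega> \<in> A} \<and> ?N \<omega> = k}"
      using fin by (intro emeasure_eq_AE) auto
    then show ?thesis using pr[of k] by (simp add: emeasure_eq_measure)
  qed
  have "(\<integral>\<^sup>+ \<omega>. ennreal (exp (- c * real (?N \<omega>))) \<partial>M)
      = (\<integral>\<^sup>+ \<omega>. (\<Sum>k. ennreal (exp (- c * real k)) * indicator {\<omega> \<in> space M. ?N \<omega> = k} \<omega>) \<partial>M)"
  proof (rule nn_integral_cong)
    fix \<omega> assume "\<omega> \<in> space M"
    then show "ennreal (exp (- c * real (?N \<omega>))) = (\<Sum>k. ennreal (exp (- c * real k)) * indicator {\<omega> \<in> space M. ?N \<omega> = k} \<omega>)"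
      by (subst suminf_finite[of "{?N \<omega>}"]) auto
  qed
  also have "\<dots> = (\<Sum>k. ennreal (exp (- c * real k)) * emeasure M {\<omega> \<in> space M. ?N \<omega> = k})"
    by (subst nn_integral_suminf) (auto simp: nn_integral_cmult)
  also have "\<dots> = (\<Sum>k. ennreal (exp (- ?m) * ((?m * exp (- c)) ^ k / fact k)))"
    by (intro suminf_cong) (simp add: pr' ennreal_mult'[symmetric] power_mult_distrib exp_of_nat_mult[symmetric] mult_ac)
  also have "\<dots> = ennreal (\<Sum>k. exp (- ?m) * ((?m * exp (- c)) ^ k / fact k))"
    using exp_converges[of "?m * exp (- c)"]
    by (intro suminf_ennreal2 summable_mult) (auto simp: sums_iff field_simps)
  also have "(\<Sum>k. exp (- ?m) * ((?m * exp (- c)) ^ k / fact k)) = exp (- ?m) * exp (?m * exp (- c))"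
    using exp_converges[of "?m * exp (- c)"]
    by (subst suminf_mult) (auto simp: sums_iff field_simps)
  finally show ?thesis by (simp add: exp_add[symmetric] algebra_simps)
qed

text \<open>The level sets of \<open>g\<close> at nonzero values are disjoint and lie beyond
  \<open>e\<close>, so they have finite intensity and independent Poisson counts. The expectation
  factors over them.\<close>

lemma Laplace_functional_simple:
  assumes g[measurable]: "g \<in> borel_measurable borel" and nn: "\<And>x. 0 \<le> g x" and fr: "finite (range g)"
    and supp: "\<And>x. g x \<noteq> 0 \<Longrightarrow> e < x" and e: "0 < e"
  shows "(\<integral>\<^sup>+ \<omega>. eexp (\<Sum>i. ennreal (g (J i \<omega>))) \<partial>M) = eexp (\<integral>\<^sup>+ x. ennreal (1 - exp (- g x)) \<partial>\<mu>)"
proof -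
  obtain h and m :: nat where h: "bij_betw h {..<m} (range g - {0})"
    using ex_bij_betw_nat_finite[of "range g - {0}"] fr by (auto simp: atLeast0LessThan)
  define A where "A = (\<lambda>l. g -` {h l})"
  let ?N = "\<lambda>l \<omega>. card {i. J i \<omega> \<in> A l}"
  have hpos: "0 < h l" if "l < m" for l
  proof -
    have "h l \<in> range g - {0}" using h that by (auto simp: bij_betw_def)
    then show ?thesis using nn by (force simp: less_le)
  qed
  have Ab: "A l \<in> sets borel" for l unfolding A_def using measurable_sets[OF g, of "{h l}"] by simp
  have Af: "emeasure \<mu> (A l) < \<top>" if "l < m" for l
  proof -
    have "A l \<subseteq> {e<..}" using hpos[OF that] supp by (auto simp: A_def)
    then have "emeasure \<mu> (A l) \<le> emeasure \<mu> {e<..}" by (intro emeasure_mono) (auto simp: sets_\<mu>)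
    then show ?thesis using \<mu>_fin[OF e] by (rule le_less_trans)
  qed
  have disj: "disjoint_family_on A {..<m}"
    using h by (auto simp: disjoint_family_on_def A_def bij_betw_def inj_on_def)
  have g_eq: "ennreal (g x) = (\<Sum>l<m. ennreal (h l) * indicator (A l) x)" for x
  proof (cases "g x = 0")
    case True
    then have "x \<notin> A l" if "l < m" for l using hpos[OF that] by (auto simp: A_def)
    then show ?thesis using True by simp
  next
    case False
    then have "g x \<in> h ` {..<m}" using h by (simp add: bij_betw_def)
    then obtain l where l: "l < m" "h l = g x" by auto
    have "x \<in> A k \<longleftrightarrow> k = l" if "k < m" for k
      using l that h by (auto simp: A_def bij_betw_def inj_on_def)
    then have "(\<Sum>k<m. ennreal (h k) * indicator (A k) x) = (\<Sum>k<m. if k = l then ennreal (h k) else 0)"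
      by (intro sum.cong) auto
    with l show ?thesis by simp
  qed
  have indep: "indep_vars (\<lambda>_. count_space UNIV) ?N {..<m}"
    using points Ab Af disj unfolding poisson_points_def by auto
  have Nm: "?N l \<in> M \<rightarrow>\<^sub>M count_space UNIV" if "l < m" for l
    using indep_vars_def2[of "\<lambda>_. count_space UNIV" ?N "{..<m}"] indep that by auto
  have "AE \<omega> in M. \<forall>l\<in>{..<m}. finite {i. J i \<omega> \<in> A l}"
    using points Ab Af unfolding poisson_points_def by (intro AE_finite_allI) auto
  then have "AE \<omega> in M. eexp (\<Sum>i. ennreal (g (J i \<omega>))) = (\<Prod>l<m. ennreal (exp (- h l * real (?N l \<omega>))))"
  proof eventually_elim
    case (elim \<omega>)
    have "(\<Sum>i. ennreal (g (J i \<omega>))) = (\<Sum>l<m. \<Sum>i. ennreal (h l) * indicator (A l) (J i \<omega>))"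
      unfolding g_eq by (rule suminf_sum) auto
    also have "\<dots> = (\<Sum>l<m. ennreal (h l * real (?N l \<omega>)))"
    proof (rule sum.cong[OF refl], goal_cases)
      case l: (1 l)
      have "(\<Sum>i. indicator (A l) (J i \<omega>) :: ennreal) = (\<Sum>i\<in>{i. J i \<omega> \<in> A l}. indicator (A l) (J i \<omega>))"
        using elim l by (intro suminf_finite) auto
      also have "\<dots> = ennreal (real (?N l \<omega>))" by (simp add: ennreal_of_nat_eq_real_of_nat)
      finally show ?case
        using hpos[of l] l by (simp add: ennreal_mult')
    qed
    finally show ?case using hpos by (auto simp: eexp_sum less_imp_le intro!: prod.cong)
  qed
  then have "(\<integral>\<^sup>+ \<omega>. eexp (\<Sum>i. ennreal (g (J i \<omega>))) \<partial>M) = (\<integral>\<^sup>+ \<omega>. (\<Prod>l<m. ennreal (exp (- h l * real (?N l \<omega>)))) \<partial>M)"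
    by (rule nn_integral_cong_AE)
  also have "\<dots> = (\<Prod>l<m. \<integral>\<^sup>+ \<omega>. ennreal (exp (- h l * real (?N l \<omega>))) \<partial>M)"
    by (rule indep_vars_nn_integral)
       (use indep_vars_compose2[OF indep, of "\<lambda>l k. ennreal (exp (- h l * real k))" "\<lambda>_. borel"] in auto)
  also have "\<dots> = (\<Prod>l<m. ennreal (exp (- (1 - exp (- h l)) * measure \<mu> (A l))))"
    using Ab Af hpos Nm by (intro prod.cong refl nn_integral_eexp_count) (auto simp: less_imp_le)
  also have "\<dots> = eexp (\<Sum>l<m. ennreal ((1 - exp (- h l)) * measure \<mu> (A l)))"
  proof -
    have "eexp (ennreal ((1 - exp (- h l)) * measure \<mu> (A l))) = ennreal (exp (- ((1 - exp (- h l)) * measure \<mu> (A l))))" if "l < m" for l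
      using hpos[OF that] by (intro eexp_ennreal) simp
    then show ?thesis by (simp add: eexp_sum del: mult_minus_left cong: prod.cong) (simp add: mult_minus_left[symmetric])
  qed
  also have "(\<Sum>l<m. ennreal ((1 - exp (- h l)) * measure \<mu> (A l))) = (\<integral>\<^sup>+ x. (\<Sum>l<m. ennreal (1 - exp (- h l)) * indicator (A l) x) \<partial>\<mu>)"
  proof -
    have "A l \<in> sets \<mu>" for l using Ab sets_\<mu> by simp
    moreover have "emeasure \<mu> (A l) = ennreal (measure \<mu> (A l))" if "l < m" for l
      using Af[OF that] by (intro emeasure_eq_ennreal_measure) auto
    ultimately show ?thesis
      using hpos
      by (subst nn_integral_sum) (auto simp: nn_integral_cmult_indicator ennreal_mult' less_imp_le intro!: sum.cong)
  qed
  also have "\<dots> = (\<integral>\<^sup>+ x. ennreal (1 - exp (- g x)) \<partial>\<mu>)"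
  proof (rule nn_integral_cong, goal_cases)
    case (1 x)
    show ?case
    proof (cases "g x = 0")
      case True
      then have "x \<notin> A l" if "l < m" for l using hpos[OF that] by (auto simp: A_def)
      then show ?thesis using True by simp
    next
      case False
      then have "g x \<in> h ` {..<m}" using h by (simp add: bij_betw_def)
    then obtain l where l: "l < m" "h l = g x" by auto
      have "x \<in> A k \<longleftrightarrow> k = l" if "k < m" for k
        using l that h by (auto simp: A_def bij_betw_def inj_on_def)
      then have "(\<Sum>k<m. ennreal (1 - exp (- h k)) * indicator (A k) x) = (\<Sum>k<m. if k = l then ennreal (1 - exp (- h k)) else 0)"
        by (intro sum.cong) auto
      with l show ?thesis by simp
    qed
  qed
  finally show ?thesis .
qed

text \<open>Monotone approximation by simple functions. These are also cut off near 0, because the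
  intensity may be infinite there and the simple case needs level sets of finite intensity.\<close>

theorem Laplace_functional:
  assumes [measurable]: "\<phi> \<in> borel_measurable borel" and nn: "\<And>x. 0 < x \<Longrightarrow> 0 \<le> \<phi> x"
  shows "(\<integral>\<^sup>+ \<omega>. eexp (\<Sum>i. ennreal (\<phi> (J i \<omega>))) \<partial>M) = eexp (\<integral>\<^sup>+ x. ennreal (1 - exp (- \<phi> x)) \<partial>\<mu>)"
proof -
  \<comment> \<open>The sign of \<open>\<phi>\<close> is known on positive arguments only; jumps and
    intensity live there, so \<open>\<phi>\<close> can be replaced by 0 elsewhere.\<close>
  define \<psi> where "\<psi> = (\<lambda>x. if 0 < x then \<phi> x else 0)"
  let ?G = "\<integral>\<^sup>+ x. ennreal (1 - exp (- \<psi> x)) \<partial>\<mu>"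
  let ?F = "\<integral>\<^sup>+ \<omega>. eexp (\<Sum>i. ennreal (\<psi> (J i \<omega>))) \<partial>M"
  have [measurable]: "\<psi> \<in> borel_measurable borel" unfolding \<psi>_def by measurable
  have \<psi>nn: "0 \<le> \<psi> x" for x using nn by (simp add: \<psi>_def)
  obtain f where f: "incseq f" "\<And>i. simple_function borel (f i)" "\<And>x. bdd_above (range (\<lambda>i. f i x))"
      "\<And>i x. 0 \<le> f i x" "\<psi> = (SUP i. f i)"
    using borel_measurable_implies_simple_function_sequence_real[OF \<open>\<psi> \<in> borel_measurable borel\<close> \<psi>nn] by blast
  have flim: "(\<lambda>i. f i x) \<longlonglongrightarrow> \<psi> x" for x
  proof -
    have "\<psi> x = (SUP i. f i x)" using f(5) by (simp add: image_comp)
    moreover have "incseq (\<lambda>i. f i x)" using f(1) by (auto simp: incseq_def le_fun_def)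
    ultimately show ?thesis using LIMSEQ_incseq_SUP[OF f(3)] by simp
  qed
  define g where "g = (\<lambda>n x. if 1 / real (Suc n) < x then f n x else 0)"
  let ?H = "\<lambda>n. \<integral>\<^sup>+ \<omega>. eexp (\<Sum>i. ennreal (g n (J i \<omega>))) \<partial>M"
  have [measurable]: "f n \<in> borel_measurable borel" for n by (rule borel_measurable_simple_function[OF f(2)])
  have [measurable]: "g n \<in> borel_measurable borel" for n unfolding g_def by measurable
  have glim: "(\<lambda>n. g n x) \<longlonglongrightarrow> \<psi> x" for x
  proof (cases "0 < x")
    case True
    obtain k :: nat where k: "1 / real (Suc k) < x" using True nat_approx_posE by blast
    have "eventually (\<lambda>n. f n x = g n x) sequentially"
      using eventually_ge_at_top[of k]
    proof eventually_elim
      case (elim n)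
      then have "1 / real (Suc n) \<le> 1 / real (Suc k)" by (simp add: field_simps)
      then show ?case using k by (simp add: g_def)
    qed
    with flim[of x] show ?thesis by (rule Lim_transform_eventually)
  next
    case False
    then have "g n x = 0" for n by (simp add: g_def) (meson divide_nonneg_nonneg less_trans not_le of_nat_0_le_iff order.strict_trans1 zero_le_one add_nonneg_nonneg)
    then show ?thesis using False by (simp add: \<psi>_def)
  qed
  have ginc: "g n x \<le> g n' x" if "n \<le> n'" for n n' x
  proof -
    have "1 / real (Suc n') \<le> 1 / real (Suc n)" using that by (simp add: field_simps)
    moreover have "f n x \<le> f n' x" using f(1) that by (auto simp: incseq_def le_fun_def)
    ultimately show ?thesis using f(4) by (auto simp: g_def)
  qed
  have gnn: "0 \<le> g n x" for n x using f(4) by (simp add: g_def)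
  have simp: "(\<integral>\<^sup>+ \<omega>. eexp (\<Sum>i. ennreal (g n (J i \<omega>))) \<partial>M) = eexp (\<integral>\<^sup>+ x. ennreal (1 - exp (- g n x)) \<partial>\<mu>)" for n
  proof (rule Laplace_functional_simple)
    have "range (g n) \<subseteq> insert 0 (range (f n))" by (auto simp: g_def)
    moreover have "finite (range (f n))" using f(2)[of n] by (simp add: simple_function_def)
    ultimately show "finite (range (g n))" by (meson finite.insertI finite_subset)
    show "1 / real (Suc n) < x" if "g n x \<noteq> 0" for x using that by (simp add: g_def split: if_splits)
  qed (use gnn in auto)
  have "?H \<longlonglongrightarrow> ?F"
  proof (rule nn_integral_dominated_convergence[where w = "\<lambda>_. 1"])
    show "AE \<omega> in M. (\<lambda>n. eexp (\<Sum>i. ennreal (g n (J i \<omega>)))) \<longlonglongrightarrow> eexp (\<Sum>i. ennreal (\<psi> (J i \<omega>)))"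
    proof (rule AE_I2, rule tendsto_eexp)
      fix \<omega>
      show "(\<lambda>n. \<Sum>i. ennreal (g n (J i \<omega>))) \<longlonglongrightarrow> (\<Sum>i. ennreal (\<psi> (J i \<omega>)))"
        unfolding nn_integral_count_space_nat[symmetric]
        by (rule nn_integral_LIMSEQ)
           (auto simp: incseq_def le_fun_def intro!: ginc ennreal_leI tendsto_ennrealI glim)
    qed
  qed (auto simp: eexp_le_1 emeasure_space_1)
  moreover have "?H \<longlonglongrightarrow> eexp ?G"
    unfolding simp
    by (intro tendsto_eexp nn_integral_LIMSEQ)
       (auto simp: incseq_def le_fun_def intro!: ginc ennreal_leI tendsto_ennrealI glim tendsto_intros)
  ultimately have "?F = eexp ?G"
    by (rule LIMSEQ_unique)
  moreover have "?F = (\<integral>\<^sup>+ \<omega>. eexp (\<Sum>i. ennreal (\<phi> (J i \<omega>))) \<partial>M)"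
    using J_pos by (intro nn_integral_cong_AE, eventually_elim) (simp add: \<psi>_def)
  moreover have "?G = (\<integral>\<^sup>+ x. ennreal (1 - exp (- \<phi> x)) \<partial>\<mu>)"
    using \<mu>_pos by (intro nn_integral_cong_AE, eventually_elim) (simp add: \<psi>_def)
  ultimately show ?thesis by simp
qed

end

lemma psum_le_power:
  assumes "0 < m"
  shows "psum m x \<le> psum 1 x ^ m"
proof -
  have le: "ennreal (x i) \<le> psum 1 x" for i
    unfolding psum_def using sum_le_suminf[of "\<lambda>i. ennreal (x i)" "{i}"] by simp
  have "ennreal (x i) ^ m \<le> psum 1 x ^ (m - 1) * ennreal (x i)" for i
  proof -
    have "ennreal (x i) ^ m = ennreal (x i) ^ (m - 1) * ennreal (x i)"
      using assms by (cases m) (auto simp: mult.commute)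
    also have "\<dots> \<le> psum 1 x ^ (m - 1) * ennreal (x i)"
      by (intro mult_right_mono power_mono le) auto
    finally show ?thesis .
  qed
  then have "psum m x \<le> (\<Sum>i. psum 1 x ^ (m - 1) * ennreal (x i))"
    unfolding psum_def[of m] by (intro suminf_le) auto
  also have "\<dots> = psum 1 x ^ (m - 1) * psum 1 x"
    by (simp add: psum_def)
  also have "\<dots> = psum 1 x ^ m"
    using assms by (cases m) (auto simp: mult.commute)
  finally show ?thesis .
qed

section \<open>Difference quotients along \<open>1 / (k + 1)\<close>\<close>

text \<open>The product rule for one-sided difference quotients. They are one-sided because
  perturbing by \<open>u * x ^ m\<close> is admissible for nonnegative \<open>u\<close>.\<close>

lemma tendsto_diff_quotient_mult:
  fixes a b :: "nat \<Rightarrow> real"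
  assumes "(\<lambda>k. real (Suc k) * (A - a k)) \<longlonglongrightarrow> d" "(\<lambda>k. real (Suc k) * (B - b k)) \<longlonglongrightarrow> e" 
  shows "(\<lambda>k. real (Suc k) * (A * B - a k * b k)) \<longlonglongrightarrow> d * B + A * e"
proof -
  have "(\<lambda>k. 1 / real (Suc k) * (real (Suc k) * (A - a k))) \<longlonglongrightarrow> 0 * d"
    using assms(1) LIMSEQ_inverse_real_of_nat by (intro tendsto_mult) (auto simp: inverse_eq_divide)
  then have "(\<lambda>k. A - a k) \<longlonglongrightarrow> 0" by simp
  then have a: "a \<longlonglongrightarrow> A" using tendsto_diff[OF tendsto_const[of A], of "\<lambda>k. A - a k" 0] by simp
  have "(\<lambda>k. (real (Suc k) * (A - a k)) * B + a k * (real (Suc k) * (B - b k))) \<longlonglongrightarrow> d * B + A * e"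
    by (intro tendsto_intros assms a)
  then show ?thesis by (simp add: algebra_simps)
qed

lemma tendsto_diff_quotient_prod:
  fixes a :: "'b \<Rightarrow> nat \<Rightarrow> real"
  assumes "finite S" "\<And>b. b \<in> S \<Longrightarrow> (\<lambda>k. real (Suc k) * (A b - a b k)) \<longlonglongrightarrow> d b"
  shows "(\<lambda>k. real (Suc k) * ((\<Prod>b\<in>S. A b) - (\<Prod>b\<in>S. a b k))) \<longlonglongrightarrow> (\<Sum>b\<in>S. d b * (\<Prod>c\<in>S - {b}. A c))"
  using assms
proof (induction S rule: finite_induct)
  case (insert x S)
  have "(\<lambda>k. real (Suc k) * (A x * (\<Prod>b\<in>S. A b) - a x k * (\<Prod>b\<in>S. a b k)))
     \<longlonglongrightarrow> d x * (\<Prod>b\<in>S. A b) + A x * (\<Sum>b\<in>S. d b * (\<Prod>c\<in>S - {b}. A c))"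
    using insert by (intro tendsto_diff_quotient_mult) auto
  moreover have "A x * (\<Sum>b\<in>S. d b * (\<Prod>c\<in>S - {b}. A c)) = (\<Sum>b\<in>S. d b * (\<Prod>c\<in>insert x S - {b}. A c))"
    unfolding sum_distrib_left
  proof (rule sum.cong[OF refl], goal_cases)
    case (1 b)
    then have "insert x S - {b} = insert x (S - {b})" using insert.hyps by auto
    then show ?case
      using insert.hyps by simp
  qed
  ultimately show ?case using insert.hyps by simp
qed simp

lemma tendsto_diff_quotient_exp:
  fixes z :: "nat \<Rightarrow> real"
  assumes "(\<lambda>k. real (Suc k) * (z k - Z)) \<longlonglongrightarrow> d"
  shows "(\<lambda>k. real (Suc k) * (exp (- Z) - exp (- z k))) \<longlonglongrightarrow> exp (- Z) * d"
proof -
  \<comment> \<open>The value \<open>q 0 = 1\<close> makes \<open>q\<close> continuous and avoids a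
    division by \<open>z k - Z\<close>, which may vanish.\<close>
  define q where "q = (\<lambda>w::real. if w = 0 then 1 else (1 - exp (- w)) / w)"
  have "DERIV (\<lambda>w. - exp (- w)) 0 :> (1::real)" by (auto intro!: derivative_eq_intros)
  then have "((\<lambda>w::real. (1 - exp (- w)) / w) \<longlongrightarrow> 1) (at 0)"
    unfolding DERIV_def by simp
  then have q: "isCont q 0"
    unfolding isCont_def q_def by (auto intro: Lim_transform_eventually simp: eventually_at_filter)
  have "(\<lambda>k. 1 / real (Suc k) * (real (Suc k) * (z k - Z))) \<longlonglongrightarrow> 0 * d"
    using assms LIMSEQ_inverse_real_of_nat by (intro tendsto_mult) (auto simp: inverse_eq_divide)
  then have "(\<lambda>k. z k - Z) \<longlonglongrightarrow> 0" by simp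
  then have "(\<lambda>k. q (z k - Z)) \<longlonglongrightarrow> q 0"
    by (rule isCont_tendsto_compose[OF q])
  moreover have "q 0 = 1" by (simp add: q_def)
  ultimately have "(\<lambda>k. q (z k - Z)) \<longlonglongrightarrow> 1" by simp
  then have "(\<lambda>k. exp (- Z) * (real (Suc k) * (z k - Z) * q (z k - Z))) \<longlonglongrightarrow> exp (- Z) * (d * 1)"
    by (intro tendsto_intros assms)
  moreover have "exp (- Z) * (real (Suc k) * (z k - Z) * q (z k - Z)) = real (Suc k) * (exp (- Z) - exp (- z k))" for k
  proof -
    have "(z k - Z) * q (z k - Z) = 1 - exp (- (z k - Z))" by (auto simp: q_def)
    moreover have "exp (- Z) * exp (- (z k - Z)) = exp (- z k)" by (simp add: exp_add[symmetric])
    ultimately show ?thesis by (metis (no_types, lifting) mult.assoc mult.commute mult_1_right right_diff_distrib)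
  qed
  ultimately show ?thesis by (simp only: mult_1_right)
qed

locale poisson_jumps_moments = poisson_jumps +
  assumes \<mu>_moment: "\<And>l m. 0 < l \<Longrightarrow> 0 < m \<Longrightarrow> (\<integral>\<^sup>+ x. ennreal x ^ m * ennreal (exp (- l * x)) \<partial>\<mu>) < \<top>"
begin

text \<open>The class contains the linear functions and is closed under adding
  \<open>u * x ^ m\<close>, along which the induction differentiates. The linear lower bound gives
  finite moments of positive order and forces summable jumps wherever the additive functional is
  finite.\<close>

definition admissible :: "(real \<Rightarrow> real) \<Rightarrow> bool" where
  "admissible \<phi> \<longleftrightarrow> \<phi> \<in> borel_measurable borel \<and> (\<exists>l>0. \<forall>x>0. l * x \<le> \<phi> x) \<and>
     (\<integral>\<^sup>+ x. ennreal (1 - exp (- \<phi> x)) \<partial>\<mu>) < \<top>"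

definition jump_moment :: "nat \<Rightarrow> (real \<Rightarrow> real) \<Rightarrow> ennreal" where
  "jump_moment m \<phi> = (\<integral>\<^sup>+ x. ennreal x ^ m * ennreal (exp (- \<phi> x)) \<partial>\<mu>)"

definition Laplace_exponent :: "(real \<Rightarrow> real) \<Rightarrow> ennreal" where
  "Laplace_exponent \<phi> = (\<integral>\<^sup>+ x. ennreal (1 - exp (- \<phi> x)) \<partial>\<mu>)"

definition additive :: "(real \<Rightarrow> real) \<Rightarrow> 'a \<Rightarrow> ennreal" where
  "additive \<phi> \<omega> = (\<Sum>i. ennreal (\<phi> (J i \<omega>)))"

lemma admissible_nonneg: "admissible \<phi> \<Longrightarrow> 0 < x \<Longrightarrow> 0 \<le> \<phi> x"
  unfolding admissible_def by (meson mult_nonneg_nonneg less_imp_le order_trans)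

lemma jump_moment_finite:
  assumes "admissible \<phi>" "0 < m"
  shows "jump_moment m \<phi> < \<top>"
proof -
  obtain l where l: "0 < l" "\<And>x. 0 < x \<Longrightarrow> l * x \<le> \<phi> x" using assms by (auto simp: admissible_def)
  have "jump_moment m \<phi> \<le> (\<integral>\<^sup>+ x. ennreal x ^ m * ennreal (exp (- l * x)) \<partial>\<mu>)"
    unfolding jump_moment_def using \<mu>_pos
    by (intro nn_integral_mono_AE, eventually_elim) (auto intro!: mult_left_mono ennreal_leI l)
  then show ?thesis using \<mu>_moment[OF l(1) assms(2)] by (rule le_less_trans)
qed

lemma measurable_\<mu>: "f \<in> borel_measurable borel \<Longrightarrow> f \<in> borel_measurable \<mu>"
  by (simp add: measurable_cong_sets[OF sets_\<mu> refl])

lemma tendsto_scaled_one_minus_exp: "(\<lambda>k. real (Suc k) * (1 - exp (- (1 / real (Suc k) * y)))) \<longlonglongrightarrow> y" for y :: real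
proof -
  have "(\<lambda>k. real (Suc k) * (1 / real (Suc k) * y - 0)) \<longlonglongrightarrow> y" by simp
  from tendsto_diff_quotient_exp[OF this] show ?thesis by simp
qed

lemma scaled_one_minus_exp_le: "real (Suc k) * (1 - exp (- (1 / real (Suc k) * y))) \<le> y"
proof -
  have "1 - exp (- (1 / real (Suc k) * y)) \<le> 1 / real (Suc k) * y"
    using exp_ge_add_one_self[of "- (1 / real (Suc k) * y)"] by linarith
  then have "real (Suc k) * (1 - exp (- (1 / real (Suc k) * y))) \<le> real (Suc k) * (1 / real (Suc k) * y)"
    by (intro mult_left_mono) auto
  then show ?thesis by simp
qed

lemma admissible_add:
  assumes "admissible \<phi>" "0 < m" "0 \<le> u"
  shows "admissible (\<lambda>x. \<phi> x + u * x ^ m)"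
proof -
  let ?F = "\<integral>\<^sup>+ x. ennreal (1 - exp (- (\<phi> x + u * x ^ m))) \<partial>\<mu>"
  obtain l where l: "0 < l" "\<And>x. 0 < x \<Longrightarrow> l * x \<le> \<phi> x" and [measurable]: "\<phi> \<in> borel_measurable borel"
    using assms by (auto simp: admissible_def)
  have "?F
     \<le> (\<integral>\<^sup>+ x. ennreal (1 - exp (- \<phi> x)) + ennreal u * (ennreal x ^ m * ennreal (exp (- \<phi> x))) \<partial>\<mu>)"
    using \<mu>_pos
  proof (intro nn_integral_mono_AE, eventually_elim)
    case (elim x)
    have "1 - exp (- (u * x ^ m)) \<le> u * x ^ m"
      using exp_ge_add_one_self[of "- (u * x ^ m)"] by linarith
    then have "exp (- \<phi> x) * (1 - exp (- (u * x ^ m))) \<le> exp (- \<phi> x) * (u * x ^ m)" by (intro mult_left_mono) auto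
    moreover have "exp (- (\<phi> x + u * x ^ m)) = exp (- \<phi> x) * exp (- (u * x ^ m))"
      by (simp add: exp_add[symmetric])
    ultimately have "1 - exp (- (\<phi> x + u * x ^ m)) \<le> (1 - exp (- \<phi> x)) + u * (x ^ m * exp (- \<phi> x))"
      by (simp add: algebra_simps)
    then have "ennreal (1 - exp (- (\<phi> x + u * x ^ m))) \<le> ennreal ((1 - exp (- \<phi> x)) + u * (x ^ m * exp (- \<phi> x)))"
      by (rule ennreal_leI)
    also have "\<dots> = ennreal (1 - exp (- \<phi> x)) + ennreal u * (ennreal x ^ m * ennreal (exp (- \<phi> x)))"
      using elim assms admissible_nonneg[OF assms(1) elim(2)]
      by (simp add: ennreal_plus ennreal_mult' ennreal_power)
    finally show ?case .
  qed
  also have "\<dots> = (\<integral>\<^sup>+ x. ennreal (1 - exp (- \<phi> x)) \<partial>\<mu>) + ennreal u * jump_moment m \<phi>"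
    unfolding jump_moment_def by (subst nn_integral_add) (auto simp: nn_integral_cmult measurable_\<mu>)
  also have "\<dots> < \<top>"
    using assms jump_moment_finite[OF assms(1,2)] by (auto simp: admissible_def ennreal_mult_less_top)
  finally have "?F < \<top>" .
  moreover have "\<forall>x>0. l * x \<le> \<phi> x + u * x ^ m"
    using l(2) assms(3) by (auto intro: add_increasing2)
  ultimately show ?thesis using l(1) unfolding admissible_def by auto
qed

text \<open>Differentiation at \<open>u = 0\<close> of the integrals over \<open>\<mu>\<close> of functions of \<open>\<phi> x + u * x ^ m\<close>.\<close>

lemma tendsto_tilted_integral:
  assumes "admissible \<phi>" "0 < m"
    and [measurable]: "h \<in> borel_measurable borel" and fin: "(\<integral>\<^sup>+ x. h x * (ennreal x ^ m * ennreal (exp (- \<phi> x))) \<partial>\<mu>) < \<top>"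
    and hfin: "\<And>x. h x < \<top>"
  shows "(\<lambda>k. ennreal (real (Suc k)) * (\<integral>\<^sup>+ x. h x * ennreal (exp (- \<phi> x) * (1 - exp (- (1 / real (Suc k) * x ^ m)))) \<partial>\<mu>))
     \<longlonglongrightarrow> (\<integral>\<^sup>+ x. h x * (ennreal x ^ m * ennreal (exp (- \<phi> x))) \<partial>\<mu>)"
proof -
  have [measurable]: "\<phi> \<in> borel_measurable borel" using assms by (auto simp: admissible_def)
  let ?e = "\<lambda>k x. real (Suc k) * (exp (- \<phi> x) * (1 - exp (- (1 / real (Suc k) * x ^ m))))"
  have eq: "ennreal (real (Suc k)) * (\<integral>\<^sup>+ x. h x * ennreal (exp (- \<phi> x) * (1 - exp (- (1 / real (Suc k) * x ^ m)))) \<partial>\<mu>)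
     = (\<integral>\<^sup>+ x. h x * ennreal (?e k x) \<partial>\<mu>)" for k
    by (subst nn_integral_cmult[symmetric])
       (auto simp: measurable_\<mu> ennreal_mult' mult_ac intro!: nn_integral_cong)
  show ?thesis
    unfolding eq
  proof (rule nn_integral_dominated_convergence[OF _ _ _ _ fin[folded infinity_ennreal_def]])
    show "AE x in \<mu>. h x * ennreal (?e k x) \<le> h x * (ennreal x ^ m * ennreal (exp (- \<phi> x)))" for k
      using \<mu>_pos
    proof eventually_elim
      case (elim x)
      have "?e k x = exp (- \<phi> x) * (real (Suc k) * (1 - exp (- (1 / real (Suc k) * x ^ m))))" by simp
      also have "\<dots> \<le> exp (- \<phi> x) * x ^ m" by (intro mult_left_mono scaled_one_minus_exp_le) auto
      finally have "ennreal (?e k x) \<le> ennreal (x ^ m * exp (- \<phi> x))" by (intro ennreal_leI) (simp add: mult.commute)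
      then show ?case using elim by (intro mult_left_mono) (auto simp: ennreal_mult' ennreal_power)
    qed
    show "AE x in \<mu>. (\<lambda>k. h x * ennreal (?e k x)) \<longlonglongrightarrow> h x * (ennreal x ^ m * ennreal (exp (- \<phi> x)))"
      using \<mu>_pos
    proof eventually_elim
      case (elim x)
      have "(\<lambda>k. exp (- \<phi> x) * (real (Suc k) * (1 - exp (- (1 / real (Suc k) * x ^ m))))) \<longlonglongrightarrow> exp (- \<phi> x) * x ^ m"
        by (intro tendsto_intros tendsto_scaled_one_minus_exp)
      then have "(\<lambda>k. ennreal (?e k x)) \<longlonglongrightarrow> ennreal (exp (- \<phi> x) * x ^ m)"
        by (intro tendsto_ennrealI) (simp add: mult_ac)
      moreover have "ennreal (exp (- \<phi> x) * x ^ m) = ennreal x ^ m * ennreal (exp (- \<phi> x))"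
        using elim by (simp add: ennreal_mult' ennreal_power mult.commute)
      ultimately show ?case using hfin[of x] by (intro ennreal_tendsto_cmult) auto
    qed
  qed (auto simp: measurable_\<mu>)
qed

lemma tendsto_jump_moment:
  assumes "admissible \<phi>" "0 < m" "0 < n"
  shows "(\<lambda>k. real (Suc k) * (enn2real (jump_moment n \<phi>) - enn2real (jump_moment n (\<lambda>x. \<phi> x + 1 / real (Suc k) * x ^ m))))
      \<longlonglongrightarrow> enn2real (jump_moment (n + m) \<phi>)"
proof -
  let ?F = "\<lambda>(k::nat) (x::real). 1 - exp (- (1 / real (Suc k) * x ^ m))"
  have [measurable]: "\<phi> \<in> borel_measurable borel" using assms by (auto simp: admissible_def)
  let ?\<phi> = "\<lambda>k x. \<phi> x + 1 / real (Suc k) * x ^ m"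
  let ?d = "\<lambda>k. \<integral>\<^sup>+ x. ennreal x ^ n * ennreal (exp (- \<phi> x) * (?F k x)) \<partial>\<mu>"
  have fin: "jump_moment (n + m) \<phi> < \<top>" using assms by (intro jump_moment_finite) auto
  have adm: "admissible (?\<phi> k)" for k by (rule admissible_add[OF assms(1,2)]) simp
  have "(\<lambda>k. ennreal (real (Suc k)) * ?d k) \<longlonglongrightarrow> jump_moment (n + m) \<phi>"
    using tendsto_tilted_integral[OF assms(1,2), of "\<lambda>x. ennreal x ^ n"] fin
    by (simp add: jump_moment_def power_add mult_ac less_top[symmetric] power_eq_top_ennreal)
  then have lim: "(\<lambda>k. enn2real (ennreal (real (Suc k)) * ?d k)) \<longlonglongrightarrow> enn2real (jump_moment (n + m) \<phi>)"
    using fin by (intro tendsto_enn2real) simp_all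
  have "real (Suc k) * (enn2real (jump_moment n \<phi>) - enn2real (jump_moment n (?\<phi> k))) = enn2real (ennreal (real (Suc k)) * ?d k)" for k
  proof -
    have "jump_moment n \<phi> = jump_moment n (?\<phi> k) + ?d k"
      unfolding jump_moment_def
    proof (subst nn_integral_add[symmetric])
      show "(\<integral>\<^sup>+ x. ennreal x ^ n * ennreal (exp (- \<phi> x)) \<partial>\<mu>) =
        (\<integral>\<^sup>+ x. ennreal x ^ n * ennreal (exp (- ?\<phi> k x)) +
          ennreal x ^ n * ennreal (exp (- \<phi> x) * (?F k x)) \<partial>\<mu>)"
        using \<mu>_pos
      proof (intro nn_integral_cong_AE, eventually_elim)
        case (elim x)
        have "exp (- \<phi> x) = exp (- ?\<phi> k x) + exp (- \<phi> x) * (?F k x)"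
          by (simp add: exp_add[symmetric] algebra_simps)
        moreover have "0 \<le> exp (- \<phi> x) * (?F k x)" using elim by simp
        ultimately have "ennreal (exp (- \<phi> x)) = ennreal (exp (- ?\<phi> k x)) + ennreal (exp (- \<phi> x) * (?F k x))"
          by (metis ennreal_plus exp_ge_zero)
        then show ?case by (simp add: distrib_left)
      qed
    qed (auto simp: measurable_\<mu>)
    moreover have "jump_moment n (?\<phi> k) < \<top>" by (rule jump_moment_finite[OF adm assms(3)])
    moreover have "jump_moment n \<phi> < \<top>" by (rule jump_moment_finite[OF assms(1,3)])
    ultimately show ?thesis by (auto simp: enn2real_mult enn2real_plus)
  qed
  with lim show ?thesis by simp
qed

lemma tendsto_Laplace_exponent:
  assumes "admissible \<phi>" "0 < m"
  shows "(\<lambda>k. real (Suc k) * (enn2real (Laplace_exponent (\<lambda>x. \<phi> x + 1 / real (Suc k) * x ^ m)) - enn2real (Laplace_exponent \<phi>)))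
      \<longlonglongrightarrow> enn2real (jump_moment m \<phi>)"
proof -
  have [measurable]: "\<phi> \<in> borel_measurable borel" using assms by (auto simp: admissible_def)
  let ?\<phi> = "\<lambda>k x. \<phi> x + 1 / real (Suc k) * x ^ m"
  let ?d = "\<lambda>k. \<integral>\<^sup>+ x. ennreal (exp (- \<phi> x) * (1 - exp (- (1 / real (Suc k) * x ^ m)))) \<partial>\<mu>"
  have fin: "jump_moment m \<phi> < \<top>" using assms by (intro jump_moment_finite) auto
  have adm: "admissible (?\<phi> k)" for k by (rule admissible_add[OF assms(1,2)]) simp
  have "(\<lambda>k. ennreal (real (Suc k)) * ?d k) \<longlonglongrightarrow> jump_moment m \<phi>"
    using tendsto_tilted_integral[OF assms(1,2), of "\<lambda>x. 1"] fin by (simp add: jump_moment_def)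
  then have lim: "(\<lambda>k. enn2real (ennreal (real (Suc k)) * ?d k)) \<longlonglongrightarrow> enn2real (jump_moment m \<phi>)"
    using fin by (intro tendsto_enn2real) simp_all
  have "real (Suc k) * (enn2real (Laplace_exponent (?\<phi> k)) - enn2real (Laplace_exponent \<phi>)) = enn2real (ennreal (real (Suc k)) * ?d k)" for k
  proof -
    have "Laplace_exponent (?\<phi> k) = Laplace_exponent \<phi> + ?d k"
      unfolding Laplace_exponent_def
    proof (subst nn_integral_add[symmetric])
      show "(\<integral>\<^sup>+ x. ennreal (1 - exp (- ?\<phi> k x)) \<partial>\<mu>) =
        (\<integral>\<^sup>+ x. ennreal (1 - exp (- \<phi> x)) +
          ennreal (exp (- \<phi> x) * (1 - exp (- (1 / real (Suc k) * x ^ m)))) \<partial>\<mu>)"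
        using \<mu>_pos
      proof (intro nn_integral_cong_AE, eventually_elim)
        case (elim x)
        have "1 - exp (- ?\<phi> k x) = (1 - exp (- \<phi> x)) + exp (- \<phi> x) * (1 - exp (- (1 / real (Suc k) * x ^ m)))"
          by (simp add: exp_add[symmetric] algebra_simps)
        moreover have "0 \<le> exp (- \<phi> x) * (1 - exp (- (1 / real (Suc k) * x ^ m)))" using elim by simp
        moreover have "0 \<le> 1 - exp (- \<phi> x)" using admissible_nonneg[OF assms(1) elim(2)] by simp
        ultimately show ?case by (metis ennreal_plus)
      qed
    qed (auto simp: measurable_\<mu>)
    moreover have "Laplace_exponent (?\<phi> k) < \<top>" "Laplace_exponent \<phi> < \<top>"
      using adm[of k] assms(1) by (auto simp: admissible_def Laplace_exponent_def)
    ultimately show ?thesis by (auto simp: enn2real_mult enn2real_plus)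
  qed
  with lim show ?thesis by simp
qed

lemma additive_measurable [measurable]:
  assumes [measurable]: "\<phi> \<in> borel_measurable borel"
  shows "additive \<phi> \<in> borel_measurable M"
  unfolding additive_def by measurable

abbreviation (input) jumps :: "'a \<Rightarrow> nat \<Rightarrow> real" where
  "jumps \<equiv> \<lambda>\<omega> i. J i \<omega>"

lemma jumps_measurable: "jumps \<in> borel_measurable M"
  by (rule measurable_coordinatewise_then_product) simp

lemma psum_finite_if_additive_finite:
  assumes "admissible \<phi>" "0 < m" "\<And>i. 0 < J i \<omega>" "additive \<phi> \<omega> < \<top>"
  shows "psum m (jumps \<omega>) < \<top>"
proof -
  obtain l where l: "0 < l" "\<And>x. 0 < x \<Longrightarrow> l * x \<le> \<phi> x" using assms by (auto simp: admissible_def)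
  have "ennreal l * psum 1 (jumps \<omega>) = (\<Sum>i. ennreal (l * J i \<omega>))"
    using l by (simp add: psum_def ennreal_mult')
  also have "\<dots> \<le> additive \<phi> \<omega>"
    unfolding additive_def using l assms(3) by (intro suminf_le ennreal_leI) auto
  finally have "ennreal l * psum 1 (jumps \<omega>) < \<top>" using assms(4) by (rule le_less_trans)
  then have "psum 1 (jumps \<omega>) < \<top>"
    using l(1) by (auto simp: ennreal_mult_less_top)
  then have "psum 1 (jumps \<omega>) ^ m < \<top>" by (simp add: less_top[symmetric] power_eq_top_ennreal)
  then show ?thesis using psum_le_power[OF assms(2)] by (rule le_less_trans[rotated])
qed

text \<open>
  By induction over \<open>A\<close>, where the new factor is produced by
  differentiating the formula for \<open>\<phi> x + u * x ^ m\<close> in \<open>u\<close>.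
\<close>

theorem factorial_moment:
  assumes "finite A" "\<And>a. a \<in> A \<Longrightarrow> 0 < n a" "admissible \<phi>"
  shows "(\<integral>\<^sup>+ \<omega>. eexp (additive \<phi> \<omega>) * edsum A n (jumps \<omega>) \<partial>M)
      = (\<Prod>a\<in>A. jump_moment (n a) \<phi>) * eexp (Laplace_exponent \<phi>)"
  using assms
proof (induction A arbitrary: n \<phi> rule: finite_induct)
  case empty
  then show ?case
    using Laplace_functional[of \<phi>] admissible_nonneg[of \<phi>]
    by (auto simp: additive_def Laplace_exponent_def admissible_def)
next
  case (insert a A)
  note adm = insert.prems(2)
  have [measurable]: "\<phi> \<in> borel_measurable borel" using adm by (auto simp: admissible_def)
  define m where "m = n a"
  have m: "0 < m" using insert.prems by (simp add: m_def)
  let ?\<phi> = "\<lambda>k x. \<phi> x + 1 / real (Suc k) * x ^ m"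
  have admk: "admissible (?\<phi> k)" for k by (rule admissible_add[OF adm m]) simp
  have npos: "0 < n b" if "b \<in> A" for b using insert.prems that by auto
  define \<Psi> where "\<Psi> = (\<lambda>\<omega>. psum m (jumps \<omega>))"
  define W where "W = (\<lambda>\<omega>. eexp (additive \<phi> \<omega>) * edsum A n (jumps \<omega>))"
  have [measurable]: "\<Psi> \<in> borel_measurable M" unfolding \<Psi>_def by (rule psum_measurable[OF jumps_measurable])
  have em[measurable]: "(\<lambda>\<omega>. edsum B k (jumps \<omega>)) \<in> borel_measurable M" if "finite B" for B and k :: "'b \<Rightarrow> nat"
    by (rule edsum_measurable[OF that jumps_measurable])
  have [measurable]: "W \<in> borel_measurable M" unfolding W_def using insert.hyps by measurable
  define I where "I = (\<lambda>n. enn2real (jump_moment n \<phi>))"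
  define Z where "Z = enn2real (Laplace_exponent \<phi>)"
  have I: "jump_moment k \<phi> = ennreal (I k)" if "0 < k" for k
    unfolding I_def using jump_moment_finite[OF adm that] by simp
  have Lfin: "Laplace_exponent \<psi> < \<top>" if "admissible \<psi>" for \<psi> using that by (simp add: admissible_def Laplace_exponent_def)
  have Zeq: "eexp (Laplace_exponent \<phi>) = ennreal (exp (- Z))"
    unfolding Z_def eexp_def using Lfin[OF adm] by simp
  have Inn: "0 \<le> I k" for k by (simp add: I_def)
  have real_moment: "(\<Prod>a\<in>A. jump_moment (n a) \<psi>) * eexp (Laplace_exponent \<psi>)
     = ennreal ((\<Prod>a\<in>A. enn2real (jump_moment (n a) \<psi>)) * exp (- enn2real (Laplace_exponent \<psi>)))" if "admissible \<psi>" for \<psi>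
  proof -
    have "(\<Prod>a\<in>A. jump_moment (n a) \<psi>) = ennreal (\<Prod>a\<in>A. enn2real (jump_moment (n a) \<psi>))"
      using jump_moment_finite[OF that npos] by (simp add: prod_ennreal[symmetric])
    then show ?thesis
      using Lfin[OF that] by (simp add: eexp_def ennreal_mult'[symmetric] prod_nonneg)
  qed
  define r where "r = (\<lambda>k. (\<Prod>a\<in>A. enn2real (jump_moment (n a) (?\<phi> k))) * exp (- enn2real (Laplace_exponent (?\<phi> k))))"
  define R where "R = (\<Prod>b\<in>A. I (n b)) * exp (- Z)"
  define D where "D = (\<Sum>b\<in>A. I (n b + m) * (\<Prod>c\<in>A - {b}. I (n c))) * exp (- Z) + (\<Prod>b\<in>A. I (n b)) * (exp (- Z) * I m)"
  have rlim: "(\<lambda>k. real (Suc k) * (R - r k)) \<longlonglongrightarrow> D"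
    unfolding R_def r_def D_def I_def Z_def
    by (intro tendsto_diff_quotient_mult tendsto_diff_quotient_prod tendsto_diff_quotient_exp
          tendsto_jump_moment tendsto_Laplace_exponent insert.hyps adm m npos)
  have EW: "(\<integral>\<^sup>+ \<omega>. W \<omega> \<partial>M) = ennreal R"
    using insert.IH[OF npos adm] real_moment[OF adm] by (simp add: W_def R_def I_def Z_def)
  have EWk: "(\<integral>\<^sup>+ \<omega>. eexp (additive (?\<phi> k) \<omega>) * edsum A n (jumps \<omega>) \<partial>M) = ennreal (r k)" for k
    using insert.IH[OF npos admk] real_moment[OF admk] by (simp add: r_def)
  \<comment> \<open>The difference quotient in \<open>u\<close> at step \<open>1 / (k + 1)\<close>,
    written as a product so that \<open>W\<close> may be infinite. Its expectation comes from the
    induction hypothesis at \<open>\<phi>\<close> and at \<open>?\<phi> k\<close>; its pointwise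
    limit is \<open>W * \<Psi>\<close>.\<close>
  define X where "X = (\<lambda>k \<omega>. W \<omega> * (ennreal (real (Suc k)) * (1 - eexp (ennreal (1 / real (Suc k)) * \<Psi> \<omega>))))"
  have [measurable]: "X k \<in> borel_measurable M" for k unfolding X_def by measurable
  have EX: "(\<integral>\<^sup>+ \<omega>. X k \<omega> \<partial>M) = ennreal (real (Suc k) * (R - r k))" for k
  proof -
    let ?V = "\<lambda>\<omega>. W \<omega> * eexp (ennreal (1 / real (Suc k)) * \<Psi> \<omega>)"
    have "AE \<omega> in M. ?V \<omega> = eexp (additive (?\<phi> k) \<omega>) * edsum A n (jumps \<omega>)"
      using J_pos
    proof eventually_elim
      case (elim \<omega>)
      have "additive (?\<phi> k) \<omega> = (\<Sum>i. ennreal (\<phi> (J i \<omega>)) + ennreal (1 / real (Suc k)) * ennreal (J i \<omega>) ^ m)"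
        unfolding additive_def
      proof (rule suminf_cong, goal_cases)
        case (1 i)
        have "0 < J i \<omega>" using elim by simp
        then show ?case
          using admissible_nonneg[OF adm, of "J i \<omega>"]
          by (simp add: ennreal_plus ennreal_power ennreal_mult'[symmetric] del: of_nat_Suc)
      qed
      also have "\<dots> = additive \<phi> \<omega> + ennreal (1 / real (Suc k)) * \<Psi> \<omega>"
        unfolding additive_def \<Psi>_def psum_def by (subst suminf_add[symmetric]) auto
      finally show ?case by (simp add: W_def eexp_add mult_ac)
    qed
    then have EV: "(\<integral>\<^sup>+ \<omega>. ?V \<omega> \<partial>M) = ennreal (r k)" by (subst EWk[symmetric]) (rule nn_integral_cong_AE)
    have Vle: "?V \<omega> \<le> W \<omega>" for \<omega>
      using mult_left_mono[OF eexp_le_1, of "W \<omega>"] by simp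
    have "(\<integral>\<^sup>+ \<omega>. W \<omega> - ?V \<omega> \<partial>M) = ennreal R - ennreal (r k)"
      using Vle EV EW by (subst nn_integral_diff) auto
    also have "\<dots> = ennreal (R - r k)" by (rule ennreal_minus) (auto simp: r_def prod_nonneg)
    finally have d: "(\<integral>\<^sup>+ \<omega>. W \<omega> - ?V \<omega> \<partial>M) = ennreal (R - r k)" .
    have "AE \<omega> in M. W \<omega> \<noteq> \<infinity>" by (rule nn_integral_PInf_AE) (auto simp: EW)
    then have "AE \<omega> in M. X k \<omega> = ennreal (real (Suc k)) * (W \<omega> - ?V \<omega>)"
    proof eventually_elim
      case (elim \<omega>)
      have "W \<omega> - ?V \<omega> = W \<omega> * (1 - eexp (ennreal (1 / real (Suc k)) * \<Psi> \<omega>))"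
        using elim by (subst ennreal_right_diff_distrib) (auto simp: infinity_ennreal_def)
      then show ?case by (simp add: X_def mult_ac)
    qed
    then have "(\<integral>\<^sup>+ \<omega>. X k \<omega> \<partial>M) = ennreal (real (Suc k)) * (\<integral>\<^sup>+ \<omega>. W \<omega> - ?V \<omega> \<partial>M)"
      by (subst nn_integral_cmult[symmetric]) (auto intro: nn_integral_cong_AE)
    then show ?thesis unfolding d by (simp add: ennreal_mult'[symmetric] del: of_nat_Suc)
  qed
  have EXlim: "(\<lambda>k. \<integral>\<^sup>+ \<omega>. X k \<omega> \<partial>M) \<longlonglongrightarrow> ennreal D" unfolding EX by (intro tendsto_ennrealI rlim)
  \<comment> \<open>Where the additive functional is infinite, \<open>W\<close> vanishes. Elsewhere
    all power sums of positive order are finite, hence so are \<open>W\<close> and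
    \<open>\<Psi>\<close>.\<close>
  have Xlim: "AE \<omega> in M. (\<forall>k. X k \<omega> \<le> W \<omega> * \<Psi> \<omega>) \<and> (\<lambda>k. X k \<omega>) \<longlonglongrightarrow> W \<omega> * \<Psi> \<omega>"
    using J_pos
  proof eventually_elim
    case (elim \<omega>)
    show ?case
    proof (cases "additive \<phi> \<omega> < \<top>")
      case True
      then have ps: "psum k (jumps \<omega>) < \<top>" if "0 < k" for k
        using psum_finite_if_additive_finite[OF adm that _ True] elim by auto
      have Wf: "W \<omega> < \<top>"
        unfolding W_def using ps npos edsum_finite[OF insert.hyps(1), of n "jumps \<omega>"] by (auto simp: ennreal_mult_less_top)
      obtain y where y: "\<Psi> \<omega> = ennreal y" "0 \<le> y"
        using ps[OF m] unfolding \<Psi>_def by (cases "psum m (jumps \<omega>)") auto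
      have e: "ennreal (real (Suc k)) * (1 - eexp (ennreal (1 / real (Suc k)) * \<Psi> \<omega>))
          = ennreal (real (Suc k) * (1 - exp (- (1 / real (Suc k) * y))))" for k
      proof -
        have "eexp (ennreal (1 / real (Suc k)) * \<Psi> \<omega>) = ennreal (exp (- (1 / real (Suc k) * y)))"
          unfolding y(1) using y(2) by (subst ennreal_mult'[symmetric]) (auto intro!: eexp_ennreal)
        then show ?thesis
          by (simp add: ennreal_mult' ennreal_minus[symmetric] del: of_nat_Suc)
      qed
      have "X k \<omega> \<le> W \<omega> * \<Psi> \<omega>" for k
        unfolding X_def e unfolding y(1) by (intro mult_left_mono ennreal_leI scaled_one_minus_exp_le) auto
      moreover have "(\<lambda>k. X k \<omega>) \<longlonglongrightarrow> W \<omega> * \<Psi> \<omega>"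
        unfolding X_def e unfolding y(1) using Wf
        by (intro ennreal_tendsto_cmult tendsto_ennrealI tendsto_scaled_one_minus_exp)
      ultimately show ?thesis by simp
    next
      case False
      then have "W \<omega> = 0" by (simp add: W_def less_top[symmetric])
      then show ?thesis by (simp add: X_def)
    qed
  qed
  \<comment> \<open>Fatou's lemma first shows that the limit is integrable; it then serves as its
    own dominating function.\<close>
  have WD: "(\<integral>\<^sup>+ \<omega>. W \<omega> * \<Psi> \<omega> \<partial>M) \<le> ennreal D"
  proof -
    have "(\<integral>\<^sup>+ \<omega>. W \<omega> * \<Psi> \<omega> \<partial>M) = (\<integral>\<^sup>+ \<omega>. liminf (\<lambda>k. X k \<omega>) \<partial>M)"
      using Xlim by (intro nn_integral_cong_AE, eventually_elim) (auto dest!: lim_imp_Liminf[rotated])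
    also have "\<dots> \<le> liminf (\<lambda>k. \<integral>\<^sup>+ \<omega>. X k \<omega> \<partial>M)" by (rule nn_integral_liminf) simp
    also have "\<dots> = ennreal D" by (rule lim_imp_Liminf[OF _ EXlim]) simp
    finally show ?thesis .
  qed
  have "(\<lambda>k. \<integral>\<^sup>+ \<omega>. X k \<omega> \<partial>M) \<longlonglongrightarrow> (\<integral>\<^sup>+ \<omega>. W \<omega> * \<Psi> \<omega> \<partial>M)"
  proof (rule nn_integral_dominated_convergence[where w = "\<lambda>\<omega>. W \<omega> * \<Psi> \<omega>"])
    show "(\<integral>\<^sup>+ \<omega>. W \<omega> * \<Psi> \<omega> \<partial>M) < \<infinity>" using WD by (auto intro: le_less_trans)
  qed (use Xlim in \<open>auto elim!: eventually_mono\<close>)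
  then have ED: "(\<integral>\<^sup>+ \<omega>. W \<omega> * \<Psi> \<omega> \<partial>M) = ennreal D" using EXlim LIMSEQ_unique by blast
  let ?n = "\<lambda>b. n(b := n b + n a)"
  \<comment> \<open>By \<open>edsum_product\<close> the limit contains the wanted expectation and,
    for each \<open>b\<close> in A, one covered by the induction hypothesis. The latter match the
    terms of the product rule in \<open>D\<close> and cancel, leaving the derivative of the Laplace
    exponent.\<close>
  have "(\<integral>\<^sup>+ \<omega>. W \<omega> * \<Psi> \<omega> \<partial>M) = (\<integral>\<^sup>+ \<omega>. eexp (additive \<phi> \<omega>) * edsum (insert a A) n (jumps \<omega>)
      + (\<Sum>b\<in>A. eexp (additive \<phi> \<omega>) * edsum A (?n b) (jumps \<omega>)) \<partial>M)"
  proof (rule nn_integral_cong, goal_cases)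
    case (1 \<omega>)
    have "W \<omega> * \<Psi> \<omega> = eexp (additive \<phi> \<omega>) * (psum (n a) (jumps \<omega>) * edsum A n (jumps \<omega>))"
      by (simp add: W_def \<Psi>_def m_def mult_ac)
    then show ?case
      unfolding edsum_product[OF insert.hyps] by (simp add: distrib_left sum_distrib_left)
  qed
  also have "\<dots> = (\<integral>\<^sup>+ \<omega>. eexp (additive \<phi> \<omega>) * edsum (insert a A) n (jumps \<omega>) \<partial>M)
      + (\<Sum>b\<in>A. \<integral>\<^sup>+ \<omega>. eexp (additive \<phi> \<omega>) * edsum A (?n b) (jumps \<omega>) \<partial>M)"
    using insert.hyps by (subst nn_integral_add) (auto simp: nn_integral_sum)
  also have "(\<Sum>b\<in>A. \<integral>\<^sup>+ \<omega>. eexp (additive \<phi> \<omega>) * edsum A (?n b) (jumps \<omega>) \<partial>M)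
      = (\<Sum>b\<in>A. ennreal (I (n b + m) * (\<Prod>c\<in>A - {b}. I (n c)) * exp (- Z)))"
  proof (rule sum.cong[OF refl], goal_cases)
    case b: (1 b)
    have "(\<integral>\<^sup>+ \<omega>. eexp (additive \<phi> \<omega>) * edsum A (?n b) (jumps \<omega>) \<partial>M) = (\<Prod>c\<in>A. jump_moment (?n b c) \<phi>) * eexp (Laplace_exponent \<phi>)"
      using npos by (intro insert.IH adm) auto
    also have "(\<Prod>c\<in>A. jump_moment (?n b c) \<phi>) = jump_moment (n b + m) \<phi> * (\<Prod>c\<in>A - {b}. jump_moment (n c) \<phi>)"
      using b insert.hyps by (simp add: prod.remove[of A b] m_def)
    also have "\<dots> = ennreal (I (n b + m) * (\<Prod>c\<in>A - {b}. I (n c)))"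
      using m npos Inn by (simp add: I prod_ennreal ennreal_mult' prod_nonneg)
    finally show ?case
      using Inn unfolding Zeq by (simp add: ennreal_mult'[symmetric] prod_nonneg del: fun_upd_apply)
  qed
  also have "\<dots> = ennreal ((\<Sum>b\<in>A. I (n b + m) * (\<Prod>c\<in>A - {b}. I (n c))) * exp (- Z))"
    using Inn by (simp add: sum_distrib_right prod_nonneg)
  finally have "(\<integral>\<^sup>+ \<omega>. eexp (additive \<phi> \<omega>) * edsum (insert a A) n (jumps \<omega>) \<partial>M)
       + ennreal ((\<Sum>b\<in>A. I (n b + m) * (\<Prod>c\<in>A - {b}. I (n c))) * exp (- Z)) = ennreal D"
    using ED by simp
  also have "ennreal D = ennreal ((\<Prod>b\<in>A. I (n b)) * (exp (- Z) * I m)) + ennreal ((\<Sum>b\<in>A. I (n b + m) * (\<Prod>c\<in>A - {b}. I (n c))) * exp (- Z))"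
    unfolding D_def using Inn by (subst add.commute, intro ennreal_plus) (auto intro!: mult_nonneg_nonneg sum_nonneg prod_nonneg)
  finally have "(\<integral>\<^sup>+ \<omega>. eexp (additive \<phi> \<omega>) * edsum (insert a A) n (jumps \<omega>) \<partial>M) = ennreal ((\<Prod>b\<in>A. I (n b)) * (exp (- Z) * I m))"
    by simp
  also have "\<dots> = (\<Prod>b\<in>insert a A. jump_moment (n b) \<phi>) * eexp (Laplace_exponent \<phi>)"
    using insert.hyps Inn npos m
    by (simp add: I Zeq prod_ennreal ennreal_mult'[symmetric] prod_nonneg m_def[symmetric] mult_ac)
  finally show ?case .
qed

end

subsection \<open>Conditional laws of stable jumps\<close>

lemma nn_integral_Gamma_scaled:
  assumes a: "0 < a" and l: "0 < l"
  shows "(\<integral>\<^sub>+ t. ennreal (t powr (a - 1) * exp (- l * t)))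
       = ennreal (Gamma a * l powr (- a))"
proof -
  let ?F = "\<integral>\<^sup>+ t. indicator {0<..} (0 + 1 / l * t) * ennreal ((0 + 1 / l * t) powr (a - 1) * exp (- l * (0 + 1 / l * t))) \<partial>lborel"
  have "(\<integral>\<^sub>+ t. ennreal (t powr (a - 1) * exp (- l * t)))
      = ennreal \<bar>1 / l\<bar> * ?F"
    using l by (intro nn_integral_real_affine) auto
  also have "?F
     = (\<integral>\<^sup>+ t. ennreal ((1 / l) powr (a - 1)) * ennreal (indicator {0..} t * t powr (a - 1) / exp t) \<partial>lborel)"
  proof (rule nn_integral_cong_AE)
    show "AE t in lborel. indicator {0<..} (0 + 1 / l * t) * ennreal ((0 + 1 / l * t) powr (a - 1) * exp (- l * (0 + 1 / l * t)))
      = ennreal ((1 / l) powr (a - 1)) * ennreal (indicator {0..} t * t powr (a - 1) / exp t)"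
      using AE_lborel_singleton[of 0]
    proof eventually_elim
      case (elim t)
      show ?case
      proof (cases "0 < t")
        case True
        then have "(1 / l * t) powr (a - 1) = (1 / l) powr (a - 1) * t powr (a - 1)"
          using l by (intro powr_mult)
        then show ?thesis
          using True l by (simp add: ennreal_mult'[symmetric] exp_minus field_simps)
      next
        case False
        then have "\<not> 0 < t / l" using l by (simp add: zero_less_divide_iff)
        then show ?thesis using False elim by simp
      qed
    qed
  qed
  also have "\<dots> = ennreal ((1 / l) powr (a - 1)) * ennreal (Gamma a)"
    by (subst nn_integral_cmult) (simp_all add: Gamma_conv_nn_integral_real[OF a])
  also have "ennreal \<bar>1 / l\<bar> * (ennreal ((1 / l) powr (a - 1)) * ennreal (Gamma a)) = ennreal (\<bar>1 / l\<bar> * ((1 / l) powr (a - 1) * Gamma a))"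
    using a by (simp add: ennreal_mult'[symmetric] less_imp_le[OF Gamma_real_pos])
  also have "\<bar>1 / l\<bar> * ((1 / l) powr (a - 1) * Gamma a) = Gamma a * l powr (- a)"
  proof -
    have "(1 / l) powr (a - 1) = l * l powr (- a)"
    proof -
      have "(1 / l) powr (a - 1) = l powr (1 + - a)"
        using l by (simp add: powr_divide powr_minus[symmetric] divide_inverse inverse_powr powr_minus_divide)
      then show ?thesis using l by (simp only: powr_add powr_one)
    qed
    then show ?thesis using l by simp
  qed
  finally show ?thesis .
qed

lemma nn_integral_lborel_powr_tail:
  assumes "0 < \<gamma>" "0 < v"
  shows "(\<integral>\<^sup>+ x. ennreal (\<gamma> * x powr (- \<gamma> - 1)) * indicator {v<..} x \<partial>lborel) = ennreal (v powr (- \<gamma>))"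
proof -
  have "(\<integral>\<^sup>+ x. ennreal (\<gamma> * x powr (- \<gamma> - 1)) * indicator {v<..} x \<partial>lborel)
     = (\<integral>\<^sup>+ x. ennreal (\<gamma> * x powr (- \<gamma> - 1)) * indicator {v..} x \<partial>lborel)"
    using AE_lborel_singleton[of v] by (intro nn_integral_cong_AE, eventually_elim) (auto split: split_indicator)
  also have "\<dots> = ennreal (0 - (- (v powr (- \<gamma>))))"
  proof (rule nn_integral_FTC_atLeast)
    show "((\<lambda>x. - (x powr - \<gamma>)) \<longlongrightarrow> 0) at_top"
      using assms by real_asymp
    show "DERIV (\<lambda>x. - (x powr - \<gamma>)) x :> \<gamma> * x powr (- \<gamma> - 1)" if "v \<le> x" for x
      using that assms by (auto intro!: derivative_eq_intros)
  qed (use assms in auto)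
  finally show ?thesis by simp
qed

lemma one_minus_exp_eq_nn_integral:
  assumes "0 \<le> l" "0 < x"
  shows "ennreal (1 - exp (- (l * x))) = (\<integral>\<^sup>+ v. ennreal (l * exp (- l * v)) * indicator {v. 0 < v \<and> v < x} v \<partial>lborel)"
proof -
  have "(\<integral>\<^sup>+ v. ennreal (l * exp (- l * v)) * indicator {v. 0 < v \<and> v < x} v \<partial>lborel)
     = (\<integral>\<^sup>+ v. ennreal (l * exp (- l * v)) * indicator {0..x} v \<partial>lborel)"
    using AE_lborel_singleton[of 0] AE_lborel_singleton[of x]
    by (intro nn_integral_cong_AE, eventually_elim) (auto split: split_indicator)
  also have "\<dots> = ennreal (- exp (- l * x) - (- exp (- l * 0)))"
    using assms by (intro nn_integral_FTC_Icc) (auto intro!: derivative_eq_intros)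
  finally show ?thesis by simp
qed

locale stable_index =
  fixes \<gamma> :: real
  assumes \<gamma>: "0 < \<gamma>" "\<gamma> < 1"
begin

lemma sets_stable_intensity [measurable_cong]: "sets (stable_intensity \<gamma>) = sets borel"
  by (simp add: stable_intensity_def)

lemma nn_integral_stable_intensity:
  assumes [measurable]: "h \<in> borel_measurable borel"
  shows "(\<integral>\<^sup>+ x. h x \<partial>stable_intensity \<gamma>)
     = ennreal (1 / Gamma (1 - \<gamma>)) * (\<integral>\<^sup>+ x. indicator {0<..} x * ennreal (\<gamma> * x powr (- \<gamma> - 1)) * h x \<partial>lborel)"
proof -
  have "0 < Gamma (1 - \<gamma>)" using \<gamma> by simp
  then have "ennreal (indicator {0<..} x * (\<gamma> / Gamma (1 - \<gamma>) * x powr (- \<gamma> - 1)))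
      = ennreal (1 / Gamma (1 - \<gamma>)) * (indicator {0<..} x * ennreal (\<gamma> * x powr (- \<gamma> - 1)))" for x
    using \<gamma> by (simp add: ennreal_mult'[symmetric] split: split_indicator)
  then show ?thesis
    unfolding stable_intensity_def
    by (subst nn_integral_density) (auto simp: nn_integral_cmult[symmetric] mult_ac)
qed

lemma AE_stable_intensity_pos: "AE x in stable_intensity \<gamma>. 0 < x"
  unfolding stable_intensity_def by (subst AE_density) (auto intro!: AE_I2 split: split_indicator)

lemma emeasure_stable_intensity_tail:
  assumes "0 < e"
  shows "emeasure (stable_intensity \<gamma>) {e<..} < \<top>"
proof -
  let ?F = "\<integral>\<^sup>+ x. indicator {0<..} x * ennreal (\<gamma> * x powr (- \<gamma> - 1)) * indicator {e<..} x \<partial>lborel"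
  have "emeasure (stable_intensity \<gamma>) {e<..} = (\<integral>\<^sup>+ x. indicator {e<..} x \<partial>stable_intensity \<gamma>)"
    by (simp add: sets_stable_intensity)
  also have "\<dots> = ennreal (1 / Gamma (1 - \<gamma>)) * ?F"
    by (rule nn_integral_stable_intensity) simp
  also have "?F = ennreal (e powr (- \<gamma>))"
    unfolding nn_integral_lborel_powr_tail[OF \<gamma>(1) assms, symmetric]
    using assms by (intro nn_integral_cong) (auto split: split_indicator)
  finally show ?thesis by (simp add: ennreal_mult_less_top)
qed

lemma stable_intensity_moment:
  assumes l: "0 < l" and m: "0 < m"
  shows "(\<integral>\<^sup>+ x. ennreal x ^ m * ennreal (exp (- l * x)) \<partial>stable_intensity \<gamma>)
    = ennreal (\<gamma> * pochhammer (1 - \<gamma>) (m - 1) * l powr (\<gamma> - real m))"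
proof -
  let ?G = "\<integral>\<^sup>+ x. indicator {0<..} x * ennreal (\<gamma> * x powr (- \<gamma> - 1)) * (ennreal x ^ m * ennreal (exp (- l * x))) \<partial>lborel"
  let ?F = "Gamma (real m - \<gamma>) * l powr (- (real m - \<gamma>))"
  have a: "0 < real m - \<gamma>" using m \<gamma> by (simp add: less_le_trans[of \<gamma> 1])
  have "(\<integral>\<^sup>+ x. ennreal x ^ m * ennreal (exp (- l * x)) \<partial>stable_intensity \<gamma>)
     = ennreal (1 / Gamma (1 - \<gamma>)) * ?G"
    by (rule nn_integral_stable_intensity) simp
  also have "?G
     = (\<integral>\<^sup>+ x. ennreal \<gamma> * (indicator {0<..} x * ennreal (x powr (real m - \<gamma> - 1) * exp (- l * x))) \<partial>lborel)"
  proof (rule nn_integral_cong, goal_cases)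
    case (1 x)
    show ?case
    proof (cases "0 < x")
      case True
      then have "x powr (real m - \<gamma> - 1) = x powr (- \<gamma> - 1) * x ^ m"
        by (simp add: powr_realpow[symmetric] powr_add[symmetric] algebra_simps)
      with True \<gamma> show ?thesis by (simp add: ennreal_mult'[symmetric] ennreal_power mult_ac)
    qed simp
  qed
  also have "\<dots> = ennreal \<gamma> * ennreal ?F"
    by (subst nn_integral_cmult) (simp, simp only: nn_integral_Gamma_scaled[OF a l])
  also have "ennreal (1 / Gamma (1 - \<gamma>)) * (ennreal \<gamma> * ennreal ?F)
     = ennreal (1 / Gamma (1 - \<gamma>) * (\<gamma> * ?F))"
    using \<gamma> a by (simp add: ennreal_mult'[symmetric] less_imp_le[OF Gamma_real_pos])
  also have "1 / Gamma (1 - \<gamma>) * (\<gamma> * ?F)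
     = \<gamma> * pochhammer (1 - \<gamma>) (m - 1) * l powr (\<gamma> - real m)"
  proof -
    have "1 - \<gamma> \<notin> \<int>\<^sub>\<le>\<^sub>0" using \<gamma> by (auto elim!: nonpos_Ints_cases)
    from pochhammer_Gamma[OF this, of "m - 1"] show ?thesis
      using m by (simp add: of_nat_diff algebra_simps)
  qed
  finally show ?thesis .
qed

text \<open>Writing the integrand as an integral over \<open>v < x\<close> and exchanging the order
  replaces the singular density by its tail, a multiple of \<open>v powr (- \<gamma>)\<close>. What
  remains is a Gamma integral.\<close>

lemma stable_intensity_Laplace:
  assumes l: "0 < l"
  shows "(\<integral>\<^sup>+ x. ennreal (1 - exp (- (l * x))) \<partial>stable_intensity \<gamma>) = ennreal (l powr \<gamma>)"
proof -
  have "(\<integral>\<^sup>+ x. ennreal (1 - exp (- (l * x))) \<partial>stable_intensity \<gamma>)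
     = ennreal (1 / Gamma (1 - \<gamma>)) * (\<integral>\<^sup>+ x. indicator {0<..} x * ennreal (\<gamma> * x powr (- \<gamma> - 1)) * ennreal (1 - exp (- (l * x))) \<partial>lborel)"
    by (rule nn_integral_stable_intensity) simp
  also have "(\<integral>\<^sup>+ x. indicator {0<..} x * ennreal (\<gamma> * x powr (- \<gamma> - 1)) * ennreal (1 - exp (- (l * x))) \<partial>lborel)
     = (\<integral>\<^sup>+ x. \<integral>\<^sup>+ v. indicator {0<..} x * ennreal (\<gamma> * x powr (- \<gamma> - 1)) *
          (ennreal (l * exp (- l * v)) * indicator {v. 0 < v \<and> v < x} v) \<partial>lborel \<partial>lborel)"
    using l by (intro nn_integral_cong) (auto simp: nn_integral_cmult one_minus_exp_eq_nn_integral split: split_indicator)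
  also have "\<dots> = (\<integral>\<^sup>+ v. \<integral>\<^sup>+ x. indicator {0<..} x * ennreal (\<gamma> * x powr (- \<gamma> - 1)) *
          (ennreal (l * exp (- l * v)) * indicator {v. 0 < v \<and> v < x} v) \<partial>lborel \<partial>lborel)"
    by (rule lborel_pair.Fubini') simp
  also have "\<dots> = (\<integral>\<^sup>+ v. ennreal l * (indicator {0<..} v * ennreal (v powr ((1 - \<gamma>) - 1) * exp (- l * v))) \<partial>lborel)"
  proof (rule nn_integral_cong, goal_cases)
    case (1 v)
    show ?case
    proof (cases "0 < v")
      case True
      have "(\<integral>\<^sup>+ x. indicator {0<..} x * ennreal (\<gamma> * x powr (- \<gamma> - 1)) *
          (ennreal (l * exp (- l * v)) * indicator {v. 0 < v \<and> v < x} v) \<partial>lborel)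
        = (\<integral>\<^sup>+ x. ennreal (l * exp (- l * v)) * (ennreal (\<gamma> * x powr (- \<gamma> - 1)) * indicator {v<..} x) \<partial>lborel)"
        using True by (intro nn_integral_cong) (auto simp: mult_ac split: split_indicator)
      also have "\<dots> = ennreal (l * exp (- l * v)) * ennreal (v powr (- \<gamma>))"
        by (subst nn_integral_cmult) (simp_all add: nn_integral_lborel_powr_tail[OF \<gamma>(1) True])
      finally show ?thesis using True l by (simp add: ennreal_mult'[symmetric] mult_ac)
    qed simp
  qed
  also have "\<dots> = ennreal l * ennreal (Gamma (1 - \<gamma>) * l powr (- (1 - \<gamma>)))"
    using nn_integral_Gamma_scaled[of "1 - \<gamma>" l] \<gamma> l by (subst nn_integral_cmult) (simp, simp only:)
  also have "ennreal (1 / Gamma (1 - \<gamma>)) * (ennreal l * ennreal (Gamma (1 - \<gamma>) * l powr (- (1 - \<gamma>))))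
     = ennreal (1 / Gamma (1 - \<gamma>) * (l * (Gamma (1 - \<gamma>) * l powr (- (1 - \<gamma>)))))"
    using \<gamma> l by (simp add: ennreal_mult'[symmetric] less_imp_le[OF Gamma_real_pos])
  also have "1 / Gamma (1 - \<gamma>) * (l * (Gamma (1 - \<gamma>) * l powr (- (1 - \<gamma>)))) = l powr \<gamma>"
  proof -
    have "0 < Gamma (1 - \<gamma>)" using \<gamma> by (intro Gamma_real_pos) simp
    then have "Gamma (1 - \<gamma>) \<noteq> 0" by (rule less_imp_neq[symmetric])
    moreover have "l * l powr (- (1 - \<gamma>)) = l powr (1 + - (1 - \<gamma>))" using l by (simp only: powr_add powr_one)
    ultimately show ?thesis by simp
  qed
  finally show ?thesis .
qed

end

locale stable_law = stable_index \<gamma> for \<gamma> :: real +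
  fixes N :: "'b measure" and J :: "nat \<Rightarrow> 'b \<Rightarrow> real" and f :: "real \<Rightarrow> real"
    and \<kappa> :: "real \<Rightarrow> (nat \<Rightarrow> real) measure"
  assumes jumps: "ranked_stable_jumps N \<gamma> J"
    and dens: "continuous_density N (total_jump J) f"
    and cond: "continuous_cond_law N (normalized_jumps J) (total_jump J) \<kappa>"
begin

sublocale poisson_jumps_moments N "stable_intensity \<gamma>" J
proof -
  have points: "poisson_points N (stable_intensity \<gamma>) J" using jumps by (simp add: ranked_stable_jumps_def)
  interpret prob_space N using points by (simp add: poisson_points_def)
  show "poisson_jumps_moments N (stable_intensity \<gamma>) J"
  proof
    have "AE \<omega> in N. \<forall>i. 0 < J (Suc i) \<omega> \<and> J (Suc i) \<omega> < J i \<omega>" using jumps by (simp add: ranked_stable_jumps_def)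
    then show "AE \<omega> in N. \<forall>i. 0 < J i \<omega>"
    proof eventually_elim
      case (elim \<omega>)
      have "0 < J 0 \<omega>" using elim less_trans by blast
      then show ?case using elim by (metis not0_implies_Suc)
    qed
    show "(\<integral>\<^sup>+ x. ennreal x ^ m * ennreal (exp (- l * x)) \<partial>stable_intensity \<gamma>) < \<top>" if "0 < l" "0 < m" for l m
      unfolding stable_intensity_moment[OF that] by simp
  qed (use points sets_stable_intensity AE_stable_intensity_pos emeasure_stable_intensity_tail in auto)
qed

abbreviation "T \<equiv> total_jump J"
abbreviation "X \<equiv> normalized_jumps J"

lemma T_measurable [measurable]: "T \<in> borel_measurable N"
  unfolding total_jump_def[abs_def] by measurable

lemma X_measurable: "X \<in> borel_measurable N"
  unfolding normalized_jumps_def[abs_def] by (rule measurable_coordinatewise_then_product) measurable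

lemma admissible_linear: "0 < l \<Longrightarrow> admissible (\<lambda>x. l * x)"
  using stable_intensity_Laplace[of l] by (auto simp: admissible_def)

lemma factorial_moment_linear:
  assumes "finite A" "\<And>a. a \<in> A \<Longrightarrow> 0 < n a" "0 < l"
  shows "(\<integral>\<^sup>+ \<omega>. eexp (additive (\<lambda>x. l * x) \<omega>) * edsum A n (\<lambda>i. J i \<omega>) \<partial>N)
    = ennreal ((\<Prod>a\<in>A. \<gamma> * pochhammer (1 - \<gamma>) (n a - 1) * l powr (\<gamma> - real (n a))) * exp (- (l powr \<gamma>)))"
proof -
  have nn: "0 \<le> \<gamma> * pochhammer (1 - \<gamma>) (n a - 1) * l powr (\<gamma> - real (n a))" for a
    using \<gamma> by (intro mult_nonneg_nonneg pochhammer_nonneg) auto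
  have "jump_moment (n a) (\<lambda>x. l * x) = ennreal (\<gamma> * pochhammer (1 - \<gamma>) (n a - 1) * l powr (\<gamma> - real (n a)))" if "a \<in> A" for a
    using stable_intensity_moment[OF assms(3) assms(2)[OF that]] by (simp add: jump_moment_def)
  then have "(\<Prod>a\<in>A. jump_moment (n a) (\<lambda>x. l * x)) = ennreal (\<Prod>a\<in>A. \<gamma> * pochhammer (1 - \<gamma>) (n a - 1) * l powr (\<gamma> - real (n a)))"
    using nn by (simp add: prod_ennreal)
  moreover have "Laplace_exponent (\<lambda>x. l * x) = ennreal (l powr \<gamma>)"
    unfolding Laplace_exponent_def by (rule stable_intensity_Laplace[OF assms(3)])
  moreover have "(\<integral>\<^sup>+ \<omega>. eexp (additive (\<lambda>x. l * x) \<omega>) * edsum A n (\<lambda>i. J i \<omega>) \<partial>N)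
      = (\<Prod>a\<in>A. jump_moment (n a) (\<lambda>x. l * x)) * eexp (Laplace_exponent (\<lambda>x. l * x))"
    by (rule factorial_moment[OF assms(1,2) admissible_linear[OF assms(3)]])
  ultimately show ?thesis
    using nn by (simp only: ennreal_mult'[symmetric] prod_nonneg eexp_ennreal powr_ge_zero)
qed

lemma additive_linear: "0 \<le> l \<Longrightarrow> additive (\<lambda>x. l * x) \<omega> = ennreal l * psum 1 (\<lambda>i. J i \<omega>)"
  by (simp add: additive_def psum_def ennreal_mult')

text \<open>As l tends to 0, the expectation of exp(-l T) tends to the probability that T is finite,
  while \<open>exp (- (l powr \<gamma>))\<close> tends to 1.\<close>

lemma AE_summable: "AE \<omega> in N. psum 1 (\<lambda>i. J i \<omega>) < \<top>"
proof -
  let ?G = "\<integral>\<^sup>+ \<omega>. indicator {\<omega> \<in> space N. psum 1 (\<lambda>i. J i \<omega>) < \<top>} \<omega> \<partial>N"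
  let ?F = "\<lambda>(k::nat) \<omega>. ennreal (1 / real (Suc k)) * psum 1 (\<lambda>i. J i \<omega>)"
  let ?H = "\<lambda>k. \<integral>\<^sup>+ \<omega>. eexp (?F k \<omega>) \<partial>N"
  have m[measurable]: "(\<lambda>\<omega>. psum 1 (\<lambda>i. J i \<omega>)) \<in> borel_measurable N" by (rule psum_measurable[OF jumps_measurable])
  note [measurable] = m[unfolded One_nat_def]
  have e: "(\<integral>\<^sup>+ \<omega>. eexp (?F k \<omega>) \<partial>N) = ennreal (exp (- ((1 / real (Suc k)) powr \<gamma>)))" for k
  proof -
    have "eexp (?F k \<omega>)
        = eexp (additive (\<lambda>x. 1 / real (Suc k) * x) \<omega>) * edsum ({} :: nat set) (\<lambda>_. 1) (\<lambda>i. J i \<omega>)" for \<omega>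
      by (subst additive_linear) (simp_all del: of_nat_Suc)
    then show ?thesis
      using factorial_moment_linear[of "{} :: nat set" "\<lambda>_. 1" "1 / real (Suc k)"] by (simp only: ) simp
  qed
  have "?H
     \<longlonglongrightarrow> ?G"
  proof (rule nn_integral_dominated_convergence[where w = "\<lambda>_. 1"])
    show "AE \<omega> in N. (\<lambda>k. eexp (?F k \<omega>))
        \<longlonglongrightarrow> indicator {\<omega> \<in> space N. psum 1 (\<lambda>i. J i \<omega>) < \<top>} \<omega>"
    proof (rule AE_I2)
      fix \<omega> assume \<omega>: "\<omega> \<in> space N"
      show "(\<lambda>k. eexp (?F k \<omega>))
        \<longlonglongrightarrow> indicator {\<omega> \<in> space N. psum 1 (\<lambda>i. J i \<omega>) < \<top>} \<omega>"
      proof (cases "psum 1 (\<lambda>i. J i \<omega>)")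
        case (real r)
        have "(\<lambda>k. ennreal (1 / real (Suc k) * r)) \<longlonglongrightarrow> ennreal (0 * r)"
          using LIMSEQ_inverse_real_of_nat
          by (intro tendsto_ennrealI tendsto_mult tendsto_const) (simp add: inverse_eq_divide)
        then have "(\<lambda>k. eexp (ennreal (1 / real (Suc k) * r))) \<longlonglongrightarrow> eexp (ennreal (0 * r))"
          by (rule tendsto_eexp)
        moreover have "psum (Suc 0) (\<lambda>i. J i \<omega>) < \<top>" using real by simp
        ultimately show ?thesis using \<omega> unfolding real by (simp add: ennreal_mult'[symmetric] del: of_nat_Suc)
      next
        case top
        then show ?thesis by (simp add: ennreal_mult_top del: of_nat_Suc)
      qed
    qed
  qed (auto simp: eexp_le_1 emeasure_space_1)
  moreover have "?H \<longlonglongrightarrow> ennreal (exp (- 0))"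
    unfolding e using \<gamma> by (intro tendsto_ennrealI) real_asymp
  ultimately have "?G = ennreal (exp (- 0))"
    by (rule LIMSEQ_unique)
  moreover have S: "{\<omega> \<in> space N. psum 1 (\<lambda>i. J i \<omega>) < \<top>} \<in> events"
    by measurable
  ultimately have "prob {\<omega> \<in> space N. psum 1 (\<lambda>i. J i \<omega>) < \<top>} = 1"
    by (simp add: measure_def)
  then have "AE \<omega> in N. \<omega> \<in> {\<omega> \<in> space N. psum 1 (\<lambda>i. J i \<omega>) < \<top>}"
    unfolding prob_eq_1[OF S] .
  then show ?thesis by eventually_elim simp
qed

lemma AE_T: "AE \<omega> in N. (\<forall>i. 0 < J i \<omega>) \<and> summable (\<lambda>i. J i \<omega>) \<and> 0 < T \<omega> \<and> ennreal (T \<omega>) = psum 1 (\<lambda>i. J i \<omega>)"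
  using AE_summable J_pos
proof eventually_elim
  case (elim \<omega>)
  have sm: "summable (\<lambda>i. J i \<omega>)"
  proof (rule summable_suminf_not_top)
    show "(\<Sum>i. ennreal (J i \<omega>)) \<noteq> \<top>" using elim(1) by (simp add: psum_def)
    show "0 \<le> J i \<omega>" for i using elim(2) by (simp add: less_imp_le)
  qed
  have "(\<Sum>i. ennreal (J i \<omega>)) = ennreal (\<Sum>i. J i \<omega>)"
  proof (rule suminf_ennreal2[OF _ sm])
    show "0 \<le> J i \<omega>" for i using elim(2) by (simp add: less_imp_le)
  qed
  then have "ennreal (T \<omega>) = psum 1 (\<lambda>i. J i \<omega>)" by (simp add: total_jump_def psum_def)
  moreover have "0 < T \<omega>" unfolding total_jump_def using elim by (intro suminf_pos sm) auto
  ultimately show ?case using elim sm by blast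
qed

text \<open>Distinct sums are homogeneous of degree equal to the sum of the exponents; this is the
  source of the power of the total mass.\<close>

lemma factorial_moment_normalized:
  assumes "finite A" "\<And>a. a \<in> A \<Longrightarrow> 0 < n a" "0 < l"
  shows "(\<integral>\<^sup>+ \<omega>. ennreal (exp (- l * T \<omega>)) * ennreal (T \<omega>) ^ (\<Sum>a\<in>A. n a) * edsum A n (X \<omega>) \<partial>N)
    = ennreal ((\<Prod>a\<in>A. \<gamma> * pochhammer (1 - \<gamma>) (n a - 1) * l powr (\<gamma> - real (n a))) * exp (- (l powr \<gamma>)))"
  (is "?L = ?R")
proof -
  have "AE \<omega> in N. ennreal (exp (- l * T \<omega>)) * ennreal (T \<omega>) ^ (\<Sum>a\<in>A. n a) * edsum A n (X \<omega>)
     = eexp (additive (\<lambda>x. l * x) \<omega>) * edsum A n (\<lambda>i. J i \<omega>)"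
    using AE_T
  proof eventually_elim
    case (elim \<omega>)
    have "additive (\<lambda>x. l * x) \<omega> = ennreal l * psum 1 (\<lambda>i. J i \<omega>)"
      using assms(3) by (intro additive_linear) simp
    also have "\<dots> = ennreal (l * T \<omega>)" using elim assms(3) by (simp add: ennreal_mult')
    finally have 1: "eexp (additive (\<lambda>x. l * x) \<omega>) = ennreal (exp (- l * T \<omega>))"
      using elim assms(3) by simp
    have "edsum A n (\<lambda>i. T \<omega> * X \<omega> i) = ennreal (T \<omega>) ^ (\<Sum>a\<in>A. n a) * edsum A n (X \<omega>)"
      using elim assms(1) by (intro edsum_scale) auto
    moreover have "(\<lambda>i. T \<omega> * X \<omega> i) = (\<lambda>i. J i \<omega>)" using elim by (simp add: normalized_jumps_def)
    ultimately show ?case using 1 by (simp add: mult.assoc)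
  qed
  then have "?L = (\<integral>\<^sup>+ \<omega>. eexp (additive (\<lambda>x. l * x) \<omega>) * edsum A n (\<lambda>i. J i \<omega>) \<partial>N)"
    by (rule nn_integral_cong_AE)
  also have "\<dots> = ?R" by (rule factorial_moment_linear[OF assms])
  finally show ?thesis .
qed

lemma \<kappa>_measurable: "\<kappa> \<in> restrict_space borel {0<..} \<rightarrow>\<^sub>M prob_algebra borel"
  using cond by (simp add: continuous_cond_law_def)

lemma \<kappa>_measurable': "\<kappa> \<in> restrict_space borel {0<..} \<rightarrow>\<^sub>M subprob_algebra borel"
  by (rule measurable_prob_algebraD[OF \<kappa>_measurable])

lemma \<kappa>_prob: "0 < t \<Longrightarrow> prob_space (\<kappa> t)" and \<kappa>_sets: "0 < t \<Longrightarrow> sets (\<kappa> t) = sets borel"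
  using measurable_space[OF \<kappa>_measurable, of t] by (auto simp: space_restrict_space space_prob_algebra)

lemma \<kappa>_P_infty: "0 < t \<Longrightarrow> AE p in \<kappa> t. p \<in> P_infty"
  using cond by (simp add: continuous_cond_law_def)

text \<open>The kernel is specified only for positive \<open>t\<close>, so functions of
  \<open>t\<close> are extended by 0.\<close>

lemma nn_integral_\<kappa>_measurable:
  assumes "g \<in> borel_measurable borel"
  shows "(\<lambda>t. indicator {0<..} t * (\<integral>\<^sup>+ p. g p \<partial>\<kappa> t)) \<in> borel_measurable borel"
proof -
  have "(\<lambda>t. \<integral>\<^sup>+ p. g p \<partial>\<kappa> t) \<in> borel_measurable (restrict_space borel {0<..})"
    by (rule measurable_compose[OF \<kappa>_measurable' nn_integral_measurable_subprob_algebra[OF assms]])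
  then show ?thesis
    by (subst (asm) borel_measurable_restrict_space_iff_ennreal) (auto simp: mult.commute)
qed

lemma distr_T: "distr N borel T = density lborel (\<lambda>x. ennreal (f x))"
  and f_measurable [measurable]: "(\<lambda>x. ennreal (f x)) \<in> borel_measurable borel"
proof -
  have "distr N lborel T = distr N borel T" by (rule distr_cong) auto
  then show "distr N borel T = density lborel (\<lambda>x. ennreal (f x))" "(\<lambda>x. ennreal (f x)) \<in> borel_measurable borel"
    using dens by (auto simp: continuous_density_def distributed_def)
qed

lemma f_nonneg: "0 \<le> f t" and f_cont: "continuous_on {0<..} f"
  using dens by (auto simp: continuous_density_def)

text \<open>The defining property concerns pairs of sets. It is extended first to functions of the
  sequence, with the event for T fixed, and then to functions of T by comparing weighted laws of
  T.\<close>

lemma disintegration: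
  assumes g[measurable]: "g \<in> borel_measurable borel" and h[measurable]: "h \<in> borel_measurable borel"
  shows "(\<integral>\<^sup>+ \<omega>. h (T \<omega>) * g (X \<omega>) \<partial>N)
    = (\<integral>\<^sub>+ t. ennreal (f t) * h t * (\<integral>\<^sup>+ p. g p \<partial>\<kappa> t))"
proof -
  let ?V = "\<lambda>t::real. \<integral>\<^sup>+ p. g p \<partial>\<kappa> t"
  let ?H = "\<integral>\<^sup>+ \<omega>. indicator {0<..} (T \<omega>) * g (X \<omega>) * h (T \<omega>) \<partial>N"
  let ?G = "\<lambda>B. density N (\<lambda>\<omega>. indicator B (T \<omega>))"
  let ?F = "density N (\<lambda>\<omega>. indicator {0<..} (T \<omega>) * g (X \<omega>))"
  note [measurable] = X_measurable nn_integral_\<kappa>_measurable[OF g]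
  let ?D = "distr N borel T"
  let ?k = "\<lambda>t. indicator {0<..} t * (?V t)"
  have set1: "(\<integral>\<^sup>+ \<omega>. indicator B (T \<omega>) * g (X \<omega>) \<partial>N) = (\<integral>\<^sup>+ t. indicator B t * (?V t) \<partial>?D)"
    if B[measurable]: "B \<in> sets borel" and sub: "B \<subseteq> {0<..}" for B
  proof -
    \<comment> \<open>The part of the law of T in \<open>B\<close>, on the space where the kernel is
      measurable; binding it to the kernel gives the law of X on that event.\<close>
    define DB where "DB = restrict_space (density ?D (indicator B)) {0<..}"
    have DB: "\<kappa> \<in> DB \<rightarrow>\<^sub>M subprob_algebra borel"
      using \<kappa>_measurable' by (simp add: DB_def measurable_def sets_restrict_space space_restrict_space cong: measurable_cong_sets)
    have sp: "space DB \<noteq> {}" by (auto simp: DB_def space_restrict_space)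
    have intDB: "(\<integral>\<^sup>+ t. u t \<partial>DB) = (\<integral>\<^sup>+ t. indicator B t * u t \<partial>?D)"
      if [measurable]: "(\<lambda>t. indicator {0<..} t * u t) \<in> borel_measurable borel" for u
    proof -
      have "(\<integral>\<^sup>+ t. u t \<partial>DB) = (\<integral>\<^sup>+ t. indicator {0<..} t * u t \<partial>density ?D (indicator B))"
        unfolding DB_def by (subst nn_integral_restrict_space) (auto simp: mult.commute)
      also have "\<dots> = (\<integral>\<^sup>+ t. indicator B t * (indicator {0<..} t * u t) \<partial>?D)"
        by (subst nn_integral_density) auto
      also have "\<dots> = (\<integral>\<^sup>+ t. indicator B t * u t \<partial>?D)"
        using sub by (intro nn_integral_cong) (auto split: split_indicator)
      finally show ?thesis .
    qed
    have "distr (?G B) borel X = DB \<bind> \<kappa>"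
    proof (rule measure_eqI)
      show "sets (distr (?G B) borel X) = sets (DB \<bind> \<kappa>)"
        using sets_bind[OF _ sp, of \<kappa> borel] \<kappa>_sets by (auto simp: DB_def space_restrict_space)
      fix A assume "A \<in> sets (distr (?G B) borel X)"
      then have A[measurable]: "A \<in> sets borel" by simp
      have "emeasure (distr (?G B) borel X) A
         = (\<integral>\<^sup>+ \<omega>. indicator B (T \<omega>) * indicator (X -` A \<inter> space N) \<omega> \<partial>N)"
        by (subst emeasure_distr) (auto simp: emeasure_density)
      also have "\<dots> = (\<integral>\<^sup>+ \<omega>. indicator {\<omega> \<in> space N. X \<omega> \<in> A \<and> T \<omega> \<in> B} \<omega> \<partial>N)"
        by (intro nn_integral_cong) (auto split: split_indicator)
      also have "\<dots> = emeasure N {\<omega> \<in> space N. X \<omega> \<in> A \<and> T \<omega> \<in> B}" by simp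
      also have "\<dots> = (\<integral>\<^sup>+ t. indicator B t * emeasure (\<kappa> t) A \<partial>?D)"
        using cond A B sub unfolding continuous_cond_law_def by blast
      also have "\<dots> = (\<integral>\<^sup>+ t. emeasure (\<kappa> t) A \<partial>DB)"
      proof (rule intDB[symmetric])
        have "(\<lambda>t. indicator {0<..} t * (\<integral>\<^sup>+ p. indicator A p \<partial>\<kappa> t)) \<in> borel_measurable borel"
          by (rule nn_integral_\<kappa>_measurable) simp
        also have "(\<lambda>t. indicator {0<..} t * (\<integral>\<^sup>+ p. indicator A p \<partial>\<kappa> t)) = (\<lambda>t. indicator {0<..} t * emeasure (\<kappa> t) A)"
          using \<kappa>_sets A by (auto simp: fun_eq_iff split: split_indicator)
        finally show "(\<lambda>t. indicator {0<..} t * emeasure (\<kappa> t) A) \<in> borel_measurable borel" .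
      qed
      also have "\<dots> = emeasure (DB \<bind> \<kappa>) A"
        by (rule emeasure_bind[OF sp DB A, symmetric])
      finally show "emeasure (distr (?G B) borel X) A = emeasure (DB \<bind> \<kappa>) A" .
    qed
    then have "(\<integral>\<^sup>+ p. g p \<partial>distr (?G B) borel X) = (\<integral>\<^sup>+ p. g p \<partial>(DB \<bind> \<kappa>))" by simp
    also have "\<dots> = (\<integral>\<^sup>+ t. \<integral>\<^sup>+ p. g p \<partial>\<kappa> t \<partial>DB)" by (rule nn_integral_bind[OF g DB])
    also have "\<dots> = (\<integral>\<^sup>+ t. indicator B t * (?V t) \<partial>?D)" by (rule intDB[OF nn_integral_\<kappa>_measurable[OF g]])
    finally show ?thesis by (simp add: nn_integral_distr nn_integral_density)
  qed
  have "distr ?F borel T = density ?D ?k"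
  proof (rule measure_eqI)
    fix B assume "B \<in> sets (distr ?F borel T)"
    then have B[measurable]: "B \<in> sets borel" by simp
    have "emeasure (distr ?F borel T) B
       = (\<integral>\<^sup>+ \<omega>. (indicator {0<..} (T \<omega>) * g (X \<omega>)) * indicator (T -` B \<inter> space N) \<omega> \<partial>N)"
      by (subst emeasure_distr) (auto simp: emeasure_density)
    also have "\<dots> = (\<integral>\<^sup>+ \<omega>. indicator (B \<inter> {0<..}) (T \<omega>) * g (X \<omega>) \<partial>N)"
      by (intro nn_integral_cong) (auto split: split_indicator)
    also have "\<dots> = (\<integral>\<^sup>+ t. indicator (B \<inter> {0<..}) t * (?V t) \<partial>?D)"
      by (rule set1) auto
    also have "\<dots> = emeasure (density ?D ?k) B"
      by (subst emeasure_density) (auto intro!: nn_integral_cong split: split_indicator)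
    finally show "emeasure (distr ?F borel T) B = emeasure (density ?D ?k) B" .
  qed simp
  then have "(\<integral>\<^sup>+ t. h t \<partial>distr ?F borel T) = (\<integral>\<^sup>+ t. h t \<partial>density ?D ?k)"
    by simp
  then have "?H = (\<integral>\<^sup>+ t. ?k t * h t \<partial>?D)"
    by (simp add: nn_integral_distr nn_integral_density)
  also have "(\<integral>\<^sup>+ t. ?k t * h t \<partial>?D) = (\<integral>\<^sup>+ t. ennreal (f t) * (?k t * h t) \<partial>lborel)"
    unfolding distr_T by (subst nn_integral_density) auto
  also have "?H = (\<integral>\<^sup>+ \<omega>. h (T \<omega>) * g (X \<omega>) \<partial>N)"
    using AE_T by (intro nn_integral_cong_AE, eventually_elim) (simp add: mult.commute)
  finally show ?thesis by (simp add: mult_ac)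
qed

lemma Laplace_edsum:
  assumes "finite A" "\<And>a. a \<in> A \<Longrightarrow> 0 < n a" "0 < l"
  shows "(\<integral>\<^sup>+ t. indicator {0<..} t * (ennreal (f t) * ennreal t ^ (\<Sum>a\<in>A. n a) * (\<integral>\<^sup>+ p. edsum A n p \<partial>\<kappa> t)) * ennreal (exp (- l * t)) \<partial>lborel)
    = ennreal ((\<Prod>a\<in>A. \<gamma> * pochhammer (1 - \<gamma>) (n a - 1) * l powr (\<gamma> - real (n a))) * exp (- (l powr \<gamma>)))"
proof -
  have "(\<lambda>p. edsum A n p) \<in> borel_measurable borel" using assms(1) by (intro edsum_measurable) auto
  then have "(\<integral>\<^sup>+ \<omega>. ennreal (exp (- l * T \<omega>)) * ennreal (T \<omega>) ^ (\<Sum>a\<in>A. n a) * edsum A n (X \<omega>) \<partial>N)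
     = (\<integral>\<^sub>+ t. ennreal (f t) * (ennreal (exp (- l * t)) * ennreal t ^ (\<Sum>a\<in>A. n a)) * (\<integral>\<^sup>+ p. edsum A n p \<partial>\<kappa> t))"
    by (rule disintegration) simp
  also have "\<dots> = (\<integral>\<^sup>+ t. indicator {0<..} t * (ennreal (f t) * ennreal t ^ (\<Sum>a\<in>A. n a) * (\<integral>\<^sup>+ p. edsum A n p \<partial>\<kappa> t)) * ennreal (exp (- l * t)) \<partial>lborel)"
    by (simp only: mult_ac)
  finally show ?thesis using factorial_moment_normalized[of A n l] assms by simp
qed

end

subsection \<open>Continuity in the conditioning variable\<close>

text \<open>The uniform tail bound that makes truncated power sums converge uniformly on
  \<open>P_infty\<close>.\<close>

lemma P_infty_le_inverse:
  assumes "p \<in> P_infty"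
  shows "p j \<le> 1 / real (Suc j)"
proof -
  note D = P_infty_D[OF assms]
  have "real (Suc j) * p j = (\<Sum>i<Suc j. p j)" by simp
  also have "\<dots> \<le> (\<Sum>i<Suc j. p i)"
    using D(1) by (intro sum_mono) (auto simp: decseq_def)
  also have "\<dots> \<le> suminf p"
    using assms D(2) by (intro sum_le_suminf) (auto simp: P_infty_def sums_iff)
  also have "\<dots> = 1" using assms by (auto simp: P_infty_def sums_iff)
  finally show ?thesis by (simp add: field_simps)
qed

text \<open>
  Functions on \<open>P_infty\<close> which are uniform limits of bounded continuous functions on the ambient
  sequence space; only for the latter is weak continuity assumed.
\<close>

definition P_continuous :: "((nat \<Rightarrow> real) \<Rightarrow> real) \<Rightarrow> bool" where
  "P_continuous F \<longleftrightarrow> (\<forall>e>0. \<exists>g. continuous_on UNIV g \<and> bounded (range g) \<and> (\<forall>p\<in>P_infty. \<bar>F p - g p\<bar> \<le> e))"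

lemma P_continuous_cong: "P_continuous F \<Longrightarrow> (\<And>p. p \<in> P_infty \<Longrightarrow> F p = G p) \<Longrightarrow> P_continuous G"
  unfolding P_continuous_def by simp

lemma P_continuous_const: "P_continuous (\<lambda>p. c)"
  unfolding P_continuous_def by (auto intro!: exI[of _ "\<lambda>_. c"])

lemma bounded_rangeD: "bounded (range g) \<Longrightarrow> \<exists>B>0. \<forall>x. \<bar>g x\<bar> \<le> B" for g :: "'x \<Rightarrow> real"
  unfolding bounded_pos by auto

lemma bounded_rangeI: "(\<And>x. \<bar>g x\<bar> \<le> B) \<Longrightarrow> bounded (range g)" for g :: "'x \<Rightarrow> real"
  by (auto simp: bounded_iff)

lemma P_continuous_diff:
  assumes "P_continuous F" "P_continuous G"
  shows "P_continuous (\<lambda>p. F p - G p)"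
  unfolding P_continuous_def
proof (intro allI impI)
  fix e :: real assume "0 < e"
  then have "0 < e / 2" by simp
  then obtain g h where g: "continuous_on UNIV g" "bounded (range g)" "\<And>p. p \<in> P_infty \<Longrightarrow> \<bar>F p - g p\<bar> \<le> e / 2"
    and h: "continuous_on UNIV h" "bounded (range h)" "\<And>p. p \<in> P_infty \<Longrightarrow> \<bar>G p - h p\<bar> \<le> e / 2"
    using assms unfolding P_continuous_def by meson
  obtain B C where B: "\<And>x. \<bar>g x\<bar> \<le> B" and C: "\<And>x. \<bar>h x\<bar> \<le> C" using g(2) h(2) bounded_rangeD by metis
  have "\<bar>g x - h x\<bar> \<le> B + C" for x using B[of x] C[of x] by linarith
  then have "bounded (range (\<lambda>x. g x - h x))" by (rule bounded_rangeI)
  moreover have "\<bar>(F p - G p) - (g p - h p)\<bar> \<le> e" if "p \<in> P_infty" for p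
    using g(3)[OF that] h(3)[OF that] by linarith
  ultimately show "\<exists>g. continuous_on UNIV g \<and> bounded (range g) \<and> (\<forall>p\<in>P_infty. \<bar>F p - G p - g p\<bar> \<le> e)"
    using g(1) h(1) by (intro exI[of _ "\<lambda>x. g x - h x"]) (auto intro!: continuous_intros)
qed

lemma P_continuous_sum:
  assumes "finite S" "\<And>s. s \<in> S \<Longrightarrow> P_continuous (F s)"
  shows "P_continuous (\<lambda>p. \<Sum>s\<in>S. F s p)"
  using assms
proof induction
  case (insert s S)
  have "P_continuous (\<lambda>p. F s p - (0 - (\<Sum>s\<in>S. F s p)))"
    using insert by (intro P_continuous_diff P_continuous_const) auto
  then show ?case by (rule P_continuous_cong) (use insert in simp)
qed (simp add: P_continuous_const)

lemma P_continuous_mult: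
  assumes "P_continuous F" "P_continuous G"
  shows "P_continuous (\<lambda>p. F p * G p)"
  unfolding P_continuous_def
proof (intro allI impI)
  fix e :: real assume e: "0 < e"
  obtain h where h: "continuous_on UNIV h" "bounded (range h)" "\<And>p. p \<in> P_infty \<Longrightarrow> \<bar>G p - h p\<bar> \<le> 1"
    using assms(2) unfolding P_continuous_def by (meson zero_less_one)
  obtain C where C: "0 < C" "\<And>x. \<bar>h x\<bar> \<le> C" using bounded_rangeD[OF h(2)] by auto
  have GC: "\<bar>G p\<bar> \<le> C + 1" if "p \<in> P_infty" for p using h(3)[OF that] C(2)[of p] by linarith
  have "0 < e / (2 * (C + 1))" using e C by simp
  then obtain g where g: "continuous_on UNIV g" "bounded (range g)" "\<And>p. p \<in> P_infty \<Longrightarrow> \<bar>F p - g p\<bar> \<le> e / (2 * (C + 1))"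
    using assms(1) unfolding P_continuous_def by meson
  obtain B where B: "0 < B" "\<And>x. \<bar>g x\<bar> \<le> B" using bounded_rangeD[OF g(2)] by auto
  have "0 < e / (2 * B)" using e B by simp
  then obtain k where k: "continuous_on UNIV k" "bounded (range k)" "\<And>p. p \<in> P_infty \<Longrightarrow> \<bar>G p - k p\<bar> \<le> e / (2 * B)"
    using assms(2) unfolding P_continuous_def by meson
  obtain D where D: "0 < D" "\<And>x. \<bar>k x\<bar> \<le> D" using bounded_rangeD[OF k(2)] by auto
  have "\<bar>g x * k x\<bar> \<le> B * D" for x unfolding abs_mult using B D by (intro mult_mono) auto
  then have "bounded (range (\<lambda>x. g x * k x))" by (rule bounded_rangeI)
  moreover have "\<bar>F p * G p - g p * k p\<bar> \<le> e" if p: "p \<in> P_infty" for p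
  proof -
    have "F p * G p - g p * k p = (F p - g p) * G p + g p * (G p - k p)" by (simp add: algebra_simps)
    then have "\<bar>F p * G p - g p * k p\<bar> \<le> \<bar>F p - g p\<bar> * \<bar>G p\<bar> + \<bar>g p\<bar> * \<bar>G p - k p\<bar>"
      by (metis abs_mult abs_triangle_ineq)
    also have "\<dots> \<le> e / (2 * (C + 1)) * (C + 1) + B * (e / (2 * B))"
      using e B C g(3)[OF p] k(3)[OF p] GC[OF p] by (intro add_mono mult_mono) auto
    also have "\<dots> = e" using B C by (simp add: field_simps)
    finally show ?thesis .
  qed
  ultimately show "\<exists>g. continuous_on UNIV g \<and> bounded (range g) \<and> (\<forall>p\<in>P_infty. \<bar>F p * G p - g p\<bar> \<le> e)"
    using g(1) k(1) by (intro exI[of _ "\<lambda>x. g x * k x"]) (auto intro!: continuous_intros)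
qed

text \<open>For order at least 2 the error of truncation at K is at most the K-th entry, hence at
  most \<open>1 / (K + 1)\<close>. For order 1 there is no such bound, but the sum is constantly 1
  on \<open>P_infty\<close>. Clipping the coordinates keeps the approximants bounded on the ambient
  space.\<close>

lemma P_continuous_psum:
  assumes "0 < m"
  shows "P_continuous (\<lambda>p. enn2real (psum m p))"
proof (cases "m = 1")
  case True
  show ?thesis
    by (rule P_continuous_cong[OF P_continuous_const[of 1]]) (use P_infty_D(4) True in simp)
next
  case False
  then obtain k where m: "m = Suc k" "0 < k" using assms by (cases m) auto
  show ?thesis
    unfolding P_continuous_def
  proof (intro allI impI)
    fix e :: real assume e: "0 < e"
    obtain K :: nat where K: "1 / real (Suc K) < e" using e nat_approx_posE by blast
    define c where "c = (\<lambda>(p :: nat \<Rightarrow> real) i. min 1 (max 0 (p i)))"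
    define g where "g = (\<lambda>p. \<Sum>i<K. c p i ^ m)"
    have "continuous_on UNIV (\<lambda>p :: nat \<Rightarrow> real. p i)" for i
      by (rule continuous_on_product_coordinates)
    then have "continuous_on UNIV g" unfolding g_def c_def by (intro continuous_intros)
    moreover have "bounded (range g)"
    proof (rule bounded_rangeI)
      fix p
      have "0 \<le> c p i ^ m" "c p i ^ m \<le> 1" for i by (auto simp: c_def intro!: power_le_one)
      then have "(\<Sum>i<K. c p i ^ m) \<le> (\<Sum>i<K. 1)" "0 \<le> (\<Sum>i<K. c p i ^ m)" by (intro sum_mono sum_nonneg; simp)+
      then show "\<bar>g p\<bar> \<le> real K" by (simp add: g_def)
    qed
    moreover have "\<bar>enn2real (psum m p) - g p\<bar> \<le> e" if p: "p \<in> P_infty" for p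
    proof -
      note D = P_infty_D[OF p]
      have "g p = (\<Sum>i<K. p i ^ m)" unfolding g_def c_def using D(2,3) by (intro sum.cong) (auto simp: min_absorb2 max_absorb2)
      moreover have "p K ^ k \<le> p K" using D(2,3)[of K] m power_decreasing[of 1 k "p K"] by auto
      moreover have "0 \<le> p K ^ m" using D(2) by simp
      ultimately show ?thesis
        using psum_tail_bounds[OF p, where j = K and m = k] P_infty_le_inverse[OF p, of K] K by (simp add: m del: power_Suc of_nat_Suc)
    qed
    ultimately show "\<exists>g. continuous_on UNIV g \<and> bounded (range g) \<and> (\<forall>p\<in>P_infty. \<bar>enn2real (psum m p) - g p\<bar> \<le> e)"
      by blast
  qed
qed

lemma edsum_le_1:
  assumes "p \<in> P_infty" "finite A" "\<And>a. a \<in> A \<Longrightarrow> 0 < n a"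
  shows "edsum A n p \<le> 1"
proof -
  have "edsum A n p \<le> (\<Prod>a\<in>A. psum (n a) p)" by (rule edsum_le_prod[OF assms(2)])
  also have "\<dots> \<le> 1" using assms P_infty_D(5) by (intro prod_le_one_ennreal) auto
  finally show ?thesis .
qed

text \<open>Solve \<open>edsum_product\<close> for the distinct sum with one more slot; the
  subtraction is legitimate because all terms are at most 1 on \<open>P_infty\<close>.\<close>

lemma P_continuous_edsum:
  assumes "finite A" "\<And>a. a \<in> A \<Longrightarrow> 0 < n a"
  shows "P_continuous (\<lambda>p. enn2real (edsum A n p))"
  using assms
proof (induction A arbitrary: n rule: finite_induct)
  case empty
  then show ?case by (simp add: P_continuous_const)
next
  case (insert a A)
  have "P_continuous (\<lambda>p. enn2real (psum (n a) p) * enn2real (edsum A n p) - (\<Sum>b\<in>A. enn2real (edsum A (n(b := n b + n a)) p)))"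
    using insert.prems insert.hyps
    by (intro P_continuous_diff P_continuous_mult P_continuous_sum P_continuous_psum insert.IH) auto
  then show ?case
  proof (rule P_continuous_cong)
    fix p assume p: "p \<in> P_infty"
    have fin: "edsum A (n(b := n b + n a)) p < \<top>" if "b \<in> A" for b
      by (rule le_less_trans[OF edsum_le_1[OF p insert.hyps(1)]]) (use insert.prems that in auto)
    have fin': "edsum (insert a A) n p < \<top>"
      by (rule le_less_trans[OF edsum_le_1[OF p]]) (use insert in auto)
    have "enn2real (psum (n a) p) * enn2real (edsum A n p) = enn2real (edsum (insert a A) n p + (\<Sum>b\<in>A. edsum A (n(b := n b + n a)) p))"
      unfolding edsum_product[OF insert.hyps, symmetric] by (simp add: enn2real_mult)
    also have "\<dots> = enn2real (edsum (insert a A) n p) + (\<Sum>b\<in>A. enn2real (edsum A (n(b := n b + n a)) p))"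
      using fin fin' insert.hyps by (subst enn2real_plus) (auto simp: enn2real_sum)
    finally show "enn2real (psum (n a) p) * enn2real (edsum A n p) - (\<Sum>b\<in>A. enn2real (edsum A (n(b := n b + n a)) p))
      = enn2real (edsum (insert a A) n p)" by simp
  qed
qed

definition emoment :: "(nat \<Rightarrow> real) measure \<Rightarrow> 'a set \<Rightarrow> ('a \<Rightarrow> nat) \<Rightarrow> real" where
  "emoment L A n = enn2real (\<integral>\<^sup>+ p. edsum A n p \<partial>L)"

lemma emoment:
  assumes "prob_space L" "AE p in L. p \<in> P_infty" "finite A" "\<And>a. a \<in> A \<Longrightarrow> 0 < n a"
  shows "(\<integral>\<^sup>+ p. edsum A n p \<partial>L) = ennreal (emoment L A n)" "0 \<le> emoment L A n" "emoment L A n \<le> 1"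
proof -
  let ?F = "\<integral>\<^sup>+ p. edsum A n p \<partial>L"
  interpret prob_space L by fact
  have "?F \<le> (\<integral>\<^sup>+ p. 1 \<partial>L)"
    using assms(2) by (intro nn_integral_mono_AE, eventually_elim) (auto intro: edsum_le_1 assms)
  then have le: "?F \<le> 1" by (simp add: emeasure_space_1)
  then show 1: "?F = ennreal (emoment L A n)"
    unfolding emoment_def by (intro ennreal_enn2real[symmetric]) (auto intro: le_less_trans)
  show "0 \<le> emoment L A n" by (simp add: emoment_def)
  show "emoment L A n \<le> 1" using le unfolding 1 by simp
qed

lemma continuous_AE_le:
  fixes g :: "real \<Rightarrow> real"
  assumes "continuous_on {a..b} g" "a < b" "AE x in lborel. x \<in> {a..b} \<longrightarrow> g x \<le> C" "x \<in> {a..b}"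
  shows "g x \<le> C"
proof (rule ccontr)
  assume "\<not> g x \<le> C"
  then have "0 < g x - C" by simp
  then obtain d where d: "0 < d" "\<And>y. y \<in> {a..b} \<Longrightarrow> dist y x < d \<Longrightarrow> dist (g y) (g x) < g x - C"
    using assms(1,4) unfolding continuous_on_iff by metis
  define l u where "l = max a (x - d)" and "u = min b (x + d)"
  have "l < u" using assms(2,4) d(1) by (auto simp: l_def u_def)
  have "AE y in lborel. y \<notin> {l<..<u}"
    using assms(3)
  proof eventually_elim
    case (elim y)
    show ?case
    proof
      assume "y \<in> {l<..<u}"
      then have "y \<in> {a..b}" "dist y x < d" by (auto simp: l_def u_def dist_real_def)
      then show False using d(2)[of y] elim by (auto simp: dist_real_def)
    qed
  qed
  then have "{l<..<u} \<in> null_sets lborel" by (subst AE_iff_null_sets) auto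
  with \<open>l < u\<close> show False by (simp add: null_sets_def)
qed

lemma continuous_AE_eq:
  fixes g h :: "real \<Rightarrow> real"
  assumes "continuous_on {0<..} g" "continuous_on {0<..} h" "AE x in lborel. 0 < x \<longrightarrow> g x = h x" "0 < x"
  shows "g x = h x"
proof -
  have c: "continuous_on {x / 2..x + 1} g" "continuous_on {x / 2..x + 1} h"
    using assms by (auto intro: continuous_on_subset)
  have "\<bar>g x - h x\<bar> \<le> 0"
    by (rule continuous_AE_le[of "x / 2" "x + 1"])
       (use c assms(3,4) in \<open>auto intro!: continuous_intros elim!: eventually_mono\<close>)
  then show ?thesis by simp
qed

lemma eqI_Laplace:
  fixes g h :: "real \<Rightarrow> real"
  assumes c: "continuous_on {0<..} g" "continuous_on {0<..} h" and nn: "\<And>t. 0 < t \<Longrightarrow> 0 \<le> g t \<and> 0 \<le> h t"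
    and L: "\<And>l. 0 < l \<Longrightarrow> laplace (\<lambda>t. ennreal (g t)) l = L l"
      "\<And>l. 0 < l \<Longrightarrow> laplace (\<lambda>t. ennreal (h t)) l = L l"
      "\<And>l. 0 < l \<Longrightarrow> L l < \<top>"
    and y: "0 < y"
  shows "g y = h y"
proof -
  let ?i = "\<lambda>g t. indicator {0<..} t * g t"
  have e: "laplace (\<lambda>t. ennreal (?i g t)) l
    = laplace (\<lambda>t. ennreal (g t)) l" for g l
    by (intro nn_integral_cong) (auto split: split_indicator)
  have "AE t in lborel. 0 < t \<longrightarrow> ennreal (?i g t) = ennreal (?i h t)"
    using borel_measurable_continuous_on_indicator[OF _ c(1)] borel_measurable_continuous_on_indicator[OF _ c(2)]
    by (intro AE_eqI_Laplace) (simp_all only: e L, simp_all)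
  then have "AE t in lborel. 0 < t \<longrightarrow> g t = h t" by eventually_elim (auto simp: nn)
  then show ?thesis by (rule continuous_AE_eq[OF c _ y])
qed

context stable_law
begin

text \<open>The kernel charges only \<open>P_infty\<close>, where \<open>F\<close> is a uniform
  limit. The integrals therefore converge uniformly in \<open>t\<close>, and a uniform limit of
  continuous functions is continuous.\<close>

lemma continuous_integral_\<kappa>:
  assumes "P_continuous F" and [measurable]: "F \<in> borel_measurable borel"
    and bd: "\<And>p. p \<in> P_infty \<Longrightarrow> \<bar>F p\<bar> \<le> B"
  shows "continuous_on {0<..} (\<lambda>t. \<integral>p. F p \<partial>\<kappa> t)"
proof -
  let ?F = "\<lambda>t::real. \<integral>p. F p \<partial>\<kappa> t"
  have "\<forall>k. \<exists>g. continuous_on UNIV g \<and> bounded (range g) \<and> (\<forall>p\<in>P_infty. \<bar>F p - g p\<bar> \<le> 1 / real (Suc k))"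
    using assms(1) unfolding P_continuous_def by (metis of_nat_0_less_iff zero_less_Suc zero_less_divide_1_iff)
  then obtain g where g: "\<And>k. continuous_on UNIV (g k)" "\<And>k. bounded (range (g k))"
      "\<And>k p. p \<in> P_infty \<Longrightarrow> \<bar>F p - g k p\<bar> \<le> 1 / real (Suc k)" by metis
  have gc: "continuous_on {0<..} (\<lambda>t. \<integral>p. g k p \<partial>\<kappa> t)" for k
    using cond g(1,2) unfolding continuous_cond_law_def by blast
  have close: "dist (\<integral>p. g k p \<partial>\<kappa> t) (?F t) \<le> 1 / real (Suc k)" if t: "0 < t" for k t
  proof -
    interpret K: prob_space "\<kappa> t" by (rule \<kappa>_prob[OF t])
    note [measurable_cong] = \<kappa>_sets[OF t]
    have [measurable]: "g k \<in> borel_measurable borel" by (rule borel_measurable_continuous_onI[OF g(1)])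
    obtain D where D: "\<And>x. \<bar>g k x\<bar> \<le> D" using bounded_rangeD[OF g(2)] by blast
    have "integrable (\<kappa> t) F"
      using \<kappa>_P_infty[OF t] bd by (intro K.integrable_const_bound[of _ B]) (auto elim!: eventually_mono)
    moreover have "integrable (\<kappa> t) (g k)"
      using D by (intro K.integrable_const_bound[of _ D]) auto
    ultimately have i: "integrable (\<kappa> t) F" "integrable (\<kappa> t) (g k)" .
    have "dist (\<integral>p. g k p \<partial>\<kappa> t) (?F t) = \<bar>\<integral>p. F p - g k p \<partial>\<kappa> t\<bar>"
      using i by (simp add: dist_real_def abs_minus_commute)
    also have "\<dots> \<le> (\<integral>p. \<bar>F p - g k p\<bar> \<partial>\<kappa> t)" by (rule integral_abs_bound)
    also have "\<dots> \<le> (\<integral>p. 1 / real (Suc k) \<partial>\<kappa> t)"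
      using i \<kappa>_P_infty[OF t] g(3) by (intro integral_mono_AE) (auto elim!: eventually_mono)
    finally show ?thesis by (simp add: K.prob_space)
  qed
  show ?thesis
  proof (rule uniform_limit_theorem[where F = sequentially])
    show "uniform_limit {0<..} (\<lambda>k t. \<integral>p. g k p \<partial>\<kappa> t) (\<lambda>t. \<integral>p. F p \<partial>\<kappa> t) sequentially"
    proof (rule uniform_limitI)
      fix e :: real assume "0 < e"
      then obtain K :: nat where K: "1 / real (Suc K) < e" using nat_approx_posE by blast
      show "\<forall>\<^sub>F k in sequentially. \<forall>t\<in>{0<..}. dist (\<integral>p. g k p \<partial>\<kappa> t) (?F t) < e"
        using eventually_ge_at_top[of K]
      proof eventually_elim
        case (elim k)
        then have "1 / real (Suc k) \<le> 1 / real (Suc K)" by (simp add: field_simps)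
        show ?case
        proof
          fix t :: real assume "t \<in> {0<..}"
          then have "dist (\<integral>p. g k p \<partial>\<kappa> t) (?F t) \<le> 1 / real (Suc k)" by (intro close) simp
          with \<open>1 / real (Suc k) \<le> 1 / real (Suc K)\<close> K show "dist (\<integral>p. g k p \<partial>\<kappa> t) (?F t) < e" by linarith
        qed
      qed
    qed
  qed (use gc in auto)
qed

lemma emoment_\<kappa>:
  assumes "finite A" "\<And>a. a \<in> A \<Longrightarrow> 0 < n a" "0 < t"
  shows "(\<integral>\<^sup>+ p. edsum A n p \<partial>\<kappa> t) = ennreal (emoment (\<kappa> t) A n)" "0 \<le> emoment (\<kappa> t) A n" "emoment (\<kappa> t) A n \<le> 1"
  using emoment[OF \<kappa>_prob[OF assms(3)] \<kappa>_P_infty[OF assms(3)] assms(1,2)] by auto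

lemma continuous_emoment:
  assumes "finite A" "\<And>a. a \<in> A \<Longrightarrow> 0 < n a"
  shows "continuous_on {0<..} (\<lambda>t. emoment (\<kappa> t) A n)"
proof -
  have [measurable]: "(\<lambda>p. edsum A n p) \<in> borel_measurable borel" using assms(1) by (intro edsum_measurable) auto
  have "continuous_on {0<..} (\<lambda>t. \<integral>p. enn2real (edsum A n p) \<partial>\<kappa> t)"
  proof (rule continuous_integral_\<kappa>[OF P_continuous_edsum[OF assms]])
    show "\<bar>enn2real (edsum A n p)\<bar> \<le> 1" if "p \<in> P_infty" for p
      using edsum_le_1[OF that assms] by (simp add: enn2real_leI)
  qed auto
  moreover have "(\<integral>p. enn2real (edsum A n p) \<partial>\<kappa> t) = emoment (\<kappa> t) A n" if t: "t \<in> {0<..}" for t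
  proof -
    have t: "0 < t" using t by simp
    note [measurable_cong] = \<kappa>_sets[OF t]
    have "(\<integral>p. enn2real (edsum A n p) \<partial>\<kappa> t) = enn2real (\<integral>\<^sup>+ p. ennreal (enn2real (edsum A n p)) \<partial>\<kappa> t)"
      by (rule integral_eq_nn_integral) auto
    also have "(\<integral>\<^sup>+ p. ennreal (enn2real (edsum A n p)) \<partial>\<kappa> t) = (\<integral>\<^sup>+ p. edsum A n p \<partial>\<kappa> t)"
      using \<kappa>_P_infty[OF t]
    proof (intro nn_integral_cong_AE, eventually_elim)
      case (elim p)
      then have "edsum A n p \<le> 1" using assms by (intro edsum_le_1) auto
      then show ?case by (intro ennreal_enn2real) (rule le_less_trans, auto)
    qed
    finally show ?thesis by (simp add: emoment_def)
  qed
  ultimately show ?thesis by (rule continuous_on_eq)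
qed

text \<open>The moment formula for a sample without slots. With a single slot of exponent 1 it
  yields the transform of \<open>t * f t\<close>, because \<open>psum 1\<close> equals 1 on
  \<open>P_infty\<close>.\<close>

lemma Laplace_f:
  assumes "0 < l"
  shows "laplace (\<lambda>t. ennreal (f t)) l = ennreal (exp (- (l powr \<gamma>)))"
proof -
  have "indicator {0<..} t * (ennreal (f t) * (\<integral>\<^sup>+ p. 1 \<partial>\<kappa> t)) = indicator {0<..} t * ennreal (f t)" for t
    using prob_space.emeasure_space_1[OF \<kappa>_prob[of t]] by (auto split: split_indicator)
  then show ?thesis using Laplace_edsum[of "{} :: nat set" "\<lambda>_. 1" l] assms by simp
qed

lemma Laplace_t_f:
  assumes "0 < l"
  shows "laplace (\<lambda>t. (ennreal (f t) * ennreal t)) l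
     = ennreal (\<gamma> * l powr (\<gamma> - 1) * exp (- (l powr \<gamma>)))"
proof -
  have "(\<integral>\<^sup>+ p. psum 1 p \<partial>\<kappa> t) = 1" if "0 < t" for t
  proof -
    have "(\<integral>\<^sup>+ p. psum 1 p \<partial>\<kappa> t) = (\<integral>\<^sup>+ p. 1 \<partial>\<kappa> t)"
      using \<kappa>_P_infty[OF that] by (intro nn_integral_cong_AE, eventually_elim) (simp add: P_infty_D(4)[unfolded One_nat_def])
    then show ?thesis using prob_space.emeasure_space_1[OF \<kappa>_prob[OF that]] by simp
  qed
  then have "indicator {0<..} t * (ennreal (f t) * ennreal t * (\<integral>\<^sup>+ p. psum 1 p \<partial>\<kappa> t)) = indicator {0<..} t * (ennreal (f t) * ennreal t)" for t
    by (auto split: split_indicator)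
  then show ?thesis using Laplace_edsum[of "{()}" "\<lambda>_. 1" l] assms by simp
qed

lemma nn_integral_f_le_1: "(\<integral>\<^sub>+ t. ennreal (f t)) \<le> 1"
proof -
  have "(\<integral>\<^sub>+ t. ennreal (f t)) = (\<integral>\<^sup>+ t. indicator {0<..} t \<partial>density lborel (\<lambda>x. ennreal (f x)))"
    by (subst nn_integral_density) (auto simp: mult.commute)
  also have "\<dots> = emeasure (distr N borel T) {0<..}" by (simp add: distr_T[symmetric])
  also have "\<dots> \<le> 1" by (subst emeasure_distr) (auto simp: emeasure_le_1)
  finally show ?thesis .
qed

text \<open>The size-biasing identity: \<open>t f(t)\<close> is the convolution of \<open>x \<nu>(dx)\<close> with \<open>f\<close>, \<open>\<nu>\<close> being the L\'evy measure.\<close>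

lemma AE_f_eq_convolution:
  "AE t in lborel. 0 < t \<longrightarrow> ennreal (f t) * ennreal t
     = ennreal (\<gamma> / Gamma (1 - \<gamma>)) * (\<integral>\<^sup>+ v. indicator {0<..<t} v * ennreal ((t - v) powr (- \<gamma>)) * ennreal (f v) \<partial>lborel)"
proof (rule AE_eqI_Laplace)
  let ?V = "\<gamma> / Gamma (1 - \<gamma>)"
  have G: "0 < Gamma (1 - \<gamma>)" using \<gamma> by (intro Gamma_real_pos) simp
  show "(\<lambda>t. ennreal ?V * (\<integral>\<^sup>+ v. indicator {0<..<t} v * ennreal ((t - v) powr (- \<gamma>)) * ennreal (f v) \<partial>lborel)) \<in> borel_measurable borel"
  proof -
    have "(\<lambda>t. \<integral>\<^sup>+ v. indicator {z. 0 < snd z \<and> snd z < fst z} (t, v) * ennreal ((t - v) powr (- \<gamma>)) * ennreal (f v) \<partial>lborel) \<in> borel_measurable lborel"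
      by measurable
    then have "(\<lambda>t. \<integral>\<^sup>+ v. indicator {0<..<t} v * ennreal ((t - v) powr (- \<gamma>)) * ennreal (f v) \<partial>lborel) \<in> borel_measurable borel"
      by (simp add: indicator_def)
    then show ?thesis by simp
  qed
  fix l :: real assume l: "0 < l"
  let ?W = "laplace (\<lambda>t. (ennreal (f t) * ennreal t)) l"
  let ?H = "Gamma (1 - \<gamma>) * l powr (- (1 - \<gamma>))"
  let ?G = "\<integral>\<^sup>+ t. \<integral>\<^sup>+ v. indicator {0<..<t} v * ennreal ((t - v) powr (- \<gamma>)) * ennreal (f v) * ennreal (exp (- l * t)) \<partial>lborel \<partial>lborel"
  let ?F = "\<integral>\<^sup>+ t. indicator {0<..} t * (ennreal ?V * (\<integral>\<^sup>+ v. indicator {0<..<t} v * ennreal ((t - v) powr (- \<gamma>)) * ennreal (f v) \<partial>lborel)) * ennreal (exp (- l * t)) \<partial>lborel"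
  have "?F
     = (\<integral>\<^sup>+ t. ennreal ?V * (\<integral>\<^sup>+ v. indicator {0<..<t} v * ennreal ((t - v) powr (- \<gamma>)) * ennreal (f v) * ennreal (exp (- l * t)) \<partial>lborel) \<partial>lborel)"
    proof (rule nn_integral_cong, goal_cases)
      case (1 t)
      show ?case
        by (cases "0 < t") (simp_all add: nn_integral_multc[symmetric] mult.assoc)
    qed
  also have "\<dots> = ennreal ?V * ?G"
  proof (rule nn_integral_cmult)
    have "(\<lambda>t. \<integral>\<^sup>+ v. indicator {z. 0 < snd z \<and> snd z < fst z} (t, v) * ennreal ((t - v) powr (- \<gamma>)) * ennreal (f v) * ennreal (exp (- l * t)) \<partial>lborel) \<in> borel_measurable lborel"
      by measurable
    then show "(\<lambda>t. \<integral>\<^sup>+ v. indicator {0<..<t} v * ennreal ((t - v) powr (- \<gamma>)) * ennreal (f v) * ennreal (exp (- l * t)) \<partial>lborel) \<in> borel_measurable lborel"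
      by (simp add: indicator_def)
  qed
  also have "?G
    = (\<integral>\<^sup>+ v. \<integral>\<^sup>+ t. indicator {0<..<t} v * ennreal ((t - v) powr (- \<gamma>)) * ennreal (f v) * ennreal (exp (- l * t)) \<partial>lborel \<partial>lborel)"
  proof -
    have "(\<lambda>(v, t). indicator {z. 0 < fst z \<and> fst z < snd z} (v, t) * ennreal ((t - v) powr (- \<gamma>)) * ennreal (f v) * ennreal (exp (- l * t)))
        \<in> borel_measurable (lborel \<Otimes>\<^sub>M lborel)"
      by measurable
    from lborel_pair.Fubini'[OF this] show ?thesis by (simp add: indicator_def)
  qed
  also have "\<dots> = (\<integral>\<^sup>+ v. (indicator {0<..} v * ennreal (f v) * ennreal (exp (- l * v))) * ennreal ?H \<partial>lborel)"
  proof (rule nn_integral_cong, goal_cases)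
    case (1 v)
    have "(\<integral>\<^sup>+ t. indicator {0<..<t} v * ennreal ((t - v) powr (- \<gamma>)) * ennreal (f v) * ennreal (exp (- l * t)) \<partial>lborel)
       = ennreal \<bar>1\<bar> * (\<integral>\<^sup>+ t. indicator {0<..<v + 1 * t} v * ennreal ((v + 1 * t - v) powr (- \<gamma>)) * ennreal (f v) * ennreal (exp (- l * (v + 1 * t))) \<partial>lborel)"
    proof (rule nn_integral_real_affine)
      have "(\<lambda>t. indicator {t. 0 < v \<and> v < t} t * ennreal ((t - v) powr (- \<gamma>)) * ennreal (f v) * ennreal (exp (- l * t))) \<in> borel_measurable borel"
        by measurable
      then show "(\<lambda>t. indicator {0<..<t} v * ennreal ((t - v) powr (- \<gamma>)) * ennreal (f v) * ennreal (exp (- l * t))) \<in> borel_measurable borel"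
        by (simp add: indicator_def)
    qed simp
    also have "\<dots> = (\<integral>\<^sup>+ t. (indicator {0<..} v * ennreal (f v) * ennreal (exp (- l * v))) * (indicator {0<..} t * ennreal (t powr ((1 - \<gamma>) - 1) * exp (- l * t))) \<partial>lborel)"
      by (simp, intro nn_integral_cong) (auto simp: ennreal_mult'[symmetric] f_nonneg exp_add[symmetric] algebra_simps split: split_indicator)
    also have "\<dots> = (indicator {0<..} v * ennreal (f v) * ennreal (exp (- l * v))) * ennreal ?H"
      using nn_integral_Gamma_scaled[of "1 - \<gamma>" l] \<gamma> l by (subst nn_integral_cmult) (simp, simp only:)
    finally show ?case .
  qed
  also have "\<dots> = ennreal (exp (- (l powr \<gamma>))) * ennreal ?H"
    unfolding Laplace_f[OF l, symmetric] by (rule nn_integral_multc) measurable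
  also have "ennreal ?V * (ennreal (exp (- (l powr \<gamma>))) * ennreal ?H)
     = ennreal (\<gamma> * l powr (\<gamma> - 1) * exp (- (l powr \<gamma>)))"
    using G \<gamma> by (simp add: ennreal_mult'[symmetric] less_imp_neq[OF G, symmetric] mult_ac)
  finally show "?W
     = ?F"
    unfolding Laplace_t_f[OF l] ..
  show "?W < \<top>"
    unfolding Laplace_t_f[OF l] by simp
qed measurable

text \<open>Split the convolution at \<open>v = t - 1\<close>. Below it the kernel is at most 1 and
  the density has mass at most 1; above it the density is at most \<open>M\<close> and the kernel
  integrates to \<open>1 / (1 - \<gamma>)\<close>. Continuity extends the almost-everywhere bound to
  every \<open>t\<close>.\<close>

lemma t_f_le:
  assumes M: "\<And>v. 1 \<le> v \<Longrightarrow> v \<le> U \<Longrightarrow> f v \<le> M" and U: "2 < U" and t: "2 \<le> t" "t \<le> U"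
  shows "t * f t \<le> \<gamma> / Gamma (1 - \<gamma>) * (1 + M / (1 - \<gamma>))"
proof -
  let ?G = "\<lambda>t::real. \<integral>\<^sup>+ v. indicator {t - 1..t} v * ennreal ((t - v) powr (- \<gamma>)) \<partial>lborel"
  let ?F = "\<lambda>t::real. \<integral>\<^sup>+ v. indicator {0<..<t} v * ennreal ((t - v) powr (- \<gamma>)) * ennreal (f v) \<partial>lborel"
  have G: "0 < Gamma (1 - \<gamma>)" using \<gamma> by (intro Gamma_real_pos) simp
  have M0: "0 \<le> M" using M[of 1] U f_nonneg[of 1] by linarith
  show ?thesis
  proof (rule continuous_AE_le[of 2 U "\<lambda>t. t * f t"])
    show "continuous_on {2..U} (\<lambda>t. t * f t)"
      by (intro continuous_intros continuous_on_subset[OF f_cont]) auto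
    show "AE t in lborel. t \<in> {2..U} \<longrightarrow> t * f t \<le> \<gamma> / Gamma (1 - \<gamma>) * (1 + M / (1 - \<gamma>))"
      using AE_f_eq_convolution
    proof (eventually_elim, intro impI)
      fix t assume e: "0 < t \<longrightarrow> ennreal (f t) * ennreal t
         = ennreal (\<gamma> / Gamma (1 - \<gamma>)) * (?F t)"
        and t: "t \<in> {2..U}"
      have "(?F t)
        \<le> (\<integral>\<^sup>+ v. indicator {0<..} v * ennreal (f v) + ennreal M * (indicator {t - 1..t} v * ennreal ((t - v) powr (- \<gamma>))) \<partial>lborel)"
      proof (rule nn_integral_mono, goal_cases)
        case (1 v)
        show ?case
        proof (cases "0 < v \<and> v < t")
          case True
          show ?thesis
          proof (cases "v < t - 1")
            case True2: True
            have "(t - v) powr (- \<gamma>) \<le> 1 powr (- \<gamma>)" using True2 \<gamma> by (intro powr_mono2') auto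
            then have "ennreal ((t - v) powr (- \<gamma>)) * ennreal (f v) \<le> 1 * ennreal (f v)"
              by (intro mult_right_mono) auto
            then show ?thesis using True by (auto intro: order_trans)
          next
            case False
            then have "f v \<le> M" using True t by (intro M) auto
            then have "ennreal ((t - v) powr (- \<gamma>)) * ennreal (f v) \<le> ennreal ((t - v) powr (- \<gamma>)) * ennreal M"
              by (intro mult_left_mono ennreal_leI) auto
            then show ?thesis using True False by (auto simp: mult.commute intro: add_increasing)
          qed
        qed auto
      qed
      also have "\<dots> = (\<integral>\<^sub>+ v. ennreal (f v))
          + ennreal M * (?G t)"
        by (simp add: nn_integral_add nn_integral_cmult)
      also have "(?G t) = ennreal (1 / (1 - \<gamma>))"
      proof -
        have "(?G t)
          = ennreal \<bar>- 1\<bar> * (\<integral>\<^sup>+ v. indicator {t - 1..t} (t + (- 1) * v) * ennreal ((t - (t + (- 1) * v)) powr (- \<gamma>)) \<partial>lborel)"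
          by (rule nn_integral_real_affine) auto
        also have "\<dots> = (\<integral>\<^sup>+ v. ennreal (indicator {0..1} v * v powr (- \<gamma>)) \<partial>lborel)"
          by (simp, intro nn_integral_cong) (auto split: split_indicator)
        also have "\<dots> = ennreal (1 / (1 - \<gamma>))"
        proof -
          have "((\<lambda>v. v powr (- \<gamma>)) has_integral (1 powr (- \<gamma> + 1) / (- \<gamma> + 1))) {0..1::real}"
            by (rule has_integral_powr_from_0) (use \<gamma> in auto)
          then have "((\<lambda>v. v powr (- \<gamma>)) has_integral (1 / (1 - \<gamma>))) {0..1::real}" by simp
          from nn_integral_has_integral_lebesgue[OF _ this] show ?thesis by simp
        qed
        finally show ?thesis .
      qed
      finally have "(?F t) \<le> 1 + ennreal M * ennreal (1 / (1 - \<gamma>))"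
        using nn_integral_f_le_1 by (meson add_right_mono order_trans)
      also have "\<dots> = ennreal (1 + M / (1 - \<gamma>))"
        using M0 \<gamma> by (simp add: ennreal_mult'[symmetric] ennreal_1[symmetric] del: ennreal_1)
      finally have "ennreal (f t) * ennreal t \<le> ennreal (\<gamma> / Gamma (1 - \<gamma>)) * ennreal (1 + M / (1 - \<gamma>))"
        using e t by (auto intro: mult_left_mono)
      moreover have "ennreal (f t) * ennreal t = ennreal (t * f t)"
        using t by (simp add: ennreal_mult' mult.commute)
      moreover have "ennreal (\<gamma> / Gamma (1 - \<gamma>)) * ennreal (1 + M / (1 - \<gamma>)) = ennreal (\<gamma> / Gamma (1 - \<gamma>) * (1 + M / (1 - \<gamma>)))"
        using G \<gamma> by (intro ennreal_mult'[symmetric]) auto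
      moreover have "0 \<le> \<gamma> / Gamma (1 - \<gamma>) * (1 + M / (1 - \<gamma>))"
        using G \<gamma> M0 by (intro mult_nonneg_nonneg) auto
      ultimately show "t * f t \<le> \<gamma> / Gamma (1 - \<gamma>) * (1 + M / (1 - \<gamma>))"
        by (simp only: ennreal_le_iff)
    qed
  qed (use U t in auto)
qed

text \<open>A bootstrap: inserting the maximum of \<open>f\<close> over a compact interval as
  \<open>M\<close> into \<open>t_f_le\<close> bounds that maximum by \<open>c\<close> whenever it is
  attained beyond \<open>u\<close>. The bound does not depend on the interval.\<close>

lemma f_bounded_at_top: "\<exists>K. \<forall>t\<ge>1. f t \<le> K"
proof -
  define c where "c = \<gamma> / Gamma (1 - \<gamma>)"
  have c: "0 < c" unfolding c_def using \<gamma> by (intro divide_pos_pos Gamma_real_pos) auto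
  \<comment> \<open>Chosen so that beyond \<open>u\<close> the term with the unknown maximum is at
    most half of the left-hand side and can be absorbed.\<close>
  define u where "u = max 2 (2 * c / (1 - \<gamma>))"
  have cont: "continuous_on {1..U} f" for U by (rule continuous_on_subset[OF f_cont]) auto
  have u: "2 \<le> u" "2 * c / (1 - \<gamma>) \<le> u" by (auto simp: u_def)
  obtain x0 where x0: "\<And>v. v \<in> {1..u} \<Longrightarrow> f v \<le> f x0"
    using continuous_attains_sup[OF _ _ cont[of u]] u by force
  have "f t \<le> max (f x0) c" if t: "1 \<le> t" for t
  proof -
    define U where "U = max t u + 1"
    obtain x1 where x1: "x1 \<in> {1..U}" "\<And>v. v \<in> {1..U} \<Longrightarrow> f v \<le> f x1"
      using continuous_attains_sup[OF _ _ cont[of U]] u by (force simp: U_def)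
    have "f x1 \<le> max (f x0) c"
    proof (cases "x1 \<le> u")
      case True
      then show ?thesis using x0[of x1] x1 by auto
    next
      case False
      have "x1 * f x1 \<le> c * (1 + f x1 / (1 - \<gamma>))"
        unfolding c_def using x1 u False by (intro t_f_le[of U]) (auto simp: U_def)
      also have "\<dots> = c + c / (1 - \<gamma>) * f x1" by (simp add: algebra_simps)
      also have "\<dots> \<le> c + (x1 / 2) * f x1"
      proof -
        have "2 * c / (1 - \<gamma>) = 2 * (c / (1 - \<gamma>))" by simp
        then have "c / (1 - \<gamma>) \<le> x1 / 2" using u False by linarith
        then show ?thesis using f_nonneg[of x1] by (intro add_left_mono mult_right_mono)
      qed
      finally have "(x1 / 2) * f x1 \<le> c" by simp
      moreover have "1 * f x1 \<le> (x1 / 2) * f x1" using u False f_nonneg[of x1] by (intro mult_right_mono) auto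
      ultimately show ?thesis by simp
    qed
    moreover have "f t \<le> f x1" using t by (intro x1(2)) (auto simp: U_def)
    ultimately show ?thesis by linarith
  qed
  then show ?thesis by blast
qed

text \<open>\<open>t_f_le\<close> covers large \<open>t\<close>, compactness the rest. The positive
  lower end is kept because continuity of \<open>f\<close> is given on the open half-line
  only.\<close>

lemma t_f_bounded:
  assumes "0 < \<delta>"
  shows "\<exists>K. \<forall>t\<ge>\<delta>. t * f t \<le> K"
proof -
  obtain K where K: "\<And>t. 1 \<le> t \<Longrightarrow> f t \<le> K" using f_bounded_at_top by blast
  define C where "C = \<gamma> / Gamma (1 - \<gamma>) * (1 + K / (1 - \<gamma>))"
  have far: "t * f t \<le> C" if "2 \<le> t" for t
    unfolding C_def using K that by (intro t_f_le[of "t + 1"]) auto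
  have "continuous_on {\<delta>..max \<delta> 2} (\<lambda>t. t * f t)"
    using assms by (intro continuous_intros continuous_on_subset[OF f_cont]) auto
  then obtain x where x: "\<And>t. t \<in> {\<delta>..max \<delta> 2} \<Longrightarrow> t * f t \<le> x * f x"
    using continuous_attains_sup[of "{\<delta>..max \<delta> 2}" "\<lambda>t. t * f t"] by force
  have "t * f t \<le> max C (x * f x)" if "\<delta> \<le> t" for t
    using far[of t] x[of t] that by (cases "2 \<le> t") (auto simp: max_def)
  then show ?thesis by blast
qed

end

section \<open>Dominated integrals and changes of variable\<close>

lemma
  fixes g :: "real \<Rightarrow> 'b \<Rightarrow> ennreal"
  assumes [measurable]: "\<And>y. y \<in> S \<Longrightarrow> g y \<in> borel_measurable M" "w \<in> borel_measurable M"
    and bound: "\<And>y u. y \<in> S \<Longrightarrow> g y u \<le> w u" and fin: "(\<integral>\<^sup>+ u. w u \<partial>M) < \<top>"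
  shows nn_integral_dominated_finite: "y \<in> S \<Longrightarrow> (\<integral>\<^sup>+ u. g y u \<partial>M) < \<top>"
    and continuous_on_nn_integral_dominated:
      "(\<And>u. continuous_on S (\<lambda>y. g y u)) \<Longrightarrow> continuous_on S (\<lambda>y. \<integral>\<^sup>+ u. g y u \<partial>M)"
proof -
  show "(\<integral>\<^sup>+ u. g y u \<partial>M) < \<top>" if "y \<in> S"
    using bound[OF that] by (intro le_less_trans[OF _ fin] nn_integral_mono)
  assume c: "\<And>u. continuous_on S (\<lambda>y. g y u)"
  show "continuous_on S (\<lambda>y. \<integral>\<^sup>+ u. g y u \<partial>M)"
    unfolding continuous_on_sequentially o_def
  proof (intro allI ballI impI, elim conjE)
    fix x y assume x: "\<forall>k. x k \<in> S" "x \<longlonglongrightarrow> y" and y: "y \<in> S"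
    have "(\<lambda>k. g (x k) u) \<longlonglongrightarrow> g y u" for u
      using c[of u] x y unfolding continuous_on_sequentially o_def by blast
    then show "(\<lambda>k. \<integral>\<^sup>+ u. g (x k) u \<partial>M) \<longlonglongrightarrow> (\<integral>\<^sup>+ u. g y u \<partial>M)"
      using x(1) y bound fin by (intro nn_integral_dominated_convergence[where w = w]) auto
  qed
qed

text \<open>Substitute on the intervals from -n to n and pass to the limit. By the intermediate
  value theorem their images exhaust exactly the range of \<open>\<phi>\<close>.\<close>

lemma nn_integral_mono_substitution:
  fixes \<phi> \<phi>' :: "real \<Rightarrow> real"
  assumes [measurable]: "g \<in> borel_measurable borel"
    and D: "\<And>x. (\<phi> has_real_derivative \<phi>' x) (at x)" and cont: "continuous_on UNIV \<phi>'" and nn: "\<And>x. 0 \<le> \<phi>' x"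
    and rng[measurable]: "range \<phi> \<in> sets borel"
  shows "(\<integral>\<^sup>+ s. indicator (range \<phi>) s * g s \<partial>lborel) = (\<integral>\<^sup>+ x. g (\<phi> x) * ennreal (\<phi>' x) \<partial>lborel)"
proof -
  let ?H = "\<lambda>s. indicator (range \<phi>) s"
  let ?G = "density lborel (\<lambda>x. ennreal (\<phi>' x))"
  let ?F = "\<lambda>A (x::real). indicator A (\<phi> x) * \<phi>' x"
  have c\<phi>: "continuous_on S \<phi>" for S using D by (meson DERIV_isCont continuous_at_imp_continuous_on)
  have [measurable]: "\<phi> \<in> borel_measurable borel" "\<phi>' \<in> borel_measurable borel"
    using c\<phi> cont by (auto intro: borel_measurable_continuous_onI)
  have mono: "\<phi> x \<le> \<phi> y" if "x \<le> y" for x y using DERIV_nonneg_imp_nondecreasing[OF that] D nn by blast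
  have "density lborel ?H = distr ?G borel \<phi>"
  proof (rule measure_eqI)
    fix A assume "A \<in> sets (density lborel (\<lambda>s::real. indicator (range \<phi>) s :: ennreal))"
    then have A[measurable]: "A \<in> sets (borel :: real measure)" by simp
    let ?I = "\<lambda>n. {\<phi> (- real n)..\<phi> (real n)}"
    have "(\<lambda>n. \<integral>\<^sup>+ s. ennreal (indicator A s) * indicator (?I n) s \<partial>lborel)
       \<longlonglongrightarrow> (\<integral>\<^sup>+ s. ennreal (indicator A s) * indicator (range \<phi>) s \<partial>lborel)"
    proof (rule nn_integral_LIMSEQ)
      have "?I m \<subseteq> ?I n" if "m \<le> n" for m n using mono[of "- real n" "- real m"] mono[of "real m" "real n"] that by auto
      then show "incseq (\<lambda>n s. ennreal (indicator A s) * indicator (?I n) s)"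
        by (auto simp: incseq_def le_fun_def subset_iff split: split_indicator)
      fix s :: real
      show "(\<lambda>n. ennreal (indicator A s) * indicator (?I n) s) \<longlonglongrightarrow> ennreal (indicator A s) * indicator (range \<phi>) s"
      proof (cases "s \<in> range \<phi>")
        case True
        then obtain x where x: "s = \<phi> x" by auto
        obtain k :: nat where k: "\<bar>x\<bar> \<le> real k" using real_arch_simple by blast
        have "eventually (\<lambda>n. ennreal (indicator A s) * indicator (?I n) s = ennreal (indicator A s) * indicator (range \<phi>) s) sequentially"
          using eventually_ge_at_top[of k]
        proof eventually_elim
          case (elim n)
          then have "s \<in> ?I n" using k mono[of "- real n" x] mono[of x "real n"] unfolding x by auto
          then show ?case using True by simp
        qed
        then show ?thesis by (rule tendsto_eventually)
      next
        case False
        have "s \<notin> ?I n" for n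
        proof
          assume "s \<in> ?I n"
          then obtain x where "\<phi> x = s" using IVT'[of \<phi> "- real n" s "real n"] c\<phi> by auto
          then show False using False by blast
        qed
        then show ?thesis using False by simp
      qed
    qed measurable
    moreover have "(\<integral>\<^sup>+ s. ennreal (indicator A s) * indicator (?I n) s \<partial>lborel)
       = (\<integral>\<^sup>+ x. ennreal (?F A x) * indicator {- real n..real n} x \<partial>lborel)" for n
    proof -
      have "(\<integral>\<^sup>+ s. ennreal (indicator A s * indicator (?I n) s) \<partial>lborel)
         = (\<integral>\<^sup>+ x. ennreal (indicator A (\<phi> x) * \<phi>' x * indicator {- real n..real n} x) \<partial>lborel)"
        by (rule nn_integral_substitution)
           (use D nn in \<open>auto simp: set_borel_measurable_def intro: continuous_on_subset[OF cont]\<close>)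
      then show ?thesis by (simp add: ennreal_mult' ennreal_indicator nn)
    qed
    moreover have "(\<lambda>n. \<integral>\<^sup>+ x. ennreal (?F A x) * indicator {- real n..real n} x \<partial>lborel)
       \<longlonglongrightarrow> (\<integral>\<^sup>+ x. ennreal (?F A x) \<partial>lborel)"
    proof (rule nn_integral_LIMSEQ)
      show "incseq (\<lambda>n x. ennreal (?F A x) * indicator {- real n..real n} (x::real))"
        by (auto simp: incseq_def le_fun_def split: split_indicator)
      fix x :: real
      obtain k :: nat where k: "\<bar>x\<bar> \<le> real k" using real_arch_simple by blast
      have "eventually (\<lambda>n. ennreal (?F A x) * indicator {- real n..real n} x = ennreal (?F A x)) sequentially"
        using eventually_ge_at_top[of k]
      proof eventually_elim
        case (elim n)
        then have "x \<in> {- real n..real n}" using k by auto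
        then show ?case by simp
      qed
      then show "(\<lambda>n. ennreal (?F A x) * indicator {- real n..real n} x) \<longlonglongrightarrow> ennreal (?F A x)"
        by (rule tendsto_eventually)
    qed measurable
    ultimately have "(\<integral>\<^sup>+ s. ennreal (indicator A s) * indicator (range \<phi>) s \<partial>lborel) = (\<integral>\<^sup>+ x. ennreal (?F A x) \<partial>lborel)"
      using LIMSEQ_unique by simp
    moreover have [measurable]: "\<phi> -` A \<in> sets borel" using measurable_sets[of \<phi> borel borel A] by simp
    ultimately show "emeasure (density lborel ?H) A = emeasure (distr ?G borel \<phi>) A"
      by (simp add: emeasure_density emeasure_distr ennreal_indicator mult.commute ennreal_mult' nn indicator_vimage)
  qed simp
  then have "(\<integral>\<^sup>+ s. g s \<partial>density lborel ?H) = (\<integral>\<^sup>+ s. g s \<partial>distr ?G borel \<phi>)"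
    by simp
  then show ?thesis by (simp add: nn_integral_density nn_integral_distr mult.commute)
qed

lemma range_exp: "range (exp :: real \<Rightarrow> real) = {0<..}"
proof -
  have "x \<in> range exp" if "0 < x" for x :: real using exp_ln[OF that] by (metis rangeI)
  then show ?thesis by auto
qed

lemma nn_integral_exp_substitution:
  assumes [measurable]: "g \<in> borel_measurable borel"
  shows "(\<integral>\<^sub>+ s. g s) = (\<integral>\<^sup>+ x. g (exp x) * ennreal (exp x) \<partial>(lborel :: real measure))"
  using nn_integral_mono_substitution[OF assms DERIV_exp continuous_on_exp[OF continuous_on_id]] by (simp add: range_exp)

text \<open>On the logarithmic scale the power map is affine, so both signs of \<open>p\<close> are
  treated at once.\<close>

lemma nn_integral_powr_substitution:
  assumes [measurable]: "g \<in> borel_measurable borel" and c: "0 < c" and p: "p \<noteq> 0"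
  shows "(\<integral>\<^sub>+ s. g s)
       = (\<integral>\<^sub>+ u. g (c * u powr p) * ennreal (c * \<bar>p\<bar> * u powr (p - 1)))"
proof -
  have "(\<integral>\<^sub>+ u. g (c * u powr p) * ennreal (c * \<bar>p\<bar> * u powr (p - 1)))
     = (\<integral>\<^sup>+ x. g (c * exp x powr p) * ennreal (c * \<bar>p\<bar> * exp x powr (p - 1)) * ennreal (exp x) \<partial>lborel)"
    by (rule nn_integral_exp_substitution) measurable
  also have "\<dots> = (\<integral>\<^sup>+ x. ennreal \<bar>p\<bar> * (g (exp (ln c + p * x)) * ennreal (exp (ln c + p * x))) \<partial>lborel)"
  proof (rule nn_integral_cong, goal_cases)
    case (1 x)
    have "c * exp x powr p = exp (ln c + p * x)" using c by (simp add: exp_add powr_def)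
    moreover have "c * \<bar>p\<bar> * exp x powr (p - 1) * exp x = \<bar>p\<bar> * exp (ln c + p * x)"
      using c by (simp add: exp_add powr_def exp_diff algebra_simps)
    moreover have "ennreal (c * \<bar>p\<bar> * exp x powr (p - 1)) * ennreal (exp x) = ennreal (c * \<bar>p\<bar> * exp x powr (p - 1) * exp x)"
      using c by (intro ennreal_mult'[symmetric]) auto
    ultimately show ?case
      by (simp only: mult.assoc) (simp add: ennreal_mult mult_ac)
  qed
  also have "\<dots> = ennreal \<bar>p\<bar> * (\<integral>\<^sup>+ x. g (exp (ln c + p * x)) * ennreal (exp (ln c + p * x)) \<partial>lborel)"
    by (rule nn_integral_cmult) measurable
  also have "\<dots> = (\<integral>\<^sup>+ x. g (exp x) * ennreal (exp x) \<partial>lborel)"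
    by (rule nn_integral_real_affine[symmetric]) (use p in auto)
  also have "\<dots> = (\<integral>\<^sub>+ s. g s)"
    by (rule nn_integral_exp_substitution[symmetric]) measurable
  finally show ?thesis ..
qed

lemma (in stable_law) f_borel [measurable]: "f \<in> borel_measurable borel"
proof -
  have "(\<lambda>x. enn2real (ennreal (f x))) \<in> borel_measurable borel" by measurable
  then show ?thesis by (simp add: f_nonneg)
qed

section \<open>Mixtures over the conditioning value\<close>

locale stable_mixture =
  A: stable_law \<alpha> N J f \<kappa> + G: stable_law \<gamma> N' J' f' \<kappa>'
  for \<alpha> :: real and N :: "'b measure" and J f \<kappa> and \<gamma> :: real and N' :: "'b measure" and J' f' \<kappa>'
begin

text \<open>The joint density, at \<open>y\<close> and \<open>s\<close>, of
  \<open>S * U powr (1 / \<alpha>)\<close> and S, where S has density \<open>f\<close> and U,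
  independent of S, has density \<open>f'\<close>. Dividing it by the density of index \<beta> at
  \<open>y\<close> gives the weight in \<open>PD_mixed\<close>.\<close>

definition mix_kernel :: "real \<Rightarrow> real \<Rightarrow> real" where
  "mix_kernel y s = \<alpha> * y powr (\<alpha> - 1) * f' ((y / s) powr \<alpha>) / s powr \<alpha> * f s"

definition mix :: "(real \<Rightarrow> real) \<Rightarrow> real \<Rightarrow> ennreal" where
  "mix b y = (\<integral>\<^sub>+ s. ennreal (b s) * ennreal (mix_kernel y s))"

lemma mix_kernel_nonneg: "0 < y \<Longrightarrow> 0 \<le> mix_kernel y s"
  using A.\<gamma> A.f_nonneg G.f_nonneg by (simp add: mix_kernel_def)

lemma mix_kernel_eq:
  assumes "0 < y" "0 < s"
  shows "mix_kernel y s = \<alpha> / y * ((y / s) powr \<alpha> * f' ((y / s) powr \<alpha>)) * f s"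
  using assms by (simp add: mix_kernel_def powr_divide powr_diff)

lemma mix_kernel_measurable [measurable]: "(\<lambda>z. mix_kernel (fst z) (snd z)) \<in> borel_measurable (borel \<Otimes>\<^sub>M borel)"
  unfolding mix_kernel_def by measurable

lemma mix_kernel_measurable' [measurable]: "mix_kernel y \<in> borel_measurable borel"
  unfolding mix_kernel_def by measurable

text \<open>
  Near \<open>s = \<infinity>\<close> a bound uniform in \<open>y\<close> is available only in the variable \<open>u = (y / s) powr \<alpha>\<close>,
  near \<open>s = 0\<close> only in the variable \<open>s\<close>.
\<close>

lemma mix_near_0:
  assumes b: "continuous_on {0<..} b" "\<And>s. 0 < s \<Longrightarrow> 0 \<le> b s \<and> b s \<le> 1" "\<And>s. 2 \<le> s \<Longrightarrow> b s = 0"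
    and y1: "0 < y1"
  shows "continuous_on {y1..} (mix b)" "y1 \<le> y \<Longrightarrow> mix b y < \<top>"
proof -
  have bm[measurable]: "(\<lambda>s. indicator {0<..} s * b s) \<in> borel_measurable borel"
    using borel_measurable_continuous_on_indicator[OF _ b(1)] by simp
  \<comment> \<open>For \<open>s < 2\<close> and \<open>y \<ge> y1\<close> the argument
    \<open>(y / s) powr \<alpha>\<close> of \<open>f'\<close> stays above this threshold, so
    \<open>t_f_bounded\<close> applies to it.\<close>
  obtain K where K: "\<And>u. (y1 / 2) powr \<alpha> \<le> u \<Longrightarrow> u * f' u \<le> K"
    using G.t_f_bounded[of "(y1 / 2) powr \<alpha>"] y1 by auto
  have K0: "0 \<le> K" using K[of "(y1 / 2) powr \<alpha>"] G.f_nonneg y1 by (meson mult_nonneg_nonneg order_refl order_trans powr_ge_zero)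
  let ?w = "\<lambda>s. ennreal (\<alpha> / y1 * K) * (indicator {0<..} s * ennreal (f s))"
  let ?F = "\<integral>\<^sup>+ s. ?w s \<partial>lborel"
  have eq: "mix b y = (\<integral>\<^sup>+ s. ennreal (indicator {0<..} s * b s) * ennreal (mix_kernel y s) \<partial>lborel)" for y
    unfolding mix_def by (intro nn_integral_cong) (auto split: split_indicator)
  have bound: "ennreal (indicator {0<..} s * b s) * ennreal (mix_kernel y s) \<le> ?w s" if y: "y1 \<le> y" for y s
  proof (cases "0 < s \<and> s < 2")
    case True
    let ?u = "(y / s) powr \<alpha>"
    have "y1 / 2 \<le> y / s" using True y y1 by (intro frac_le) auto
    then have "(y1 / 2) powr \<alpha> \<le> ?u" using A.\<gamma> y1 by (intro powr_mono2) auto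
    then have "?u * f' ?u \<le> K" by (rule K)
    moreover have "\<alpha> / y \<le> \<alpha> / y1" using y y1 A.\<gamma> by (intro divide_left_mono) auto
    ultimately have "\<alpha> / y * (?u * f' ?u) \<le> \<alpha> / y1 * K"
      using y1 A.\<gamma> G.f_nonneg[of ?u] by (intro mult_mono) auto
    then have "\<alpha> / y * (?u * f' ?u) * f s \<le> \<alpha> / y1 * K * f s"
      by (intro mult_right_mono A.f_nonneg)
    then have "mix_kernel y s \<le> \<alpha> / y1 * K * f s"
      using mix_kernel_eq[of y s] True y y1 by linarith
    then have "b s * mix_kernel y s \<le> 1 * (\<alpha> / y1 * K * f s)"
      using b(2)[of s] True mix_kernel_nonneg[of y s] y y1 by (intro mult_mono) auto
    then have "ennreal (b s * mix_kernel y s) \<le> ennreal (\<alpha> / y1 * K * f s)" by (intro ennreal_leI) simp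
    then show ?thesis
      using True b(2)[of s] K0 A.\<gamma> y1 by (simp add: ennreal_mult' ennreal_mult''[symmetric] A.f_nonneg mult_ac)
  next
    case False
    then have *: "indicator {0<..} s * b s = 0" using b(3)[of s] by (auto split: split_indicator)
    show ?thesis unfolding * by simp
  qed
  have wfin: "?F < \<infinity>"
  proof -
    have "?F = ennreal (\<alpha> / y1 * K) * (\<integral>\<^sub>+ s. ennreal (f s))"
      by (rule nn_integral_cmult) measurable
    also have "\<dots> \<le> ennreal (\<alpha> / y1 * K) * 1" by (intro mult_left_mono A.nn_integral_f_le_1) auto
    finally show ?thesis by (auto intro: le_less_trans)
  qed
  have c: "continuous_on {y1..} (\<lambda>y. ennreal (indicator {0<..} s * b s) * ennreal (mix_kernel y s))" for s
  proof (cases "0 < s")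
    case True
    have "continuous_on {y1..} (\<lambda>y. f' ((y / s) powr \<alpha>))"
      using True y1 by (intro continuous_on_compose2[OF G.f_cont] continuous_intros) auto
    then have "continuous_on {y1..} (\<lambda>y. mix_kernel y s)"
      unfolding mix_kernel_def using y1 True by (intro continuous_intros) auto
    then show ?thesis by (intro ennreal_continuous_on_cmult continuous_on_ennreal) auto
  qed simp
  have bd: "ennreal (indicator {0<..} s * b s) * ennreal (mix_kernel y s) \<le> ?w s" if "y \<in> {y1..}" for y s
    by (rule bound) (use that in simp)
  have wm: "?w \<in> borel_measurable lborel" by measurable
  have gm: "(\<lambda>s. ennreal (indicator {0<..} s * b s) * ennreal (mix_kernel y s)) \<in> borel_measurable lborel" if "y \<in> {y1..}" for y
    by measurable
  note dom = gm wm bd wfin[unfolded infinity_ennreal_def]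
  show "continuous_on {y1..} (mix b)" unfolding eq[abs_def] by (rule continuous_on_nn_integral_dominated[OF dom c])
  show "mix b y < \<top>" if "y1 \<le> y" unfolding eq by (rule nn_integral_dominated_finite[where S = "{y1..}", OF dom]) (use that in auto)
qed

lemma mix_near_top:
  assumes b: "continuous_on {0<..} b" "\<And>s. 0 < s \<Longrightarrow> 0 \<le> b s \<and> b s \<le> 1" "\<And>s. s < 1 \<Longrightarrow> b s = 0"
    and y1: "0 < y1"
  shows "continuous_on {y1..} (mix b)" "y1 \<le> y \<Longrightarrow> mix b y < \<top>"
proof -
  let ?F = "\<lambda>(y::real) (u::real). y * \<bar>- 1 / \<alpha>\<bar> * u powr (- 1 / \<alpha> - 1)"
  have bm[measurable]: "(\<lambda>s. indicator {0<..} s * b s) \<in> borel_measurable borel"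
    using borel_measurable_continuous_on_indicator[OF _ b(1)] by simp
  have bm'[measurable]: "(\<lambda>s. ennreal (indicator {0<..} s * b s) * ennreal (mix_kernel y s)) \<in> borel_measurable borel" for y
    by measurable
  obtain K where K: "\<And>s. 1 \<le> s \<Longrightarrow> s * f s \<le> K" using A.t_f_bounded[of 1] by auto
  have K0: "0 \<le> K" using K[of 1] A.f_nonneg[of 1] by linarith
  \<comment> \<open>The inverse of \<open>u = (y / s) powr \<alpha>\<close>. The kernel times the
    Jacobian becomes \<open>s * f s / y * f' u\<close>: the first factor is bounded because
    \<open>s \<ge> 1\<close>, and the density \<open>f'\<close> dominates.\<close>
  let ?s = "\<lambda>y u. y * u powr (- 1 / \<alpha>)"
  let ?g = "\<lambda>y u. indicator {0<..} u * ennreal ((indicator {0<..} (?s y u) * b (?s y u)) * (?s y u * f (?s y u)) / y * f' u)"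
  have eq: "mix b y = (\<integral>\<^sup>+ u. ?g y u \<partial>lborel)" if y: "y1 \<le> y" for y
  proof -
    have y0: "0 < y" using y y1 by simp
    have "mix b y = (\<integral>\<^sub>+ s. ennreal (indicator {0<..} s * b s) * ennreal (mix_kernel y s))"
      unfolding mix_def by (intro nn_integral_cong) (auto split: split_indicator)
    also have "\<dots> = (\<integral>\<^sub>+ u. ennreal (indicator {0<..} (?s y u) * b (?s y u)) * ennreal (mix_kernel y (?s y u))
         * ennreal (?F y u))"
      by (rule nn_integral_powr_substitution[OF bm' y0]) (use A.\<gamma> in simp)
    also have "\<dots> = (\<integral>\<^sup>+ u. ?g y u \<partial>lborel)"
    proof (rule nn_integral_cong, goal_cases)
      case (1 u)
      show ?case
      proof (cases "0 < u")
        case True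
        have s0: "0 < ?s y u" using True y0 by simp
        have "(y / ?s y u) powr \<alpha> = u"
        proof -
          have "y / ?s y u = u powr (1 / \<alpha>)" using True y0 by (simp add: powr_minus divide_simps)
          then show ?thesis using True A.\<gamma> by (simp add: powr_powr)
        qed
        then have k: "mix_kernel y (?s y u) = \<alpha> / y * (u * f' u) * f (?s y u)" using mix_kernel_eq[OF y0 s0] by simp
        have "mix_kernel y (?s y u) * (?F y u) = (?s y u * f (?s y u)) / y * f' u"
        proof -
          have "u * u powr (- 1 / \<alpha> - 1) = u powr (- 1 / \<alpha>)"
            using True by (simp add: powr_diff)
          moreover have "\<bar>- 1 / \<alpha>\<bar> = 1 / \<alpha>" using A.\<gamma> by simp
          ultimately show ?thesis unfolding k using y0 A.\<gamma> True by (simp add: field_simps)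
        qed
        note kd = this
        have b0: "0 \<le> indicator {0<..} (?s y u) * b (?s y u)" using b(2) s0 by simp
        have "ennreal (indicator {0<..} (?s y u) * b (?s y u)) * ennreal (mix_kernel y (?s y u))
            * ennreal (?F y u)
          = ennreal (indicator {0<..} (?s y u) * b (?s y u) * (mix_kernel y (?s y u) * (?F y u)))"
          unfolding ennreal_mult'[OF b0] ennreal_mult'[OF mix_kernel_nonneg[OF y0]] by (rule mult.assoc)
        also have "\<dots> = ennreal ((indicator {0<..} (?s y u) * b (?s y u)) * (?s y u * f (?s y u)) / y * f' u)"
          unfolding kd by (simp only: mult.assoc times_divide_eq_right times_divide_eq_left)
        finally show ?thesis by simp
      qed simp
    qed
    finally show ?thesis .
  qed
  let ?w = "\<lambda>u. ennreal (K / y1) * (indicator {0<..} u * ennreal (f' u))"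
  let ?G = "\<integral>\<^sup>+ s. ?w s \<partial>lborel"
  have bound: "?g y u \<le> ?w u" if y: "y1 \<le> y" for y u
  proof (cases "0 < u \<and> 1 \<le> ?s y u")
    case True
    have "b (?s y u) * (?s y u * f (?s y u)) \<le> 1 * K"
      using True b(2)[of "?s y u"] K[of "?s y u"] A.f_nonneg[of "?s y u"] by (intro mult_mono) auto
    then have "b (?s y u) * (?s y u * f (?s y u)) / y \<le> K / y1"
      using y y1 K0 by (intro frac_le) auto
    then have "b (?s y u) * (?s y u * f (?s y u)) / y * f' u \<le> K / y1 * f' u"
      by (intro mult_right_mono G.f_nonneg)
    then have "ennreal (b (?s y u) * (?s y u * f (?s y u)) / y * f' u) \<le> ennreal (K / y1 * f' u)" by (rule ennreal_leI)
    moreover have "0 < ?s y u" using True by linarith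
    then have *: "indicator {0<..} (?s y u) * b (?s y u) = b (?s y u)" by simp
    have "ennreal (K / y1 * f' u) = ennreal (K / y1) * (indicator {0<..} u * ennreal (f' u))"
      using True K0 y1 by (subst ennreal_mult') auto
    moreover have "?g y u = ennreal (b (?s y u) * (?s y u * f (?s y u)) / y * f' u)" unfolding * using True by simp
    ultimately show ?thesis by metis
  next
    case False
    then show ?thesis using b(3)[of "?s y u"] by (cases "0 < u") auto
  qed
  have wfin: "?G < \<infinity>"
  proof -
    have "?G = ennreal (K / y1) * (\<integral>\<^sub>+ s. ennreal (f' s))"
      by (rule nn_integral_cmult) measurable
    also have "\<dots> \<le> ennreal (K / y1) * 1" by (intro mult_left_mono G.nn_integral_f_le_1) auto
    finally show ?thesis by (auto intro: le_less_trans)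
  qed
  have gm: "?g y \<in> borel_measurable lborel" if "y \<in> {y1..}" for y
  proof -
    have "(\<lambda>u. ?s y u) \<in> borel_measurable borel" by measurable
    from measurable_compose[OF this bm]
    have [measurable]: "(\<lambda>u. indicator {0<..} (?s y u) * b (?s y u)) \<in> borel_measurable borel" .
    show ?thesis by measurable
  qed
  have c: "continuous_on {y1..} (\<lambda>y. ?g y u)" for u
  proof (cases "0 < u")
    case True
    have pos: "?s y u \<in> {0<..}" if "y \<in> {y1..}" for y using True y1 that by simp
    have "continuous_on {y1..} (\<lambda>y. b (?s y u))" "continuous_on {y1..} (\<lambda>y. f (?s y u))"
      using pos by (auto intro!: continuous_on_compose2[OF b(1)] continuous_on_compose2[OF A.f_cont] continuous_intros)
    then have "continuous_on {y1..} (\<lambda>y. ennreal (b (?s y u) * (?s y u * f (?s y u)) / y * f' u))"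
      using y1 by (intro continuous_on_ennreal continuous_intros) auto
    then show ?thesis using pos True by (subst continuous_on_cong[OF refl]) auto
  qed simp
  have bd: "?g y u \<le> ?w u" if "y \<in> {y1..}" for y u by (rule bound) (use that in simp)
  have wm: "?w \<in> borel_measurable lborel" by measurable
  note dom = gm wm bd wfin[unfolded infinity_ennreal_def]
  have "continuous_on {y1..} (\<lambda>y. \<integral>\<^sup>+ u. ?g y u \<partial>lborel)" by (rule continuous_on_nn_integral_dominated[OF dom c])
  then show "continuous_on {y1..} (mix b)" by (subst continuous_on_cong[OF refl eq]) auto
  show "mix b y < \<top>" if "y1 \<le> y" unfolding eq[OF that]
    by (rule nn_integral_dominated_finite[where S = "{y1..}", OF dom]) (use that in auto)
qed

lemma
  assumes b: "continuous_on {0<..} b" "\<And>s. 0 < s \<Longrightarrow> 0 \<le> b s \<and> b s \<le> 1"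
  shows continuous_mix: "continuous_on {0<..} (mix b)" and mix_finite: "0 < y \<Longrightarrow> mix b y < \<top>"
proof -
  \<comment> \<open>A continuous partition of unity. It interpolates between 1 and 2, which explains
    the supports required in the two preceding lemmas.\<close>
  define cut where "cut = (\<lambda>s::real. max 0 (min 1 (2 - s)))"
  have cut: "0 \<le> cut s" "cut s \<le> 1" "2 \<le> s \<Longrightarrow> cut s = 0" "s < 1 \<Longrightarrow> cut s = 1" for s by (auto simp: cut_def)
  have cutc: "continuous_on S cut" for S unfolding cut_def by (intro continuous_intros)
  let ?b1 = "\<lambda>s. b s * cut s" and ?b2 = "\<lambda>s. b s * (1 - cut s)"
  have c: "continuous_on {0<..} ?b1" "continuous_on {0<..} ?b2" by (intro continuous_intros b cutc)+
  have bd: "0 \<le> ?b1 s \<and> ?b1 s \<le> 1" "0 \<le> ?b2 s \<and> ?b2 s \<le> 1" if "0 < s" for s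
    using b(2)[OF that] cut[of s] by (auto intro!: mult_le_one)
  have split: "mix b y = mix ?b1 y + mix ?b2 y" for y
  proof -
    have [measurable]: "(\<lambda>s. indicator {0<..} s * ?b1 s) \<in> borel_measurable borel" "(\<lambda>s. indicator {0<..} s * ?b2 s) \<in> borel_measurable borel"
      using borel_measurable_continuous_on_indicator[OF _ c(1)] borel_measurable_continuous_on_indicator[OF _ c(2)] by simp_all
    have "mix b' y = (\<integral>\<^sup>+ s. ennreal (indicator {0<..} s * b' s) * ennreal (mix_kernel y s) \<partial>lborel)" for b'
      unfolding mix_def by (intro nn_integral_cong) (auto split: split_indicator)
    note eq = this
    have "mix ?b1 y + mix ?b2 y = (\<integral>\<^sup>+ s. ennreal (indicator {0<..} s * ?b1 s) * ennreal (mix_kernel y s)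
        + ennreal (indicator {0<..} s * ?b2 s) * ennreal (mix_kernel y s) \<partial>lborel)"
      unfolding eq by (rule nn_integral_add[symmetric]) measurable
    also have "\<dots> = mix b y"
      unfolding eq
    proof (rule nn_integral_cong, goal_cases)
      case (1 s)
      have "ennreal (?b1 s) + ennreal (?b2 s) = ennreal (b s)" if "0 < s"
        using bd[OF that] by (subst ennreal_plus[symmetric]) (auto simp: algebra_simps)
      then show ?case
        by (cases "0 < s") (simp_all add: distrib_right[symmetric])
    qed
    finally show ?thesis ..
  qed
  have n: "continuous_on {y1..} (mix ?b1)" "continuous_on {y1..} (mix ?b2)"
     "mix ?b1 y1 < \<top>" "mix ?b2 y1 < \<top>" if "0 < y1" for y1
    by (rule mix_near_0[OF c(1) bd(1) _ that] mix_near_top[OF c(2) bd(2) _ that]; use cut in simp)+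
  show "mix b y < \<top>" if "0 < y" using n(3,4)[OF that] by (simp add: split)
  show "continuous_on {0<..} (mix b)"
  proof -
    have "continuous_on {0<..} (\<lambda>y. mix ?b1 y + mix ?b2 y)"
      unfolding continuous_on_eq_continuous_at[OF open_greaterThan]
    proof
      fix y :: real assume "y \<in> {0<..}"
      then have y: "0 < y / 2" "y / 2 < y" by auto
      have "continuous_on {y / 2<..} (\<lambda>y. mix ?b1 y + mix ?b2 y)"
        using n(1,2)[OF y(1)] by (intro continuous_on_add_ennreal) (auto intro: continuous_on_subset)
      then show "isCont (\<lambda>y. mix ?b1 y + mix ?b2 y) y"
        using y by (simp add: continuous_on_eq_continuous_at)
    qed
    then show ?thesis by (simp add: split[symmetric])
  qed
qed

text \<open>In the variables \<open>s\<close> and \<open>u = (y / s) powr \<alpha>\<close> the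
  kernel is the product density \<open>f s * f' u\<close>; this undoes the change of variables
  behind it.\<close>

lemma nn_integral_mix:
  assumes [measurable]: "(\<lambda>s. indicator {0<..} s * b s) \<in> borel_measurable borel" and h[measurable]: "h \<in> borel_measurable borel"
  shows "(\<integral>\<^sub>+ y. h y * mix b y)
    = (\<integral>\<^sup>+ u. indicator {0<..} u * ennreal (f' u) *
        (\<integral>\<^sub>+ s. ennreal (f s) * ennreal (b s) * h (s * u powr (1 / \<alpha>))) \<partial>lborel)"
proof -
  let ?F = "\<lambda>u::real. \<integral>\<^sub>+ s. ennreal (f s) * ennreal (b s) * h (s * u powr (1 / \<alpha>))"
  have [measurable]: "(\<lambda>s. ennreal (indicator {0<..} s * b s)) \<in> borel_measurable borel" by measurable
  let ?B = "\<lambda>s. ennreal (indicator {0<..} s * b s)"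
  have "(\<integral>\<^sub>+ y. h y * mix b y)
     = (\<integral>\<^sup>+ y. \<integral>\<^sup>+ s. indicator {0<..} y * h y * (?B s * ennreal (mix_kernel y s)) \<partial>lborel \<partial>lborel)"
    unfolding mix_def
  proof (rule nn_integral_cong, goal_cases)
    case (1 y)
    have "(\<integral>\<^sub>+ s. ennreal (b s) * ennreal (mix_kernel y s)) = (\<integral>\<^sup>+ s. ?B s * ennreal (mix_kernel y s) \<partial>lborel)"
      by (intro nn_integral_cong) (auto split: split_indicator)
    then show ?case
      by (simp add: nn_integral_cmult mult.assoc)
  qed
  also have "\<dots> = (\<integral>\<^sup>+ s. \<integral>\<^sup>+ y. indicator {0<..} y * h y * (?B s * ennreal (mix_kernel y s)) \<partial>lborel \<partial>lborel)"
  proof -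
    have "(\<lambda>(s, y). indicator {0<..} y * h y * (?B s * ennreal (mix_kernel (fst (y, s)) (snd (y, s))))) \<in> borel_measurable (lborel \<Otimes>\<^sub>M lborel)"
      by measurable
    from lborel_pair.Fubini'[OF this] show ?thesis by simp
  qed
  also have "\<dots> = (\<integral>\<^sup>+ s. \<integral>\<^sup>+ u. indicator {0<..} u * ennreal (f' u) * (?B s * ennreal (f s) * h (s * u powr (1 / \<alpha>))) \<partial>lborel \<partial>lborel)"
  proof (rule nn_integral_cong, goal_cases)
    case (1 s)
    show ?case
    proof (cases "0 < s")
      case True
      have "(\<integral>\<^sup>+ y. indicator {0<..} y * h y * (?B s * ennreal (mix_kernel y s)) \<partial>lborel)
         = (\<integral>\<^sub>+ y. h y * (?B s * ennreal (mix_kernel y s)))"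
        by (simp add: mult.assoc)
      also have "\<dots> = (\<integral>\<^sub>+ u. h (s * u powr (1 / \<alpha>)) * (?B s * ennreal (mix_kernel (s * u powr (1 / \<alpha>)) s))
          * ennreal (s * \<bar>1 / \<alpha>\<bar> * u powr (1 / \<alpha> - 1)))"
        by (rule nn_integral_powr_substitution[where g = "\<lambda>y. h y * (?B s * ennreal (mix_kernel (fst (y, s)) (snd (y, s))))" and p = "1 / \<alpha>", OF _ True, unfolded fst_conv snd_conv]) (use A.\<gamma> in \<open>auto intro!: borel_measurable_times_ennreal simp: mix_kernel_def\<close>)
      also have "\<dots> = (\<integral>\<^sup>+ u. indicator {0<..} u * ennreal (f' u) * (?B s * ennreal (f s) * h (s * u powr (1 / \<alpha>))) \<partial>lborel)"
      proof (rule nn_integral_cong, goal_cases)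
        case (1 u)
        show ?case
        proof (cases "0 < u")
          case u: True
          let ?y = "s * u powr (1 / \<alpha>)"
          have y0: "0 < ?y" using u True by simp
          have "(?y / s) powr \<alpha> = u" using u True A.\<gamma> by (simp add: powr_powr)
          then have k: "mix_kernel ?y s = \<alpha> / ?y * (u * f' u) * f s" using mix_kernel_eq[OF y0 True] by simp
          have "mix_kernel ?y s * (s * \<bar>1 / \<alpha>\<bar> * u powr (1 / \<alpha> - 1)) = f' u * f s"
          proof -
            have "u * u powr (1 / \<alpha> - 1) = u powr (1 / \<alpha>)" using u by (simp add: powr_diff)
            moreover have "\<bar>1 / \<alpha>\<bar> = 1 / \<alpha>" using A.\<gamma> by simp
            ultimately show ?thesis unfolding k using u True A.\<gamma> by (simp add: field_simps)
          qed
          then have "ennreal (mix_kernel ?y s) * ennreal (s * \<bar>1 / \<alpha>\<bar> * u powr (1 / \<alpha> - 1)) = ennreal (f' u) * ennreal (f s)"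
            using mix_kernel_nonneg[OF y0] G.f_nonneg[of u] by (simp add: ennreal_mult'[symmetric])
          then show ?thesis using u by (simp add: mult_ac)
        qed simp
      qed
      finally show ?thesis .
    qed simp
  qed
  also have "\<dots> = (\<integral>\<^sup>+ u. \<integral>\<^sup>+ s. indicator {0<..} u * ennreal (f' u) * (?B s * ennreal (f s) * h (s * u powr (1 / \<alpha>))) \<partial>lborel \<partial>lborel)"
    by (rule lborel_pair.Fubini'[symmetric]) measurable
  also have "\<dots> = (\<integral>\<^sup>+ u. indicator {0<..} u * ennreal (f' u) *
        (?F u) \<partial>lborel)"
  proof (rule nn_integral_cong, goal_cases)
    case (1 u)
    have "(?F u)
        = (\<integral>\<^sup>+ s. ?B s * ennreal (f s) * h (s * u powr (1 / \<alpha>)) \<partial>lborel)"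
      by (intro nn_integral_cong) (auto simp: mult_ac split: split_indicator)
    then show ?case
      by (simp add: nn_integral_cmult)
  qed
  finally show ?thesis .
qed

end

subsection \<open>Fragmentation\<close>

lemma sum_edsum_card:
  assumes "p \<in> P_infty" "finite A"
  shows "(\<Sum>\<sigma> | partition_on A \<sigma>. edsum \<sigma> card p) = 1"
proof -
  have "(\<Sum>\<sigma> | partition_on A \<sigma>. edsum \<sigma> card p) = (\<Sum>\<sigma> | partition_on A \<sigma>. dsum \<sigma> (\<lambda>B i. \<Prod>b\<in>B. ennreal (p i)))"
    by (simp add: edsum_def)
  also have "\<dots> = (\<Prod>a\<in>A. \<Sum>i. ennreal (p i))"
    using prod_suminf_eq_sum_dsum[OF assms(2), of "\<lambda>_ i. ennreal (p i)"] by simp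
  also have "(\<Sum>i. ennreal (p i)) = 1"
    using P_infty_D[OF assms(1)] by (simp add: psum_def)
  finally show ?thesis by simp
qed

lemma partition_on_sum:
  assumes "partition_on A \<sigma>" "finite A"
  shows "(\<Sum>B\<in>\<sigma>. \<Sum>b\<in>B. g b) = (\<Sum>a\<in>A. g a :: 'b::comm_monoid_add)"
proof -
  have "(\<Sum>a\<in>\<Union>\<sigma>. g a) = (\<Sum>B\<in>\<sigma>. \<Sum>b\<in>B. g b)"
    using assms by (subst sum.Union_disjoint) (auto simp: partition_on_def disjoint_def finite_UnionD intro: finite_subset)
  then show ?thesis using assms by (simp add: partition_on_def)
qed

lemma partition_on_prod:
  assumes "partition_on A \<sigma>" "finite A"
  shows "(\<Prod>B\<in>\<sigma>. \<Prod>b\<in>B. g b) = (\<Prod>a\<in>A. g a :: 'b::comm_monoid_mult)"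
proof -
  have "(\<Prod>a\<in>\<Union>\<sigma>. g a) = (\<Prod>B\<in>\<sigma>. \<Prod>b\<in>B. g b)"
    using assms by (subst prod.Union_disjoint) (auto simp: partition_on_def disjoint_def finite_UnionD intro: finite_subset)
  then show ?thesis using assms by (simp add: partition_on_def)
qed

lemma partition_on_finite_blocks:
  assumes "partition_on A \<sigma>" "finite A"
  shows "finite \<sigma>" "B \<in> \<sigma> \<Longrightarrow> finite B" "B \<in> \<sigma> \<Longrightarrow> B \<subseteq> A" "B \<in> \<sigma> \<Longrightarrow> 0 < card B"
    "B \<in> \<sigma> \<Longrightarrow> (\<And>a. a \<in> A \<Longrightarrow> 0 < n a) \<Longrightarrow> 0 < (\<Sum>b\<in>B. n b :: nat)"
proof -
  show "finite \<sigma>" using finite_elements[OF assms(2,1)] .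
  show *: "B \<in> \<sigma> \<Longrightarrow> finite B" "B \<in> \<sigma> \<Longrightarrow> B \<subseteq> A" using assms by (auto simp: partition_on_def intro: finite_subset)
  show "B \<in> \<sigma> \<Longrightarrow> 0 < card B" using assms * by (auto simp: partition_on_def card_gt_0_iff)
  show "B \<in> \<sigma> \<Longrightarrow> (\<And>a. a \<in> A \<Longrightarrow> 0 < n a) \<Longrightarrow> 0 < (\<Sum>b\<in>B. n b :: nat)"
    using assms * by (intro sum_pos) (auto simp: partition_on_def)
qed

lemma finite_partitions: "finite A \<Longrightarrow> finite {\<sigma>. partition_on A \<sigma>}"
  by (rule finitely_many_partition_on)

context stable_law
begin

text \<open>Insert 1 as the sum over all partitions of \<open>A\<close> of the probabilities of
  sampling them. This is how partitions of \<open>A\<close> enter on the mixture side, to be matched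
  with those produced by fragmentation.\<close>

lemma Laplace_power:
  assumes "finite A" "0 < l"
  shows "laplace (\<lambda>t. (ennreal (f t) * ennreal t ^ card A)) l
    = (\<Sum>\<sigma> | partition_on A \<sigma>. ennreal ((\<Prod>B\<in>\<sigma>. \<gamma> * pochhammer (1 - \<gamma>) (card B - 1) * l powr (\<gamma> - real (card B))) * exp (- (l powr \<gamma>))))"
proof -
  let ?G = "\<lambda>\<sigma>. (\<Prod>B\<in>\<sigma>. \<gamma> * pochhammer (1 - \<gamma>) (card B - 1) * l powr (\<gamma> - real (card B))) * exp (- (l powr \<gamma>))"
  let ?F = "\<lambda>\<sigma> (t::real). \<integral>\<^sup>+ p. edsum \<sigma> card p \<partial>\<kappa> t"
  let ?\<Pi> = "{\<sigma>. partition_on A \<sigma>}"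
  note blocks = partition_on_finite_blocks[OF _ assms(1)]
  have m: "(\<lambda>t. indicator {0<..} t * (?F \<sigma> t)) \<in> borel_measurable borel" if "\<sigma> \<in> ?\<Pi>" for \<sigma>
    by (rule nn_integral_\<kappa>_measurable) (use blocks(1)[of \<sigma>] that in simp)
  have "laplace (\<lambda>t. (ennreal (f t) * ennreal t ^ card A)) l
     = (\<integral>\<^sup>+ t. (\<Sum>\<sigma>\<in>?\<Pi>. ennreal (f t) * ennreal t ^ card A * (indicator {0<..} t * (?F \<sigma> t)) * ennreal (exp (- l * t))) \<partial>lborel)"
  proof (rule nn_integral_cong, goal_cases)
    case (1 t)
    have "(\<Sum>\<sigma>\<in>?\<Pi>. \<integral>\<^sup>+ p. edsum \<sigma> card p \<partial>\<kappa> t) = 1" if t: "0 < t"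
    proof -
      have "(\<Sum>\<sigma>\<in>?\<Pi>. \<integral>\<^sup>+ p. edsum \<sigma> card p \<partial>\<kappa> t) = (\<integral>\<^sup>+ p. (\<Sum>\<sigma>\<in>?\<Pi>. edsum \<sigma> card p) \<partial>\<kappa> t)"
      proof (rule nn_integral_sum[symmetric])
        fix \<sigma> assume "\<sigma> \<in> ?\<Pi>"
        then have "(\<lambda>p. edsum \<sigma> card p) \<in> borel_measurable borel" using blocks(1)[of \<sigma>] by (intro edsum_measurable) auto
        then show "edsum \<sigma> card \<in> borel_measurable (\<kappa> t)"
          by (subst measurable_cong_sets[OF \<kappa>_sets[OF t] refl])
      qed
      also have "\<dots> = (\<integral>\<^sup>+ p. 1 \<partial>\<kappa> t)"
        using \<kappa>_P_infty[OF t] by (intro nn_integral_cong_AE, eventually_elim) (rule sum_edsum_card[OF _ assms(1)])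
      also have "\<dots> = 1" using prob_space.emeasure_space_1[OF \<kappa>_prob[OF t]] by simp
      finally show ?thesis .
    qed
    then show ?case
      by (simp add: sum_distrib_left[symmetric] sum_distrib_right[symmetric] split: split_indicator)
  qed
  also have "\<dots> = (\<Sum>\<sigma>\<in>?\<Pi>. \<integral>\<^sup>+ t. ennreal (f t) * ennreal t ^ card A * (indicator {0<..} t * (?F \<sigma> t)) * ennreal (exp (- l * t)) \<partial>lborel)"
    by (rule nn_integral_sum) (use m in measurable)
  also have "\<dots> = (\<Sum>\<sigma>\<in>?\<Pi>. ennreal (?G \<sigma>))"
  proof (rule sum.cong, goal_cases)
    case \<sigma>: (2 \<sigma>)
    have c: "(\<Sum>B\<in>\<sigma>. card B) = card A" using partition_on_sum[of A \<sigma> "\<lambda>_. 1::nat"] \<sigma> assms(1) by simp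
    have "(\<integral>\<^sup>+ t. ennreal (f t) * ennreal t ^ card A * (indicator {0<..} t * (?F \<sigma> t)) * ennreal (exp (- l * t)) \<partial>lborel)
       = laplace (\<lambda>t. (ennreal (f t) * ennreal t ^ (\<Sum>B\<in>\<sigma>. card B) * (?F \<sigma> t))) l"
      by (simp add: c mult_ac)
    also have "\<dots> = ennreal (?G \<sigma>)"
      using \<sigma> blocks by (intro Laplace_edsum assms) auto
    finally show ?case .
  qed simp
  finally show ?thesis .
qed

lemma emoment_\<kappa>_borel:
  assumes "finite A" "\<And>a. a \<in> A \<Longrightarrow> 0 < n a"
  shows "(\<lambda>t. indicator {0<..} t * emoment (\<kappa> t) A n) \<in> borel_measurable borel"
  using borel_measurable_continuous_on_indicator[OF _ continuous_emoment[OF assms]] by simp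

end

text \<open>For fixed \<open>u\<close> the integral over \<open>s\<close> is a transform at
  \<open>l * u powr (1 / \<alpha>)\<close>, whose exponential is
  \<open>exp (- (l powr \<alpha>) * u)\<close>. The remaining powers of \<open>u\<close> combine to
  \<open>u ^ card A\<close>, so the outer integral is a transform at
  \<open>l powr \<alpha>\<close>.\<close>

lemma (in stable_mixture) Laplace_mix:
  assumes A: "finite A" "\<And>a. a \<in> A \<Longrightarrow> 0 < n a" and l: "0 < l"
  shows "laplace (\<lambda>y. (ennreal y ^ (\<Sum>a\<in>A. n a) * mix (\<lambda>s. emoment (\<kappa> s) A n) y)) l
    = (\<Sum>\<sigma> | partition_on A \<sigma>. ennreal ((\<Prod>a\<in>A. \<alpha> * pochhammer (1 - \<alpha>) (n a - 1) * l powr (\<alpha> - real (n a)))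
        * (\<Prod>B\<in>\<sigma>. \<gamma> * pochhammer (1 - \<gamma>) (card B - 1) * l powr (\<alpha> * (\<gamma> - real (card B)))) * exp (- (l powr (\<alpha> * \<gamma>)))))"
proof -
  let ?N = "\<Sum>a\<in>A. n a"
  let ?F = "\<lambda>s::real. ennreal (f s) * ennreal s ^ ?N * ennreal (indicator {0<..} s * emoment (\<kappa> s) A n)"
  let ?C = "\<Prod>a\<in>A. \<alpha> * pochhammer (1 - \<alpha>) (n a - 1) * l powr (\<alpha> - real (n a))"
  let ?h = "\<lambda>y. ennreal y ^ ?N * ennreal (exp (- l * y))"
  let ?G = "\<lambda>u::real. \<integral>\<^sub>+ s. ennreal (f s) * ennreal (emoment (\<kappa> s) A n) * ?h (s * u powr (1 / \<alpha>))"
  have C0: "0 \<le> ?C" using A.\<gamma> by (intro prod_nonneg) (auto intro!: mult_nonneg_nonneg pochhammer_nonneg)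
  have inner: "(?G u)
      = ennreal ?C * (ennreal u ^ card A * ennreal (exp (- (l powr \<alpha>) * u)))" if u: "0 < u" for u
  proof -
    let ?v = "u powr (1 / \<alpha>)"
    note [measurable] = A.emoment_\<kappa>_borel[OF A]
    have v: "0 < ?v" using u by simp
    have "(\<integral>\<^sub>+ s. ennreal (f s) * ennreal (emoment (\<kappa> s) A n) * ?h (s * ?v))
       = (\<integral>\<^sup>+ s. ennreal ?v ^ ?N * (indicator {0<..} s * (?F s) * ennreal (exp (- (l * ?v) * s))) \<partial>lborel)"
      using v by (intro nn_integral_cong) (auto simp: ennreal_mult power_mult_distrib mult_ac split: split_indicator)
    also have "\<dots> = ennreal ?v ^ ?N * laplace ?F (l * ?v)"
      by (rule nn_integral_cmult) measurable
    also have "laplace ?F (l * ?v)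
       = (\<integral>\<^sup>+ s. indicator {0<..} s * (ennreal (f s) * ennreal s ^ ?N * (\<integral>\<^sup>+ p. edsum A n p \<partial>\<kappa> s)) * ennreal (exp (- (l * ?v) * s)) \<partial>lborel)"
      by (intro nn_integral_cong) (auto simp: A.emoment_\<kappa>(1)[OF A] split: split_indicator)
    also have "\<dots> = ennreal ((\<Prod>a\<in>A. \<alpha> * pochhammer (1 - \<alpha>) (n a - 1) * (l * ?v) powr (\<alpha> - real (n a))) * exp (- ((l * ?v) powr \<alpha>)))"
      using v l by (intro A.Laplace_edsum A) auto
    also have "(\<Prod>a\<in>A. \<alpha> * pochhammer (1 - \<alpha>) (n a - 1) * (l * ?v) powr (\<alpha> - real (n a))) = ?C * (\<Prod>a\<in>A. u / ?v ^ n a)"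
    proof (subst prod.distrib[symmetric], rule prod.cong)
      fix a
      have "?v powr (\<alpha> - real (n a)) = u / ?v ^ n a"
        unfolding powr_diff powr_realpow[OF v] using u A.\<gamma> by (simp add: powr_powr)
      then show "\<alpha> * pochhammer (1 - \<alpha>) (n a - 1) * (l * ?v) powr (\<alpha> - real (n a))
        = \<alpha> * pochhammer (1 - \<alpha>) (n a - 1) * l powr (\<alpha> - real (n a)) * (u / ?v ^ n a)"
        using l v by (simp add: powr_mult)
    qed simp
    also have "(\<Prod>a\<in>A. u / ?v ^ n a) = u ^ card A / ?v ^ ?N"
      by (simp add: prod_dividef power_sum)
    also have "(l * ?v) powr \<alpha> = l powr \<alpha> * u" using l u A.\<gamma> by (simp add: powr_mult powr_powr)
    also have "ennreal ?v ^ ?N * ennreal (?C * (u ^ card A / ?v ^ ?N) * exp (- (l powr \<alpha> * u))) = ennreal (?v ^ ?N * (?C * (u ^ card A / ?v ^ ?N) * exp (- (l powr \<alpha> * u))))"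
      using v by (simp add: ennreal_power ennreal_mult'[symmetric])
    also have "?v ^ ?N * (?C * (u ^ card A / ?v ^ ?N) * exp (- (l powr \<alpha> * u))) = ?C * (u ^ card A * exp (- (l powr \<alpha> * u)))"
      using u by simp
    finally show ?thesis using u C0 by (simp add: ennreal_mult ennreal_power)
  qed
  have "laplace (\<lambda>y. (ennreal y ^ ?N * mix (\<lambda>s. emoment (\<kappa> s) A n) y)) l
     = (\<integral>\<^sub>+ y. ?h y * mix (\<lambda>s. emoment (\<kappa> s) A n) y)" by (simp add: mult_ac)
  also have "\<dots> = (\<integral>\<^sup>+ u. indicator {0<..} u * ennreal (f' u) *
      (?G u) \<partial>lborel)"
    by (intro nn_integral_mix A.emoment_\<kappa>_borel A) measurable
  also have "\<dots> = (\<integral>\<^sup>+ u. ennreal ?C * (indicator {0<..} u * (ennreal (f' u) * ennreal u ^ card A) * ennreal (exp (- (l powr \<alpha>) * u))) \<partial>lborel)"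
  proof (rule nn_integral_cong, goal_cases)
    case (1 u)
    show ?case
      by (cases "0 < u") (simp_all only: inner, simp_all add: mult_ac)
  qed
  also have "\<dots> = ennreal ?C * laplace (\<lambda>u. (ennreal (f' u) * ennreal u ^ card A)) (l powr \<alpha>)"
    by (rule nn_integral_cmult) measurable
  also have "\<dots> = (\<Sum>\<sigma> | partition_on A \<sigma>. ennreal ?C * ennreal ((\<Prod>B\<in>\<sigma>. \<gamma> * pochhammer (1 - \<gamma>) (card B - 1) * (l powr \<alpha>) powr (\<gamma> - real (card B))) * exp (- ((l powr \<alpha>) powr \<gamma>))))"
    using G.Laplace_power[OF A(1), of "l powr \<alpha>"] l by (simp add: sum_distrib_left)
  finally show ?thesis using C0 l by (simp add: ennreal_mult'[symmetric] powr_powr mult.assoc)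
qed

locale stable_fragmentation =
  stable_mixture \<alpha> N J f \<kappa> "\<beta> / \<alpha>" N' J' f' \<kappa>' + B: stable_law \<beta> N'' J'' f'' \<kappa>''
  for \<alpha> :: real and N :: "'b measure" and J f \<kappa> and \<beta> :: real and N' :: "'b measure" and J' f' \<kappa>' and N'' :: "'b measure" and J'' f'' \<kappa>''
begin

lemma \<beta>_less: "\<beta> < \<alpha>" and gem: "gem_parameters \<alpha> (- \<beta>)"
proof -
  show "\<beta> < \<alpha>" using G.\<gamma> A.\<gamma> by (simp add: divide_simps split: if_splits)
  then show "gem_parameters \<alpha> (- \<beta>)" using A.\<gamma> by unfold_locales auto
qed

text \<open>The elements of \<open>A\<close> stand for the blocks after fragmentation, and \<sigma>
  groups those that lie in the same piece of P. The first factor samples the pieces, the second the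
  splitting inside each piece.\<close>

definition frag_moment :: "'c set \<Rightarrow> ('c \<Rightarrow> nat) \<Rightarrow> real \<Rightarrow> real" where
  "frag_moment A n y = (\<Sum>\<sigma> | partition_on A \<sigma>. emoment (\<kappa>'' y) \<sigma> (\<lambda>B. \<Sum>b\<in>B. n b) * (\<Prod>B\<in>\<sigma>. py_eppf \<alpha> (- \<beta>) B n))"

text \<open>With \<theta> = - \<beta> the numerator of the sampling formula is a rescaled Pochhammer
  symbol: multiplying each factor of the one for \<open>1 - \<beta> / \<alpha>\<close> by \<alpha>
  gives the factors i \<alpha> - \<beta>. The denominator cancels the Pochhammer symbol of the
  \<beta>-stable moment, and the exponents of \<open>l\<close> add up.\<close>

lemma block_identity:
  assumes "finite B" "B \<noteq> {}" "\<And>b. b \<in> B \<Longrightarrow> 0 < n b" "0 < l"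
  shows "\<beta> * pochhammer (1 - \<beta>) ((\<Sum>b\<in>B. n b) - 1) * l powr (\<beta> - real (\<Sum>b\<in>B. n b)) * py_eppf \<alpha> (- \<beta>) B n
    = (\<Prod>b\<in>B. \<alpha> * pochhammer (1 - \<alpha>) (n b - 1) * l powr (\<alpha> - real (n b)))
      * (\<beta> / \<alpha> * pochhammer (1 - \<beta> / \<alpha>) (card B - 1) * l powr (\<alpha> * (\<beta> / \<alpha> - real (card B))))"
proof -
  have p: "pochhammer (1 - \<beta>) k \<noteq> 0" for k using B.\<gamma> pochhammer_pos[of "1 - \<beta>" k] by simp
  have "\<alpha> * \<alpha> ^ k * pochhammer (1 - \<beta> / \<alpha>) k = \<alpha> * (\<Prod>i = 1..<Suc k. real i * \<alpha> - \<beta>)" for k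
  proof (induction k)
    case (Suc k)
    then show ?case using A.\<gamma> by (simp add: pochhammer_Suc field_simps)
  qed simp
  from this[of "card B - 1"] have "\<alpha> ^ card B * pochhammer (1 - \<beta> / \<alpha>) (card B - 1) = \<alpha> * (\<Prod>i = 1..<card B. real i * \<alpha> - \<beta>)"
    using assms(1,2) by (cases "card B") auto
  then have 1: "\<alpha> ^ card B * (\<beta> / \<alpha> * pochhammer (1 - \<beta> / \<alpha>) (card B - 1)) = \<beta> * (\<Prod>i = 1..<card B. - \<beta> + real i * \<alpha>)"
    using A.\<gamma> by (simp add: field_simps)
  have 2: "(\<Prod>b\<in>B. l powr (\<alpha> - real (n b))) = l powr (\<alpha> * real (card B) - real (\<Sum>b\<in>B. n b))"
    using assms(1,4) by (simp add: powr_sum[symmetric] sum_subtractf mult.commute)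
  have 3: "l powr (\<alpha> * real (card B) - real (\<Sum>b\<in>B. n b)) * l powr (\<alpha> * (\<beta> / \<alpha> - real (card B))) = l powr (\<beta> - real (\<Sum>b\<in>B. n b))"
    using A.\<gamma> by (simp add: powr_add[symmetric] algebra_simps)
  have "(\<Prod>b\<in>B. \<alpha> * pochhammer (1 - \<alpha>) (n b - 1) * l powr (\<alpha> - real (n b)))
      * (\<beta> / \<alpha> * pochhammer (1 - \<beta> / \<alpha>) (card B - 1) * l powr (\<alpha> * (\<beta> / \<alpha> - real (card B))))
    = (\<alpha> ^ card B * (\<beta> / \<alpha> * pochhammer (1 - \<beta> / \<alpha>) (card B - 1))) * (\<Prod>b\<in>B. pochhammer (1 - \<alpha>) (n b - 1)) *
      (l powr (\<alpha> * real (card B) - real (\<Sum>b\<in>B. n b)) * l powr (\<alpha> * (\<beta> / \<alpha> - real (card B))))"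
    by (simp only: prod.distrib 2 prod_constant) (simp only: mult_ac)
  also have "\<dots> = \<beta> * (\<Prod>i = 1..<card B. - \<beta> + real i * \<alpha>) * (\<Prod>b\<in>B. pochhammer (1 - \<alpha>) (n b - 1)) * l powr (\<beta> - real (\<Sum>b\<in>B. n b))"
    by (simp only: 1 3)
  finally show ?thesis using p by (simp add: py_eppf_def add.commute)
qed

lemma frag_moment_nonneg:
  assumes A: "finite A" "\<And>a. a \<in> A \<Longrightarrow> 0 < n a" and y: "0 < y"
  shows "0 \<le> frag_moment A n y"
  unfolding frag_moment_def
  using gem_parameters.py_eppf_nonneg[OF gem] y partition_on_finite_blocks[OF _ A(1)] A(2)
  by (intro sum_nonneg mult_nonneg_nonneg prod_nonneg B.emoment_\<kappa>(2)) auto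

lemma continuous_frag_moment:
  assumes A: "finite A" "\<And>a. a \<in> A \<Longrightarrow> 0 < n a"
  shows "continuous_on {0<..} (frag_moment A n)"
  unfolding frag_moment_def[abs_def]
  using partition_on_finite_blocks[OF _ A(1)] A(2)
  by (intro continuous_intros B.continuous_emoment) auto

lemma Laplace_frag_moment:
  assumes A: "finite A" "\<And>a. a \<in> A \<Longrightarrow> 0 < n a" and l: "0 < l"
  shows "laplace (\<lambda>y. (ennreal y ^ (\<Sum>a\<in>A. n a) * ennreal (f'' y * frag_moment A n y))) l
    = (\<Sum>\<sigma> | partition_on A \<sigma>. ennreal ((\<Prod>B\<in>\<sigma>. \<beta> * pochhammer (1 - \<beta>) ((\<Sum>b\<in>B. n b) - 1) * l powr (\<beta> - real (\<Sum>b\<in>B. n b)) * py_eppf \<alpha> (- \<beta>) B n) * exp (- (l powr \<beta>))))"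
proof -
  let ?\<Pi> = "{\<sigma>. partition_on A \<sigma>}"
  let ?N = "\<Sum>a\<in>A. n a"
  let ?n = "\<lambda>B. \<Sum>b\<in>B. n b"
  let ?F = "\<lambda>\<sigma> (y::real). \<integral>\<^sup>+ p. edsum \<sigma> ?n p \<partial>\<kappa>'' y"
  let ?q = "\<lambda>\<sigma>. \<Prod>B\<in>\<sigma>. py_eppf \<alpha> (- \<beta>) B n"
  let ?I = "\<lambda>\<sigma> y. indicator {0<..} y * (ennreal (f'' y) * ennreal y ^ (\<Sum>B\<in>\<sigma>. ?n B) * (?F \<sigma> y)) * ennreal (exp (- l * y))"
  have q0: "0 \<le> ?q \<sigma>" if "\<sigma> \<in> ?\<Pi>" for \<sigma>
    using that gem_parameters.py_eppf_nonneg[OF gem] partition_on_finite_blocks[OF _ A(1)] A(2)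
    by (intro prod_nonneg) auto
  have "laplace (\<lambda>y. (ennreal y ^ ?N * ennreal (f'' y * frag_moment A n y))) l
     = (\<integral>\<^sup>+ y. (\<Sum>\<sigma>\<in>?\<Pi>. ennreal (?q \<sigma>) * ?I \<sigma> y) \<partial>lborel)"
  proof (rule nn_integral_cong, goal_cases)
    case (1 y)
    show ?case
    proof (cases "0 < y")
      case True
      have e: "(?F \<sigma> y) = ennreal (emoment (\<kappa>'' y) \<sigma> ?n)" "0 \<le> emoment (\<kappa>'' y) \<sigma> ?n"
        if "\<sigma> \<in> ?\<Pi>" for \<sigma>
        using that partition_on_finite_blocks[OF _ A(1)] A(2) True by (intro B.emoment_\<kappa>; simp)+
      have "ennreal (frag_moment A n y) = (\<Sum>\<sigma>\<in>?\<Pi>. (?F \<sigma> y) * ennreal (?q \<sigma>))"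
        unfolding frag_moment_def
        by (subst sum_ennreal[symmetric]) (use e q0 in \<open>auto simp: ennreal_mult intro!: sum.cong\<close>)
      then have "indicator {0<..} y * (ennreal y ^ ?N * ennreal (f'' y * frag_moment A n y)) * ennreal (exp (- l * y))
        = (\<Sum>\<sigma>\<in>?\<Pi>. ennreal (?q \<sigma>) * (indicator {0<..} y * (ennreal (f'' y) * ennreal y ^ ?N * (?F \<sigma> y)) * ennreal (exp (- l * y))))"
        using True by (simp add: ennreal_mult' B.f_nonneg sum_distrib_left sum_distrib_right mult_ac)
      also have "\<dots> = (\<Sum>\<sigma>\<in>?\<Pi>. ennreal (?q \<sigma>) * ?I \<sigma> y)"
        by (intro sum.cong refl) (simp add: partition_on_sum[OF _ A(1)])
      finally show ?thesis .
    qed simp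
  qed
  also have "\<dots> = (\<Sum>\<sigma>\<in>?\<Pi>. ennreal (?q \<sigma>) * (\<integral>\<^sup>+ y. ?I \<sigma> y \<partial>lborel))"
  proof -
    have "?I \<sigma> \<in> borel_measurable borel" if "\<sigma> \<in> ?\<Pi>" for \<sigma>
    proof -
      have [measurable]: "(\<lambda>y. indicator {0<..} y * (?F \<sigma> y)) \<in> borel_measurable borel"
        by (rule B.nn_integral_\<kappa>_measurable) (use that partition_on_finite_blocks[OF _ A(1)] in simp)
      have "?I \<sigma> = (\<lambda>y. (indicator {0<..} y * (?F \<sigma> y)) * (ennreal (f'' y) * ennreal y ^ (\<Sum>B\<in>\<sigma>. ?n B) * ennreal (exp (- l * y))))"
        by (simp add: mult_ac)
      also have "\<dots> \<in> borel_measurable borel" by measurable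
      finally show ?thesis .
    qed
    then show ?thesis by (subst nn_integral_sum) (auto intro!: sum.cong nn_integral_cmult)
  qed
  also have "\<dots> = (\<Sum>\<sigma>\<in>?\<Pi>. ennreal ((\<Prod>B\<in>\<sigma>. \<beta> * pochhammer (1 - \<beta>) (?n B - 1) * l powr (\<beta> - real (?n B)) * py_eppf \<alpha> (- \<beta>) B n) * exp (- (l powr \<beta>))))"
  proof (rule sum.cong, goal_cases)
    case \<sigma>: (2 \<sigma>)
    have "(\<integral>\<^sup>+ y. ?I \<sigma> y \<partial>lborel) = ennreal ((\<Prod>B\<in>\<sigma>. \<beta> * pochhammer (1 - \<beta>) (?n B - 1) * l powr (\<beta> - real (?n B))) * exp (- (l powr \<beta>)))"
      using \<sigma> partition_on_finite_blocks[OF _ A(1)] A(2) by (intro B.Laplace_edsum l) auto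
    then show ?case
      by (simp only: ennreal_mult'[OF q0[OF \<sigma>], symmetric]) (simp only: prod.distrib mult_ac)
  qed simp
  finally show ?thesis .
qed

text \<open>Both sides are transformed after multiplication by \<open>y\<close> to the power of the
  sample size, the form in which the moment formulas are available; the factor is cancelled at the
  end.\<close>

lemma mix_eq_frag_moment:
  assumes A: "finite A" "\<And>a. a \<in> A \<Longrightarrow> 0 < n a" and y: "0 < y"
  shows "mix (\<lambda>s. emoment (\<kappa> s) A n) y = ennreal (f'' y * frag_moment A n y)"
proof -
  let ?F = "\<lambda>\<sigma> (l::real). \<Prod>B\<in>\<sigma>. \<beta> * pochhammer (1 - \<beta>) ((\<Sum>b\<in>B. n b) - 1) * l powr (\<beta> - real (\<Sum>b\<in>B. n b)) * py_eppf \<alpha> (- \<beta>) B n"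
  let ?N = "\<Sum>a\<in>A. n a"
  let ?b = "\<lambda>s. emoment (\<kappa> s) A n"
  have b: "continuous_on {0<..} ?b" "\<And>s. 0 < s \<Longrightarrow> 0 \<le> ?b s \<and> ?b s \<le> 1"
    using A.continuous_emoment[OF A] A.emoment_\<kappa>[OF A] by auto
  have c: "continuous_on {0<..} (\<lambda>y. f'' y * frag_moment A n y)"
    by (intro continuous_intros B.f_cont continuous_frag_moment A)
  have c': "continuous_on {0<..} (\<lambda>y. enn2real (mix ?b y))"
    unfolding continuous_on_def
  proof
    fix x :: real assume x: "x \<in> {0<..}"
    have "((\<lambda>y. mix ?b y) \<longlongrightarrow> ennreal (enn2real (mix ?b x))) (at x within {0<..})"
      using continuous_mix[OF b] mix_finite[OF b, of x] x by (simp add: continuous_on_def)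
    then show "((\<lambda>y. enn2real (mix ?b y)) \<longlongrightarrow> enn2real (mix ?b x)) (at x within {0<..})"
      by (rule tendsto_enn2real) simp
  qed
  let ?L = "\<lambda>l. \<Sum>\<sigma> | partition_on A \<sigma>. ennreal ((?F \<sigma> l) * exp (- (l powr \<beta>)))"
  have "y ^ ?N * (f'' y * frag_moment A n y) = y ^ ?N * enn2real (mix ?b y)"
  proof (rule eqI_Laplace[where L = ?L, OF _ _ _ _ _ _ y])
    fix l :: real assume l: "0 < l"
    show "?L l < \<top>" by (simp add: finite_partitions[OF A(1)])
    show "laplace (\<lambda>t. ennreal (t ^ ?N * (f'' t * frag_moment A n t))) l = ?L l"
      by (rule trans[OF _ Laplace_frag_moment[OF A l]], intro nn_integral_cong)
         (auto simp: ennreal_mult' ennreal_power split: split_indicator)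
    have "laplace (\<lambda>t. ennreal (t ^ ?N * enn2real (mix ?b t))) l
      = laplace (\<lambda>t. (ennreal t ^ ?N * mix ?b t)) l"
      by (intro nn_integral_cong) (auto simp: ennreal_mult' ennreal_power mix_finite[OF b] split: split_indicator)
    also have "\<dots> = ?L l"
    proof (rule sym, rule trans[OF _ Laplace_mix[OF A l, symmetric]], intro sum.cong refl arg_cong[where f = ennreal], goal_cases)
      case (1 \<sigma>)
      then have \<sigma>: "partition_on A \<sigma>" by simp
      note bl = partition_on_finite_blocks[OF \<sigma> A(1)]
      have "?F \<sigma> l = (\<Prod>B\<in>\<sigma>. (\<Prod>b\<in>B. \<alpha> * pochhammer (1 - \<alpha>) (n b - 1) * l powr (\<alpha> - real (n b)))
          * (\<beta> / \<alpha> * pochhammer (1 - \<beta> / \<alpha>) (card B - 1) * l powr (\<alpha> * (\<beta> / \<alpha> - real (card B)))))"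
        by (intro prod.cong refl block_identity l) (use bl(2-4) A(2) in \<open>auto simp: card_gt_0_iff subset_iff\<close>)
      then show ?case using A.\<gamma> by (simp only: prod.distrib[of _ _ \<sigma>] partition_on_prod[OF \<sigma> A(1)]) simp
    qed
    finally show "laplace (\<lambda>t. ennreal (t ^ ?N * enn2real (mix ?b t))) l = ?L l" .
  qed (auto intro!: continuous_intros c c' mult_nonneg_nonneg B.f_nonneg frag_moment_nonneg A)
  then show ?thesis using mix_finite[OF b y] y by simp
qed

end

section \<open>Moments of a fragmented sequence\<close>

lemma fragments_psum:
  fixes P :: "nat \<Rightarrow> real" and Q :: "nat \<Rightarrow> nat \<Rightarrow> real"
  assumes P: "p \<in> P_infty" and Q: "\<And>i. q i \<in> P_infty"
  defines "x \<equiv> \<lambda>(i, l). p i * q i l"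
  shows "ranked x \<in> P_infty" "0 < m \<Longrightarrow> psum m (ranked x) = (\<Sum>i. ennreal (p i) ^ m * psum m (q i))"
proof -
  have x0: "0 \<le> x z" for z using P_infty_D(2)[OF P] P_infty_D(2)[OF Q] by (auto simp: x_def split: prod.split)
  have s: "(\<integral>\<^sup>+ z. ennreal (x z) ^ m \<partial>count_space UNIV) = (\<Sum>i. ennreal (p i) ^ m * psum m (q i))" for m
  proof -
    have "(\<integral>\<^sup>+ z. ennreal (x z) ^ m \<partial>count_space UNIV) = (\<integral>\<^sup>+ i. \<integral>\<^sup>+ l. ennreal (x (i, l)) ^ m \<partial>count_space UNIV \<partial>count_space UNIV)"
      by (rule nn_integral_fst_count_space[symmetric])
    also have "\<dots> = (\<Sum>i. \<Sum>l. ennreal (x (i, l)) ^ m)"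
      by (simp add: nn_integral_count_space_nat)
    also have "\<dots> = (\<Sum>i. \<Sum>l. ennreal (p i) ^ m * ennreal (q i l) ^ m)"
      using P_infty_D(2)[OF P] by (simp add: x_def ennreal_mult' power_mult_distrib)
    finally show ?thesis by (simp add: psum_def)
  qed
  have 1: "(\<integral>\<^sup>+ z. ennreal (x z) \<partial>count_space UNIV) = 1"
    using s[of 1] P_infty_D(4)[OF Q] P_infty_D(4)[OF P] by (simp add: psum_def)
  show "ranked x \<in> P_infty" by (rule ranked_in_P_infty[OF x0 1])
  show "psum m (ranked x) = (\<Sum>i. ennreal (p i) ^ m * psum m (q i))" if "0 < m"
    using psum_ranked[of x m, OF x0 _ that] 1 s by simp
qed

text \<open>For a fixed assignment of blocks to pieces the expectation factors by independence:
  distinct blocks use distinct copies of Q because the assignment is injective. Countability of the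
  assignments permits summing afterwards.\<close>

lemma (in prob_space) FRAG_moments:
  assumes g: "gem_parameters \<alpha> \<theta>" and P: "P \<in> borel_measurable M" "AE \<omega> in M. P \<omega> \<in> P_infty"
    and frag: "is_FRAG M \<alpha> \<theta> P X"
  shows "X \<in> borel_measurable M" "AE \<omega> in M. X \<omega> \<in> P_infty"
    "finite A \<Longrightarrow> (\<And>a. a \<in> A \<Longrightarrow> 0 < n a) \<Longrightarrow> (\<integral>\<^sup>+ \<omega>. edsum A n (X \<omega>) \<partial>M)
      = (\<Sum>\<sigma> | partition_on A \<sigma>. (\<integral>\<^sup>+ \<omega>. edsum \<sigma> (\<lambda>B. \<Sum>b\<in>B. n b) (P \<omega>) \<partial>M) * ennreal (\<Prod>B\<in>\<sigma>. py_eppf \<alpha> \<theta> B n))"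
proof -
  interpret g: gem_parameters \<alpha> \<theta> by (rule g)
  obtain Q where ind: "indep_vars (\<lambda>_. borel) (case_option P Q) UNIV"
    and Q: "\<And>i. Q i \<in> borel_measurable M" "\<And>i. distr M borel (Q i) = PD \<alpha> \<theta>"
    and X: "\<And>\<omega>. \<omega> \<in> space M \<Longrightarrow> X \<omega> = ranked (\<lambda>(i, l). P \<omega> i * Q i \<omega> l)"
    using frag by (auto simp: is_FRAG_def has_law_def)
  note [measurable] = P(1) Q(1)
  have [measurable]: "(\<lambda>\<omega>. P \<omega> i) \<in> borel_measurable M" "(\<lambda>\<omega>. Q j \<omega> i) \<in> borel_measurable M" for i j
    by (rule measurable_product_then_coordinatewise; measurable)+
  have "(\<lambda>\<omega>. ranked (\<lambda>z. P \<omega> (fst z) * Q (fst z) \<omega> (snd z))) \<in> borel_measurable M"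
    by (rule ranked_measurable) measurable
  then show Xm: "X \<in> borel_measurable M"
    by (rule measurable_cong[THEN iffD1, rotated]) (simp add: X case_prod_unfold)
  have "AE \<omega> in M. Q i \<omega> \<in> P_infty" for i
    using g.AE_PD unfolding Q(2)[of i, symmetric] by (rule AE_distrD[OF Q(1)])
  then have AEQ: "AE \<omega> in M. \<forall>i. Q i \<omega> \<in> P_infty" by (simp add: AE_all_countable)
  show AEX: "AE \<omega> in M. X \<omega> \<in> P_infty"
    using AEQ P(2) AE_space by eventually_elim (simp add: X fragments_psum(1))
  assume A: "finite A" "\<And>a. a \<in> A \<Longrightarrow> 0 < n a"
  let ?\<Pi> = "{\<sigma>. partition_on A \<sigma>}"
  let ?n = "\<lambda>B. \<Sum>b\<in>B. n b"
  let ?F = "\<lambda>\<sigma>. \<integral>\<^sup>+ \<omega>. edsum \<sigma> ?n (P \<omega>) \<partial>M"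
  let ?q = "\<lambda>\<sigma>. \<Prod>B\<in>\<sigma>. py_eppf \<alpha> \<theta> B n"
  let ?w = "\<lambda>\<omega> B i. ennreal (P \<omega> i) ^ ?n B * edsum B n (Q i \<omega>)"
  have em: "(\<lambda>\<omega>. edsum B n (Q i \<omega>)) \<in> borel_measurable M" if "finite B" for B :: "'b set" and i
    by (rule edsum_measurable[OF that]) measurable
  have "(\<integral>\<^sup>+ \<omega>. edsum A n (X \<omega>) \<partial>M) = (\<integral>\<^sup>+ \<omega>. (\<Sum>\<sigma>\<in>?\<Pi>. dsum \<sigma> (?w \<omega>)) \<partial>M)"
  proof (rule nn_integral_cong_AE)
    show "AE \<omega> in M. edsum A n (X \<omega>) = (\<Sum>\<sigma>\<in>?\<Pi>. dsum \<sigma> (?w \<omega>))"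
      using AEQ P(2) AE_space
    proof eventually_elim
      case (elim \<omega>)
      have PX: "X \<omega> \<in> P_infty" using elim by (simp add: X fragments_psum(1))
      show ?case
      proof (rule edsum_fragments[OF A])
        fix m :: nat assume "0 < m"
        then show "psum m (X \<omega>) = (\<Sum>i. ennreal (P \<omega> i) ^ m * psum m (Q i \<omega>))"
          using elim by (simp add: X fragments_psum(2))
        show "psum m (X \<omega>) < \<top>" using P_infty_D(5)[OF PX \<open>0 < m\<close>] by (auto intro: le_less_trans)
      qed
    qed
  qed
  also have "\<dots> = (\<Sum>\<sigma>\<in>?\<Pi>. \<integral>\<^sup>+ \<omega>. dsum \<sigma> (?w \<omega>) \<partial>M)"
    using partition_on_finite_blocks[OF _ A(1)]
    by (intro nn_integral_sum dsum_measurable borel_measurable_times_ennreal em) auto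
  also have "\<dots> = (\<Sum>\<sigma>\<in>?\<Pi>. (?F \<sigma>) * ennreal (?q \<sigma>))"
  proof (rule sum.cong, goal_cases)
    case (2 \<sigma>)
    then have \<sigma>: "partition_on A \<sigma>" by simp
    note bl = partition_on_finite_blocks[OF \<sigma> A(1)]
    have cnt: "countable (\<sigma> \<rightarrow>\<^sub>E (UNIV :: nat set))" using bl(1) by (intro countable_PiE) auto
    let ?v = "\<lambda>I \<omega>. \<Prod>B\<in>\<sigma>. ennreal (P \<omega> (I B)) ^ ?n B"
    have step: "(\<integral>\<^sup>+ \<omega>. (\<Prod>B\<in>\<sigma>. ?w \<omega> B (I B)) \<partial>M) = (\<integral>\<^sup>+ \<omega>. ?v I \<omega> \<partial>M) * ennreal (?q \<sigma>)" if I: "inj_on I \<sigma>" for I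
    proof -
      \<comment> \<open>The variables that actually occur: P and the copies assigned to the blocks.
        By injectivity \<open>inv_into\<close> recovers the block to which a copy belongs.\<close>
      let ?K = "insert None (Some ` I ` \<sigma>)"
      let ?Y = "\<lambda>k p. case k of None \<Rightarrow> (\<Prod>B\<in>\<sigma>. ennreal (p (I B)) ^ ?n B) | Some i \<Rightarrow> edsum (inv_into \<sigma> I i) n p"
      have "indep_vars (\<lambda>_. borel) (case_option P Q) ?K" by (rule indep_vars_subset[OF ind]) simp
      then have "indep_vars (\<lambda>_. borel) (\<lambda>k \<omega>. ?Y k (case_option P Q k \<omega>)) ?K"
      proof (rule indep_vars_compose2)
        fix k assume "k \<in> ?K"
        have [measurable]: "(\<lambda>p :: nat \<Rightarrow> real. p i) \<in> borel_measurable borel" for i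
          by (rule measurable_product_then_coordinatewise) simp
        show "?Y k \<in> measurable borel borel"
        proof (cases k)
          case None
          then show ?thesis by simp
        next
          case (Some i)
          then have "inv_into \<sigma> I i \<in> \<sigma>" using \<open>k \<in> ?K\<close> by (auto intro: inv_into_into)
          then have "(\<lambda>p. edsum (inv_into \<sigma> I i) n p) \<in> borel_measurable borel" using bl(2) by (intro edsum_measurable) auto
          then show ?thesis using Some by simp
        qed
      qed
      then have "(\<integral>\<^sup>+ \<omega>. (\<Prod>k\<in>?K. ?Y k (case_option P Q k \<omega>)) \<partial>M)
          = (\<Prod>k\<in>?K. \<integral>\<^sup>+ \<omega>. ?Y k (case_option P Q k \<omega>) \<partial>M)"
        using bl(1) by (intro indep_vars_nn_integral) auto
      then have "(\<integral>\<^sup>+ \<omega>. ?v I \<omega> * (\<Prod>B\<in>\<sigma>. edsum B n (Q (I B) \<omega>)) \<partial>M) = (\<integral>\<^sup>+ \<omega>. ?v I \<omega> \<partial>M) * (\<Prod>B\<in>\<sigma>. \<integral>\<^sup>+ \<omega>. edsum B n (Q (I B) \<omega>) \<partial>M)"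
        using bl(1) I by (subst (asm) (1 2) prod.insert) (auto simp: prod.reindex)
      also have "(\<Prod>B\<in>\<sigma>. \<integral>\<^sup>+ \<omega>. edsum B n (Q (I B) \<omega>) \<partial>M) = (\<Prod>B\<in>\<sigma>. ennreal (py_eppf \<alpha> \<theta> B n))"
      proof (rule prod.cong, goal_cases)
        case B: (2 B)
        have "(\<integral>\<^sup>+ \<omega>. edsum B n (Q (I B) \<omega>) \<partial>M) = (\<integral>\<^sup>+ p. edsum B n p \<partial>distr M borel (Q (I B)))"
          using bl(2)[OF B] by (subst nn_integral_distr) (auto intro!: edsum_measurable)
        also have "\<dots> = ennreal (py_eppf \<alpha> \<theta> B n)"
          unfolding Q(2) using bl(2,3)[OF B] A(2) by (intro g.nn_integral_edsum_PD) auto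
        finally show ?case .
      qed simp
      finally show ?thesis by (simp add: prod.distrib prod_ennreal g.py_eppf_nonneg)
    qed
    have "(\<integral>\<^sup>+ \<omega>. dsum \<sigma> (?w \<omega>) \<partial>M)
       = (\<integral>\<^sup>+ I. \<integral>\<^sup>+ \<omega>. (if inj_on I \<sigma> then \<Prod>B\<in>\<sigma>. ?w \<omega> B (I B) else 0) \<partial>M \<partial>count_space (\<sigma> \<rightarrow>\<^sub>E UNIV))"
      unfolding dsum_def
    proof (rule nn_integral_count_space_nn_integral[OF cnt])
      fix I :: "'b set \<Rightarrow> nat"
      have "(\<lambda>\<omega>. \<Prod>B\<in>\<sigma>. ?w \<omega> B (I B)) \<in> borel_measurable M"
        by (intro borel_measurable_prod_ennreal borel_measurable_times_ennreal em bl(2)) auto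
      then show "(\<lambda>\<omega>. if inj_on I \<sigma> then \<Prod>B\<in>\<sigma>. ?w \<omega> B (I B) else 0) \<in> borel_measurable M" by simp
    qed
    also have "\<dots> = (\<integral>\<^sup>+ I. (\<integral>\<^sup>+ \<omega>. (if inj_on I \<sigma> then ?v I \<omega> else 0) \<partial>M) * ennreal (?q \<sigma>) \<partial>count_space (\<sigma> \<rightarrow>\<^sub>E UNIV))"
    proof (rule nn_integral_cong, goal_cases)
      case (1 I)
      show ?case
        by (cases "inj_on I \<sigma>") (simp_all only: if_True if_False step, simp)
    qed
    also have "\<dots> = (\<integral>\<^sup>+ I. \<integral>\<^sup>+ \<omega>. (if inj_on I \<sigma> then ?v I \<omega> else 0) \<partial>M \<partial>count_space (\<sigma> \<rightarrow>\<^sub>E UNIV)) * ennreal (?q \<sigma>)"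
      by (rule nn_integral_multc) simp
    also have "(\<integral>\<^sup>+ I. \<integral>\<^sup>+ \<omega>. (if inj_on I \<sigma> then ?v I \<omega> else 0) \<partial>M \<partial>count_space (\<sigma> \<rightarrow>\<^sub>E UNIV)) = (?F \<sigma>)"
      unfolding edsum_def dsum_def
      by (intro nn_integral_count_space_nn_integral[OF cnt, symmetric]) auto
    finally show ?case .
  qed simp
  finally show "(\<integral>\<^sup>+ \<omega>. edsum A n (X \<omega>) \<partial>M) = (\<Sum>\<sigma>\<in>?\<Pi>. (?F \<sigma>) * ennreal (?q \<sigma>))" .
qed

section \<open>The law after fragmentation\<close>

context stable_fragmentation
begin

definition mixed :: "real \<Rightarrow> (nat \<Rightarrow> real) measure" where
  "mixed y = bind (density (restrict_space lborel {0<..}) (\<lambda>s. ennreal (mix_kernel y s / f'' y))) \<kappa>"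

lemma
  fixes y :: real
  defines "D \<equiv> density (restrict_space lborel {0<..}) (\<lambda>s. ennreal (mix_kernel y s / f'' y))"
  shows sets_mixed: "sets (mixed y) = sets borel"
    and nn_integral_mixed: "g \<in> borel_measurable borel \<Longrightarrow> (\<integral>\<^sup>+ p. g p \<partial>mixed y)
      = (\<integral>\<^sub>+ s. (\<integral>\<^sup>+ p. g p \<partial>\<kappa> s) * ennreal (mix_kernel y s / f'' y))"
proof -
  have k: "\<kappa> \<in> D \<rightarrow>\<^sub>M subprob_algebra borel"
    using A.\<kappa>_measurable' unfolding D_def
    by (simp cong: measurable_cong_sets sets_restrict_space_cong)
  have "space D = {0<..}" by (simp add: D_def space_restrict_space)
  then have ne: "space D \<noteq> {}" by auto
  show "sets (mixed y) = sets borel"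
    unfolding mixed_def D_def[symmetric] using ne by (intro sets_bind) (auto simp: sets_kernel[OF k])
  assume g: "g \<in> borel_measurable borel"
  have gm: "(\<lambda>s. \<integral>\<^sup>+ p. g p \<partial>\<kappa> s) \<in> borel_measurable (restrict_space lborel {0<..})"
    using measurable_compose[OF k nn_integral_measurable_subprob_algebra[OF g]] by (simp add: D_def)
  have "(\<integral>\<^sup>+ p. g p \<partial>mixed y) = (\<integral>\<^sup>+ s. \<integral>\<^sup>+ p. g p \<partial>\<kappa> s \<partial>D)"
    unfolding mixed_def D_def[symmetric] by (rule nn_integral_bind[OF g k])
  also have "\<dots> = (\<integral>\<^sup>+ s. ennreal (mix_kernel y s / f'' y) * (\<integral>\<^sup>+ p. g p \<partial>\<kappa> s) \<partial>restrict_space lborel {0<..})"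
    unfolding D_def by (rule nn_integral_density[OF _ gm]) (intro measurable_restrict_space1, measurable)
  also have "\<dots> = (\<integral>\<^sup>+ s. ennreal (mix_kernel y s / f'' y) * (\<integral>\<^sup>+ p. g p \<partial>\<kappa> s) * indicator {0<..} s \<partial>lborel)"
    by (rule nn_integral_restrict_space) simp
  finally show "(\<integral>\<^sup>+ p. g p \<partial>mixed y)
      = (\<integral>\<^sub>+ s. (\<integral>\<^sup>+ p. g p \<partial>\<kappa> s) * ennreal (mix_kernel y s / f'' y))"
    by (simp add: mult_ac)
qed

lemma nn_integral_edsum_mixed:
  assumes A: "finite A" "\<And>a. a \<in> A \<Longrightarrow> 0 < n a" and y: "0 < y" and pos: "0 < f'' y"
  shows "(\<integral>\<^sup>+ p. edsum A n p \<partial>mixed y) = ennreal (frag_moment A n y)"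
proof -
  let ?F = "\<integral>\<^sup>+ s. ennreal (indicator {0<..} s * emoment (\<kappa> s) A n) * ennreal (mix_kernel y s) \<partial>lborel"
  have "(\<lambda>p. edsum A n p) \<in> borel_measurable borel" using A(1) by (intro edsum_measurable) auto
  then have "(\<integral>\<^sup>+ p. edsum A n p \<partial>mixed y)
      = (\<integral>\<^sub>+ s. (\<integral>\<^sup>+ p. edsum A n p \<partial>\<kappa> s) * ennreal (mix_kernel y s / f'' y))"
    by (rule nn_integral_mixed)
  also have "\<dots> = (\<integral>\<^sup>+ s. ennreal (1 / f'' y) * (ennreal (indicator {0<..} s * emoment (\<kappa> s) A n) * ennreal (mix_kernel y s)) \<partial>lborel)"
  proof (rule nn_integral_cong, goal_cases)
    case (1 s)
    have "ennreal (mix_kernel y s / f'' y) = ennreal (1 / f'' y) * ennreal (mix_kernel y s)"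
      using pos by (subst ennreal_mult'[symmetric]) auto
    then show ?case
      using A.emoment_\<kappa>(1)[where t = s, OF A] by (cases "0 < s") (simp_all add: mult_ac)
  qed
  also have "\<dots> = ennreal (1 / f'' y) * ?F"
    using A.emoment_\<kappa>_borel[OF A] by (intro nn_integral_cmult) simp
  also have "?F = mix (\<lambda>s. emoment (\<kappa> s) A n) y"
    unfolding mix_def by (intro nn_integral_cong) (auto split: split_indicator)
  also have "\<dots> = ennreal (f'' y * frag_moment A n y)" by (rule mix_eq_frag_moment[OF A y])
  finally show ?thesis using pos by (simp add: ennreal_mult'[symmetric])
qed

lemma law_eq_mixed:
  assumes y: "0 < y" and pos: "0 < f'' y" and L: "prob_space L" "sets L = sets borel" "AE p in L. p \<in> P_infty"
    and mom: "\<And>A n. finite A \<Longrightarrow> (\<And>a. a \<in> A \<Longrightarrow> 0 < n a) \<Longrightarrow> (\<integral>\<^sup>+ p. edsum (A :: nat set) n p \<partial>L) = ennreal (frag_moment A n y)"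
  shows "L = mixed y"
proof (rule measure_eqI_edsum)
  show "sets (mixed y) = sets borel" by (rule sets_mixed)
  interpret prob_space L by (rule L)
  show "finite_measure L" by (rule finite_measure_axioms)
  \<comment> \<open>The total mass of the mixture is the moment for the empty sample; this gives
    finiteness before the measure is known to be a probability.\<close>
  have "emeasure (mixed y) (space (mixed y)) = (\<integral>\<^sup>+ p. edsum ({} :: nat set) (\<lambda>_. 1) p \<partial>mixed y)" by simp
  also have "\<dots> = ennreal (frag_moment ({} :: nat set) (\<lambda>_. 1) y)" by (rule nn_integral_edsum_mixed[OF _ _ y pos]) auto
  finally show "finite_measure (mixed y)" by (intro finite_measureI) simp
  have "(\<integral>\<^sup>+ p. indicator (- P_infty) p \<partial>mixed y)
      = (\<integral>\<^sub>+ s. (\<integral>\<^sup>+ p. indicator (- P_infty) p \<partial>\<kappa> s) * ennreal (mix_kernel y s / f'' y))"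
    using P_infty_measurable by (intro nn_integral_mixed) auto
  also have "\<dots> = (\<integral>\<^sup>+ s. 0 \<partial>(lborel :: real measure))"
  proof (rule nn_integral_cong, goal_cases)
    case (1 s)
    have "(\<integral>\<^sup>+ p. indicator (- P_infty) p \<partial>\<kappa> s) = (\<integral>\<^sup>+ p. 0 \<partial>\<kappa> s)" if "0 < s"
      using A.\<kappa>_P_infty[OF that] by (intro nn_integral_cong_AE) auto
    then show ?case
      by (cases "0 < s") simp_all
  qed
  finally have "emeasure (mixed y) (- P_infty) = 0"
    using P_infty_measurable sets_mixed by (subst nn_integral_indicator[symmetric]) (auto simp: pred_def)
  then show "AE p in mixed y. p \<in> P_infty"
    using P_infty_measurable sets_mixed by (intro AE_I[of _ _ "- P_infty"]) (auto simp: pred_def)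
  show "(\<integral>\<^sup>+ x. edsum A n x \<partial>L) = (\<integral>\<^sup>+ x. edsum A n x \<partial>mixed y)" if "finite (A :: nat set)" "\<And>a. a \<in> A \<Longrightarrow> 0 < n a" for A n
    using mom[OF that] nn_integral_edsum_mixed[OF that y pos] by simp
qed (use L in auto)

lemma FRAG_moments_cond:
  assumes M: "prob_space M" and y: "0 < y" and P: "has_law M P (\<kappa>'' y)" and frag: "is_FRAG M \<alpha> (- \<beta>) P X"
    and A: "finite A" "\<And>a. a \<in> A \<Longrightarrow> 0 < n a"
  shows "X \<in> borel_measurable M" "AE \<omega> in M. X \<omega> \<in> P_infty"
    "(\<integral>\<^sup>+ p. edsum A n p \<partial>distr M borel X) = ennreal (frag_moment A n y)"
proof -
  let ?F = "\<lambda>B. \<Sum>b\<in>B. n b"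
  interpret M: prob_space M by (rule M)
  have Pm: "P \<in> borel_measurable M" and L: "distr M borel P = \<kappa>'' y" using P by (auto simp: has_law_def)
  have "AE \<omega> in M. P \<omega> \<in> P_infty"
    using B.\<kappa>_P_infty[OF y] unfolding L[symmetric] by (rule AE_distrD[OF Pm])
  note X = M.FRAG_moments[OF gem Pm this frag]
  show "X \<in> borel_measurable M" "AE \<omega> in M. X \<omega> \<in> P_infty" by (rule X)+
  have "(\<integral>\<^sup>+ p. edsum A n p \<partial>distr M borel X) = (\<integral>\<^sup>+ \<omega>. edsum A n (X \<omega>) \<partial>M)"
    using A(1) by (intro nn_integral_distr X edsum_measurable) auto
  also have "\<dots> = (\<Sum>\<sigma> | partition_on A \<sigma>. (\<integral>\<^sup>+ \<omega>. edsum \<sigma> ?F (P \<omega>) \<partial>M) * ennreal (\<Prod>B\<in>\<sigma>. py_eppf \<alpha> (- \<beta>) B n))"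
    by (rule X(3)[OF A])
  also have "\<dots> = (\<Sum>\<sigma> | partition_on A \<sigma>. ennreal (emoment (\<kappa>'' y) \<sigma> ?F * (\<Prod>B\<in>\<sigma>. py_eppf \<alpha> (- \<beta>) B n)))"
  proof (rule sum.cong, goal_cases)
    case (2 \<sigma>)
    then have \<sigma>: "partition_on A \<sigma>" by simp
    note bl = partition_on_finite_blocks[OF \<sigma> A(1)]
    have "(\<integral>\<^sup>+ \<omega>. edsum \<sigma> ?F (P \<omega>) \<partial>M) = (\<integral>\<^sup>+ p. edsum \<sigma> ?F p \<partial>distr M borel P)"
      using bl(1) by (intro nn_integral_distr[symmetric] Pm edsum_measurable) auto
    also have "\<dots> = ennreal (emoment (\<kappa>'' y) \<sigma> ?F)"
      unfolding L using bl A(2) y by (intro B.emoment_\<kappa>(1)) auto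
    finally show ?case
      by (simp add: ennreal_mult'' prod_nonneg gem_parameters.py_eppf_nonneg[OF gem])
  qed simp
  also have "\<dots> = ennreal (frag_moment A n y)"
    unfolding frag_moment_def
    by (rule sum_ennreal)
       (use partition_on_finite_blocks[OF _ A(1)] A(2) y in \<open>auto intro!: mult_nonneg_nonneg B.emoment_\<kappa>(2) prod_nonneg gem_parameters.py_eppf_nonneg[OF gem]\<close>)
  finally show "(\<integral>\<^sup>+ p. edsum A n p \<partial>distr M borel X) = ennreal (frag_moment A n y)" .
qed

end

subsection \<open>Hermite functions\<close>

lemma nn_integral_gaussian:
  assumes b: "0 < b"
  shows "(\<integral>\<^sup>+ x. ennreal (exp (- (b * x\<^sup>2))) \<partial>lborel) = ennreal (sqrt (pi / b))"
proof -
  let ?\<sigma> = "1 / sqrt (2 * b)"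
  have \<sigma>2: "?\<sigma>\<^sup>2 = 1 / (2 * b)" using b by (simp add: power_divide)
  have *: "exp (- (b * x\<^sup>2)) = sqrt (pi / b) * normal_density 0 ?\<sigma> x" for x
    unfolding normal_density_def \<sigma>2 using b by (simp add: real_sqrt_divide)
  interpret prob_space "density lborel (normal_density 0 ?\<sigma>)"
    by (rule prob_space_normal_density) (use b in simp)
  have "(\<integral>\<^sup>+ x. ennreal (normal_density 0 ?\<sigma> x) \<partial>lborel) = 1"
    using emeasure_space_1 by (simp add: emeasure_density)
  then show ?thesis
    unfolding * using b by (subst ennreal_mult) (auto simp: nn_integral_cmult)
qed

text \<open>Averaging with the reflection of \<open>t\<close> replaces \<open>exp t\<close> by half
  the derivative of \<open>?\<phi>\<close>, and the exponent is a constant minus \<open>b\<close>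
  times the square of \<open>?\<phi>\<close>. The substitution leaves a Gaussian integral.\<close>

lemma nn_integral_exp_cosh:
  assumes b: "0 < b"
  shows "(\<integral>\<^sup>+ t. ennreal (exp (- (b * (exp (2 * t) + exp (- (2 * t))))) * exp t) \<partial>lborel)
    = ennreal (exp (- (2 * b)) * sqrt (pi / b) / 2)"
proof -
  let ?F = "\<lambda>t. exp (- (b * (exp (2 * t) + exp (- (2 * t)))))"
  let ?I = "\<integral>\<^sup>+ t. ennreal (?F t * exp t) \<partial>lborel"
  let ?\<phi> = "\<lambda>t::real. exp t - exp (- t)"
  have "?I = (\<integral>\<^sup>+ t. ennreal (?F t * exp (- t)) \<partial>lborel)"
  proof -
    have "?F (- t) = ?F t" for t using add.commute[of "exp (2 * t)" "exp (- (2 * t))"] by simp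
    moreover have "?I = (\<integral>\<^sup>+ t. ennreal (?F (- t) * exp (- t)) \<partial>lborel)"
      by (subst nn_integral_real_affine[of _ "- 1" 0]) simp_all
    ultimately show ?thesis by (simp only:)
  qed
  note IJ = this
  have "2 * ?I = (\<integral>\<^sup>+ t. ennreal (?F t * exp t) \<partial>lborel) + (\<integral>\<^sup>+ t. ennreal (?F t * exp (- t)) \<partial>lborel)"
    by (rule trans[OF mult_2 arg_cong2[where f = "(+)", OF refl IJ]])
  also have "\<dots> = (\<integral>\<^sup>+ t. ennreal (?F t * exp t) + ennreal (?F t * exp (- t)) \<partial>lborel)"
    by (rule nn_integral_add[symmetric]) measurable
  also have "\<dots> = (\<integral>\<^sup>+ t. ennreal (exp (- (2 * b)) * exp (- (b * (?\<phi> t)\<^sup>2))) * ennreal (exp t + exp (- t)) \<partial>lborel)"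
  proof (rule nn_integral_cong, goal_cases)
    case (1 t)
    have "exp (- (2 * b)) * exp (- (b * (?\<phi> t)\<^sup>2)) = ?F t"
    proof -
      have *: "(?\<phi> t)\<^sup>2 = exp (2 * t) + exp (- (2 * t)) - 2"
        by (simp add: power2_diff exp_double[symmetric] exp_minus power_inverse[symmetric]) (simp add: exp_double power_inverse)
      show ?thesis unfolding exp_add[symmetric] * by (simp add: algebra_simps)
    qed
    then show ?case
      by (simp add: ennreal_plus[symmetric] ennreal_mult'[symmetric] distrib_left del: ennreal_plus)
  qed
  also have "\<dots> = (\<integral>\<^sup>+ s. indicator (range ?\<phi>) s * ennreal (exp (- (2 * b)) * exp (- (b * s\<^sup>2))) \<partial>lborel)"
  proof (rule nn_integral_mono_substitution[symmetric])
    have "s \<in> range ?\<phi>" for s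
    proof
      show "s = ?\<phi> (arsinh (s / 2))"
        using sinh_arsinh_real[of "s / 2"] by (simp add: sinh_field_def)
    qed simp
    then have "range ?\<phi> = UNIV" by blast
    then show "range ?\<phi> \<in> sets borel" by simp
  qed (auto intro!: derivative_eq_intros continuous_intros add_nonneg_nonneg)
  also have "\<dots> = (\<integral>\<^sup>+ s. ennreal (exp (- (2 * b))) * ennreal (exp (- (b * s\<^sup>2))) \<partial>lborel)"
  proof (rule nn_integral_cong, goal_cases)
    case (1 s)
    have "s = ?\<phi> (arsinh (s / 2))" using sinh_arsinh_real[of "s / 2"] by (simp add: sinh_field_def)
    then have "s \<in> range ?\<phi>" by blast
    then show ?case
      by (simp add: ennreal_mult)
  qed
  also have "\<dots> = ennreal (exp (- (2 * b)) * sqrt (pi / b))"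
    using b by (simp add: nn_integral_cmult nn_integral_gaussian ennreal_mult)
  also have "\<dots> = 2 * ennreal (exp (- (2 * b)) * sqrt (pi / b) / 2)"
    using b by (subst ennreal_numeral[symmetric], subst ennreal_mult[symmetric]) auto
  finally show ?thesis by (subst (asm) ennreal_mult_cancel_left) auto
qed

text \<open>The substitution \<open>y = r * exp (2 * t)\<close> with this \<open>r\<close> balances
  the two exponents: both get the coefficient \<open>b\<close>, which is the symmetric situation of
  \<open>nn_integral_exp_cosh\<close>.\<close>

lemma nn_integral_exp_reciprocal:
  assumes c: "0 < c" and l: "0 < l"
  shows "(\<integral>\<^sub>+ y. ennreal (1 / sqrt (pi * y) * exp (- (c\<^sup>2 / (4 * y)))) * ennreal (exp (- l * y)))
    = ennreal (exp (- (c * sqrt l)) / sqrt l)"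
proof -
  define r where "r = c / (2 * sqrt l)"
  define b where "b = c * sqrt l / 2"
  let ?F = "\<lambda>t::real. exp (- (b * (exp (2 * t) + exp (- (2 * t))))) * exp t"
  have r: "0 < r" and b: "0 < b" using c l by (auto simp: r_def b_def)
  let ?\<phi> = "\<lambda>t. r * exp (2 * t)"
  have rng: "range ?\<phi> = {0<..}"
  proof -
    have "y \<in> range ?\<phi>" if "0 < y" for y
    proof
      show "y = ?\<phi> (ln (y / r) / 2)" using that r by simp
    qed simp
    then show ?thesis using r by auto
  qed
  have "(\<integral>\<^sub>+ y. ennreal (1 / sqrt (pi * y) * exp (- (c\<^sup>2 / (4 * y)))) * ennreal (exp (- l * y)))
    = (\<integral>\<^sup>+ t. ennreal (1 / sqrt (pi * ?\<phi> t) * exp (- (c\<^sup>2 / (4 * ?\<phi> t)))) * ennreal (exp (- l * ?\<phi> t)) * ennreal (r * (exp (2 * t) * 2)) \<partial>lborel)"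
    unfolding rng[symmetric]
    by (rule nn_integral_mono_substitution)
       (auto simp: rng less_imp_le[OF r] intro!: derivative_eq_intros continuous_intros)
  also have "\<dots> = (\<integral>\<^sup>+ t. ennreal (2 * sqrt (r / pi)) * ennreal (?F t) \<partial>lborel)"
  proof (rule nn_integral_cong, goal_cases)
    case (1 t)
    have e1: "c\<^sup>2 / (4 * ?\<phi> t) = b * exp (- (2 * t))"
      using c l by (simp add: r_def b_def exp_minus field_simps power2_eq_square)
    have e2: "l * ?\<phi> t = b * exp (2 * t)"
      using l by (simp add: r_def b_def field_simps)
    have s: "sqrt (pi * ?\<phi> t) = sqrt (pi * r) * exp t" using exp_double[of t] by (simp add: real_sqrt_mult)
    have "1 / sqrt (pi * ?\<phi> t) * (r * (exp (2 * t) * 2)) = 2 * sqrt (r / pi) * exp t"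
    proof -
      have "r = sqrt r * sqrt r" "exp (2 * t) = exp t * exp t" using r exp_double[of t] by (simp_all add: power2_eq_square)
      then have "r * exp (2 * t) = sqrt r * sqrt r * (exp t * exp t)" by metis
      then show ?thesis unfolding s using r by (simp add: real_sqrt_mult real_sqrt_divide field_simps)
    qed
    note u = this
    have v: "exp (- (c\<^sup>2 / (4 * ?\<phi> t))) * exp (- l * ?\<phi> t) = exp (- (b * (exp (2 * t) + exp (- (2 * t)))))"
      using e1 e2 by (simp add: exp_add[symmetric] algebra_simps)
    have "(1 / sqrt (pi * ?\<phi> t) * exp (- (c\<^sup>2 / (4 * ?\<phi> t)))) * exp (- l * ?\<phi> t) * (r * (exp (2 * t) * 2))
      = 2 * sqrt (r / pi) * (?F t)"
    proof -
      have *: "(u * e) * e' * w = (u * w) * (e * e')" for u e e' w :: real by (simp only: mult_ac)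
      show ?thesis
        unfolding *[of "1 / sqrt (pi * ?\<phi> t)" "exp (- (c\<^sup>2 / (4 * ?\<phi> t)))" "exp (- l * ?\<phi> t)" "r * (exp (2 * t) * 2)"] u v
        by (simp only: mult_ac)
    qed
    then show ?case
    proof -
      have e: "ennreal a * ennreal b * ennreal c = ennreal (a * b * c)" if "0 \<le> a" "0 \<le> b" "0 \<le> c" for a b c
        using that by (simp add: ennreal_mult)
      have "ennreal (2 * sqrt (r / pi)) * ennreal (?F t)
        = ennreal (2 * sqrt (r / pi) * (?F t))"
        using r by (intro ennreal_mult[symmetric]) auto
      then show ?thesis
        unfolding \<open>_ = 2 * sqrt (r / pi) * (exp (- (b * (exp (2 * t) + exp (- (2 * t))))) * exp t)\<close>[symmetric]
        using r by (subst e) auto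
    qed
  qed
  also have "\<dots> = ennreal (2 * sqrt (r / pi)) * ennreal (exp (- (2 * b)) * sqrt (pi / b) / 2)"
    by (subst nn_integral_cmult) (auto simp: nn_integral_exp_cosh[OF b])
  also have "\<dots> = ennreal (2 * sqrt (r / pi) * (exp (- (2 * b)) * sqrt (pi / b) / 2))"
    using r b by (intro ennreal_mult[symmetric]) auto
  also have "2 * sqrt (r / pi) * (exp (- (2 * b)) * sqrt (pi / b) / 2) = exp (- (2 * b)) * sqrt (r / pi * (pi / b))"
    by (simp only: real_sqrt_mult[of "r / pi" "pi / b"]) simp
  also have "r / pi * (pi / b) = 1 / l"
    using c l by (simp add: r_def b_def field_simps)
  finally show ?thesis using l by (simp add: b_def real_sqrt_divide)
qed

text \<open>The Levy density. The comparison is made for \<open>y * f y\<close>, whose transform is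
  the preceding integral with \<open>c = 1\<close>.\<close>

lemma (in stable_law) f_half:
  assumes half: "\<gamma> = 1 / 2" and y: "0 < y"
  shows "y * f y = 1 / 2 * (1 / sqrt (pi * y) * exp (- (1 / (4 * y))))"
proof -
  let ?h = "\<lambda>y. 1 / 2 * (1 / sqrt (pi * y) * exp (- (1 / (4 * y))))"
  let ?L = "\<lambda>l. ennreal (1 / 2 * (exp (- sqrt l) / sqrt l))"
  show ?thesis
  proof (rule eqI_Laplace[where L = ?L, OF _ _ _ _ _ _ y])
    fix l :: real assume l: "0 < l"
    have "laplace (\<lambda>t. ennreal (t * f t)) l
      = laplace (\<lambda>t. (ennreal (f t) * ennreal t)) l"
      by (intro nn_integral_cong) (auto simp: ennreal_mult' f_nonneg mult.commute split: split_indicator)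
    also have "\<dots> = ?L l"
      using Laplace_t_f[OF l] l by (simp add: half powr_half_sqrt powr_minus powr_diff[of l "1/2" 1] field_simps)
    finally show "laplace (\<lambda>t. ennreal (t * f t)) l = ?L l" .
    have "laplace (\<lambda>t. ennreal (?h t)) l
      = (\<integral>\<^sup>+ t. ennreal (1 / 2) * (indicator {0<..} t * (ennreal (1 / sqrt (pi * t) * exp (- (1\<^sup>2 / (4 * t)))) * ennreal (exp (- l * t)))) \<partial>lborel)"
      by (intro nn_integral_cong, subst ennreal_mult') (simp, simp only: one_power2 mult_ac)
    also have "\<dots> = ennreal (1 / 2) * ennreal (exp (- (1 * sqrt l)) / sqrt l)"
      unfolding nn_integral_exp_reciprocal[OF zero_less_one l, symmetric] by (rule nn_integral_cmult) measurable
    also have "\<dots> = ?L l" using l by (subst ennreal_mult[symmetric]) auto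
    finally show "laplace (\<lambda>t. ennreal (?h t)) l = ?L l" .
  qed (auto intro!: continuous_intros f_cont f_nonneg mult_nonneg_nonneg)
qed

lemma nn_integral_powr_exp_square:
  assumes p: "0 < p" and c: "0 < c"
  shows "(\<integral>\<^sub>+ x. ennreal (x powr (p - 1) * exp (- (c * x\<^sup>2))))
    = ennreal (c powr (- (p / 2)) * Gamma (p / 2) / 2)"
proof -
  let ?F = "\<lambda>u::real. (1 * u powr (1 / 2)) powr (p - 1) * exp (- (c * (1 * u powr (1 / 2))\<^sup>2))"
  have "(\<integral>\<^sub>+ x. ennreal (x powr (p - 1) * exp (- (c * x\<^sup>2))))
    = (\<integral>\<^sub>+ u. ennreal (?F u)
        * ennreal (1 * \<bar>1 / 2\<bar> * u powr (1 / 2 - 1)))"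
    by (rule nn_integral_powr_substitution) auto
  also have "\<dots> = (\<integral>\<^sup>+ u. ennreal (1 / 2) * (indicator {0<..} u * ennreal (u powr (p / 2 - 1) * exp (- c * u))) \<partial>lborel)"
  proof (rule nn_integral_cong, goal_cases)
    case (1 u)
    show ?case
    proof (cases "0 < u")
      case True
      have "(u powr (1 / 2))\<^sup>2 = u" using True by (simp add: powr_half_sqrt)
      moreover have "(u powr (1 / 2)) powr (p - 1) * u powr (1 / 2 - 1) = u powr (p / 2 - 1)"
      proof -
        have "1 / 2 * (p - 1) + (1 / 2 - 1) = p / 2 - 1" by (simp add: field_simps)
        then show ?thesis by (simp only: powr_powr powr_add[symmetric])
      qed
      ultimately have "(?F u) * (1 * \<bar>1 / 2\<bar> * u powr (1 / 2 - 1))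
        = 1 / 2 * (u powr (p / 2 - 1) * exp (- c * u))" by simp
      then have "ennreal (?F u) * ennreal (1 * \<bar>1 / 2\<bar> * u powr (1 / 2 - 1))
        = ennreal (1 / 2) * ennreal (u powr (p / 2 - 1) * exp (- c * u))"
        by (subst (1 2) ennreal_mult[symmetric]) (auto simp only:, auto)
      then show ?thesis using True by simp
    qed simp
  qed
  also have "\<dots> = ennreal (1 / 2) * ennreal (Gamma (p / 2) * c powr (- (p / 2)))"
    using nn_integral_Gamma_scaled[of "p / 2" c] p c by (subst nn_integral_cmult) auto
  also have "\<dots> = ennreal (c powr (- (p / 2)) * Gamma (p / 2) / 2)"
    using p by (subst ennreal_mult[symmetric]) (auto simp: mult.commute)
  finally show ?thesis .
qed

lemma cosh_sums: "(\<lambda>l. (x::real) ^ (2 * l) / fact (2 * l)) sums cosh x"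
  and sinh_sums: "(\<lambda>l. (x::real) ^ (2 * l + 1) / fact (2 * l + 1)) sums sinh x"
  using sums_group[OF cosh_converges[of x], of 2] sums_group[OF sinh_converges[of x], of 2]
  by (simp_all add: mult.commute divide_inverse)

text \<open>It turns the even and odd factorials of the hyperbolic series into the denominators of
  the Kummer series with lower parameters 1/2 and 3/2.\<close>

lemma fact_parity:
  assumes "d < 2"
  shows "fact (2 * l + d) = (4 :: real) ^ l * pochhammer (real d + 1 / 2) l * fact l"
proof (induction l)
  case 0
  then show ?case using assms by (auto simp: less_2_cases_iff)
next
  case (Suc l)
  have "fact (2 * Suc l + d) = (real (2 * l + 2 + d) * real (2 * l + 1 + d)) * fact (2 * l + d)"
    by (simp add: algebra_simps)
  also have "real (2 * l + 2 + d) * real (2 * l + 1 + d) = 4 * (real d + 1 / 2 + real l) * (real l + 1)"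
    using assms by (auto simp: less_2_cases_iff algebra_simps)
  finally show ?case unfolding Suc by (simp add: pochhammer_Suc algebra_simps)
qed

text \<open>The Laplace transform of this weight at \<open>s\<close> is Gamma(q) times the Hermite
  function of index -q.\<close>

definition hermite_weight :: "real \<Rightarrow> real \<Rightarrow> ennreal" where
  "hermite_weight q x = indicator {0<..} x * ennreal (x powr (q - 1) * exp (- (1 / 2 * x\<^sup>2)))"

lemma hermite_weight_measurable [measurable]: "hermite_weight q \<in> borel_measurable borel"
  unfolding hermite_weight_def[abs_def] by measurable

lemma nn_integral_hermite_weight_exp:
  assumes q: "0 < q"
  shows "(\<integral>\<^sup>+ x. hermite_weight q x * ennreal (exp (s * x)) \<partial>lborel) < \<top>"
proof -
  have "(\<integral>\<^sup>+ x. hermite_weight q x * ennreal (exp (s * x)) \<partial>lborel)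
    \<le> (\<integral>\<^sup>+ x. ennreal (exp (s\<^sup>2)) * (indicator {0<..} x * ennreal (x powr (q - 1) * exp (- (1 / 4 * x\<^sup>2)))) \<partial>lborel)"
  proof (rule nn_integral_mono, goal_cases)
    case (1 x)
    \<comment> \<open>Completing the square absorbs \<open>s * x\<close> into half of the Gaussian
      exponent.\<close>
    have "(x / 2 - s)\<^sup>2 = 1 / 4 * x\<^sup>2 - s * x + s\<^sup>2" by (simp add: power2_eq_square field_simps)
    then have "- (1 / 2 * x\<^sup>2) + s * x \<le> s\<^sup>2 + - (1 / 4 * x\<^sup>2)" using zero_le_power2[of "x / 2 - s"] by linarith
    then have "exp (- (1 / 2 * x\<^sup>2)) * exp (s * x) \<le> exp (s\<^sup>2) * exp (- (1 / 4 * x\<^sup>2))"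
      unfolding exp_add[symmetric] by simp
    then have "x powr (q - 1) * (exp (- (1 / 2 * x\<^sup>2)) * exp (s * x)) \<le> x powr (q - 1) * (exp (s\<^sup>2) * exp (- (1 / 4 * x\<^sup>2)))"
      by (rule mult_left_mono) simp
    then have "ennreal (x powr (q - 1) * exp (- (1 / 2 * x\<^sup>2)) * exp (s * x)) \<le> ennreal (exp (s\<^sup>2) * (x powr (q - 1) * exp (- (1 / 4 * x\<^sup>2))))"
      by (intro ennreal_leI) (simp only: mult_ac)
    then show ?case
      by (cases "0 < x") (simp_all add: hermite_weight_def ennreal_mult)
  qed
  also have "\<dots> < \<top>"
    by (subst nn_integral_cmult, measurable, subst nn_integral_powr_exp_square[OF q]) (auto simp: ennreal_mult_less_top)
  finally show ?thesis .
qed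

text \<open>
  Both Kummer series in the definition of \<open>tricomi_U\<close> arise by integrating a power series termwise:
  that of \<open>cosh (s x)\<close> for \<open>d = 0\<close>, that of \<open>sinh (s x)\<close> for \<open>d = 1\<close>.
\<close>

lemma kummer_parity:
  assumes q: "0 < q" and s: "0 < s" and d: "d < 2"
    and g: "\<And>x. (\<lambda>l. x ^ (2 * l + d) / fact (2 * l + d)) sums g x" "\<And>x. 0 \<le> x \<Longrightarrow> g x \<le> exp x"
      "g \<in> borel_measurable borel"
  shows "(\<integral>\<^sup>+ x. hermite_weight q x * ennreal (g (s * x)) \<partial>lborel)
    = ennreal (s ^ d * (2 powr ((q + real d) / 2 - 1) * Gamma ((q + real d) / 2)) * kummer_M ((q + real d) / 2) (real d + 1 / 2) (s\<^sup>2 / 2))"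
    (is "?I = ennreal (?C * kummer_M ?a ?b ?z)")
    and "0 \<le> kummer_M ((q + real d) / 2) (real d + 1 / 2) (s\<^sup>2 / 2)"
proof -
  let ?k = "\<lambda>l. pochhammer ?a l / (pochhammer ?b l * fact l) * ?z ^ l"
  have a: "0 < ?a" and b: "0 < ?b" using q by auto
  have C: "0 < ?C" using a s by (intro mult_pos_pos Gamma_real_pos) auto
  have k0: "0 \<le> ?k l" for l using a b by (intro mult_nonneg_nonneg divide_nonneg_nonneg pochhammer_nonneg) auto
  have tm: "(\<integral>\<^sup>+ x. hermite_weight q x * ennreal ((s * x) ^ (2 * l + d) / fact (2 * l + d)) \<partial>lborel) = ennreal (?C * ?k l)" for l
  proof -
    let ?m = "2 * l + d"
    have "(\<integral>\<^sup>+ x. hermite_weight q x * ennreal ((s * x) ^ ?m / fact ?m) \<partial>lborel)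
      = (\<integral>\<^sup>+ x. ennreal (s ^ ?m / fact ?m) * (indicator {0<..} x * ennreal (x powr ((q + real ?m) - 1) * exp (- (1 / 2 * x\<^sup>2)))) \<partial>lborel)"
    proof (rule nn_integral_cong, goal_cases)
      case (1 x)
      have "x powr (q - 1) * exp (- (1 / 2 * x\<^sup>2)) * ((s * x) ^ ?m / fact ?m) = s ^ ?m / fact ?m * (x powr ((q + real ?m) - 1) * exp (- (1 / 2 * x\<^sup>2)))" if "0 < x"
      proof -
        have "x powr ((q + real ?m) - 1) = x powr (q - 1) * x ^ ?m"
          unfolding powr_realpow[OF that, symmetric] powr_add[symmetric] by (simp add: algebra_simps)
        then show ?thesis by (simp only: power_mult_distrib) simp
      qed
      then show ?case
        using s by (cases "0 < x") (simp_all add: hermite_weight_def ennreal_mult[symmetric] del: fact_Suc)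
    qed
    also have "\<dots> = ennreal (s ^ ?m / fact ?m) * ennreal ((1 / 2) powr (- ((q + real ?m) / 2)) * Gamma ((q + real ?m) / 2) / 2)"
      by (subst nn_integral_cmult, measurable, subst nn_integral_powr_exp_square) (use q in auto)
    also have "\<dots> = ennreal (s ^ ?m / fact ?m * ((1 / 2) powr (- ((q + real ?m) / 2)) * Gamma ((q + real ?m) / 2) / 2))"
      using s q by (intro ennreal_mult[symmetric]) auto
    also have "s ^ ?m / fact ?m * ((1 / 2) powr (- ((q + real ?m) / 2)) * Gamma ((q + real ?m) / 2) / 2) = ?C * ?k l"
    proof -
      have e: "(q + real ?m) / 2 = ?a + real l" by simp
      have "?a \<notin> \<int>\<^sub>\<le>\<^sub>0" using a by (auto simp: nonpos_Ints_def)
      then have G: "Gamma (?a + real l) = pochhammer ?a l * Gamma ?a" using pochhammer_Gamma[of ?a l] a by (simp add: Gamma_real_pos less_imp_neq[symmetric])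
      have "(1 / 2 :: real) powr (- w) = 2 powr w" for w by (simp add: powr_minus powr_divide)
      then have "(1 / 2 :: real) powr (- (?a + real l)) = 2 powr (?a + real l)" .
      also have "\<dots> = 2 powr (?a - 1) * 2 * 2 ^ l" by (simp add: powr_add powr_diff powr_realpow)
      finally have P: "(1 / 2 :: real) powr (- (?a + real l)) = 2 powr (?a - 1) * 2 * 2 ^ l" .
      have z: "s ^ ?m = s ^ d * (s\<^sup>2) ^ l" by (simp add: power_add power_mult)
      have "(4::real) ^ l = 2 ^ l * 2 ^ l" by (simp add: power_mult_distrib[symmetric])
      then show ?thesis unfolding e G P z fact_parity[OF d] power_divide by (simp add: field_simps)
    qed
    finally show ?thesis .
  qed
  have "?I = (\<integral>\<^sup>+ x. (\<Sum>l. hermite_weight q x * ennreal ((s * x) ^ (2 * l + d) / fact (2 * l + d))) \<partial>lborel)"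
  proof (rule nn_integral_cong, goal_cases)
    case (1 x)
    show ?case
    proof (cases "0 < x")
      case True
      have "(\<Sum>l. ennreal ((s * x) ^ (2 * l + d) / fact (2 * l + d))) = ennreal (g (s * x))"
        using g(1)[of "s * x"] True s by (subst suminf_ennreal2) (auto simp: sums_iff simp del: fact_Suc)
      then show ?thesis by (simp del: fact_Suc)
    qed (simp add: hermite_weight_def)
  qed
  also have "\<dots> = (\<Sum>l. \<integral>\<^sup>+ x. hermite_weight q x * ennreal ((s * x) ^ (2 * l + d) / fact (2 * l + d)) \<partial>lborel)"
    by (rule nn_integral_suminf) measurable
  also have "\<dots> = (\<Sum>l. ennreal (?C * ?k l))" unfolding tm ..
  finally have I: "?I = (\<Sum>l. ennreal (?C * ?k l))" .
  have "?I \<le> (\<integral>\<^sup>+ x. hermite_weight q x * ennreal (exp (s * x)) \<partial>lborel)"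
  proof (rule nn_integral_mono, goal_cases)
    case (1 x)
    show ?case
      using g(2)[of "s * x"] s by (cases "0 < x") (auto intro!: mult_left_mono ennreal_leI simp: hermite_weight_def)
  qed
  \<comment> \<open>Convergence of the Kummer series is deduced from the finite integral that it
    represents.\<close>
  then have fin: "(\<Sum>l. ennreal (?C * ?k l)) \<noteq> \<top>" using nn_integral_hermite_weight_exp[OF q, of s] I by auto
  have Ck: "0 \<le> ?C * ?k l" for l by (rule mult_nonneg_nonneg[OF less_imp_le[OF C] k0])
  have sm: "summable (\<lambda>l. ?C * ?k l)" by (rule summable_suminf_not_top[OF Ck fin])
  have "?C = 0 \<or> summable ?k" by (rule iffD1[OF summable_cmult_iff sm])
  then have sm': "summable ?k" using C by (elim disjE) (linarith, assumption)
  show "0 \<le> kummer_M ?a ?b ?z" unfolding kummer_M_def by (intro suminf_nonneg sm' k0)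
  show "?I = ennreal (?C * kummer_M ?a ?b ?z)"
    unfolding I kummer_M_def suminf_ennreal2[OF Ck sm] suminf_mult[OF sm'] ..
qed

lemma Gamma_legendre_duplication_real:
  assumes "0 < (x::real)"
  shows "Gamma x * Gamma (x + 1 / 2) = 2 powr (1 - 2 * x) * sqrt pi * Gamma (2 * x)"
proof -
  have n: "complex_of_real x \<notin> \<int>\<^sub>\<le>\<^sub>0" "complex_of_real x + 1 / 2 \<notin> \<int>\<^sub>\<le>\<^sub>0"
    using assms by (auto elim!: nonpos_Ints_cases simp: complex_eq_iff)
  have "complex_of_real x + 1 / 2 = complex_of_real (x + 1 / 2)" "2 * complex_of_real x = complex_of_real (2 * x)"
    "(1 - complex_of_real (2 * x)) * complex_of_real (ln 2) = complex_of_real ((1 - 2 * x) * ln 2)" by simp_all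
  note eqs = this
  have "Gamma x * Gamma (x + 1 / 2) = exp ((1 - 2 * x) * ln 2) * sqrt pi * Gamma (2 * x)"
    using Gamma_legendre_duplication[OF n]    unfolding eqs Gamma_complex_of_real exp_of_real unfolding of_real_mult[symmetric] of_real_eq_iff .
  then show ?thesis by (simp add: powr_def)
qed

text \<open>Since exp(-x) = cosh x - sinh x, the integral is the difference of the two Kummer terms,
  obtained in \<open>ennreal\<close> as an addition solved for one summand. The duplication formula
  matches the Gamma factors with those of \<open>tricomi_U\<close>.\<close>

lemma nn_integral_hermite_fn:
  assumes q: "0 < q" and s: "0 < s"
  shows "(\<integral>\<^sup>+ x. hermite_weight q x * ennreal (exp (- s * x)) \<partial>lborel) = ennreal (Gamma q * hermite_fn (- q) s)"
    and "0 \<le> hermite_fn (- q) s"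
proof -
  let ?G = "\<integral>\<^sup>+ x. hermite_weight q x * ennreal (sinh (s * x)) \<partial>lborel"
  let ?F = "\<integral>\<^sup>+ x. hermite_weight q x * ennreal (cosh (s * x)) \<partial>lborel"
  let ?I = "\<integral>\<^sup>+ x. hermite_weight q x * ennreal (exp (- s * x)) \<partial>lborel"
  let ?z = "s\<^sup>2 / 2"
  define M0 where "M0 = kummer_M (q / 2) (1 / 2) ?z"
  define M1 where "M1 = kummer_M ((q + 1) / 2) (3 / 2) ?z"
  let ?e = "2 powr (q / 2 - 1) * Gamma (q / 2) * M0"
  let ?o = "s * (2 powr ((q + 1) / 2 - 1) * Gamma ((q + 1) / 2)) * M1"
  have m: "(cosh :: real \<Rightarrow> real) \<in> borel_measurable borel" "(sinh :: real \<Rightarrow> real) \<in> borel_measurable borel"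
    by (intro borel_measurable_continuous_onI continuous_intros)+
  note [measurable] = m
  have le: "cosh x \<le> exp x" "sinh x \<le> exp x" if "0 \<le> x" for x :: real
  proof -
    have "exp (- x) \<le> exp x" "0 \<le> exp (- x)" "0 \<le> exp x" using that by simp_all
    then show "cosh x \<le> exp x" "sinh x \<le> exp x" by (simp_all add: cosh_field_def sinh_field_def field_simps)
  qed
  have E: "?F = ennreal ?e" "0 \<le> M0"
    using kummer_parity[OF q s, of 0 cosh, OF _ _ le(1) m(1)] cosh_sums by (simp_all add: M0_def)
  have O: "?G = ennreal ?o" "0 \<le> M1"
    using kummer_parity[OF q s, of 1 sinh, OF _ _ le(2) m(2)] sinh_sums by (simp_all add: M1_def)
  have o0: "0 \<le> ?o" using O(2) q s by (intro mult_nonneg_nonneg) auto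
  have "?I + ?G = (\<integral>\<^sup>+ x. hermite_weight q x * ennreal (exp (- s * x)) + hermite_weight q x * ennreal (sinh (s * x)) \<partial>lborel)"
    by (rule nn_integral_add[symmetric]) measurable
  also have "\<dots> = ?F"
  proof (rule nn_integral_cong, goal_cases)
    case (1 x)
    have "ennreal (exp (- s * x)) + ennreal (sinh (s * x)) = ennreal (cosh (s * x))" if "0 < x"
      using that s by (subst ennreal_plus[symmetric]) (auto simp: cosh_field_def sinh_field_def field_simps)
    then show ?case
      by (cases "0 < x") (simp_all add: distrib_left[symmetric] hermite_weight_def del: distrib_left_numeral)
  qed
  finally have *: "?I + ennreal ?o = ennreal ?e" by (simp add: E O)
  have "0 \<le> ?e" using E(2) q by (intro mult_nonneg_nonneg) auto
  moreover have "ennreal ?o \<le> ennreal ?e" unfolding *[symmetric] by (rule add_increasing) simp_all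
  ultimately have le: "?o \<le> ?e" by simp
  have "?I = ?I + ennreal ?o - ennreal ?o" by (rule ennreal_add_diff_cancel_right[symmetric]) simp
  also have "\<dots> = ennreal (?e - ?o)" unfolding * by (rule ennreal_minus[OF o0])
  finally have "?I = ennreal (?e - ?o)" .
  moreover have "Gamma q * hermite_fn (- q) s = ?e - ?o"
  proof -
    have h: "Gamma (1 / 2 :: real) = sqrt pi" by (rule Gamma_one_half_real)
    have h': "Gamma (- (1 / 2) :: real) = - 2 * sqrt pi"
    proof -
      have "- (1 / 2) \<notin> (\<int>\<^sub>\<le>\<^sub>0 :: real set)"
      proof
        assume "- (1 / 2) \<in> (\<int>\<^sub>\<le>\<^sub>0 :: real set)"
        then obtain m :: int where "- (1 / 2) = real_of_int m" by (auto elim: nonpos_Ints_cases)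
        then have "real_of_int (2 * m) = real_of_int (- 1)" by simp
        then have "2 * m = - 1" by (simp only: of_int_eq_iff)
        then show False by presburger
      qed
      then have "Gamma (- (1 / 2) + 1) = - (1 / 2) * Gamma (- (1 / 2) :: real)" by (rule Gamma_plus1)
      then show ?thesis using h by simp
    qed
    have D: "Gamma (q / 2) * Gamma ((q + 1) / 2) = 2 powr (1 - q) * sqrt pi * Gamma q"
      using Gamma_legendre_duplication_real[of "q / 2"] q by (simp add: add_divide_distrib)
    have G: "0 < Gamma (q / 2)" "0 < Gamma ((q + 1) / 2)" using q by (auto intro!: Gamma_real_pos)
    have Gq: "Gamma q = Gamma (q / 2) * Gamma ((q + 1) / 2) / (2 powr (1 - q) * sqrt pi)" using D by simp
    have U: "tricomi_U (q / 2) (1 / 2) ?z = sqrt pi / Gamma ((q + 1) / 2) * M0 - 2 * sqrt pi / Gamma (q / 2) * (s / sqrt 2) * M1"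
    proof -
      have z: "?z powr (1 / 2) = s / sqrt 2" using s by (simp add: powr_half_sqrt real_sqrt_divide)
      have args: "q / 2 - 1 / 2 + 1 = (q + 1) / 2" "1 - 1 / 2 = (1 / 2 :: real)" "1 / 2 - 1 = - (1 / 2 :: real)" "2 - 1 / 2 = (3 / 2 :: real)"
        by simp_all
      have "u * inverse a * M0 + - 2 * u * inverse b * w * M1 = u / a * M0 - 2 * u / b * w * M1" for u a b w :: real
        by (simp add: divide_inverse)
      then show ?thesis
        unfolding tricomi_U_def args h h' z rGamma_inverse_Gamma M0_def[symmetric] M1_def[symmetric] .
    qed
    have "Gamma q * hermite_fn (- q) s = 2 powr (- (q / 2)) * Gamma (q / 2) * Gamma ((q + 1) / 2) / (2 powr (1 - q) * sqrt pi)
       * (sqrt pi / Gamma ((q + 1) / 2) * M0 - 2 * sqrt pi / Gamma (q / 2) * (s / sqrt 2) * M1)"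
      unfolding hermite_fn_def Gq using U by simp
    also have "\<dots> = 2 powr (- (q / 2)) / 2 powr (1 - q) * (Gamma (q / 2) * M0 - 2 * Gamma ((q + 1) / 2) * (s / sqrt 2) * M1)"
    proof -
      have "a * g0 * g1 / (c * r) * (r / g1 * M0 - 2 * r / g0 * u * M1) = a / c * (g0 * M0 - 2 * g1 * u * M1)"
        if "0 < g0" "0 < g1" "0 < c" "0 < r" for a g0 g1 c r u :: real
        using that by (simp add: field_simps)
      note * = this
      show ?thesis by (rule *) (use G in simp_all)
    qed
    also have "2 powr (- (q / 2)) / 2 powr (1 - q) = 2 powr (q / 2 - 1)"
      by (simp add: powr_diff[symmetric] algebra_simps)
    also have "2 powr (q / 2 - 1) * (Gamma (q / 2) * M0 - 2 * Gamma ((q + 1) / 2) * (s / sqrt 2) * M1)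
        = ?e - s * (2 powr (q / 2 - 1) * (2 / sqrt 2) * Gamma ((q + 1) / 2)) * M1"
      by (simp add: algebra_simps)
    also have "2 powr (q / 2 - 1) * (2 / sqrt 2) = 2 powr ((q + 1) / 2 - 1)"
    proof -
      have "2 / sqrt 2 = 2 powr (1 / 2)" by (simp add: powr_half_sqrt real_div_sqrt)
      then show ?thesis by (simp add: powr_add[symmetric] add_divide_distrib)
    qed
    finally show ?thesis .
  qed
  ultimately show "?I = ennreal (Gamma q * hermite_fn (- q) s)" by (simp only:)
  have "0 \<le> Gamma q * hermite_fn (- q) s"
    unfolding \<open>Gamma q * hermite_fn (- q) s = ?e - ?o\<close> using le by (simp only: diff_ge_0_iff_ge)
  then show "0 \<le> hermite_fn (- q) s" using Gamma_real_pos[OF q] by (simp add: zero_le_mult_iff)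
qed

text \<open>Index 0 occurs for a sample of one point and is outside the range of the integral
  representation. \<open>rGamma 0 = 0\<close> removes the second series, and the first reduces to
  its leading term.\<close>

lemma hermite_fn_0: "hermite_fn 0 s = 1"
proof -
  have "kummer_M 0 (1 / 2) (s\<^sup>2 / 2) = (\<Sum>l\<in>{0}. pochhammer 0 l / (pochhammer (1 / 2) l * fact l) * (s\<^sup>2 / 2) ^ l)"
    unfolding kummer_M_def by (rule suminf_finite) (auto simp: pochhammer_0_left)
  then show ?thesis by (simp add: hermite_fn_def tricomi_U_def rGamma_inverse_Gamma Gamma_one_half_real)
qed

text \<open>For positive \<open>q\<close> the integral representation gives continuity by domination
  with the weight itself; index 0 is constant.\<close>

lemma continuous_hermite_fn:
  assumes q: "0 \<le> q"
  shows "continuous_on {0<..} (hermite_fn (- q))"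
proof (cases "q = 0")
  case True
  then show ?thesis by (simp add: hermite_fn_0)
next
  case False
  then have q: "0 < q" using q by simp
  have "continuous_on {0<..} (\<lambda>s. \<integral>\<^sup>+ x. hermite_weight q x * ennreal (exp (- s * x)) \<partial>lborel)"
  proof (rule continuous_on_nn_integral_dominated[where w = "hermite_weight q"])
    show "hermite_weight q x * ennreal (exp (- s * x)) \<le> hermite_weight q x" if "s \<in> {0<..}" for s x
      using mult_left_mono[of "ennreal (exp (- s * x))" 1 "hermite_weight q x"] that by (cases "0 < x") (simp_all add: hermite_weight_def)
    show "(\<integral>\<^sup>+ x. hermite_weight q x \<partial>lborel) < \<top>"
      using nn_integral_hermite_weight_exp[OF q, of 0] by simp
    show "continuous_on {0<..} (\<lambda>s. hermite_weight q x * ennreal (exp (- s * x)))" for x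
      by (intro ennreal_continuous_on_cmult continuous_on_ennreal continuous_intros) (auto simp: hermite_weight_def split: split_indicator)
  qed measurable
  then have c: "continuous_on {0<..} (\<lambda>s. ennreal (Gamma q * hermite_fn (- q) s))"
    by (rule continuous_on_eq) (use nn_integral_hermite_fn[OF q] in auto)
  have "continuous_on {0<..} (\<lambda>s. inverse (Gamma q) * (Gamma q * hermite_fn (- q) s))"
    unfolding continuous_on_def
  proof (rule ballI, rule tendsto_mult[OF tendsto_const])
    fix s :: real assume s: "s \<in> {0<..}"
    have "((\<lambda>s. enn2real (ennreal (Gamma q * hermite_fn (- q) s))) \<longlongrightarrow> Gamma q * hermite_fn (- q) s) (at s within {0<..})"
      using c s nn_integral_hermite_fn(2)[OF q, of s] Gamma_real_pos[OF q]
      by (intro tendsto_enn2real) (auto simp: continuous_on_def)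
    then show "((\<lambda>s. Gamma q * hermite_fn (- q) s) \<longlongrightarrow> Gamma q * hermite_fn (- q) s) (at s within {0<..})"
      by (rule Lim_transform_within[OF _ zero_less_one]) (use nn_integral_hermite_fn(2)[OF q] Gamma_real_pos[OF q] in auto)
  qed
  then show ?thesis using Gamma_real_pos[OF q] by (simp add: mult.assoc[symmetric])
qed

section \<open>Moments at index 1/2\<close>

text \<open>The inverse Laplace transform of
  \<open>l powr (- ((q + 1) / 2)) * exp (- sqrt l)\<close>. In terms of
  \<open>s = 1 / sqrt (2 * y)\<close> the exponential is the Gaussian factor with exponent
  \<open>- s\<^sup>2 / 2\<close>.\<close>

definition hermite_density :: "real \<Rightarrow> real \<Rightarrow> real" where
  "hermite_density q y = 1 / sqrt (pi * y) * (1 / sqrt (2 * y)) powr (- q) * exp (- (1 / (4 * y))) * hermite_fn (- q) (1 / sqrt (2 * y))"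

lemma hermite_density_nonneg: "0 \<le> q \<Longrightarrow> 0 < y \<Longrightarrow> 0 \<le> hermite_density q y"
  unfolding hermite_density_def using nn_integral_hermite_fn(2)[of q "1 / sqrt (2 * y)"]
  by (cases "q = 0") (auto simp: hermite_fn_0)

lemma continuous_hermite_density:
  assumes "0 \<le> q"
  shows "continuous_on {0<..} (hermite_density q)"
proof -
  have "continuous_on {0<..} (\<lambda>y. hermite_fn (- q) (1 / sqrt (2 * y)))"
    by (rule continuous_on_compose2[OF continuous_hermite_fn[OF assms]]) (auto intro!: continuous_intros)
  then show ?thesis unfolding hermite_density_def[abs_def] by (intro continuous_intros) auto
qed

text \<open>
  In the integral of \<open>nn_integral_hermite_fn\<close> the Gaussian is completed to \<open>exp (- (x + s)\<^sup>2 / 2)\<close>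
  and \<open>x = s w\<close> is substituted.
\<close>

lemma hermite_density_integral:
  assumes q: "0 < q" and y: "0 < y"
  shows "ennreal (hermite_density q y) = (\<integral>\<^sub>+ w. ennreal (w powr (q - 1) / Gamma q)
    * ennreal (1 / sqrt (pi * y) * exp (- ((1 + w)\<^sup>2 / (4 * y)))))"
proof -
  let ?G = "\<lambda>w::real. 1 / sqrt (pi * y) * exp (- ((1 + w)\<^sup>2 / (4 * y)))"
  define s where "s = 1 / sqrt (2 * y)"
  let ?F = "\<lambda>w::real. ennreal ((s * w powr 1) powr (q - 1) * exp (- (1 / 2 * (s * w powr 1)\<^sup>2)) * exp (- s * (s * w powr 1))) * ennreal (s * \<bar>1\<bar> * w powr (1 - 1))"
  have s: "0 < s" and s2: "s\<^sup>2 = 1 / (2 * y)" using y by (simp_all add: s_def power_divide)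
  let ?C = "1 / sqrt (pi * y) * s powr (- q) * exp (- (1 / (4 * y))) / Gamma q"
  have C: "0 \<le> ?C" using Gamma_real_pos[OF q] y by simp
  have "hermite_density q y = ?C * (Gamma q * hermite_fn (- q) s)"
    using Gamma_real_pos[OF q] by (simp add: hermite_density_def s_def)
  then have "ennreal (hermite_density q y) = ennreal ?C * ennreal (Gamma q * hermite_fn (- q) s)"
    by (simp only: ennreal_mult'[OF C])
  also have "ennreal (Gamma q * hermite_fn (- q) s) = (\<integral>\<^sub>+ x. ennreal (x powr (q - 1) * exp (- (1 / 2 * x\<^sup>2)) * exp (- s * x)))"
    unfolding nn_integral_hermite_fn(1)[OF q s, symmetric] by (intro nn_integral_cong) (simp add: hermite_weight_def ennreal_mult mult.assoc)
  also have "\<dots> = (\<integral>\<^sub>+ w. ?F w)"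
    by (rule nn_integral_powr_substitution) (use s in auto)
  also have "ennreal ?C * \<dots> = (\<integral>\<^sup>+ w. ennreal ?C * (indicator {0<..} w * (?F w)) \<partial>lborel)"
    by (rule nn_integral_cmult[symmetric]) measurable
  also have "\<dots> = (\<integral>\<^sub>+ w. ennreal (w powr (q - 1) / Gamma q) * ennreal (?G w))"
  proof (rule nn_integral_cong, goal_cases)
    case (1 w)
    show ?case
    proof (cases "0 < w")
      case True
      have e1: "s powr (- q) * (s powr (q - 1) * s) = 1" using s by (simp add: powr_add[symmetric] powr_mult_base mult.commute[of _ s])
      have e2: "(s * w) powr (q - 1) = s powr (q - 1) * w powr (q - 1)" using s True by (simp add: powr_mult)
      have e3: "exp (- (1 / (4 * y))) * (exp (- (1 / 2 * (s * w)\<^sup>2)) * exp (- s * (s * w))) = exp (- ((1 + w)\<^sup>2 / (4 * y)))"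
      proof -
        have "- (1 / 2 * (s * w)\<^sup>2) = - (w\<^sup>2 / (4 * y))" "- s * (s * w) = - (w / (2 * y))"
        proof -
          have "- s * (s * w) = - (s\<^sup>2 * w)" by (simp add: power2_eq_square)
          then show "- (1 / 2 * (s * w)\<^sup>2) = - (w\<^sup>2 / (4 * y))" "- s * (s * w) = - (w / (2 * y))"
            unfolding power_mult_distrib s2 by simp_all
        qed
        moreover have "- (1 / (4 * y)) + (- (w\<^sup>2 / (4 * y)) + - (w / (2 * y))) = - ((1 + w)\<^sup>2 / (4 * y))"
          using y by (simp add: power2_eq_square field_simps)
        ultimately show ?thesis by (simp only: exp_add[symmetric])
      qed
      have alg: "a * b * c / G * (b' * w' * e * e' * b'') = (b * (b' * b'')) * (w' / G * (a * (c * (e * e'))))" for a b c G b' w' e e' b'' :: real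
        by simp
      have "?C * ((s * w) powr (q - 1) * exp (- (1 / 2 * (s * w)\<^sup>2)) * exp (- s * (s * w)) * s)
        = w powr (q - 1) / Gamma q * (?G w)"
        unfolding e2 alg e1 e3 by (rule mult_1)
      then have "ennreal ?C * ennreal ((s * w) powr (q - 1) * exp (- (1 / 2 * (s * w)\<^sup>2)) * exp (- s * (s * w)) * s)
        = ennreal (w powr (q - 1) / Gamma q) * ennreal (?G w)"
        using Gamma_real_pos[OF q] y by (simp only: ennreal_mult'[OF C, symmetric]) (subst ennreal_mult[symmetric]; simp)
      then show ?thesis using True s by (simp add: ennreal_mult mult.assoc)
    qed simp
  qed
  finally show ?thesis .
qed

text \<open>The density is a mixture over \<open>w\<close> of the functions in
  \<open>nn_integral_exp_reciprocal\<close> with \<open>c = 1 + w\<close>. Their transforms carry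
  \<open>exp (- w * sqrt l)\<close>, and the integral over \<open>w\<close> is a Gamma
  integral.\<close>

lemma Laplace_hermite_density:
  assumes q: "0 \<le> q" and l: "0 < l"
  shows "laplace (\<lambda>y. ennreal (hermite_density q y)) l
    = ennreal (l powr (- ((q + 1) / 2)) * exp (- sqrt l))"
proof (cases "q = 0")
  case True
  have "laplace (\<lambda>y. ennreal (hermite_density q y)) l
    = (\<integral>\<^sub>+ y. ennreal (1 / sqrt (pi * y) * exp (- (1\<^sup>2 / (4 * y)))) * ennreal (exp (- l * y)))"
    by (intro nn_integral_cong) (auto simp: True hermite_density_def hermite_fn_0 mult.assoc split: split_indicator)
  also have "\<dots> = ennreal (exp (- (1 * sqrt l)) / sqrt l)" by (rule nn_integral_exp_reciprocal[OF _ l]) simp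
  finally show ?thesis using l by (simp add: True powr_minus powr_half_sqrt field_simps)
next
  case False
  then have q: "0 < q" using q by simp
  let ?F = "\<lambda>w y. indicator {0<..} w * ennreal (w powr (q - 1) / Gamma q) * (indicator {0<..} y * (ennreal (1 / sqrt (pi * y) * exp (- ((1 + w)\<^sup>2 / (4 * y)))) * ennreal (exp (- l * y))))"
  have "laplace (\<lambda>y. ennreal (hermite_density q y)) l = (\<integral>\<^sup>+ y. \<integral>\<^sup>+ w. ?F w y \<partial>lborel \<partial>lborel)"
  proof (rule nn_integral_cong, goal_cases)
    case (1 y)
    have "(\<integral>\<^sup>+ w. ?F w y \<partial>lborel) = (\<integral>\<^sup>+ w. indicator {0<..} y * ennreal (exp (- l * y)) * (indicator {0<..} w * (ennreal (w powr (q - 1) / Gamma q)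
      * ennreal (1 / sqrt (pi * y) * exp (- ((1 + w)\<^sup>2 / (4 * y)))))) \<partial>lborel)"
      by (intro nn_integral_cong) (simp only: mult_ac)
    also have "\<dots> = indicator {0<..} y * ennreal (exp (- l * y)) * (\<integral>\<^sub>+ w. ennreal (w powr (q - 1) / Gamma q)
      * ennreal (1 / sqrt (pi * y) * exp (- ((1 + w)\<^sup>2 / (4 * y)))))"
      by (rule nn_integral_cmult) measurable
    also have "\<dots> = indicator {0<..} y * ennreal (hermite_density q y) * ennreal (exp (- l * y))"
      by (cases "0 < y") (simp_all only: hermite_density_integral[OF q, symmetric], simp_all add: mult.commute)
    finally show ?case ..
  qed
  also have "\<dots> = (\<integral>\<^sup>+ w. \<integral>\<^sup>+ y. ?F w y \<partial>lborel \<partial>lborel)"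
    by (rule lborel_pair.Fubini') measurable
  also have "\<dots> = (\<integral>\<^sup>+ w. ennreal (exp (- sqrt l) / (sqrt l * Gamma q)) * (indicator {0<..} w * ennreal (w powr (q - 1) * exp (- sqrt l * w))) \<partial>lborel)"
  proof (rule nn_integral_cong, goal_cases)
    case (1 w)
    have "(\<integral>\<^sup>+ y. ?F w y \<partial>lborel) = indicator {0<..} w * ennreal (w powr (q - 1) / Gamma q) *
      (\<integral>\<^sub>+ y. ennreal (1 / sqrt (pi * y) * exp (- ((1 + w)\<^sup>2 / (4 * y)))) * ennreal (exp (- l * y)))"
      by (rule nn_integral_cmult) measurable
    also have "\<dots> = ennreal (exp (- sqrt l) / (sqrt l * Gamma q)) * (indicator {0<..} w * ennreal (w powr (q - 1) * exp (- sqrt l * w)))"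
    proof (cases "0 < w")
      case True
      have x: "exp (- ((1 + w) * sqrt l)) = exp (- sqrt l) * exp (- sqrt l * w)" by (simp add: exp_add[symmetric] algebra_simps)
      have "a / g * (b * c / r) = b / (r * g) * (a * c)" for a b c g r :: real by (simp add: mult_ac)
      then have "w powr (q - 1) / Gamma q * (exp (- ((1 + w) * sqrt l)) / sqrt l) = exp (- sqrt l) / (sqrt l * Gamma q) * (w powr (q - 1) * exp (- sqrt l * w))"
        unfolding x .
      then have "ennreal (w powr (q - 1) / Gamma q) * ennreal (exp (- ((1 + w) * sqrt l)) / sqrt l) = ennreal (exp (- sqrt l) / (sqrt l * Gamma q)) * ennreal (w powr (q - 1) * exp (- sqrt l * w))"
        using Gamma_real_pos[OF q] l by (subst (1 2) ennreal_mult[symmetric]) auto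
      then show ?thesis using True nn_integral_exp_reciprocal[of "1 + w", OF _ l] by simp
    qed simp
    finally show ?case .
  qed
  also have "\<dots> = ennreal (exp (- sqrt l) / (sqrt l * Gamma q)) * (\<integral>\<^sub>+ w. ennreal (w powr (q - 1) * exp (- sqrt l * w)))"
    by (rule nn_integral_cmult) measurable
  also have "\<dots> = ennreal (exp (- sqrt l) / (sqrt l * Gamma q)) * ennreal (Gamma q * sqrt l powr (- q))"
    using nn_integral_Gamma_scaled[OF q, of "sqrt l"] l by simp
  also have "\<dots> = ennreal (exp (- sqrt l) / (sqrt l * Gamma q) * (Gamma q * sqrt l powr (- q)))"
    using Gamma_real_pos[OF q] l by (intro ennreal_mult[symmetric]) auto
  also have "exp (- sqrt l) / (sqrt l * Gamma q) * (Gamma q * sqrt l powr (- q)) = l powr (- ((q + 1) / 2)) * exp (- sqrt l)"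
  proof -
    have "sqrt l powr (- q) / sqrt l = l powr (- ((q + 1) / 2))"
    proof -
      have "sqrt l powr (- q) / sqrt l = l powr (1 / 2 * - q - 1 / 2)"
        unfolding powr_diff using l by (simp add: powr_half_sqrt[symmetric] powr_powr)
      also have "1 / 2 * - q - 1 / 2 = - ((q + 1) / 2)" by (simp add: field_simps)
      finally show ?thesis .
    qed
    moreover have "exp (- sqrt l) / (sqrt l * Gamma q) * (Gamma q * sqrt l powr (- q)) = sqrt l powr (- q) / sqrt l * exp (- sqrt l)"
      using Gamma_real_pos[OF q] by simp
    ultimately show ?thesis by (simp only:)
  qed
  finally show ?thesis .
qed

lemma (in stable_law) emoment_half:
  assumes half: "\<gamma> = 1 / 2" and A: "finite A" "A \<noteq> {}" "\<And>a. a \<in> A \<Longrightarrow> 0 < n a" and y: "0 < y"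
  shows "y ^ (\<Sum>a\<in>A. n a) * (f y * emoment (\<kappa> y) A n)
    = (\<Prod>a\<in>A. 1 / 2 * pochhammer (1 / 2) (n a - 1)) * hermite_density (2 * real (\<Sum>a\<in>A. n a) - 1 - real (card A)) y"
proof -
  let ?N = "\<Sum>a\<in>A. n a"
  \<comment> \<open>The solution of \<open>(q + 1) / 2 = ?N - card A / 2\<close>, where the
    right-hand side is minus the exponent of \<open>l\<close> in the moment formula at index
    1/2.\<close>
  let ?q = "2 * real ?N - 1 - real (card A)"
  let ?C = "\<Prod>a\<in>A. 1 / 2 * pochhammer (1 / 2 :: real) (n a - 1)"
  have "card A \<le> ?N" using sum_mono[of A "\<lambda>_. 1" n] A(3) by (simp add: Suc_le_eq)
  moreover have "1 \<le> card A" using A by (simp add: Suc_le_eq card_gt_0_iff)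
  ultimately have q: "0 \<le> ?q" by linarith
  have C: "0 \<le> ?C" by (intro prod_nonneg) (auto intro!: pochhammer_nonneg)
  have c: "continuous_on {0<..} (\<lambda>y. y ^ ?N * (f y * emoment (\<kappa> y) A n))"
    by (intro continuous_intros f_cont continuous_emoment A)
  have c': "continuous_on {0<..} (\<lambda>y. ?C * hermite_density ?q y)"
    by (intro continuous_intros continuous_hermite_density q)
  let ?L = "\<lambda>l. ennreal (?C * (l powr (- ((?q + 1) / 2)) * exp (- sqrt l)))"
  show ?thesis
  proof (rule eqI_Laplace[where L = ?L, OF c c' _ _ _ _ y])
    show "0 \<le> t ^ ?N * (f t * emoment (\<kappa> t) A n) \<and> 0 \<le> ?C * hermite_density ?q t" if "0 < t" for t
      using that C emoment_\<kappa>(2)[OF A(1,3) that] hermite_density_nonneg[OF q that] f_nonneg by (auto intro!: mult_nonneg_nonneg)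
    fix l :: real assume l: "0 < l"
    have [measurable]: "(\<lambda>y. indicator {0<..} y * hermite_density ?q y) \<in> borel_measurable borel"
      using borel_measurable_continuous_on_indicator[OF _ continuous_hermite_density[OF q]] by simp
    have "laplace (\<lambda>y. ennreal (?C * hermite_density ?q y)) l
      = (\<integral>\<^sup>+ y. ennreal ?C * (ennreal (indicator {0<..} y * hermite_density ?q y) * ennreal (exp (- l * y))) \<partial>lborel)"
    proof (rule nn_integral_cong, goal_cases)
      case (1 y)
      have "indicator {0<..} y * ennreal (?C * hermite_density ?q y) = ennreal (?C * (indicator {0<..} y * hermite_density ?q y))" by (cases "0 < y") simp_all
      then show ?case by (simp only: ennreal_mult'[OF C] mult.assoc)
    qed
    also have "\<dots> = ennreal ?C * (\<integral>\<^sup>+ y. ennreal (indicator {0<..} y * hermite_density ?q y) * ennreal (exp (- l * y)) \<partial>lborel)"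
      by (rule nn_integral_cmult) measurable
    also have "(\<integral>\<^sup>+ y. ennreal (indicator {0<..} y * hermite_density ?q y) * ennreal (exp (- l * y)) \<partial>lborel)
      = laplace (\<lambda>y. ennreal (hermite_density ?q y)) l"
      by (intro nn_integral_cong) (auto split: split_indicator)
    also have "ennreal ?C * \<dots> = ?L l" by (simp only: Laplace_hermite_density[OF q l] ennreal_mult'[OF C])
    finally show "laplace (\<lambda>y. ennreal (?C * hermite_density ?q y)) l = ?L l" .
    have "laplace (\<lambda>t. ennreal (t ^ ?N * (f t * emoment (\<kappa> t) A n))) l
      = (\<integral>\<^sup>+ t. indicator {0<..} t * (ennreal (f t) * ennreal t ^ ?N * (\<integral>\<^sup>+ p. edsum A n p \<partial>\<kappa> t)) * ennreal (exp (- l * t)) \<partial>lborel)"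
    proof (rule nn_integral_cong, goal_cases)
      case (1 t)
      show ?case
        by (cases "0 < t") (simp_all add: emoment_\<kappa>(1)[OF A(1,3)] emoment_\<kappa>(2)[OF A(1,3)] ennreal_mult ennreal_power f_nonneg mult_ac)
    qed
    also have "\<dots> = ennreal ((\<Prod>a\<in>A. 1 / 2 * pochhammer (1 / 2) (n a - 1) * l powr (1 / 2 - real (n a))) * exp (- (l powr (1 / 2))))"
      using Laplace_edsum[OF A(1,3) l] by (simp add: half)
    also have "(\<Prod>a\<in>A. 1 / 2 * pochhammer (1 / 2) (n a - 1) * l powr (1 / 2 - real (n a))) = ?C * l powr (- ((?q + 1) / 2))"
    proof -
      have "(\<Prod>a\<in>A. l powr (1 / 2 - real (n a))) = l powr (\<Sum>a\<in>A. 1 / 2 - real (n a))" using l A(1) by (simp add: powr_sum)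
      also have "(\<Sum>a\<in>A. 1 / 2 - real (n a)) = real (card A) * (1 / 2) - real ?N" by (simp add: sum_subtractf)
      also have "\<dots> = - ((?q + 1) / 2)" by (simp add: field_simps)
      finally show ?thesis by (simp only: prod.distrib)
    qed
    finally show "laplace (\<lambda>t. ennreal (t ^ ?N * (f t * emoment (\<kappa> t) A n))) l = ?L l"
      using l by (simp add: powr_half_sqrt mult.assoc)
  qed simp
qed

text \<open>Normalizing to the sampling formula with \<theta> = 0 leaves a quotient of Gamma values.
  It becomes the quotient of those at k and j in the final formula, where the Gamma value at n
  cancels against the denominator of \<open>eppf_PD0\<close>.\<close>

lemma py_eppf_card:
  assumes \<sigma>: "partition_on A \<sigma>" "finite A" "A \<noteq> {}"
  shows "(\<Prod>B\<in>\<sigma>. \<gamma> * pochhammer (1 - \<gamma>) (card B - 1)) = \<gamma> * Gamma (real (card A)) / Gamma (real (card \<sigma>)) * py_eppf \<gamma> 0 \<sigma> card"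
proof -
  note bl = partition_on_finite_blocks[OF \<sigma>(1,2)]
  have c: "(\<Sum>B\<in>\<sigma>. card B) = card A" using partition_on_sum[OF \<sigma>(1,2), of "\<lambda>_. 1::nat"] by simp
  have "\<sigma> \<noteq> {}" using \<sigma> by (auto simp: partition_on_def)
  then obtain j k where j: "card \<sigma> = Suc j" and k: "card A = Suc k" using bl(1) \<sigma>(2,3) by (metis card_eq_0_iff not0_implies_Suc)
  have P: "(\<Prod>i = 1..<Suc j. 0 + real i * \<gamma>) = \<gamma> ^ j * fact j" for j by (induction j) (simp_all add: mult_ac)
  have G: "Gamma (real (Suc m)) = fact m" for m using Gamma_fact[of m, where ?'a = real] by (simp add: add.commute)
  show ?thesis
    unfolding py_eppf_def c j k P G by (simp add: pochhammer_fact[symmetric] prod.distrib j)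
qed

text \<open>Every term of the fragmentation moment contains a Hermite density whose index depends on
  \<sigma> only through the number of its blocks. Grouping by that number leaves sums of sampling
  probabilities with parameter \<open>\<beta> / \<alpha>\<close>.\<close>

lemma (in stable_fragmentation) frag_moment_half:
  fixes s :: real and A :: "'x set"
  defines "y \<equiv> 1 / 2 * s powr (- 2)"
  assumes half: "\<beta> = 1 / 2" and A: "finite A" "A \<noteq> {}" "\<And>a. a \<in> A \<Longrightarrow> 0 < n a" and s: "0 < s"
  shows "frag_moment A n y = (\<Sum>j = 1..card A. (\<Sum>\<sigma> | partition_on A \<sigma> \<and> card \<sigma> = j. py_eppf (\<beta> / \<alpha>) 0 \<sigma> card) * 2 ^ ((\<Sum>a\<in>A. n a) - 1)
       * s ^ (j - 1) * hermite_fn (real j + 1 - 2 * real (\<Sum>a\<in>A. n a)) s * (Gamma (real (\<Sum>a\<in>A. n a)) / Gamma (real j)))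
     * (\<alpha> ^ (card A - 1) * Gamma (real (card A)) / Gamma (real (\<Sum>a\<in>A. n a)) * (\<Prod>a\<in>A. pochhammer (1 - \<alpha>) (n a - 1)))"
    and "0 < f'' y" "0 < y"
proof -
  let ?G = "\<lambda>\<sigma> (j::nat). \<Sum>\<sigma> | partition_on A \<sigma> \<and> card \<sigma> = j. py_eppf (\<beta> / \<alpha>) 0 \<sigma> card"
  let ?N = "\<Sum>a\<in>A. n a"
  let ?F = "\<alpha> ^ (card A - 1) * Gamma (real (card A)) / Gamma (real ?N) * (\<Prod>a\<in>A. pochhammer (1 - \<alpha>) (n a - 1))"
  let ?\<Pi> = "{\<sigma>. partition_on A \<sigma>}"
  let ?H = "\<lambda>j. 2 ^ (?N - 1) * s ^ (j - 1) * hermite_fn (real j + 1 - 2 * real ?N) s"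
  show y: "0 < y" using s by (simp add: y_def)
  have y_eq: "y = 1 / (2 * s\<^sup>2)" using s by (simp add: y_def powr_minus powr_numeral field_simps)
  have sy: "1 / sqrt (2 * y) = s" using s by (simp add: y_eq real_sqrt_divide)
  define e where "e = 1 / sqrt (pi * y) * exp (- (1 / (4 * y)))"
  have e: "0 < e" using y by (simp add: e_def)
  have fy: "y * f'' y = 1 / 2 * e" using B.f_half[OF half y] by (simp add: e_def)
  then show f0: "0 < f'' y" using e zero_less_mult_pos[of y "f'' y"] y by simp
  have N: "0 < ?N" using A by (intro sum_pos) auto
  have "card A \<le> ?N" using sum_mono[of A "\<lambda>_. 1" n] A(3) by (simp add: Suc_le_eq)
  have yN: "y ^ ?N * f'' y = (1 / 2) * y ^ (?N - 1) * e"
    using fy N by (cases ?N) (simp_all add: mult_ac)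
  \<comment> \<open>At \<open>y = 1 / (2 * s\<^sup>2)\<close> the Gaussian and square-root factors
    are those of the \<beta>-stable density. Comparing the powers of \<open>y\<close> and
    \<open>s\<close> leaves \<open>2 ^ (?N - 1) * s ^ (j - 1)\<close>.\<close>
  have hd: "hermite_density (2 * real ?N - 1 - real j) y = 2 * (y ^ ?N * f'' y) * ?H j" if j: "1 \<le> j" for j
  proof -
    have "s powr (real j + 1 - 2 * real ?N) * s powr (2 * real (?N - 1)) = s powr real (j - 1)"
      using N j by (simp add: powr_add[symmetric] of_nat_diff)
    then have a: "s powr (real j + 1 - 2 * real ?N) * (s ^ (?N - 1))\<^sup>2 = s ^ (j - 1)"
      using s by (simp add: powr_realpow[symmetric] powr_power powr_powr mult.commute)
    have b: "y ^ (?N - 1) * 2 ^ (?N - 1) = 1 / (s ^ (?N - 1))\<^sup>2"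
      unfolding y_eq by (simp add: power_mult_distrib[symmetric] power_one_over[symmetric] power_divide[symmetric] power_mult[symmetric] mult.commute)
    have "y ^ (?N - 1) * 2 ^ (?N - 1) * s ^ (j - 1) = s powr (real j + 1 - 2 * real ?N)"
      unfolding b a[symmetric] using s by simp
    then have "2 * (y ^ ?N * f'' y) * ?H j = e * s powr (real j + 1 - 2 * real ?N) * hermite_fn (real j + 1 - 2 * real ?N) s"
      unfolding yN by (simp add: mult_ac)
    moreover have "- (2 * real ?N - 1 - real j) = real j + 1 - 2 * real ?N" by simp
    ultimately show ?thesis unfolding hermite_density_def sy e_def by (simp only: mult_ac)
  qed
  have p: "pochhammer (1 / 2 :: real) k \<noteq> 0" for k using pochhammer_pos[of "1 / 2 :: real" k] by simp
  have card_\<sigma>: "card \<sigma> \<in> {1..card A}" if "\<sigma> \<in> ?\<Pi>" for \<sigma>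
  proof -
    have \<sigma>: "partition_on A \<sigma>" using that by simp
    note bl = partition_on_finite_blocks[OF \<sigma> A(1)]
    have "\<sigma> \<noteq> {}" using \<sigma> A by (auto simp: partition_on_def)
    then have "1 \<le> card \<sigma>" using bl(1) by (simp add: Suc_le_eq card_gt_0_iff)
    moreover have "card \<sigma> \<le> (\<Sum>B\<in>\<sigma>. card B)" using sum_mono[of \<sigma> "\<lambda>_. 1" card] bl(4) by (simp add: Suc_le_eq)
    ultimately show ?thesis using partition_on_sum[OF \<sigma> A(1), of "\<lambda>_. 1::nat"] by simp
  qed
  let ?a = "\<Prod>a\<in>A. \<alpha> * pochhammer (1 - \<alpha>) (n a - 1)"
  let ?t = "\<lambda>\<sigma>. ?a * (\<beta> / \<alpha> * Gamma (real (card A)) / Gamma (real (card \<sigma>)) * py_eppf (\<beta> / \<alpha>) 0 \<sigma> card) * (2 * ?H (card \<sigma>))"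
  have "y ^ ?N * f'' y * frag_moment A n y = (\<Sum>\<sigma>\<in>?\<Pi>. y ^ ?N * f'' y * ?t \<sigma>)"
    unfolding frag_moment_def sum_distrib_left
  proof (rule sum.cong, goal_cases)
    case (2 \<sigma>)
    then have \<sigma>: "partition_on A \<sigma>" and j: "1 \<le> card \<sigma>" using card_\<sigma> by auto
    note bl = partition_on_finite_blocks[OF \<sigma> A(1)]
    let ?n = "\<lambda>B. \<Sum>b\<in>B. n b"
    have em: "y ^ ?N * (f'' y * emoment (\<kappa>'' y) \<sigma> ?n) = (\<Prod>B\<in>\<sigma>. 1 / 2 * pochhammer (1 / 2) (?n B - 1)) * hermite_density (2 * real ?N - 1 - real (card \<sigma>)) y"
    proof -
      have "\<sigma> \<noteq> {}" using j by auto
      then show ?thesis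
        using B.emoment_half[OF half bl(1) _ _ y, of ?n] bl(5) A(3) by (simp add: partition_on_sum[OF \<sigma> A(1)])
    qed
    have pd: "(\<Prod>B\<in>\<sigma>. 1 / 2 * pochhammer (1 / 2) (?n B - 1) * py_eppf \<alpha> (- \<beta>) B n)
      = (\<Prod>B\<in>\<sigma>. 1 / 2 * pochhammer (1 / 2) (?n B - 1)) * (\<Prod>B\<in>\<sigma>. py_eppf \<alpha> (- \<beta>) B n)" by (rule prod.distrib)
    have as: "y ^ ?N * f'' y * (emoment (\<kappa>'' y) \<sigma> ?n * q) = y ^ ?N * (f'' y * emoment (\<kappa>'' y) \<sigma> ?n) * q" for q
      by (simp only: mult.assoc)
    have "y ^ ?N * f'' y * (emoment (\<kappa>'' y) \<sigma> ?n * (\<Prod>B\<in>\<sigma>. py_eppf \<alpha> (- \<beta>) B n))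
      = (\<Prod>B\<in>\<sigma>. 1 / 2 * pochhammer (1 / 2) (?n B - 1) * py_eppf \<alpha> (- \<beta>) B n) * hermite_density (2 * real ?N - 1 - real (card \<sigma>)) y"
      unfolding as em pd by (simp only: mult_ac)
    also have "(\<Prod>B\<in>\<sigma>. 1 / 2 * pochhammer (1 / 2) (?n B - 1) * py_eppf \<alpha> (- \<beta>) B n)
      = (\<Prod>B\<in>\<sigma>. (\<Prod>b\<in>B. \<alpha> * pochhammer (1 - \<alpha>) (n b - 1)) * (\<beta> / \<alpha> * pochhammer (1 - \<beta> / \<alpha>) (card B - 1)))"
    proof (rule prod.cong, goal_cases)
      case B: (2 B)
      have "B \<noteq> {}" using B \<sigma> by (auto simp: partition_on_def)
      then have *: "\<beta> * pochhammer (1 - \<beta>) (?n B - 1) * py_eppf \<alpha> (- \<beta>) B n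
        = (\<Prod>b\<in>B. \<alpha> * pochhammer (1 - \<alpha>) (n b - 1)) * (\<beta> / \<alpha> * pochhammer (1 - \<beta> / \<alpha>) (card B - 1))"
        using block_identity[OF bl(2)[OF B], of n 1] bl(3)[OF B] A(3) by (simp add: subset_iff)
      have "1 - 1 / 2 = (1 / 2 :: real)" by simp
      then show ?case
        using * unfolding half by (simp only:)
    qed simp
    also have "\<dots> = ?a * (\<beta> / \<alpha> * Gamma (real (card A)) / Gamma (real (card \<sigma>)) * py_eppf (\<beta> / \<alpha>) 0 \<sigma> card)"
      unfolding py_eppf_card[OF \<sigma> A(1,2), symmetric] by (subst prod.distrib) (simp only: partition_on_prod[OF \<sigma> A(1)])
    finally show ?case
      unfolding hd[OF j] by (simp only: mult_ac)
  qed simp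
  also have "\<dots> = y ^ ?N * f'' y * (\<Sum>\<sigma>\<in>?\<Pi>. ?t \<sigma>)" by (simp only: sum_distrib_left)
  finally have "frag_moment A n y = (\<Sum>\<sigma>\<in>?\<Pi>. ?t \<sigma>)" using y f0 by simp
  \<comment> \<open>Grouping by the number of blocks, on which the Hermite index depends.\<close>
  also have "\<dots> = (\<Sum>j\<in>{1..card A}. \<Sum>\<sigma> | \<sigma> \<in> ?\<Pi> \<and> card \<sigma> = j. ?t \<sigma>)"
    using card_\<sigma> by (intro sum.group[symmetric] finite_partitions A) auto
  also have "\<dots> = (\<Sum>j = 1..card A. (?G \<sigma> j) * ?H j * (Gamma (real ?N) / Gamma (real j)))
     * ?F"
  proof (subst sum_distrib_right, rule sum.cong)
    fix j assume "j \<in> {1..card A}"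
    have a: "?a * (\<beta> / \<alpha>) * 2 = \<alpha> ^ (card A - 1) * (\<Prod>a\<in>A. pochhammer (1 - \<alpha>) (n a - 1))"
      using A A.\<gamma> half by (cases "card A") (simp_all add: prod.distrib)
    have G: "Gamma (real ?N) \<noteq> 0" using Gamma_real_pos[of "real ?N"] N by linarith
    have "(\<Sum>\<sigma> | \<sigma> \<in> ?\<Pi> \<and> card \<sigma> = j. ?t \<sigma>) = (\<Sum>\<sigma> | partition_on A \<sigma> \<and> card \<sigma> = j. py_eppf (\<beta> / \<alpha>) 0 \<sigma> card * (?H j * (Gamma (real ?N) / Gamma (real j))
       * ?F))"
    proof (rule sum.cong, goal_cases)
      case (2 \<sigma>)
      then have [simp]: "card \<sigma> = j" by simp
      have *: "a * (b * g / g' * x) * (2 * h) = x * (h * (G / g') * (c * g / G * w))"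
        if "a * b * 2 = c * w" "G \<noteq> 0" for a b g g' x h G c w :: real
      proof -
        have "a * (b * g / g' * x) * (2 * h) = (a * b * 2) * (g / g' * x * h)" by simp
        then show ?thesis using that by simp
      qed
      show ?case
        unfolding \<open>card \<sigma> = j\<close> by (rule *[OF a G])
    qed auto
    then show "(\<Sum>\<sigma> | \<sigma> \<in> ?\<Pi> \<and> card \<sigma> = j. ?t \<sigma>) = (?G \<sigma> j) * ?H j * (Gamma (real ?N) / Gamma (real j))
      * ?F"
      by (simp only: sum_distrib_right[symmetric] mult.assoc)
  qed simp
  finally show "frag_moment A n y = (\<Sum>j = 1..card A. (?G \<sigma> j) * 2 ^ (?N - 1)
       * s ^ (j - 1) * hermite_fn (real j + 1 - 2 * real ?N) s * (Gamma (real ?N) / Gamma (real j)))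
     * ?F"
    by (simp only: mult.assoc)
qed

subsection \<open>Exchangeable partitions\<close>

lemma partition_on_index_partition: "partition_on {1..n} (index_partition n I)"
  by (rule partition_onI) (auto simp: index_partition_def disjnt_def)

text \<open>An index map whose level sets are the blocks of \<pi> is the same as an injective
  labelling of the blocks. This turns sampling probabilities into distinct sums.\<close>

lemma bij_betw_index_functions:
  assumes \<pi>: "partition_on {1..n} \<pi>"
  defines "block \<equiv> \<lambda>m. THE B. B \<in> \<pi> \<and> m \<in> B"
  shows "bij_betw (\<lambda>K. restrict (\<lambda>m. K (block m)) {1..n}) {K \<in> \<pi> \<rightarrow>\<^sub>E (UNIV :: nat set). inj_on K \<pi>}
    {I \<in> {1..n} \<rightarrow>\<^sub>E UNIV. index_partition n I = \<pi>}"
    and "B \<in> \<pi> \<Longrightarrow> m \<in> B \<Longrightarrow> block m = B"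
proof -
  have b: "block m = B" if "B \<in> \<pi>" "m \<in> B" for m B
    unfolding block_def using partition_onD2[OF \<pi>] that by (intro the_equality) (auto simp: disjoint_def)
  then show "B \<in> \<pi> \<Longrightarrow> m \<in> B \<Longrightarrow> block m = B" .
  have sub: "B \<subseteq> {1..n}" if "B \<in> \<pi>" for B using partition_onD1[OF \<pi>] that by auto
  have ne: "B \<noteq> {}" if "B \<in> \<pi>" for B using partition_onD3[OF \<pi>] that by auto
  have blk: "block m \<in> \<pi>" "m \<in> block m" if "m \<in> {1..n}" for m
  proof -
    have "m \<in> \<Union>\<pi>" using that partition_onD1[OF \<pi>] by (simp only:)
    then obtain B where "B \<in> \<pi>" "m \<in> B" by blast
    then show "block m \<in> \<pi>" "m \<in> block m" using b by simp_all
  qed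
  let ?g = "\<lambda>K. restrict (\<lambda>m. K (block m)) {1..n}"
  let ?h = "\<lambda>I. restrict (\<lambda>B. I (SOME m. m \<in> B)) \<pi>"
  have some: "(SOME m. m \<in> B) \<in> B" if "B \<in> \<pi>" for B using ne[OF that] by (simp add: some_in_eq)
  have level: "B = {m' \<in> {1..n}. I m' = I m}" if "index_partition n I = \<pi>" "B \<in> \<pi>" "m \<in> B" for I :: "nat \<Rightarrow> nat" and B m
    using that by (auto simp: index_partition_def)
  have ip: "index_partition n (?g K) = \<pi>" if K: "inj_on K \<pi>" for K :: "nat set \<Rightarrow> nat"
  proof -
    have "{m' \<in> {1..n}. ?g K m' = ?g K m} = block m" if m: "m \<in> {1..n}" for m
    proof -
      have "K (block m') = K (block m) \<longleftrightarrow> m' \<in> block m" if "m' \<in> {1..n}" for m'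
        using inj_onD[OF K _ blk(1)[OF that] blk(1)[OF m]] b[OF blk(1)[OF m]] blk(2)[OF that] by metis
      then show ?thesis using m sub[OF blk(1)[OF m]] by auto
    qed
    then have "index_partition n (?g K) = block ` {1..n}" by (simp add: index_partition_def cong: image_cong_simp)
    also have "\<dots> = \<pi>"
    proof
      show "\<pi> \<subseteq> block ` {1..n}"
      proof
        fix B assume B: "B \<in> \<pi>"
        then have "block (SOME m. m \<in> B) = B" "(SOME m. m \<in> B) \<in> {1..n}" using b some sub by blast+
        then show "B \<in> block ` {1..n}" by (metis imageI)
      qed
    qed (use blk in auto)
    finally show ?thesis .
  qed
  show "bij_betw ?g {K \<in> \<pi> \<rightarrow>\<^sub>E (UNIV :: nat set). inj_on K \<pi>} {I \<in> {1..n} \<rightarrow>\<^sub>E UNIV. index_partition n I = \<pi>}"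
  proof (rule bij_betw_byWitness[where f' = ?h])
    show "\<forall>K\<in>{K \<in> \<pi> \<rightarrow>\<^sub>E (UNIV :: nat set). inj_on K \<pi>}. ?h (?g K) = K"
    proof (rule ballI, rule ext)
      fix K :: "nat set \<Rightarrow> nat" and B assume "K \<in> {K \<in> \<pi> \<rightarrow>\<^sub>E (UNIV :: nat set). inj_on K \<pi>}"
      then have K: "K \<in> \<pi> \<rightarrow>\<^sub>E UNIV" by simp
      show "?h (?g K) B = K B"
      proof (cases "B \<in> \<pi>")
        case True
        then have "(SOME m. m \<in> B) \<in> {1..n}" using sub some by blast
        then show ?thesis using True b[OF True some[OF True]] by simp
      next
        case False
        then show ?thesis using PiE_arb[OF K] by simp
      qed
    qed
    show "\<forall>I\<in>{I \<in> {1..n} \<rightarrow>\<^sub>E UNIV. index_partition n I = \<pi>}. ?g (?h I) = I"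
    proof (rule ballI, rule ext)
      fix I :: "nat \<Rightarrow> nat" and m assume "I \<in> {I \<in> {1..n} \<rightarrow>\<^sub>E UNIV. index_partition n I = \<pi>}"
      then have I: "I \<in> {1..n} \<rightarrow>\<^sub>E UNIV" "index_partition n I = \<pi>" by auto
      show "?g (?h I) m = I m"
      proof (cases "m \<in> {1..n}")
        case True
        have "(SOME m'. m' \<in> block m) \<in> block m" by (rule some[OF blk(1)[OF True]])
        then have "I (SOME m'. m' \<in> block m) = I m"
          using level[OF I(2) blk(1)[OF True] blk(2)[OF True]] by blast
        then show ?thesis using True blk(1) by simp
      next
        case False
        then show ?thesis using PiE_arb[OF I(1) False] by (simp only: restrict_apply if_False)
      qed
    qed
    show "?g ` {K \<in> \<pi> \<rightarrow>\<^sub>E (UNIV :: nat set). inj_on K \<pi>} \<subseteq> {I \<in> {1..n} \<rightarrow>\<^sub>E UNIV. index_partition n I = \<pi>}"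
      using ip by auto
    show "?h ` {I \<in> {1..n} \<rightarrow>\<^sub>E UNIV. index_partition n I = \<pi>} \<subseteq> {K \<in> \<pi> \<rightarrow>\<^sub>E (UNIV :: nat set). inj_on K \<pi>}"
    proof (rule image_subsetI)
      fix I :: "nat \<Rightarrow> nat" assume "I \<in> {I \<in> {1..n} \<rightarrow>\<^sub>E UNIV. index_partition n I = \<pi>}"
      then have I: "index_partition n I = \<pi>" by simp
      have "inj_on (?h I) \<pi>"
      proof (rule inj_onI)
        fix B C assume B: "B \<in> \<pi>" and C: "C \<in> \<pi>" and "?h I B = ?h I C"
        then have e: "I (SOME m. m \<in> B) = I (SOME m. m \<in> C)" by simp
        show "B = C"
          by (rule trans[OF level[OF I B some[OF B]] trans[OF _ level[OF I C some[OF C], symmetric]]]) (simp only: e)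
      qed
      then show "?h I \<in> {K \<in> \<pi> \<rightarrow>\<^sub>E (UNIV :: nat set). inj_on K \<pi>}" by simp
    qed
  qed
qed

text \<open>The event is a finite disjoint union over partitions. For each of them the point masses
  of its index maps, summed along the bijection above, give the distinct sum with the block sizes as
  exponents.\<close>

lemma emeasure_index_partition:
  fixes n :: nat
  assumes p: "p \<in> P_infty"
  defines "\<nu> \<equiv> PiM {1..n} (\<lambda>_. point_measure UNIV (\<lambda>i. ennreal (p i)))"
  shows "emeasure \<nu> {I \<in> space \<nu>. index_partition n I \<in> S} = (\<Sum>\<pi> | partition_on {1..n} \<pi> \<and> \<pi> \<in> S. edsum \<pi> card p)"
proof -
  let ?m = "point_measure UNIV (\<lambda>i. ennreal (p i))"
  have "prob_space ?m"
  proof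
    have "emeasure ?m (space ?m) = (\<Sum>i. ennreal (p i))"
      by (simp add: point_measure_def emeasure_density nn_integral_count_space_nat)
    then show "emeasure ?m (space ?m) = 1" using P_infty_D(4)[OF p] by (simp add: psum_def)
  qed
  then interpret product_prob_space "\<lambda>_ :: nat. ?m" "{1..n}" by (rule product_prob_spaceI)
  have sp: "space \<nu> = {1..n} \<rightarrow>\<^sub>E UNIV" by (simp add: \<nu>_def space_PiM space_point_measure)
  have cnt: "countable ({1..n} \<rightarrow>\<^sub>E (UNIV :: nat set))" by (intro countable_PiE) auto
  have single: "{I} \<in> sets \<nu>" "emeasure \<nu> {I} = (\<Prod>m\<in>{1..n}. ennreal (p (I m)))" if I: "I \<in> {1..n} \<rightarrow>\<^sub>E UNIV" for I
  proof -
    have "(\<Pi>\<^sub>E m\<in>{1..n}. {I m}) = {I}" by (rule PiE_singleton) (use I in \<open>simp add: PiE_def\<close>)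
    moreover have "(\<Pi>\<^sub>E m\<in>{1..n}. {I m}) \<in> sets \<nu>" unfolding \<nu>_def by (intro sets_PiM_I_finite) (auto simp: sets_point_measure)
    moreover have "emeasure \<nu> (\<Pi>\<^sub>E m\<in>{1..n}. {I m}) = (\<Prod>m\<in>{1..n}. emeasure ?m {I m})"
      unfolding \<nu>_def by (intro emeasure_PiM) (auto simp: sets_point_measure)
    ultimately show "{I} \<in> sets \<nu>" "emeasure \<nu> {I} = (\<Prod>m\<in>{1..n}. ennreal (p (I m)))"
      by (simp_all add: emeasure_point_measure_finite2)
  qed
  let ?E = "\<lambda>\<pi>. {I \<in> {1..n} \<rightarrow>\<^sub>E UNIV. index_partition n I = \<pi>}"
  let ?\<Pi> = "{\<pi>. partition_on {1..n} \<pi> \<and> \<pi> \<in> S}"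
  have cE: "countable (?E \<pi>)" for \<pi> by (rule countable_subset[OF _ cnt]) auto
  have E: "emeasure \<nu> (?E \<pi>) = edsum \<pi> card p" if \<pi>: "partition_on {1..n} \<pi>" for \<pi>
  proof -
    define block where "block m = (THE B. B \<in> \<pi> \<and> m \<in> B)" for m
    note bij = bij_betw_index_functions[OF \<pi>, folded block_def]
    have "emeasure \<nu> (?E \<pi>) = (\<integral>\<^sup>+ I. emeasure \<nu> {I} \<partial>count_space (?E \<pi>))"
      by (rule emeasure_countable_singleton[OF _ cE]) (use single in auto)
    also have "\<dots> = (\<integral>\<^sup>+ I. (\<Prod>m\<in>{1..n}. ennreal (p (I m))) \<partial>count_space (?E \<pi>))"
      by (intro nn_integral_cong) (simp add: single)
    also have "\<dots> = (\<integral>\<^sup>+ K. (\<Prod>m\<in>{1..n}. ennreal (p (restrict (\<lambda>m. K (block m)) {1..n} m))) \<partial>count_space {K \<in> \<pi> \<rightarrow>\<^sub>E UNIV. inj_on K \<pi>})"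
      by (rule nn_integral_bij_count_space[OF bij(1), of "\<lambda>I. \<Prod>m\<in>{1..n}. ennreal (p (I m))", symmetric])
    also have "\<dots> = (\<integral>\<^sup>+ K. (\<Prod>B\<in>\<pi>. ennreal (p (K B)) ^ card B) \<partial>count_space {K \<in> \<pi> \<rightarrow>\<^sub>E UNIV. inj_on K \<pi>})"
    proof (rule nn_integral_cong, goal_cases)
      case (1 K)
      have "(\<Prod>m\<in>{1..n}. ennreal (p (restrict (\<lambda>m. K (block m)) {1..n} m))) = (\<Prod>m\<in>{1..n}. ennreal (p (K (block m))))"
        by (intro prod.cong) auto
      also have "\<dots> = (\<Prod>B\<in>\<pi>. \<Prod>m\<in>B. ennreal (p (K (block m))))" by (rule partition_on_prod[OF \<pi>, symmetric]) simp
      also have "\<dots> = (\<Prod>B\<in>\<pi>. ennreal (p (K B)) ^ card B)" using bij(2) by (intro prod.cong refl) simp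
      finally show ?case .
    qed
    also have "\<dots> = edsum \<pi> card p"
      unfolding edsum_def dsum_def
      by (subst (1 2) nn_integral_count_space_indicator) (auto intro!: nn_integral_cong split: split_indicator)
    finally show ?thesis .
  qed
  have "{I \<in> space \<nu>. index_partition n I \<in> S} = (\<Union>\<pi>\<in>?\<Pi>. ?E \<pi>)"
  proof (intro equalityI subsetI)
    fix I assume "I \<in> {I \<in> space \<nu>. index_partition n I \<in> S}"
    then have "I \<in> {1..n} \<rightarrow>\<^sub>E UNIV" "index_partition n I \<in> S" unfolding sp by simp_all
    then show "I \<in> (\<Union>\<pi>\<in>?\<Pi>. ?E \<pi>)"
      by (intro UN_I[of "index_partition n I"] CollectI conjI refl partition_on_index_partition)
  next
    fix I assume "I \<in> (\<Union>\<pi>\<in>?\<Pi>. ?E \<pi>)"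
    then show "I \<in> {I \<in> space \<nu>. index_partition n I \<in> S}"
      unfolding sp by (elim UN_E CollectE conjE) (intro CollectI conjI; simp only:)
  qed
  also have "emeasure \<nu> \<dots> = (\<Sum>\<pi>\<in>?\<Pi>. emeasure \<nu> (?E \<pi>))"
  proof (rule sum_emeasure[symmetric])
    show "?E ` ?\<Pi> \<subseteq> sets \<nu>"
      by (intro image_subsetI sets.countable[OF _ cE]) (elim CollectE conjE, rule single(1))
    show "finite ?\<Pi>" using finite_partitions[of "{1..n}"] by (rule rev_finite_subset) auto
  qed (auto simp: disjoint_family_on_def)
  finally show ?thesis using E by simp
qed

lemma partition_prob_eq:
  assumes L: "sets L = sets borel" "AE p in L. p \<in> P_infty"
  shows "partition_prob L n S = enn2real (\<Sum>\<pi> | partition_on {1..n} \<pi> \<and> \<pi> \<in> S. \<integral>\<^sup>+ p. edsum \<pi> card p \<partial>L)"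
proof -
  let ?\<Pi> = "{\<pi>. partition_on {1..n} \<pi> \<and> \<pi> \<in> S}"
  have "partition_prob L n S = enn2real (\<integral>\<^sup>+ p. (\<Sum>\<pi>\<in>?\<Pi>. edsum \<pi> card p) \<partial>L)"
    unfolding partition_prob_def Let_def using L(2)
    by (intro arg_cong[where f = enn2real] nn_integral_cong_AE, eventually_elim) (rule emeasure_index_partition)
  also have "(\<integral>\<^sup>+ p. (\<Sum>\<pi>\<in>?\<Pi>. edsum \<pi> card p) \<partial>L) = (\<Sum>\<pi>\<in>?\<Pi>. \<integral>\<^sup>+ p. edsum \<pi> card p \<partial>L)"
  proof (rule nn_integral_sum)
    fix \<pi> assume "\<pi> \<in> ?\<Pi>"
    then have "(\<lambda>p. edsum \<pi> card p) \<in> borel_measurable borel"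
      using partition_on_finite_blocks(1)[of "{1..n}" \<pi>] by (intro edsum_measurable) auto
    then show "edsum \<pi> card \<in> borel_measurable L" by (subst measurable_cong_sets[OF L(1) refl])
  qed
  finally show ?thesis .
qed

lemma block_count_prob_eq:
  assumes "0 < \<gamma>" "\<gamma> < 1"
  shows "block_count_prob \<gamma> k j = (\<Sum>\<pi> | partition_on {1..k} \<pi> \<and> card \<pi> = j. py_eppf \<gamma> 0 \<pi> card)"
proof -
  let ?F = "\<Sum>\<pi> | partition_on {1..k} \<pi> \<and> card \<pi> = j. \<integral>\<^sup>+ p. edsum \<pi> card p \<partial>PD \<gamma> 0"
  interpret gem_parameters \<gamma> 0 by unfold_locales (use assms in auto)
  have "block_count_prob \<gamma> k j = enn2real ?F"
    unfolding block_count_prob_def by (subst partition_prob_eq[OF sets_PD AE_PD]) simp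
  also have "?F
    = (\<Sum>\<pi> | partition_on {1..k} \<pi> \<and> card \<pi> = j. ennreal (py_eppf \<gamma> 0 \<pi> card))"
    using partition_on_finite_blocks[of "{1..k}"] by (intro sum.cong refl nn_integral_edsum_PD) auto
  also have "\<dots> = ennreal (\<Sum>\<pi> | partition_on {1..k} \<pi> \<and> card \<pi> = j. py_eppf \<gamma> 0 \<pi> card)"
    by (rule sum_ennreal) (rule py_eppf_nonneg)
  finally show ?thesis by (simp add: sum_nonneg py_eppf_nonneg)
qed

lemma partition_on_image:
  assumes k: "inj_on k C" and \<sigma>: "partition_on C \<sigma>"
  shows "partition_on (k ` C) (image (image k) \<sigma>)" "inj_on (image k) \<sigma>" "card (image (image k) \<sigma>) = card \<sigma>"
proof -
  have "image (image k) \<sigma> - {{}} = image (image k) \<sigma>" using \<sigma> by (auto simp: partition_on_def)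
  then show "partition_on (k ` C) (image (image k) \<sigma>)" using partition_on_inj_image[OF \<sigma> k] by simp
  have "\<sigma> \<subseteq> Pow C" using \<sigma> by (auto simp: partition_on_def)
  then show "inj_on (image k) \<sigma>" using inj_on_image_Pow[OF k] inj_on_subset by blast
  then show "card (image (image k) \<sigma>) = card \<sigma>" by (rule card_image)
qed

text \<open>\<open>block_count_prob\<close> refers to partitions of \<open>{1..k}\<close>, the
  fragmentation moment to partitions of a set of blocks; the sampling formula sees cardinalities
  only and is carried over by a bijection.\<close>

lemma sum_partitions_reindex:
  assumes h: "bij_betw h A B" and A: "finite A"
  shows "(\<Sum>\<sigma> | partition_on A \<sigma> \<and> card \<sigma> = j. py_eppf \<gamma> \<theta> \<sigma> card) = (\<Sum>\<sigma> | partition_on B \<sigma> \<and> card \<sigma> = j. py_eppf \<gamma> \<theta> \<sigma> card)"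
proof -
  let ?f = "image (image h)" and ?g = "image (image (inv_into A h))"
  have hA: "inj_on h A" "h ` A = B" using h by (auto simp: bij_betw_def)
  have gB: "inj_on (inv_into A h) B" "inv_into A h ` B = A" using bij_betw_inv_into[OF h] by (auto simp: bij_betw_def)
  have bij: "bij_betw ?f {\<sigma>. partition_on A \<sigma> \<and> card \<sigma> = j} {\<sigma>. partition_on B \<sigma> \<and> card \<sigma> = j}"
  proof (rule bij_betw_byWitness[where f' = ?g])
    show "\<forall>\<sigma>\<in>{\<sigma>. partition_on A \<sigma> \<and> card \<sigma> = j}. ?g (?f \<sigma>) = \<sigma>"
    proof
      fix \<sigma> assume "\<sigma> \<in> {\<sigma>. partition_on A \<sigma> \<and> card \<sigma> = j}"
      then have "inv_into A h ` h ` C = C" if "C \<in> \<sigma>" for C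
        using that hA by (intro inv_into_image_cancel) (auto simp: partition_on_def)
      then have "(\<lambda>C. inv_into A h ` h ` C) ` \<sigma> = (\<lambda>C. C) ` \<sigma>" by (rule image_cong[OF refl])
      then show "?g (?f \<sigma>) = \<sigma>" by (simp only: image_image[of _ "image h"] image_ident)
    qed
    show "\<forall>\<sigma>\<in>{\<sigma>. partition_on B \<sigma> \<and> card \<sigma> = j}. ?f (?g \<sigma>) = \<sigma>"
    proof
      fix \<sigma> assume "\<sigma> \<in> {\<sigma>. partition_on B \<sigma> \<and> card \<sigma> = j}"
      then have "h ` inv_into A h ` C = C" if "C \<in> \<sigma>" for C
        using that by (intro image_inv_into_cancel[OF hA(2)]) (auto simp: partition_on_def)
      then have "(\<lambda>C. h ` inv_into A h ` C) ` \<sigma> = (\<lambda>C. C) ` \<sigma>" by (rule image_cong[OF refl])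
      then show "?f (?g \<sigma>) = \<sigma>" by (simp only: image_image[of _ "image (inv_into A h)"] image_ident)
    qed
    show "?f ` {\<sigma>. partition_on A \<sigma> \<and> card \<sigma> = j} \<subseteq> {\<sigma>. partition_on B \<sigma> \<and> card \<sigma> = j}"
      using partition_on_image[OF hA(1)] hA(2) by auto
    show "?g ` {\<sigma>. partition_on B \<sigma> \<and> card \<sigma> = j} \<subseteq> {\<sigma>. partition_on A \<sigma> \<and> card \<sigma> = j}"
      using partition_on_image[OF gB(1)] gB(2) by auto
  qed
  have "(\<Sum>\<sigma> | partition_on A \<sigma> \<and> card \<sigma> = j. py_eppf \<gamma> \<theta> \<sigma> card) = (\<Sum>\<sigma> | partition_on A \<sigma> \<and> card \<sigma> = j. py_eppf \<gamma> \<theta> (?f \<sigma>) card)"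
  proof (rule sum.cong, goal_cases)
    case (2 \<sigma>)
    then have \<sigma>: "partition_on A \<sigma>" by simp
    have c: "card (h ` C) = card C" if "C \<in> \<sigma>" for C
      using that \<sigma> hA(1) by (intro card_image) (auto simp: partition_on_def intro: inj_on_subset)
    show ?case
      unfolding py_eppf_def partition_on_image(3)[OF hA(1) \<sigma>] sum.reindex[OF partition_on_image(2)[OF hA(1) \<sigma>]] prod.reindex[OF partition_on_image(2)[OF hA(1) \<sigma>]]
      by (simp add: c cong: sum.cong prod.cong)
  qed simp
  also have "\<dots> = (\<Sum>\<sigma> | partition_on B \<sigma> \<and> card \<sigma> = j. py_eppf \<gamma> \<theta> \<sigma> card)"
    by (rule sum.reindex_bij_betw[OF bij])
  finally show ?thesis .
qed

theorem proposition4p4: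
  fixes N :: "real \<Rightarrow> 'b measure"
    and J :: "real \<Rightarrow> nat \<Rightarrow> 'b \<Rightarrow> real"
    and f :: "real \<Rightarrow> real \<Rightarrow> real"
    and PD_given :: "real \<Rightarrow> real \<Rightarrow> (nat \<Rightarrow> real) measure"
    and M :: "'a measure"
    and P P_\<alpha> :: "'a \<Rightarrow> nat \<Rightarrow> real"
    and s \<alpha> :: real
  assumes jumps: "\<And>\<gamma>. 0 < \<gamma> \<Longrightarrow> \<gamma> < 1 \<Longrightarrow> ranked_stable_jumps (N \<gamma>) \<gamma> (J \<gamma>)"
    and dens: "\<And>\<gamma>. 0 < \<gamma> \<Longrightarrow> \<gamma> < 1 \<Longrightarrow>
                 continuous_density (N \<gamma>) (total_jump (J \<gamma>)) (f \<gamma>)"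
    and cond: "\<And>\<gamma>. 0 < \<gamma> \<Longrightarrow> \<gamma> < 1 \<Longrightarrow>
                 continuous_cond_law (N \<gamma>) (normalized_jumps (J \<gamma>)) (total_jump (J \<gamma>)) (PD_given \<gamma>)"
    and s: "0 < s"
    and M: "prob_space M"
    and P: "has_law M P (PD_given (1/2) (1/2 * s powr (-2)))"
    and \<alpha>: "1/2 < \<alpha>" "\<alpha> < 1"
    and frag: "is_FRAG M \<alpha> (- (1/2)) P P_\<alpha>"
  shows "has_law M P_\<alpha> (PD_mixed f PD_given \<alpha> (1/2) (1/2 * s powr (-2))) \<and>
         has_EPPF (distr M borel P_\<alpha>)
           (\<lambda>ns. let k = length ns; n = sum_list ns in
              (\<Sum>j=1..k. block_count_prob (1 / (2 * \<alpha>)) k j * 2 ^ (n - 1) * s ^ (j - 1) *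
                 hermite_fn (real j + 1 - 2 * real n) s * (Gamma (real n) / Gamma (real j)))
              * eppf_PD0 \<alpha> ns)"
proof -
  have law: "stable_law \<gamma> (N \<gamma>) (J \<gamma>) (f \<gamma>) (PD_given \<gamma>)" if "0 < \<gamma>" "\<gamma> < 1" for \<gamma>
    using jumps[OF that] dens[OF that] cond[OF that] that by unfold_locales
  \<comment> \<open>The three stable laws have the indices \<alpha>, \<open>1 / 2 / \<alpha>\<close>
    and \<open>1 / 2\<close>; the second is below 1 because \<alpha> exceeds 1/2.\<close>
  interpret F: stable_fragmentation \<alpha> "N \<alpha>" "J \<alpha>" "f \<alpha>" "PD_given \<alpha>" "1 / 2"
    "N (1 / 2 / \<alpha>)" "J (1 / 2 / \<alpha>)" "f (1 / 2 / \<alpha>)" "PD_given (1 / 2 / \<alpha>)" "N (1 / 2)" "J (1 / 2)" "f (1 / 2)" "PD_given (1 / 2)"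
    by (intro stable_fragmentation.intro stable_mixture.intro law) (use \<alpha> in \<open>auto simp: field_simps\<close>)
  interpret M: prob_space M by (rule M)
  define y where "y = 1/2 * s powr (-2)"
  note y_half = F.frag_moment_half[OF refl _ _ _ s, folded y_def]
  have y: "0 < y" using s by (simp add: y_def)
  \<comment> \<open>Positivity of the density at \<open>y\<close> is read off from the explicit
    formula, instantiated with a one-point sample.\<close>
  have pos: "0 < f (1 / 2) y" using y_half(2)[of "{0 :: nat}" "\<lambda>_. 1"] by simp
  note X = F.FRAG_moments_cond(1,2)[OF M y P[folded y_def] frag finite.emptyI[where ?'a = nat], of "\<lambda>_. 1", simplified]
  let ?L = "distr M borel P_\<alpha>"
  have L: "sets ?L = sets borel" "AE p in ?L. p \<in> P_infty"
    using X P_infty_measurable by (auto simp: AE_distr_iff pred_def)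
  have "?L = F.mixed y"
    by (rule F.law_eq_mixed[OF y pos _ L]) (auto intro!: M.prob_space_distr X F.FRAG_moments_cond(3)[OF M y P[folded y_def] frag])
  also have "F.mixed y = PD_mixed f PD_given \<alpha> (1/2) y"
    unfolding F.mixed_def PD_mixed_def omega_weight_def F.mix_kernel_def by simp
  finally have 1: "has_law M P_\<alpha> (PD_mixed f PD_given \<alpha> (1/2) y)" using X by (simp add: has_law_def)
  have 2: "partition_prob ?L n {set As} = (\<Sum>j=1..length As. block_count_prob (1 / (2 * \<alpha>)) (length As) j * 2 ^ (sum_list (map card As) - 1) * s ^ (j - 1) *
       hermite_fn (real j + 1 - 2 * real (sum_list (map card As))) s * (Gamma (real (sum_list (map card As))) / Gamma (real j))) * eppf_PD0 \<alpha> (map card As)"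
    if n: "1 \<le> n" and As: "distinct As" "partition_on {1..n} (set As)" for n and As :: "nat set list"
  proof -
    have ne: "set As \<noteq> {}" using As(2) n by (auto simp: partition_on_def)
    have pc: "\<And>B. B \<in> set As \<Longrightarrow> 0 < card B" using partition_on_finite_blocks(4)[OF As(2)] by simp
    have k: "card (set As) = length As" by (rule distinct_card[OF As(1)])
    have sl: "(\<Sum>B\<in>set As. card B) = sum_list (map card As)" using As(1) by (simp add: sum.distinct_set_conv_list)
    have pl: "(\<Prod>B\<in>set As. pochhammer (1 - \<alpha>) (card B - 1)) = (\<Prod>m\<leftarrow>map card As. pochhammer (1 - \<alpha>) (m - 1))"
      using As(1) by (simp add: prod.distinct_set_conv_list o_def)
    have e: "eppf_PD0 \<alpha> (map card As) = \<alpha> ^ (card (set As) - 1) * Gamma (real (card (set As))) / Gamma (real (\<Sum>B\<in>set As. card B)) * (\<Prod>B\<in>set As. pochhammer (1 - \<alpha>) (card B - 1))"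
      unfolding eppf_PD0_def k sl pl by simp
    obtain h where h: "bij_betw h {1..length As} (set As)"
      using ex_bij_betw_nat_finite_1[of "set As"] k by auto
    have bc: "block_count_prob (1 / (2 * \<alpha>)) (length As) j = (\<Sum>\<sigma> | partition_on (set As) \<sigma> \<and> card \<sigma> = j. py_eppf (1 / 2 / \<alpha>) 0 \<sigma> card)" for j
      using block_count_prob_eq[of "1 / 2 / \<alpha>" "length As" j] \<alpha> sum_partitions_reindex[OF h] by (simp add: field_simps)
    have "{\<pi>. partition_on {1..n} \<pi> \<and> \<pi> \<in> {set As}} = {set As}" using As(2) by auto
    then have "partition_prob ?L n {set As} = F.frag_moment (set As) card y"
      using partition_prob_eq[OF L, of n "{set As}"] F.FRAG_moments_cond(3)[OF M y P[folded y_def] frag, of "set As" card] pc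
        F.frag_moment_nonneg[OF _ _ y, of "set As" card] by simp
    then show ?thesis using y_half(1)[of "set As" card, OF finite_set ne pc] unfolding e bc unfolding k sl by (simp only:)
  qed
  show ?thesis
    using 1 2 unfolding y_def has_EPPF_def Let_def by simp
qed

end
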